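(* Let $0<s<4$. The expected Riesz $s$-energy of the points coming from the harmonic ensemble $\mathfrak{X}^{(N)}$, $N=d_k$, satisfies, as $N\to\infty$ (i.e. $k\to\infty$), $$\mathbb{E}_{x\sim\mathfrak{X}^{(N)}}[E_s(x)]=W_s(\mathrm{Gr}_{2,4})N^2-C_sN^{1+s/4}+o(N^{1+s/4}),$$ where $$C_s=2^{2+3s/4}\int_0^\infty\!\!\int_0^\infty\frac{J_1(x)^2J_1(y)^2}{xy(x^2+y^2)^{s/2}}\,dx\,dy$$ and $J_1$ is the Bessel function of the first kind of order $1$. For $s=2$, $$C_2=-\frac{2^{7/2}(4-24G+3\pi)}{48\pi},$$ where $G$ is Catalan's constant.
   Context: $\mathrm{Gr}_{2,4}$ is the Grassmannian of $2$-dimensional linear subspaces of $\mathbb{R}^4$, with its $\mathrm{O}(4)$-invariant Borel probability measure $\sigma$. For $P,Q\in\mathrm{Gr}_{2,4}$ the principal angles $0\le\theta_1\le\theta_2\le\pi/2$ are such that $\cos\theta_1\ge\cos\theta_2$ are the singular values of $A^{T}B$, where $A,B$ are $4\times2$ matrices with orthonormal columns spanning $P$ and $Q$. Put $\xi_\pm(P,Q)=\cos(\theta_1\pm\theta_2)$ and $d_c(P,Q)=\sqrt{\sin^2\theta_1+\sin^2\theta_2}=\sqrt{1-\xi_+\xi_-}$. For a finite set $x=\{P_1,\dots,P_N\}$, $E_s(x)=\sum_{i\ne j}d_c(P_i,P_j)^{-s}$; $W_s(\mathrm{Gr}_{2,4})=\inf_\mu\iint d_c(P,Q)^{-s}d\mu(P)d\mu(Q)$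 over Borel probability measures $\mu$ on $\mathrm{Gr}_{2,4}$. Harmonic ensemble. For integers $\tau_1\ge\tau_2\ge0$ and $\tau=(\tau_1,\tau_2)$, $|\tau|=\tau_1+\tau_2$, let $d_\tau=(2-\delta_{0,\tau_2})(2(\tau_1+\tau_2)+1)(2(\tau_1-\tau_2)+1)$ and $P_\tau(x,y)=\frac12(P_{\tau_1+\tau_2}(x)P_{\tau_1-\tau_2}(y)+P_{\tau_1+\tau_2}(y)P_{\tau_1-\tau_2}(x))$, with $P_n$ (integer index) the Legendre polynomials. For $k\ge1$, $\mathcal{K}_k(P,Q)=\sum_{|\tau|\le k}d_\tau P_\tau(\xi_+(P,Q),\xi_-(P,Q))$ is the reproducing kernel of a subspace $H_k\subset L^2(\mathrm{Gr}_{2,4},\sigma)$ of dimension $d_k=\sum_{|\tau|\le k}d_\tau=\frac12(k+1)^2(k^2+2k+2)$. For $N=d_k$, $\mathfrak{X}^{(N)}$ is the determinantal point process of $N$ points on $\mathrm{Gr}_{2,4}$ with kernel $\mathcal{K}_k$ with respect to $\sigma$, i.e. with joint intensities $\rho_m(P_1,\dots,P_m)=\det(\mathcal{K}_k(P_i,P_j))_{1\le i,j\le m}$. In particular $\mathbb{E}_{x\sim\mathfrak{X}^{(N)}}[\sum_{i\ne j}f(P_i,P_j)]=\iint(\mathcal{K}_k(P,P)\mathcal{K}_k(Q,Q)-\mathcal{K}_k(P,Q)^2)f(P,Q)\,d\sigma(P)\,d\sigma(Q)$ for measurable $f\ge0$. *)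

theory Defs
  imports "Jordan_Normal_Form.Determinant" "HOL-Probability.Probability"
begin

text \<open>
  Jordan_Normal_Form supplies determinants of matrices whose size is a natural number. Its names
  and notation that clash with HOL-Analysis are disabled, so that \<^term>\<open>det\<close>, \<^term>\<open>mat\<close>, \<open>$\<close> etc.
  mean the HOL-Analysis ones; the others are available by qualified name.
\<close>

hide_const (open) Determinant.det Matrix.mat Matrix.vec Matrix.vec_index Matrix.row Matrix.col
  Matrix.rows Matrix.scalar_prod Matrix.orthogonal
hide_type (open) Matrix.vec Matrix.mat
no_notation Matrix.vec_index (infixl \<open>$\<close> 100)
no_notation Matrix.scalar_prod (infix \<open>\<bullet>\<close> 70)
no_notation Matrix.transpose_mat (\<open>(_\<^sup>T)\<close> [1000])

section \<open>The Grassmannian\<close>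

definition gr24 :: "(real^4) set set" where
  "gr24 = {P. subspace P \<and> dim P = 2}"

text \<open>A matrix of type \<^typ>\<open>real^2^4\<close> has 4 rows and 2 columns.\<close>

definition stiefel24 :: "(real^2^4) set" where
  "stiefel24 = {A. transpose A ** A = mat 1}"

text \<open>The topology of the Grassmannian is the quotient topology of the Stiefel manifold.\<close>

definition gr24_topology :: "(real^4) set topology" where
  "gr24_topology = topology (\<lambda>U. U \<subseteq> gr24 \<and>
     openin (top_of_set stiefel24) {A \<in> stiefel24. span (columns A) \<in> U})"

lemma openin_gr24_topology:
  "openin gr24_topology U \<longleftrightarrow>
     U \<subseteq> gr24 \<and> openin (top_of_set stiefel24) {A \<in> stiefel24. span (columns A) \<in> U}"
proof -
  let ?pre = "\<lambda>U. {A \<in> stiefel24. span (columns A) \<in> U}"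
  let ?T = "\<lambda>U. U \<subseteq> gr24 \<and> openin (top_of_set stiefel24) (?pre U)"
  have "istopology ?T"
    unfolding istopology_def
  proof (intro conjI allI impI)
    fix S T assume "?T S" "?T T"
    moreover have "?pre (S \<inter> T) = ?pre S \<inter> ?pre T" by auto
    ultimately show "S \<inter> T \<subseteq> gr24" "openin (top_of_set stiefel24) (?pre (S \<inter> T))"
      by (auto intro: openin_Int)
  next
    fix \<K> assume K: "\<forall>K\<in>\<K>. ?T K"
    then show "\<Union>\<K> \<subseteq> gr24" by auto
    have "?pre (\<Union>\<K>) = \<Union>(?pre ` \<K>)" by auto
    then show "openin (top_of_set stiefel24) (?pre (\<Union>\<K>))"
      using K by (auto intro!: openin_Union)
  qed
  then show ?thesis
    by (simp add: gr24_topology_def topology_inverse')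
qed

definition gr24_borel :: "(real^4) set measure" where
  "gr24_borel = sigma gr24 {U. openin gr24_topology U}"

definition gr24_prob_measures :: "(real^4) set measure set" where
  "gr24_prob_measures = {\<mu>. prob_space \<mu> \<and> sets \<mu> = sets gr24_borel}"

definition O4_invariant :: "(real^4) set measure \<Rightarrow> bool" where
  "O4_invariant \<mu> \<longleftrightarrow>
     (\<forall>U :: real^4^4. orthogonal_matrix U \<longrightarrow> distr \<mu> gr24_borel (\<lambda>P. (*v) U ` P) = \<mu>)"

section \<open>Principal angles and the chordal distance\<close>

text \<open>
  The singular values of a matrix \<open>M\<close> are the square roots of the eigenvalues of
  \<open>M\<^sup>T M\<close>, counted with multiplicity.
\<close>

definition singular_values2 :: "real^2^2 \<Rightarrow> real \<Rightarrow> real \<Rightarrow> bool" where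
  "singular_values2 M a b \<longleftrightarrow> 0 \<le> b \<and> b \<le> a \<and>
     (\<forall>t. det (mat t - transpose M ** M) = (t - a\<^sup>2) * (t - b\<^sup>2))"

definition is_principal_angles :: "(real^4) set \<Rightarrow> (real^4) set \<Rightarrow> real \<Rightarrow> real \<Rightarrow> bool" where
  "is_principal_angles P Q \<theta>1 \<theta>2 \<longleftrightarrow> 0 \<le> \<theta>1 \<and> \<theta>1 \<le> \<theta>2 \<and> \<theta>2 \<le> pi / 2 \<and>
     (\<exists>A\<in>stiefel24. \<exists>B\<in>stiefel24. span (columns A) = P \<and> span (columns B) = Q \<and>
        singular_values2 (transpose A ** B) (cos \<theta>1) (cos \<theta>2))"

text \<open>The angles do not depend on the choice of the orthonormal bases.\<close>

definition principal_angles :: "(real^4) set \<Rightarrow> (real^4) set \<Rightarrow> real \<times> real" where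
  "principal_angles P Q = (THE \<theta>. is_principal_angles P Q (fst \<theta>) (snd \<theta>))"

definition xi_plus :: "(real^4) set \<Rightarrow> (real^4) set \<Rightarrow> real" where
  "xi_plus P Q = cos (fst (principal_angles P Q) + snd (principal_angles P Q))"

definition xi_minus :: "(real^4) set \<Rightarrow> (real^4) set \<Rightarrow> real" where
  "xi_minus P Q = cos (fst (principal_angles P Q) - snd (principal_angles P Q))"

definition chordal_dist :: "(real^4) set \<Rightarrow> (real^4) set \<Rightarrow> real" where
  "chordal_dist P Q =
     sqrt ((sin (fst (principal_angles P Q)))\<^sup>2 + (sin (snd (principal_angles P Q)))\<^sup>2)"

section \<open>Riesz energy\<close>

text \<open>
  The value is in \<^typ>\<open>ennreal\<close> so that \<open>riesz_kernel s P P = \<infinity>\<close> for \<open>s > 0\<close>; in the reals,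
  \<open>0 powr (- s)\<close> is \<open>0\<close>.
\<close>

definition riesz_kernel :: "real \<Rightarrow> (real^4) set \<Rightarrow> (real^4) set \<Rightarrow> ennreal" where
  "riesz_kernel s P Q = inverse (ennreal (chordal_dist P Q powr s))"

definition riesz_energy :: "real \<Rightarrow> (real^4) set set \<Rightarrow> ennreal" where
  "riesz_energy s x = (\<Sum>P\<in>x. \<Sum>Q\<in>x - {P}. riesz_kernel s P Q)"

definition wiener_const :: "real \<Rightarrow> ennreal" where
  "wiener_const s =
     (INF \<mu>\<in>gr24_prob_measures. \<integral>\<^sup>+P. (\<integral>\<^sup>+Q. riesz_kernel s P Q \<partial>\<mu>) \<partial>\<mu>)"

section \<open>The harmonic ensemble\<close>

fun legendre_poly :: "nat \<Rightarrow> real \<Rightarrow> real" where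
  "legendre_poly 0 x = 1"
| "legendre_poly (Suc 0) x = x"
| "legendre_poly (Suc (Suc n)) x =
     ((2 * real n + 3) * x * legendre_poly (Suc n) x - (real n + 1) * legendre_poly n x) / (real n + 2)"

definition tau_index :: "nat \<Rightarrow> (nat \<times> nat) set" where
  "tau_index k = {(t1, t2). t2 \<le> t1 \<and> t1 + t2 \<le> k}"

definition d_tau :: "nat \<times> nat \<Rightarrow> nat" where
  "d_tau = (\<lambda>(t1, t2).
     (2 - (if t2 = 0 then 1 else 0)) * (2 * (t1 + t2) + 1) * (2 * (t1 - t2) + 1))"

definition P_tau :: "nat \<times> nat \<Rightarrow> real \<Rightarrow> real \<Rightarrow> real" where
  "P_tau = (\<lambda>(t1, t2) x y.
     (legendre_poly (t1 + t2) x * legendre_poly (t1 - t2) y +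
      legendre_poly (t1 + t2) y * legendre_poly (t1 - t2) x) / 2)"

definition harmonic_kernel :: "nat \<Rightarrow> (real^4) set \<Rightarrow> (real^4) set \<Rightarrow> real" where
  "harmonic_kernel k P Q = (\<Sum>\<tau>\<in>tau_index k. real (d_tau \<tau>) * P_tau \<tau> (xi_plus P Q) (xi_minus P Q))"

definition harmonic_dim :: "nat \<Rightarrow> nat" where
  "harmonic_dim k = (\<Sum>\<tau>\<in>tau_index k. d_tau \<tau>)"

text \<open>
  A simple point process with finitely many points, realised as a random finite subset
  \<open>X \<omega>\<close> of the Grassmannian with measurable counting variables.
\<close>

definition random_finite_subset :: "'w measure \<Rightarrow> ('w \<Rightarrow> (real^4) set set) \<Rightarrow> bool" where
  "random_finite_subset M X \<longleftrightarrow> prob_space M \<and>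
     (\<forall>\<omega>\<in>space M. finite (X \<omega>) \<and> X \<omega> \<subseteq> gr24) \<and>
     (\<forall>D\<in>sets gr24_borel. (\<lambda>\<omega>. card (X \<omega> \<inter> D)) \<in> measurable M (count_space UNIV))"

text \<open>
  The joint intensity \<open>\<rho>\<close> of order \<open>m\<close> is the density, with respect to the \<open>m\<close>-fold product
  measure, of the intensity of \<open>m\<close>-tuples of distinct points of the process.
\<close>

definition joint_intensity ::
  "(real^4) set measure \<Rightarrow> 'w measure \<Rightarrow> ('w \<Rightarrow> (real^4) set set) \<Rightarrow> nat \<Rightarrow>
     ((nat \<Rightarrow> (real^4) set) \<Rightarrow> real) \<Rightarrow> bool" where
  "joint_intensity \<sigma> M X m \<rho> \<longleftrightarrow>
     (\<forall>f :: (nat \<Rightarrow> (real^4) set) \<Rightarrow> ennreal. f \<in> borel_measurable (PiM {..<m} (\<lambda>_. \<sigma>)) \<longrightarrow>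
        (\<integral>\<^sup>+\<omega>. (\<Sum>p\<in>{p \<in> {..<m} \<rightarrow>\<^sub>E X \<omega>. inj_on p {..<m}}. f p) \<partial>M) =
        (\<integral>\<^sup>+p. f p * ennreal (\<rho> p) \<partial>PiM {..<m} (\<lambda>_. \<sigma>)))"

definition determinantal_process ::
  "(real^4) set measure \<Rightarrow> ((real^4) set \<Rightarrow> (real^4) set \<Rightarrow> real) \<Rightarrow>
     'w measure \<Rightarrow> ('w \<Rightarrow> (real^4) set set) \<Rightarrow> bool" where
  "determinantal_process \<sigma> K M X \<longleftrightarrow> random_finite_subset M X \<and>
     (\<forall>m\<ge>1. joint_intensity \<sigma> M X m
        (\<lambda>p. Determinant.det (Matrix.mat m m (\<lambda>(i, j). K (p i) (p j)))))"

definition harmonic_ensemble ::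
  "(real^4) set measure \<Rightarrow> nat \<Rightarrow> 'w measure \<Rightarrow> ('w \<Rightarrow> (real^4) set set) \<Rightarrow> bool" where
  "harmonic_ensemble \<sigma> k M X \<longleftrightarrow> determinantal_process \<sigma> (harmonic_kernel k) M X \<and>
     (AE \<omega> in M. card (X \<omega>) = harmonic_dim k)"

section \<open>The constants\<close>

definition bessel_J1 :: "real \<Rightarrow> real" where
  "bessel_J1 x = (\<Sum>m. (-1) ^ m / (fact m * fact (m + 1)) * (x / 2) ^ (2 * m + 1))"

definition catalan_const :: real where
  "catalan_const = (\<Sum>n. (-1) ^ n / (2 * real n + 1)\<^sup>2)"

definition energy_const :: "real \<Rightarrow> real" where
  "energy_const s = 2 powr (2 + 3 * s / 4) *
     (LBINT x:{0<..}. LBINT y:{0<..}.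
        (bessel_J1 x)\<^sup>2 * (bessel_J1 y)\<^sup>2 / (x * y * (x\<^sup>2 + y\<^sup>2) powr (s / 2)))"

end

theory Submission
  imports Defs
begin

text \<open>
  A plane \<open>P\<close> is encoded by the self-dual and anti-self-dual parts of its Pluecker vector, a pair
  \<open>(u, v)\<close> of points of the unit sphere \<open>S\<^sup>2\<close>, well defined up to a common sign. For two planes, the numbers
  \<open>u \<bullet> u'\<close> and \<open>v \<bullet> v'\<close> are \<open>\<xi>\<^sub>+\<close> and \<open>\<xi>\<^sub>-\<close> up to order and common sign, and by Archimedes'
  theorem they are independent and uniform on \<open>[-1, 1]\<close> under the invariant measure. Energies thus become
  integrals over the square \<open>[-1, 1]\<^sup>2\<close>. The powers of \<open>\<xi>\<^sub>+ \<xi>\<^sub>- = (u \<bullet> u') (v \<bullet> v')\<close> are positive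
  definite and \<open>(1 - t)\<^bsup>-s/2\<^esup>\<close> has nonnegative Taylor coefficients, so the invariant measure is the minimiser
  and the determinantal formula gives \<open>E = N\<^sup>2 W - (1/4) \<integral>\<integral> K(x, y)\<^sup>2 (1 - x y)\<^bsup>-s/2\<^esup> dx dy\<close>.

  The kernel factors: with \<open>S(x) = \<Sum>\<^bsub>m \<le> k\<^esub> (2 m + 1) P\<^sub>m(x)\<close> one has
  \<open>K(x, y) = (S(x) S(y) + S(-x) S(-y)) / 2\<close>. At the scale \<open>x = 1 - p / (k + 1)\<^sup>2\<close> the sum \<open>S\<close> tends to a Bessel
  function, and dominated convergence yields the second term.

  For \<open>s = 2\<close> write \<open>1 / (p + q)\<close> as the integral of \<open>exp (- l (p + q))\<close> over \<open>l > 0\<close>. The Laplace transform of the squared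
  Bessel kernel is the average over \<open>x\<close> of \<open>4 sin\<^sup>2 x (1 - exp (- 2 cos\<^sup>2 x / l))\<close>, so the constant becomes
  an average over the torus of \<open>sin\<^sup>2 a sin\<^sup>2 b\<close> times \<open>f(u + v) - f(u) - f(v)\<close>, where \<open>f(t) = t ln t\<close>,
  \<open>u = cos\<^sup>2 a\<close> and \<open>v = cos\<^sup>2 b\<close>. Since \<open>u + v = 1 + cos (a + b) cos (a - b)\<close>, the substitution \<open>(a + b, a - b)\<close> and the
  Taylor series of \<open>f\<close> at \<open>1\<close> reduce it to series in the Wallis ratios, which telescope except for one logarithmic
  series that contributes Catalan's constant.
\<close>

section \<open>Legendre polynomials\<close>

text \<open>The weight (1 - x y)^(-s/2) is singular at two opposite corners of the square. Folding
  along the central symmetry leaves one of them, and in scaled coordinates the arithmetic-geometric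
  mean inequality gives the majorant p^(-s/4) q^(-s/4) / ((1 + p) (1 + q)), integrable for 0 < s <
  4. The decay 1 / (1 + p) has to be uniform in k; Laplace's integral for the Legendre polynomials
  provides it. On the geometric side the obstacle is the common sign of (u, v): a chosen pair need
  not depend measurably on the plane. All statements about planes are therefore phrased through two
  even invariants, the product and the squared mean of \<xi>+ and \<xi>-, which recover both numbers
  as roots of a quadratic. The given measure is only known to be invariant. Zonal integrals then do
  not depend on the base plane, and averaging over a random base plane transfers uniformity from the
  spheres to the measure. The Riesz kernel is infinite on the diagonal, so minimality is obtained
  for powers of 1 - r \<xi>+ \<xi>- with r < 1 and passed to the limit by Fatou. Energies stay in
  the extended nonnegative reals, where identities are written as sums, and are subtracted only at
  the end.\<close>

lemma laplace_integral:
  fixes x :: real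
  assumes "\<bar>x\<bar> \<le> 1"
  shows "((\<lambda>\<phi>. (of_real x + \<i> * of_real (sqrt (1 - x\<^sup>2) * cos \<phi>)) ^ n)
           has_integral (of_real (pi * legendre_poly n x) :: complex)) {0..pi}"
  using assms
proof (induction n x rule: legendre_poly.induct)
  case (1 x)
  show ?case using has_integral_const_real[of "1::complex" 0 pi] by (simp add: scaleR_conv_of_real)
next
  case (2 x)
  have "((\<lambda>\<phi>. complex_of_real (cos \<phi>)) has_integral (of_real (sin pi) - of_real (sin 0))) {0..pi}"
    by (rule fundamental_theorem_of_calculus)
       (auto intro!: derivative_eq_intros simp flip: has_real_derivative_iff_has_vector_derivative)
  then have c: "((\<lambda>\<phi>. complex_of_real (cos \<phi>)) has_integral 0) {0..pi}" by simp
  have "((\<lambda>\<phi>. complex_of_real x + \<i> * of_real (sqrt (1 - x\<^sup>2)) * complex_of_real (cos \<phi>))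
      has_integral (pi *\<^sub>R of_real x + \<i> * of_real (sqrt (1 - x\<^sup>2)) * 0)) {0..pi}"
    using has_integral_const_real[of "complex_of_real x" 0 pi]
    by (intro has_integral_add has_integral_mult_right c) simp
  then show ?case by (simp add: scaleR_conv_of_real mult_ac)
next
  case (3 n x)
  define r where "r = sqrt (1 - x\<^sup>2)"
  have r2: "complex_of_real r ^ 2 = 1 - of_real x ^ 2"
    using "3.prems" by (simp add: r_def abs_square_le_1 flip: of_real_power)
  define z where "z = (\<lambda>\<phi>. complex_of_real x + \<i> * of_real (r * cos \<phi>))"
  \<comment> \<open>\<open>D\<close> is the derivative of sin \<phi> z^(n+1), which vanishes at 0
    and pi. The integrand satisfies the Legendre recurrence up to a multiple of \<open>D\<close>, so
    the integrals satisfy it exactly.\<close>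
  define D where "D = (\<lambda>\<phi>. of_real (cos \<phi>) * z \<phi> ^ (n + 1)
      + of_real (sin \<phi>) * (of_nat (n + 1) * z \<phi> ^ n * (\<i> * of_real (r * - sin \<phi>))))"
  have "((\<lambda>\<phi>. of_real (sin \<phi>) * z \<phi> ^ (n + 1)) has_vector_derivative D \<phi>) (at \<phi> within {0..pi})" for \<phi>
  proof -
    have z': "((\<lambda>w. of_real x + \<i> * (of_real r * cos w)) has_field_derivative
        (\<i> * of_real (r * - sin \<phi>))) (at (complex_of_real \<phi>))"
      by (auto intro!: derivative_eq_intros simp: sin_of_real)
    have "((\<lambda>w. sin w * (of_real x + \<i> * (of_real r * cos w)) ^ Suc n) has_field_derivative D \<phi>)
       (at (of_real \<phi>))"
      using DERIV_mult[OF DERIV_sin DERIV_power_Suc[OF z', of n]]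
      unfolding D_def z_def by (simp add: sin_of_real cos_of_real mult_ac add_ac)
    then have "((\<lambda>w. sin w * (of_real x + \<i> * (of_real r * cos w)) ^ Suc n) \<circ> of_real has_vector_derivative D \<phi>) (at \<phi> within {0..pi})"
      by (intro field_vector_diff_chain_within[where f=of_real and f'=1, simplified])
         (auto intro: has_vector_derivative_of_real has_field_derivative_at_within derivative_eq_intros)
    then show ?thesis by (simp add: o_def z_def sin_of_real cos_of_real)
  qed
  then have "(D has_integral (of_real (sin pi) * z pi ^ (n + 1) - of_real (sin 0) * z 0 ^ (n + 1))) {0..pi}"
    by (intro fundamental_theorem_of_calculus) auto
  then have D: "(D has_integral 0) {0..pi}" by simp
  have i0: "((\<lambda>\<phi>. z \<phi> ^ n) has_integral of_real (pi * legendre_poly n x)) {0..pi}"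
    and i1: "((\<lambda>\<phi>. z \<phi> ^ Suc n) has_integral of_real (pi * legendre_poly (Suc n) x)) {0..pi}"
    using 3 by (simp_all add: z_def r_def)
  have eq: "(of_nat (2 * n + 3) * of_real x) * z \<phi> ^ Suc n - of_nat (n + 1) * z \<phi> ^ n + (\<i> * of_real r) * D \<phi>
     = of_nat (n + 2) * z \<phi> ^ (n + 2)" for \<phi>
  proof -
    define c :: complex where "c = of_real (cos \<phi>)"
    define s :: complex where "s = of_real (sin \<phi>)"
    have sc: "s ^ 2 = 1 - c ^ 2" unfolding s_def c_def
      by (metis of_real_1 of_real_diff of_real_power sin_squared_eq)
    define R X where "R = complex_of_real r" and "X = complex_of_real x"
    have zz: "z \<phi> = X + \<i> * R * c" by (simp add: z_def c_def R_def X_def)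
    have "\<i> * R * D \<phi> = \<i> * R * c * z \<phi> ^ (n+1) + of_nat (n+1) * z \<phi> ^ n * (R^2 * s^2)"
      by (simp add: D_def R_def c_def s_def power2_eq_square algebra_simps)
    moreover have "\<i> * R * c = z \<phi> - X" by (simp add: zz)
    moreover have "R^2 * s^2 = R^2 + (z \<phi> - X)^2"
      by (simp add: sc zz power_mult_distrib right_diff_distrib)
    then have "R^2 * s^2 = 1 - X^2 + (z \<phi> - X)^2" by (simp add: R_def X_def r2)
    ultimately have DD: "\<i> * R * D \<phi> = (z \<phi> - X) * z \<phi> ^ (n+1) + of_nat (n+1) * z \<phi> ^ n * (1 - X^2 + (z \<phi> - X)^2)"
      by simp
    show ?thesis unfolding R_def[symmetric] X_def[symmetric] DD
      by (simp add: power2_eq_square algebra_simps)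
  qed
  have "((\<lambda>\<phi>. of_nat (n + 2) * z \<phi> ^ (n + 2)) has_integral
     ((of_nat (2 * n + 3) * of_real x) * of_real (pi * legendre_poly (Suc n) x) - of_nat (n + 1) * of_real (pi * legendre_poly n x)
       + (\<i> * of_real r) * 0)) {0..pi}"
    unfolding eq[symmetric]
    by (intro has_integral_add has_integral_diff has_integral_mult_right D i0 i1)
  from has_integral_mult_right[OF this, of "inverse (of_nat (n+2))"]
  have "((\<lambda>\<phi>. z \<phi> ^ (n + 2)) has_integral
     inverse (of_nat (n+2)) * ((of_nat (2 * n + 3) * of_real x) * of_real (pi * legendre_poly (Suc n) x) - of_nat (n + 1) * of_real (pi * legendre_poly n x)
       + (\<i> * of_real r) * 0)) {0..pi}"
    by (simp add: mult.assoc[symmetric] del: of_nat_Suc of_nat_add)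
  moreover have "inverse (of_nat (n+2)) * ((of_nat (2 * n + 3) * of_real x) * of_real (pi * legendre_poly (Suc n) x) - of_nat (n + 1) * of_real (pi * legendre_poly n x)
       + (\<i> * of_real r) * 0) = complex_of_real (inverse (real n+2) * (((2 * real n + 3) * x) * (pi * legendre_poly (Suc n) x) - (real n + 1) * (pi * legendre_poly n x)))"
    by (simp add: add.commute)
  moreover have "inverse (real n+2) * (((2 * real n + 3) * x) * (pi * legendre_poly (Suc n) x) - (real n + 1) * (pi * legendre_poly n x)) = pi * legendre_poly (Suc (Suc n)) x"
    by (simp add: divide_inverse algebra_simps)
  ultimately show ?case by (simp add: z_def r_def)
qed

text \<open>The squared moduli are x^2 + (1 - x^2) cos^2 and (1 - x)^2 + (1 - x^2) cos^2, largest
  for cos^2 = 1. These pointwise bounds on Laplace's integrand do not involve the degree, hence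
  neither do the bounds on Legendre polynomials drawn from them.\<close>

lemma norm_laplace_le:
  fixes x :: real
  assumes "\<bar>x\<bar> \<le> 1"
  shows "norm (complex_of_real x + \<i> * of_real (sqrt (1 - x\<^sup>2) * cos \<phi>)) \<le> 1"
    and "norm (1 - (complex_of_real x + \<i> * of_real (sqrt (1 - x\<^sup>2) * cos \<phi>))) \<le> sqrt (2 * (1 - x))"
proof -
  have x2: "0 \<le> 1 - x\<^sup>2" using assms by (simp add: abs_square_le_1)
  have c: "(1 - x\<^sup>2) * (cos \<phi>)\<^sup>2 \<le> (1 - x\<^sup>2) * 1"
    by (intro mult_left_mono x2) (simp add: abs_square_le_1)
  show "norm (complex_of_real x + \<i> * of_real (sqrt (1 - x\<^sup>2) * cos \<phi>)) \<le> 1"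
    using c x2 by (simp add: cmod_def power_mult_distrib)
  have "(1 - x)\<^sup>2 + (1 - x\<^sup>2) = 2 * (1 - x)" by (simp add: power2_eq_square algebra_simps)
  then show "norm (1 - (complex_of_real x + \<i> * of_real (sqrt (1 - x\<^sup>2) * cos \<phi>))) \<le> sqrt (2 * (1 - x))"
    using c x2 by (simp add: cmod_def power_mult_distrib)
qed

lemma abs_legendre_poly_le_1:
  assumes "\<bar>x\<bar> \<le> 1" shows "\<bar>legendre_poly n x\<bar> \<le> 1"
proof -
  have "norm (complex_of_real (pi * legendre_poly n x)) \<le> 1 * content (cbox 0 pi)"
    using laplace_integral[OF assms, of n]
    by (intro has_integral_bound[where f="\<lambda>\<phi>. (of_real x + \<i> * of_real (sqrt (1 - x\<^sup>2) * cos \<phi>)) ^ n"])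
       (use norm_laplace_le(1)[OF assms] in \<open>auto simp: norm_power intro!: power_le_one\<close>)
  then show ?thesis by (simp add: abs_mult del: of_real_mult)
qed

text \<open>The difference has the integrand z^n (1 - z) with |z| \<le> 1. The square root at x = 1,
  uniform in the degree, is what makes the Christoffel-Darboux formula a useful estimate near the
  singular corner.\<close>

lemma abs_legendre_poly_diff_le:
  assumes "\<bar>x\<bar> \<le> 1" shows "\<bar>legendre_poly n x - legendre_poly (Suc n) x\<bar> \<le> sqrt (2 * (1 - x))"
proof -
  have "((\<lambda>\<phi>. (of_real x + \<i> * of_real (sqrt (1 - x\<^sup>2) * cos \<phi>)) ^ n
        - (of_real x + \<i> * of_real (sqrt (1 - x\<^sup>2) * cos \<phi>)) ^ Suc n) has_integral
        (complex_of_real (pi * legendre_poly n x) - complex_of_real (pi * legendre_poly (Suc n) x))) (cbox 0 pi)"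
    using laplace_integral[OF assms, of n] laplace_integral[OF assms, of "Suc n"]
    by (intro has_integral_diff) (simp_all add: cbox_interval)
  then have "norm (complex_of_real (pi * legendre_poly n x) - complex_of_real (pi * legendre_poly (Suc n) x))
    \<le> sqrt (2 * (1 - x)) * content (cbox 0 pi)"
  proof (rule has_integral_bound[rotated])
    fix \<phi> :: real
    let ?z = "complex_of_real x + \<i> * of_real (sqrt (1 - x\<^sup>2) * cos \<phi>)"
    have "norm (?z ^ n - ?z ^ Suc n) = norm ?z ^ n * norm (1 - ?z)"
      unfolding norm_power[symmetric] norm_mult[symmetric] by (simp only: power_Suc2 right_diff_distrib mult_1_right)
    also have "\<dots> \<le> 1 * sqrt (2 * (1 - x))"
      by (intro mult_mono power_le_one norm_laplace_le[OF assms]) auto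
    finally show "norm (?z ^ n - ?z ^ Suc n) \<le> sqrt (2 * (1 - x))" by simp
  qed (use assms in auto)
  also have "norm (complex_of_real (pi * legendre_poly n x) - complex_of_real (pi * legendre_poly (Suc n) x))
    = pi * \<bar>legendre_poly n x - legendre_poly (Suc n) x\<bar>"
    by (subst of_real_diff[symmetric], subst norm_of_real)
       (simp only: right_diff_distrib[symmetric] abs_mult, simp)
  finally show ?thesis by simp
qed

lemma legendre_poly_1 [simp]: "legendre_poly n 1 = 1"
  by (induction n "1::real" rule: legendre_poly.induct) (simp_all add: field_simps)

lemma legendre_poly_minus: "legendre_poly n (- x) = (-1) ^ n * legendre_poly n x"
  by (induction n x rule: legendre_poly.induct) (simp_all add: field_simps)

definition legendre_sum :: "nat \<Rightarrow> real \<Rightarrow> real" where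
  "legendre_sum k x = (\<Sum>m\<le>k. (2 * real m + 1) * legendre_poly m x)"

lemma legendre_sum_Suc:
  "legendre_sum (Suc k) x = legendre_sum k x + (2 * real k + 3) * legendre_poly (Suc k) x"
  by (simp add: legendre_sum_def algebra_simps)

text \<open>The Christoffel-Darboux formula with second argument 1, where every Legendre polynomial
  has the value 1.\<close>

lemma christoffel_darboux_legendre:
  "(1 - x) * legendre_sum k x = (real k + 1) * (legendre_poly k x - legendre_poly (Suc k) x)"
proof (induction k)
  case (Suc k)
  show ?case unfolding legendre_sum_Suc distrib_left Suc by (simp add: field_simps)
qed (simp add: legendre_sum_def)

lemma sum_odd_numbers: "(\<Sum>m\<le>k. 2 * real m + 1) = (real k + 1)\<^sup>2"
  by (induction k) (simp_all add: power2_eq_square algebra_simps)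

lemma abs_legendre_sum_le:
  assumes "\<bar>x\<bar> \<le> 1" shows "\<bar>legendre_sum k x\<bar> \<le> (real k + 1)\<^sup>2"
proof -
  have "\<bar>legendre_sum k x\<bar> \<le> (\<Sum>m\<le>k. \<bar>(2 * real m + 1) * legendre_poly m x\<bar>)"
    unfolding legendre_sum_def by (rule sum_abs)
  also have "\<dots> \<le> (\<Sum>m\<le>k. (2 * real m + 1) * 1)"
    unfolding abs_mult using abs_legendre_poly_le_1[OF assms] by (intro sum_mono mult_mono) auto
  finally show ?thesis by (simp add: sum_odd_numbers)
qed

text \<open>With K = k + 1 and p = (1 - x) K^2 this says that (S / K^2)^2 p \<le> 2 for S =
  \<open>legendre_sum k x\<close>: decay like 1 / p of the rescaled square, uniformly in k.\<close>

lemma abs_legendre_sum_sqrt_le: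
  assumes "\<bar>x\<bar> \<le> 1" shows "\<bar>legendre_sum k x\<bar> * sqrt (1 - x) \<le> sqrt 2 * (real k + 1)"
proof (cases "x = 1")
  case False
  then have pos: "sqrt (1 - x) > 0" using assms by simp
  have "sqrt (1 - x) * sqrt (1 - x) = 1 - x" using assms by simp
  then have "(\<bar>legendre_sum k x\<bar> * sqrt (1 - x)) * sqrt (1 - x) = \<bar>(1 - x) * legendre_sum k x\<bar>"
    using assms by (simp add: abs_mult mult.assoc)
  also have "\<dots> \<le> (real k + 1) * sqrt (2 * (1 - x))"
    unfolding christoffel_darboux_legendre abs_mult
    using abs_legendre_poly_diff_le[OF assms] by (intro mult_mono) auto
  also have "\<dots> = (sqrt 2 * (real k + 1)) * sqrt (1 - x)" by (simp only: real_sqrt_mult mult_ac)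
  finally show ?thesis using pos by (rule mult_right_le_imp_le)
qed simp

section \<open>Sums of Legendre polynomials and the Bessel scaling\<close>

text \<open>For j \<le> n this is C(n, j) C(n + j, j), the coefficient of z^j in the Legendre
  polynomial at 1 + 2 z. The rising factorial contains the factor 0 as soon as j > n, so no case
  distinction is needed.\<close>

definition legendre_coeff :: "nat \<Rightarrow> nat \<Rightarrow> real" where
  "legendre_coeff n j = pochhammer (real n - real j + 1) (2 * j) / (fact j)\<^sup>2"

lemma pochhammer_eq_0_real:
  assumes "k < m" shows "pochhammer (- real k) m = 0"
  using assms by (simp add: pochhammer_of_nat_eq_0_lemma)

lemma legendre_coeff_eq_0: "n < j \<Longrightarrow> legendre_coeff n j = 0"
  using pochhammer_eq_0_real[of "j - n - 1" "2 * j"]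
  by (simp add: legendre_coeff_def of_nat_diff algebra_simps)

lemma legendre_coeff_rec:
  "(real n + 2) * legendre_coeff (n + 2) (Suc j) + (real n + 1) * legendre_coeff n (Suc j)
     = (2 * real n + 3) * (legendre_coeff (n + 1) (Suc j) + 2 * legendre_coeff (n + 1) j)"
proof -
  define C where "C = pochhammer (real n - real j + 2) (2 * j)"
  have a: "pochhammer (real n - real (Suc j) + 1) (2 * Suc j) = (real n - real j) * (real n - real j + 1) * C"
    using pochhammer_rec[of "real n - real j" "Suc (2 * j)"] pochhammer_rec[of "real n - real j + 1" "2 * j"]
    by (simp add: C_def add.commute)
  have b: "pochhammer (real (n+1) - real (Suc j) + 1) (2 * Suc j) = (real n - real j + 1) * C * (real n + real j + 2)"
    using pochhammer_rec[of "real n - real j + 1" "Suc (2 * j)"] pochhammer_Suc[of "real n - real j + 2" "2 * j"]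
    by (simp add: C_def algebra_simps)
  have c: "pochhammer (real (n+2) - real (Suc j) + 1) (2 * Suc j) = C * (real n + real j + 2) * (real n + real j + 3)"
    using pochhammer_Suc[of "real n - real j + 2" "Suc (2 * j)"] pochhammer_Suc[of "real n - real j + 2" "2 * j"]
    by (simp add: C_def algebra_simps)
  have d: "pochhammer (real (n+1) - real j + 1) (2 * j) = C"
    by (simp add: C_def algebra_simps)
  define F :: real where "F = (fact j)\<^sup>2"
  have F: "F > 0" by (simp add: F_def)
  have f: "(fact (Suc j) :: real)\<^sup>2 = (real j + 1)\<^sup>2 * F"
    by (simp add: F_def power_mult_distrib add.commute)
  define J where "J = real j + 1"
  have J: "J > 0" "real j = J - 1" by (simp_all add: J_def)
  show ?thesis
    unfolding legendre_coeff_def a b c d f F_def[symmetric]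
    unfolding J(2)
    using F J(1) by (simp add: divide_simps) (simp add: power2_eq_square algebra_simps)
qed

lemma legendre_coeff_0: "legendre_coeff n 0 = 1"
  by (simp add: legendre_coeff_def)

text \<open>The truncation order \<open>M\<close> is any number from n on, so that the polynomials
  of the three-term recurrence can be expanded over compatible index ranges.\<close>

lemma legendre_poly_expansion:
  assumes "n \<le> M"
  shows "legendre_poly n (1 + 2 * z) = (\<Sum>j\<le>M. legendre_coeff n j * z ^ j)"
proof -
  have "legendre_poly n x = (\<Sum>j\<le>M. legendre_coeff n j * z ^ j)" if "x = 1 + 2 * z" "n \<le> M" for x M
    using that
  proof (induction n x arbitrary: M rule: legendre_poly.induct)
    case (1 x)
    then show ?case by (subst sum.mono_neutral_right[of _ "{0}"]) (auto simp: legendre_coeff_eq_0 legendre_coeff_0)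
  next
    case (2 x)
    have "(\<Sum>j\<le>M. legendre_coeff (Suc 0) j * z ^ j) = (\<Sum>j\<in>{0,1}. legendre_coeff (Suc 0) j * z ^ j)"
      using 2 by (intro sum.mono_neutral_right) (auto simp: legendre_coeff_eq_0)
    then show ?case using 2 by (simp add: legendre_coeff_def pochhammer_Suc numeral_2_eq_2)
  next
    case (3 n x)
    obtain M' where M: "M = Suc M'" using "3.prems" by (cases M) auto
    have i1: "legendre_poly (Suc n) x = (\<Sum>j\<le>Suc M'. legendre_coeff (Suc n) j * z ^ j)"
      and i1': "legendre_poly (Suc n) x = (\<Sum>j\<le>M'. legendre_coeff (Suc n) j * z ^ j)"
      and i0: "legendre_poly n x = (\<Sum>j\<le>Suc M'. legendre_coeff n j * z ^ j)"
      using "3.IH"(1)[of "Suc M'"] "3.IH"(1)[of M'] "3.IH"(2)[of "Suc M'"] "3.prems" M by auto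
    have "(real n + 2) * (\<Sum>j\<le>M. legendre_coeff (n + 2) j * z ^ j)
        = (real n + 2) + (\<Sum>j\<le>M'. ((real n + 2) * legendre_coeff (n + 2) (Suc j)) * z ^ Suc j)"
      unfolding M sum.atMost_Suc_shift by (simp add: distrib_left sum_distrib_left legendre_coeff_0 mult_ac)
    also have "\<dots> = (real n + 2) + (\<Sum>j\<le>M'. ((2 * real n + 3) * (legendre_coeff (n + 1) (Suc j) + 2 * legendre_coeff (n + 1) j) - (real n + 1) * legendre_coeff n (Suc j)) * z ^ Suc j)"
      unfolding legendre_coeff_rec[symmetric] by simp
    \<comment> \<open>Here x = 1 + 2 z. The summand without z is expanded up to
      \<open>Suc M'\<close>, the one with the factor 2 z only up to \<open>M'\<close>, because the
      factor z raises each exponent by one.\<close>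
    also have "\<dots> = (2 * real n + 3) * (legendre_poly (Suc n) x + 2 * z * legendre_poly (Suc n) x) - (real n + 1) * legendre_poly n x"
      apply (subst (1) i1)
      apply (subst i1')
      unfolding i0 sum.atMost_Suc_shift
      by (simp add: sum_distrib_left sum.distrib sum_subtractf algebra_simps legendre_coeff_0)
    also have "\<dots> = (real n + 2) * legendre_poly (Suc (Suc n)) x"
    proof -
      have "(real n + 2) * legendre_poly (Suc (Suc n)) x
          = (2 * real n + 3) * x * legendre_poly (Suc n) x - (real n + 1) * legendre_poly n x"
        by (simp add: nonzero_mult_div_cancel_left)
      then show ?thesis unfolding "3.prems"(1) by (simp add: algebra_simps)
    qed
    finally have "(real n + 2) * (\<Sum>j\<le>M. legendre_coeff (n + 2) j * z ^ j) = (real n + 2) * legendre_poly (Suc (Suc n)) x" .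
    then show ?case by (subst (asm) mult_left_cancel) auto
  qed
  then show ?thesis using assms by blast
qed

text \<open>Induction on k: the increment of each coefficient is (2 k + 3) times a Legendre
  coefficient. The result is a rising factorial centred at K = k + 1, which is why the scaling uses
  K and not k.\<close>

lemma legendre_sum_expansion:
  assumes "k \<le> M"
  shows "legendre_sum k (1 + 2 * z) = (\<Sum>j\<le>M. (real k + 1) * pochhammer (real k + 1 - real j) (2 * j + 1) / (fact j * fact (Suc j)) * z ^ j)"
  using assms
proof (induction k)
  case 0
  have "(\<Sum>j\<le>M. (real 0 + 1) * pochhammer (real 0 + 1 - real j) (2 * j + 1) / (fact j * fact (Suc j)) * z ^ j)
    = (\<Sum>j\<in>{0}. (real 0 + 1) * pochhammer (real 0 + 1 - real j) (2 * j + 1) / (fact j * fact (Suc j)) * z ^ j)"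
  proof (intro sum.mono_neutral_right ballI)
    fix i assume "i \<in> {..M} - {0}"
    then have "pochhammer (real 0 + 1 - real i) (2 * i + 1) = 0"
      using pochhammer_eq_0_real[of "i - 1" "2 * i + 1"] by (simp add: of_nat_diff algebra_simps)
    then show "(real 0 + 1) * pochhammer (real 0 + 1 - real i) (2 * i + 1) / (fact i * fact (Suc i)) * z ^ i = 0"
      by simp
  qed auto
  then show ?case by (simp add: legendre_sum_def)
next
  case (Suc k)
  have *: "(real (Suc k) + 1) * pochhammer (real (Suc k) + 1 - real j) (2 * j + 1) / (fact j * fact (Suc j))
     = (real k + 1) * pochhammer (real k + 1 - real j) (2 * j + 1) / (fact j * fact (Suc j))
       + (2 * real k + 3) * legendre_coeff (Suc k) j" for j
  proof -
    define C where "C = pochhammer (real k - real j + 2) (2 * j)"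
    have a: "pochhammer (real (Suc k) + 1 - real j) (2 * j + 1) = C * (real k + real j + 2)"
      using pochhammer_Suc[of "real k - real j + 2" "2 * j"] by (simp add: C_def algebra_simps)
    have b: "pochhammer (real k + 1 - real j) (2 * j + 1) = (real k - real j + 1) * C"
      using pochhammer_rec[of "real k - real j + 1" "2 * j"] by (simp add: C_def algebra_simps)
    have c: "pochhammer (real (Suc k) - real j + 1) (2 * j) = C" by (simp add: C_def algebra_simps)
    define F :: real where "F = fact j"
    have F: "F > 0" by (simp add: F_def)
    have f: "(fact (Suc j) :: real) = (real j + 1) * F" by (simp add: F_def add.commute)
    define J where "J = real j + 1"
    have J: "J > 0" "real j = J - 1" by (simp_all add: J_def)
    show ?thesis unfolding legendre_coeff_def a b c f F_def[symmetric]
    unfolding J(2)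
      using F J(1) by (simp add: divide_simps) (simp add: power2_eq_square algebra_simps)
  qed
  show ?case unfolding legendre_sum_Suc * legendre_poly_expansion[OF Suc.prems]
    using Suc by (simp add: sum.distrib sum_distrib_left algebra_simps)
qed

text \<open>The factors K - i and K + i pair up. Divided by K^2, each pair becomes 1 - (i/K)^2,
  which tends to 1 as K grows.\<close>

lemma pochhammer_centered:
  fixes K :: real
  shows "pochhammer (K - real j) (2 * j + 1) = K * (\<Prod>i=1..j. (K\<^sup>2 - (real i)\<^sup>2))"
proof (induction j)
  case (Suc j)
  have "pochhammer (K - real (Suc j)) (2 * Suc j + 1)
     = (K - real j - 1) * (pochhammer (K - real j) (2 * j + 1) * (K + real j + 1))"
    using pochhammer_rec[of "K - real j - 1" "Suc (Suc (2 * j))"] pochhammer_Suc[of "K - real j" "Suc (2 * j)"]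
    by (simp add: algebra_simps)
  then show ?case unfolding Suc by (simp add: prod.nat_ivl_Suc' power2_eq_square algebra_simps)
qed simp

text \<open>With \<open>K = k + 1\<close> the shift \<open>x = 1 - p / K\<^sup>2\<close> is the scale at which \<open>legendre_sum k\<close> has a
  nontrivial limit, \<open>2 J\<^sub>1(\<surd>(2 p)) / \<surd>(2 p)\<close>.\<close>

definition bessel_ratio :: "real \<Rightarrow> real" where
  "bessel_ratio p = (\<Sum>m. (- p / 2) ^ m / (fact m * fact (Suc m)))"

definition scaled_legendre_sum :: "nat \<Rightarrow> real \<Rightarrow> real" where
  "scaled_legendre_sum k p = legendre_sum k (1 - p / (real k + 1)\<^sup>2) / (real k + 1)\<^sup>2"

text \<open>Each term is the corresponding term of \<open>bessel_ratio p\<close> times a product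
  that lies between 0 and 1 and tends to 1. In this form dominated convergence of series
  applies.\<close>

lemma scaled_legendre_sum_series:
  "scaled_legendre_sum k p
     = (\<Sum>j. (- p / 2) ^ j / (fact j * fact (Suc j)) * (\<Prod>i=1..j. 1 - (real i / (real k + 1))\<^sup>2))"
proof -
  define K where "K = real k + 1"
  have K: "K > 0" by (simp add: K_def)
  have "scaled_legendre_sum k p = (\<Sum>j\<le>k. K * pochhammer (K - real j) (2 * j + 1) / (fact j * fact (Suc j)) * (- p / (2 * K\<^sup>2)) ^ j) / K\<^sup>2"
    unfolding scaled_legendre_sum_def K_def
    using legendre_sum_expansion[of k k "- p / (2 * (real k + 1)\<^sup>2)"] by (simp add: field_simps)
  also have "\<dots> = (\<Sum>j\<le>k. (- p / 2) ^ j / (fact j * fact (Suc j)) * (\<Prod>i=1..j. 1 - (real i / K)\<^sup>2))"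
    unfolding sum_divide_distrib
  proof (rule sum.cong[OF refl])
    fix j
    have "(\<Prod>i=1..j. (K\<^sup>2 - (real i)\<^sup>2)) = (\<Prod>i=1..j. K\<^sup>2 * (1 - (real i / K)\<^sup>2))"
      using K by (intro prod.cong) (auto simp: field_simps)
    also have "\<dots> = (K\<^sup>2) ^ j * (\<Prod>i=1..j. 1 - (real i / K)\<^sup>2)"
      by (simp add: prod.distrib)
    finally show "K * pochhammer (K - real j) (2 * j + 1) / (fact j * fact (Suc j)) * (- p / (2 * K\<^sup>2)) ^ j / K\<^sup>2
       = (- p / 2) ^ j / (fact j * fact (Suc j)) * (\<Prod>i=1..j. 1 - (real i / K)\<^sup>2)"
      unfolding pochhammer_centered using K power_mult_distrib[of "K\<^sup>2" "- p / (2 * K\<^sup>2)" j]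
      by (simp add: field_simps power2_eq_square del: fact_Suc)
  qed
  \<comment> \<open>For j > k the product contains the factor with i = k + 1, which is 0, so the
    finite sum is a full series.\<close>
  also have "\<dots> = (\<Sum>j. (- p / 2) ^ j / (fact j * fact (Suc j)) * (\<Prod>i=1..j. 1 - (real i / K)\<^sup>2))"
  proof (rule suminf_finite[symmetric])
    fix j assume "j \<notin> {..k}"
    then have "k + 1 \<in> {1..j}" "1 - (real (k + 1) / K)\<^sup>2 = 0" using K by (auto simp: K_def add.commute)
    then have "(\<Prod>i=1..j. 1 - (real i / K)\<^sup>2) = 0" by (intro prod_zero) (blast | simp)+
    then show "(- p / 2) ^ j / (fact j * fact (Suc j)) * (\<Prod>i=1..j. 1 - (real i / K)\<^sup>2) = 0" by simp
  qed auto
  finally show ?thesis by (simp add: K_def)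
qed

lemma prod_le_1_abs:
  "\<bar>\<Prod>i=1..j. 1 - (real i / (real k + 1))\<^sup>2\<bar> \<le> 1"
proof (cases "j \<le> k")
  case True
  have "(real i / (real k + 1))\<^sup>2 \<le> 1" if "i \<in> {1..j}" for i
    using that True by (intro power_le_one) auto
  then have "0 \<le> (\<Prod>i=1..j. 1 - (real i / (real k + 1))\<^sup>2)" "(\<Prod>i=1..j. 1 - (real i / (real k + 1))\<^sup>2) \<le> 1"
    by (auto intro!: prod_nonneg prod_le_1)
  then show ?thesis by simp
next
  case False
  then have "k + 1 \<in> {1..j}" "1 - (real (k + 1) / (real k + 1))\<^sup>2 = 0" by (auto simp: add.commute)
  then have "(\<Prod>i=1..j. 1 - (real i / (real k + 1))\<^sup>2) = 0" by (intro prod_zero) (blast | simp)+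
  then show ?thesis by linarith
qed

lemma bessel_ratio_abs_summable: "summable (\<lambda>m. \<bar>(p::real)\<bar> ^ m / (fact m * fact (Suc m)))"
proof (rule summable_comparison_test')
  show "summable (\<lambda>m. \<bar>p\<bar> ^ m / fact m)" using summable_exp[of "\<bar>p\<bar>"] by (simp add: divide_inverse mult.commute)
  fix n :: nat
  have "\<bar>p\<bar> ^ n / (fact n * fact (Suc n)) \<le> \<bar>p\<bar> ^ n / (fact n * 1)"
    by (intro divide_left_mono mult_left_mono fact_ge_1) auto
  then show "norm (\<bar>p\<bar> ^ n / (fact n * fact (Suc n))) \<le> \<bar>p\<bar> ^ n / fact n" by simp
qed

lemma scaled_legendre_sum_tendsto: "(\<lambda>k. scaled_legendre_sum k p) \<longlonglongrightarrow> bessel_ratio p"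
  unfolding scaled_legendre_sum_series bessel_ratio_def
proof (rule tannerys_theorem[THEN conjunct2, THEN conjunct2])
  show "summable (\<lambda>m. \<bar>p / 2\<bar> ^ m / (fact m * fact (Suc m)))" by (rule bessel_ratio_abs_summable)
  have "norm ((- p / 2) ^ j / (fact j * fact (Suc j)) * (\<Prod>i=1..j. 1 - (real i / (real n + 1))\<^sup>2)) \<le> \<bar>p / 2\<bar> ^ j / (fact j * fact (Suc j))" for j n
  proof -
    have "norm ((- p / 2) ^ j / (fact j * fact (Suc j)) * (\<Prod>i=1..j. 1 - (real i / (real n + 1))\<^sup>2))
       = \<bar>p / 2\<bar> ^ j / (fact j * fact (Suc j)) * \<bar>\<Prod>i=1..j. 1 - (real i / (real n + 1))\<^sup>2\<bar>"
      by (simp add: abs_mult power_abs del: fact_Suc)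
    also have "\<dots> \<le> \<bar>p / 2\<bar> ^ j / (fact j * fact (Suc j)) * 1"
      by (intro mult_left_mono prod_le_1_abs) auto
    finally show ?thesis by simp
  qed
  then show "\<forall>\<^sub>F (j, n) in sequentially \<times>\<^sub>F sequentially. norm ((- p / 2) ^ j / (fact j * fact (Suc j)) * (\<Prod>i=1..j. 1 - (real i / (real n + 1))\<^sup>2)) \<le> \<bar>p / 2\<bar> ^ j / (fact j * fact (Suc j))"
    by (intro always_eventually) auto
  fix j
  have "(\<lambda>n. real i / (real n + 1)) \<longlonglongrightarrow> 0" for i
    by real_asymp
  then have "(\<lambda>n. \<Prod>i=1..j. 1 - (real i / (real n + 1))\<^sup>2) \<longlonglongrightarrow> (\<Prod>i=1..j. 1 - 0\<^sup>2)"
    by (intro tendsto_intros)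
  then show "(\<lambda>n. (- p / 2) ^ j / (fact j * fact (Suc j)) * (\<Prod>i=1..j. 1 - (real i / (real n + 1))\<^sup>2)) \<longlonglongrightarrow> (- p / 2) ^ j / (fact j * fact (Suc j))"
    using tendsto_mult[OF tendsto_const[of "(- p / 2) ^ j / (fact j * fact (Suc j))"]] by fastforce
qed simp

lemma bessel_J1_eq: "bessel_J1 t = t / 2 * bessel_ratio (t\<^sup>2 / 2)"
proof -
  have "summable (\<lambda>m. (- (t\<^sup>2 / 2) / 2) ^ m / (fact m * fact (Suc m)))"
    using bessel_ratio_abs_summable[of "t\<^sup>2 / 4"]
    by (rule summable_comparison_test'[where N=0]) (simp add: power_abs[symmetric] del: fact_Suc)
  from suminf_mult[OF this, of "t / 2"]
  have "t / 2 * bessel_ratio (t\<^sup>2 / 2) = (\<Sum>m. t / 2 * ((- (t\<^sup>2 / 2) / 2) ^ m / (fact m * fact (Suc m))))"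
    by (simp add: bessel_ratio_def)
  also have "\<dots> = bessel_J1 t"
    unfolding bessel_J1_def
  proof (intro suminf_cong)
    fix m :: nat
    have "(- (t\<^sup>2 / 2) / 2) ^ m = (-1) ^ m * (t / 2) ^ (2 * m)"
      by (subst power_mult, subst power_mult_distrib[symmetric]) (simp add: power_divide)
    then show "t / 2 * ((- (t\<^sup>2 / 2) / 2) ^ m / (fact m * fact (Suc m)))
      = (- 1) ^ m / (fact m * fact (m + 1)) * (t / 2) ^ (2 * m + 1)"
      by (simp del: fact_Suc add: mult_ac)
  qed
  finally show ?thesis by simp
qed

section \<open>The reproducing kernel as a polynomial in two variables\<close>

definition harmonic_poly :: "nat \<Rightarrow> real \<Rightarrow> real \<Rightarrow> real" where
  "harmonic_poly k x y = (\<Sum>\<tau>\<in>tau_index k. real (d_tau \<tau>) * P_tau \<tau> x y)"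

lemma finite_tau_index [simp]: "finite (tau_index k)"
  by (rule finite_subset[of _ "{..k} \<times> {..k}"]) (auto simp: tau_index_def)

text \<open>The substitution m = \<tau>1 + \<tau>2, n = \<tau>1 - \<tau>2 maps the index set onto
  the pairs n \<le> m \<le> k of equal parity. The factor 2 in \<open>d_tau\<close> for \<tau>2 > 0
  cancels the 1/2 of the symmetrisation, so each off-diagonal index accounts for both (m, n) and (n,
  m), and the diagonal is counted once.\<close>

lemma harmonic_poly_eq_sum:
  "harmonic_poly k x y = (\<Sum>(m, n)\<in>{(m, n). m \<le> k \<and> n \<le> k \<and> even (m + n)}.
     ((2 * real m + 1) * legendre_poly m x) * ((2 * real n + 1) * legendre_poly n y))"
proof -
  define g where "g = (\<lambda>m n. ((2 * real m + 1) * legendre_poly m x) * ((2 * real n + 1) * legendre_poly n y))"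
  define h where "h = (\<lambda>(m, n). if m = n then g m n else g m n + g n m)"
  let ?A = "{(m, n). n \<le> m \<and> m \<le> k \<and> even (m + n)}"
  let ?D = "{(m, n). n = m \<and> m \<le> k \<and> even (m + n)}"
  let ?U = "{(m, n). n < m \<and> m \<le> k \<and> even (m + n)}"
  let ?U' = "{(m, n). m < n \<and> n \<le> k \<and> even (m + n)}"
  have fin: "finite ?A" "finite ?D" "finite ?U" "finite ?U'"
    by (rule finite_subset[of _ "{..k} \<times> {..k}"]; auto)+
  have "harmonic_poly k x y = (\<Sum>\<tau>\<in>tau_index k. h (fst \<tau> + snd \<tau>, fst \<tau> - snd \<tau>))"
    unfolding harmonic_poly_def
  proof (rule sum.cong[OF refl])
    fix \<tau> assume "\<tau> \<in> tau_index k"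
    then obtain a b where t: "\<tau> = (a, b)" "b \<le> a" by (auto simp: tau_index_def)
    show "real (d_tau \<tau>) * P_tau \<tau> x y = h (fst \<tau> + snd \<tau>, fst \<tau> - snd \<tau>)"
    proof (cases "b = 0")
      case True
      then show ?thesis by (simp add: t d_tau_def P_tau_def h_def g_def algebra_simps)
    next
      case False
      obtain d where "a = b + d" using t le_Suc_ex by blast
      then show ?thesis using False t by (simp add: d_tau_def P_tau_def h_def g_def field_simps)
    qed
  qed
  also have "\<dots> = (\<Sum>z\<in>?A. h z)"
  proof (rule sum.reindex_bij_witness[where i="\<lambda>(m, n). ((m + n) div 2, (m - n) div 2)" and j="\<lambda>\<tau>. (fst \<tau> + snd \<tau>, fst \<tau> - snd \<tau>)"])
    fix a assume "a \<in> ?A"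
    then obtain m n where a: "a = (m, n)" "n \<le> m" "m \<le> k" "even (m + n)" by auto
    then obtain d where m: "m = n + 2 * d" by (metis even_diff_nat evenE le_add_diff_inverse not_less add.commute)
    have e: "(m + n) div 2 = n + d" "(m - n) div 2 = d" using m by auto
    show "(fst (case a of (m, n) \<Rightarrow> ((m + n) div 2, (m - n) div 2)) + snd (case a of (m, n) \<Rightarrow> ((m + n) div 2, (m - n) div 2)),
       fst (case a of (m, n) \<Rightarrow> ((m + n) div 2, (m - n) div 2)) - snd (case a of (m, n) \<Rightarrow> ((m + n) div 2, (m - n) div 2))) = a"
      using m by (simp add: a(1) e)
    show "(case a of (m, n) \<Rightarrow> ((m + n) div 2, (m - n) div 2)) \<in> tau_index k"
      using m a by (simp add: tau_index_def e)
  qed (auto simp: tau_index_def)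
  also have "\<dots> = (\<Sum>z\<in>?D \<union> ?U. h z)" by (rule sum.cong) auto
  also have "\<dots> = (\<Sum>z\<in>?D. h z) + (\<Sum>z\<in>?U. h z)"
    using fin by (intro sum.union_disjoint) auto
  also have "(\<Sum>z\<in>?D. h z) = (\<Sum>(m,n)\<in>?D. g m n)" by (intro sum.cong) (auto simp: h_def)
  also have "(\<Sum>z\<in>?U. h z) = (\<Sum>(m,n)\<in>?U. g m n) + (\<Sum>(m,n)\<in>?U. g n m)"
    unfolding sum.distrib[symmetric] by (intro sum.cong) (auto simp: h_def)
  also have "(\<Sum>(m,n)\<in>?U. g n m) = (\<Sum>(m,n)\<in>?U'. g m n)"
    by (rule sum.reindex_bij_witness[where i="\<lambda>(m,n). (n,m)" and j="\<lambda>(m,n). (n,m)"]) (auto simp: add.commute)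
  also have "(\<Sum>(m,n)\<in>?D. g m n) + ((\<Sum>(m,n)\<in>?U. g m n) + (\<Sum>(m,n)\<in>?U'. g m n))
     = (\<Sum>(m,n)\<in>?D \<union> (?U \<union> ?U'). g m n)"
    using fin by (subst sum.union_disjoint; (subst sum.union_disjoint)?) auto
  also have "?D \<union> (?U \<union> ?U') = {(m, n). m \<le> k \<and> n \<le> k \<and> even (m + n)}" by auto
  finally show ?thesis by (simp add: g_def)
qed

text \<open>The parity condition on m + n is the projection obtained by averaging with the values at
  (-x, -y), because P_n(-x) = (-1)^n P_n(x). Without that condition the double sum is a product of
  two single sums.\<close>

lemma harmonic_poly_eq:
  "harmonic_poly k x y = (legendre_sum k x * legendre_sum k y + legendre_sum k (- x) * legendre_sum k (- y)) / 2"
proof -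
  define g where "g = (\<lambda>m n. ((2 * real m + 1) * legendre_poly m x) * ((2 * real n + 1) * legendre_poly n y))"
  have "legendre_sum k x * legendre_sum k y = (\<Sum>m\<le>k. \<Sum>n\<le>k. g m n)"
    unfolding legendre_sum_def g_def by (rule sum_product)
  moreover have "legendre_sum k (- x) * legendre_sum k (- y) = (\<Sum>m\<le>k. \<Sum>n\<le>k. (-1) ^ (m + n) * g m n)"
    unfolding legendre_sum_def g_def legendre_poly_minus sum_product
    by (intro sum.cong refl) (simp add: power_add algebra_simps)
  ultimately have "(legendre_sum k x * legendre_sum k y + legendre_sum k (- x) * legendre_sum k (- y)) / 2
    = (\<Sum>m\<le>k. \<Sum>n\<le>k. if even (m + n) then g m n else 0)"
    by (simp add: sum.distrib[symmetric] sum_divide_distrib) (intro sum.cong refl, auto)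
  also have "\<dots> = (\<Sum>z\<in>{..k}\<times>{..k}. if even (fst z + snd z) then g (fst z) (snd z) else 0)"
    unfolding sum.cartesian_product by (intro sum.cong) auto
  also have "\<dots> = (\<Sum>z\<in>{z\<in>{..k}\<times>{..k}. even (fst z + snd z)}. g (fst z) (snd z))"
    by (rule sum.inter_filter[symmetric]) auto
  also have "\<dots> = (\<Sum>(m, n)\<in>{(m, n). m \<le> k \<and> n \<le> k \<and> even (m + n)}. g m n)"
    by (intro sum.cong) auto
  finally show ?thesis unfolding harmonic_poly_eq_sum g_def by simp
qed

lemma P_tau_1_1 [simp]: "P_tau \<tau> 1 1 = 1"
  by (simp add: P_tau_def split: prod.split)

lemma harmonic_poly_1_1: "harmonic_poly k 1 1 = real (harmonic_dim k)"
  by (simp add: harmonic_poly_def harmonic_dim_def)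

lemma legendre_sum_1: "legendre_sum k 1 = (real k + 1)\<^sup>2"
  by (simp add: legendre_sum_def sum_odd_numbers)

lemma legendre_sum_minus_1: "legendre_sum k (- 1) = (-1) ^ k * (real k + 1)"
  unfolding legendre_sum_def legendre_poly_minus by (induction k) (simp_all add: algebra_simps)

text \<open>With K = k + 1 the sums at 1 and -1 are K^2 and \<plusminus>K, so the diagonal value of
  the kernel is (K^4 + K^2) / 2. The leading term K^4 / 2 converts powers of K into powers of the
  number of points.\<close>

lemma harmonic_dim_eq: "real (harmonic_dim k) = ((real k + 1) ^ 4 + (real k + 1)\<^sup>2) / 2"
  unfolding harmonic_poly_1_1[symmetric] harmonic_poly_eq legendre_sum_1 legendre_sum_minus_1
  by (simp add: power2_eq_square power4_eq_xxxx algebra_simps power_mult_distrib[symmetric])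

lemma harmonic_poly_minus: "harmonic_poly k (- x) (- y) = harmonic_poly k x y"
  by (simp add: harmonic_poly_eq)

lemma harmonic_poly_commute: "harmonic_poly k y x = harmonic_poly k x y"
  by (simp add: harmonic_poly_eq mult.commute)

text \<open>Ensures that N^2 minus the squared kernel is nonnegative, so that its embedding into the
  extended nonnegative reals loses nothing.\<close>

lemma abs_harmonic_poly_le:
  assumes "\<bar>x\<bar> \<le> 1" "\<bar>y\<bar> \<le> 1" shows "\<bar>harmonic_poly k x y\<bar> \<le> real (harmonic_dim k)"
proof -
  have P: "\<bar>P_tau \<tau> x y\<bar> \<le> 1" for \<tau>
  proof -
    obtain a b where t: "\<tau> = (a, b)" by force
    have "\<bar>legendre_poly m u * legendre_poly n v\<bar> \<le> 1" if "\<bar>u\<bar> \<le> 1" "\<bar>v\<bar> \<le> 1" for m n u v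
      unfolding abs_mult using abs_legendre_poly_le_1 that by (intro mult_le_one) auto
    from this[of x y "a+b" "a-b"] this[of y x "a+b" "a-b"] show ?thesis
      using assms by (simp add: P_tau_def t abs_le_iff)
  qed
  have "\<bar>harmonic_poly k x y\<bar> \<le> (\<Sum>\<tau>\<in>tau_index k. \<bar>real (d_tau \<tau>) * P_tau \<tau> x y\<bar>)"
    unfolding harmonic_poly_def by (rule sum_abs)
  also have "\<dots> \<le> (\<Sum>\<tau>\<in>tau_index k. real (d_tau \<tau>) * 1)"
    unfolding abs_mult using P by (intro sum_mono mult_mono) auto
  finally show ?thesis by (simp add: harmonic_dim_def)
qed

lemma legendre_poly_measurable [measurable]: "legendre_poly n \<in> borel_measurable borel"
proof -
  have "continuous_on UNIV (legendre_poly n)"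
  proof (induction n rule: less_induct)
    case (less n)
    consider "n = 0" | "n = 1" | m where "n = Suc (Suc m)" by (metis One_nat_def not0_implies_Suc)
    then show ?case
    proof cases
      case 3
      have "legendre_poly n = (\<lambda>x. ((2 * real m + 3) * x * legendre_poly (Suc m) x - (real m + 1) * legendre_poly m x) / (real m + 2))"
        unfolding 3 by (rule ext) simp
      then show ?thesis using less[of m] less[of "Suc m"] 3 by (auto intro!: continuous_intros)
    next
      case 1
      then have "legendre_poly n = (\<lambda>x. 1)" by auto
      then show ?thesis by simp
    next
      case 2
      then have "legendre_poly n = (\<lambda>x. x)" by auto
      then show ?thesis by simp
    qed
  qed
  then show ?thesis by (rule borel_measurable_continuous_onI)
qed

lemma legendre_sum_measurable [measurable]: "legendre_sum k \<in> borel_measurable borel"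
  unfolding legendre_sum_def[abs_def] by measurable

lemma harmonic_poly_measurable [measurable (raw)]:
  assumes [measurable]: "f \<in> borel_measurable M" "g \<in> borel_measurable M"
  shows "(\<lambda>z. harmonic_poly k (f z) (g z)) \<in> borel_measurable M"
  unfolding harmonic_poly_eq by measurable

lemma scaled_legendre_sum_measurable [measurable]: "scaled_legendre_sum k \<in> borel_measurable borel"
  unfolding scaled_legendre_sum_def[abs_def] by measurable

lemma bessel_ratio_measurable [measurable]: "bessel_ratio \<in> borel_measurable borel"
  by (rule borel_measurable_LIMSEQ_real[where u="\<lambda>k. scaled_legendre_sum k"])
     (auto intro: scaled_legendre_sum_tendsto)

text \<open>Sum of two bounds: the square is at most 1 by the trivial estimate, and p times the
  square is at most 2 by the square root estimate, whence 1 + 2 = 3. The range of p corresponds to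
  -1 \<le> x \<le> 1.\<close>

lemma scaled_legendre_sum_sq_le:
  assumes "0 \<le> p" "p \<le> 2 * (real k + 1)\<^sup>2"
  shows "(scaled_legendre_sum k p)\<^sup>2 \<le> 3 / (1 + p)"
proof -
  define K where "K = real k + 1"
  have K: "K > 0" by (simp add: K_def)
  define x where "x = 1 - p / K\<^sup>2"
  have "p \<le> 2 * K\<^sup>2" using assms by (simp add: K_def)
  then have x: "\<bar>x\<bar> \<le> 1" using assms(1) K by (auto simp: x_def abs_le_iff field_simps)
  have s: "scaled_legendre_sum k p = legendre_sum k x / K\<^sup>2"
    by (simp add: scaled_legendre_sum_def K_def x_def)
  have "\<bar>legendre_sum k x\<bar> \<le> K\<^sup>2" using abs_legendre_sum_le[OF x] by (simp add: K_def)
  then have "\<bar>scaled_legendre_sum k p\<bar> \<le> 1"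
    using K by (simp add: s)
  then have 1: "(scaled_legendre_sum k p)\<^sup>2 \<le> 1" by (simp add: abs_square_le_1)
  have "(\<bar>legendre_sum k x\<bar> * sqrt (1 - x))\<^sup>2 \<le> (sqrt 2 * K)\<^sup>2"
    using abs_legendre_sum_sqrt_le[OF x, of k] x by (intro power_mono) (auto simp: K_def)
  then have "(legendre_sum k x)\<^sup>2 * (1 - x) \<le> 2 * K\<^sup>2"
    using x by (simp add: power_mult_distrib)
  then have "(scaled_legendre_sum k p)\<^sup>2 * p \<le> 2"
    using K unfolding s by (simp add: x_def field_simps power2_eq_square)
  with 1 have "(scaled_legendre_sum k p)\<^sup>2 * (1 + p) \<le> 3" by (simp add: algebra_simps)
  then show ?thesis using assms by (simp add: field_simps)
qed

section \<open>The rescaled energy integral\<close>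

lemma measurable_fst_snd_real [measurable]:
  "fst \<in> borel_measurable (borel :: (real \<times> real) measure)"
  "snd \<in> borel_measurable (borel :: (real \<times> real) measure)"
  by (auto intro!: borel_measurable_continuous_onI continuous_intros)

lemmas [measurable (raw)] = borel_measurable_Pair

lemma nn_integral_lborel_pair:
  assumes [measurable]: "f \<in> borel_measurable (borel :: (real \<times> real) measure)"
  shows "(\<integral>\<^sup>+z. f z \<partial>lborel) = (\<integral>\<^sup>+x. (\<integral>\<^sup>+y. f (x, y) \<partial>lborel) \<partial>lborel)"
  by (subst lborel_prod[symmetric], subst lborel.nn_integral_fst[symmetric]) (auto simp: lborel_prod)

lemma nn_integral_affine_pair:
  fixes c t :: real
  assumes [measurable]: "f \<in> borel_measurable (borel :: (real \<times> real) measure)" and c: "c \<noteq> 0"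
  shows "(\<integral>\<^sup>+z. f z \<partial>lborel) = ennreal (c\<^sup>2) * (\<integral>\<^sup>+z. f (t + c * fst z, t + c * snd z) \<partial>lborel)"
proof -
  have "(\<integral>\<^sup>+z. f z \<partial>lborel) = (\<integral>\<^sup>+x. (\<integral>\<^sup>+y. f (x, y) \<partial>lborel) \<partial>lborel)"
    by (rule nn_integral_lborel_pair) fact
  also have "\<dots> = ennreal \<bar>c\<bar> * (\<integral>\<^sup>+x. (\<integral>\<^sup>+y. f (t + c * x, y) \<partial>lborel) \<partial>lborel)"
    by (rule nn_integral_real_affine[OF _ c]) (measurable)
  also have "(\<integral>\<^sup>+x. (\<integral>\<^sup>+y. f (t + c * x, y) \<partial>lborel) \<partial>lborel)
     = (\<integral>\<^sup>+x. ennreal \<bar>c\<bar> * (\<integral>\<^sup>+y. f (t + c * x, t + c * y) \<partial>lborel) \<partial>lborel)"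
    by (intro nn_integral_cong nn_integral_real_affine[OF _ c]) measurable
  also have "\<dots> = ennreal \<bar>c\<bar> * (\<integral>\<^sup>+x. (\<integral>\<^sup>+y. f (t + c * x, t + c * y) \<partial>lborel) \<partial>lborel)"
    by (rule nn_integral_cmult) measurable
  also have "(\<integral>\<^sup>+x. (\<integral>\<^sup>+y. f (t + c * x, t + c * y) \<partial>lborel) \<partial>lborel)
     = (\<integral>\<^sup>+z. f (t + c * fst z, t + c * snd z) \<partial>lborel)"
    by (subst nn_integral_lborel_pair) auto
  finally show ?thesis
    by (simp add: mult.assoc[symmetric] ennreal_mult[symmetric] power2_eq_square)
qed

text \<open>The one-dimensional majorant, used with a = s/4. The condition a < 1 serves
  integrability at 0 and a > 0 at infinity; this is where the range 0 < s < 4 enters.\<close>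

lemma integrable_powr_over_one_plus:
  fixes a :: real
  assumes "0 < a" "a < 1"
  shows "integrable lborel (\<lambda>p. indicator {0<..} p * (p powr (- a) / (1 + p)))"
proof -
  have "(\<lambda>p. p powr (- a)) absolutely_integrable_on {0..1}"
    using integrable_on_powr_from_0[of "-a" 1] assms by (intro nonnegative_absolutely_integrable_1) auto
  then have 1: "integrable lborel (\<lambda>p. indicator {0..1} p * p powr (- a))"
    unfolding set_integrable_def by (subst (asm) integrable_completion) auto
  have "(\<lambda>p. p powr (- a - 1)) absolutely_integrable_on {1..}"
    using has_integral_powr_to_inf[of "-a - 1" 1] assms
    by (intro nonnegative_absolutely_integrable_1) (auto simp: integrable_on_def)
  then have 2: "integrable lborel (\<lambda>p. indicator {1..} p * p powr (- a - 1))"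
    unfolding set_integrable_def by (subst (asm) integrable_completion) auto
  show ?thesis
  proof (rule Bochner_Integration.integrable_bound[OF Bochner_Integration.integrable_add[OF 1 2]])
    show "AE p in lborel. norm (indicator {0<..} p * (p powr (- a) / (1 + p)))
        \<le> norm (indicator {0..1} p * p powr (- a) + indicator {1..} p * p powr (- a - 1))"
    proof (intro always_eventually allI)
      fix p :: real
      consider "p \<le> 0" | "0 < p" "p \<le> 1" | "1 < p" by linarith
      then show "norm (indicator {0<..} p * (p powr (- a) / (1 + p)))
        \<le> norm (indicator {0..1} p * p powr (- a) + indicator {1..} p * p powr (- a - 1))"
      proof cases
        case 2
        have "p powr (- a) / (1 + p) \<le> p powr (- a) / 1" using 2 by (intro divide_left_mono) auto
        then show ?thesis using 2 by (auto simp: indicator_def)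
      next
        case 3
        have "p powr (- a) / (1 + p) \<le> p powr (- a) / p" using 3 by (intro divide_left_mono) auto
        then show ?thesis using 3 by (auto simp: indicator_def powr_diff)
      qed auto
    qed
  qed measurable
qed

lemma integrable_product_real:
  fixes f g :: "real \<Rightarrow> real"
  assumes f: "integrable lborel f" and g: "integrable lborel g"
  shows "integrable lborel (\<lambda>z. f (fst z) * g (snd z))"
proof -
  have [measurable]: "f \<in> borel_measurable borel" "g \<in> borel_measurable borel"
    using f g by auto
  have "(\<integral>\<^sup>+z. ennreal (norm (f (fst z) * g (snd z))) \<partial>lborel)
     = (\<integral>\<^sup>+x. (\<integral>\<^sup>+y. ennreal (norm (f x)) * ennreal (norm (g y)) \<partial>lborel) \<partial>lborel)"
    by (subst nn_integral_lborel_pair) (auto simp: abs_mult ennreal_mult)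
  also have "\<dots> = (\<integral>\<^sup>+x. ennreal (norm (f x)) \<partial>lborel) * (\<integral>\<^sup>+x. ennreal (norm (g x)) \<partial>lborel)"
    by (simp add: nn_integral_cmult nn_integral_multc)
  also have "\<dots> < \<infinity>"
    using f g unfolding integrable_iff_bounded by (simp add: ennreal_mult_less_top)
  finally show ?thesis by (auto simp: integrable_iff_bounded)
qed

text \<open>The energy integrand at the scale \<open>x = 1 - p / K\<^sup>2\<close>, folded along \<open>(x, y) \<mapsto> (- x, - y)\<close>
  so that \<open>(1, 1)\<close> is the only singularity left.\<close>

definition scaled_energy_density :: "real \<Rightarrow> nat \<Rightarrow> real \<times> real \<Rightarrow> real" where
  "scaled_energy_density s k = (\<lambda>(p, q).
     (if 0 < p \<and> 0 < q \<and> p < 2 * (real k + 1)\<^sup>2 \<and> q < 2 * (real k + 1)\<^sup>2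
      then (of_bool (p + q \<le> 2 * (real k + 1)\<^sup>2) + of_bool (p + q < 2 * (real k + 1)\<^sup>2)) *
        ((scaled_legendre_sum k p * scaled_legendre_sum k q
          + scaled_legendre_sum k (2 * (real k + 1)\<^sup>2 - p) * scaled_legendre_sum k (2 * (real k + 1)\<^sup>2 - q)) / 2)\<^sup>2 *
        (p + q - p * q / (real k + 1)\<^sup>2) powr (- (s / 2))
      else 0))"

definition limit_energy_density :: "real \<Rightarrow> real \<times> real \<Rightarrow> real" where
  "limit_energy_density s = (\<lambda>(p, q). if 0 < p \<and> 0 < q
     then (bessel_ratio p)\<^sup>2 * (bessel_ratio q)\<^sup>2 * (p + q) powr (- (s / 2)) / 2 else 0)"

lemma scaled_energy_density_measurable [measurable]:
  "scaled_energy_density s k \<in> borel_measurable borel"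
  unfolding scaled_energy_density_def case_prod_beta by measurable

lemma limit_energy_density_measurable [measurable]:
  "limit_energy_density s \<in> borel_measurable borel"
  unfolding limit_energy_density_def case_prod_beta by measurable

text \<open>On p + q \<le> 2 K^2 the subtracted term p q / K^2 is at most (p + q) / 2, so the base
  of the power is at least (p + q) / 2 and hence at least sqrt (p q). This separates the variables.
  The constant is 18 = 2 * 3 * 3: a factor 2 from the folding and a 3 from each squared sum.\<close>

lemma scaled_energy_density_bound:
  assumes s: "0 < s"
  shows "\<bar>scaled_energy_density s k (p, q)\<bar>
     \<le> 18 * ((indicator {0<..} p * (p powr (- (s/4)) / (1 + p))) * (indicator {0<..} q * (q powr (- (s/4)) / (1 + q))))"
proof -
  define K where "K = real k + 1"
  have K: "K > 0" by (simp add: K_def)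
  show ?thesis
  proof (cases "0 < p \<and> 0 < q \<and> p < 2 * K\<^sup>2 \<and> q < 2 * K\<^sup>2 \<and> p + q \<le> 2 * K\<^sup>2")
    case False
    then have "scaled_energy_density s k (p, q) = 0"
      by (auto simp: scaled_energy_density_def K_def[symmetric])
    then show ?thesis by (auto simp: indicator_def)
  next
    case True
    define c where "c = of_bool (p + q \<le> 2 * K\<^sup>2) + (of_bool (p + q < 2 * K\<^sup>2) :: real)"
    define a where "a = scaled_legendre_sum k p * scaled_legendre_sum k q"
    define b where "b = scaled_legendre_sum k (2 * K\<^sup>2 - p) * scaled_legendre_sum k (2 * K\<^sup>2 - q)"
    define w where "w = (p + q - p * q / K\<^sup>2) powr (- (s / 2))"
    have eq: "scaled_energy_density s k (p, q) = c * ((a + b) / 2)\<^sup>2 * w"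
      using True by (simp add: scaled_energy_density_def K_def[symmetric] c_def a_def b_def w_def)
    have c: "0 \<le> c" "c \<le> 2" by (auto simp: c_def)
    have "a\<^sup>2 \<le> 3 / (1 + p) * (3 / (1 + q))"
      unfolding a_def power_mult_distrib using True
      by (intro mult_mono scaled_legendre_sum_sq_le) (auto simp: K_def)
    \<comment> \<open>On the folded domain 2 K^2 - p \<ge> q and 2 K^2 - q \<ge> p, so the reflected
      sums obey the same bound with the two variables exchanged.\<close>
    moreover have "b\<^sup>2 \<le> 3 / (1 + q) * (3 / (1 + p))"
      unfolding b_def power_mult_distrib
    proof (intro mult_mono)
      have "(scaled_legendre_sum k (2 * K\<^sup>2 - p))\<^sup>2 \<le> 3 / (1 + (2 * K\<^sup>2 - p))"
        using True by (intro scaled_legendre_sum_sq_le) (auto simp: K_def)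
      also have "\<dots> \<le> 3 / (1 + q)" using True by (intro divide_left_mono) auto
      finally show "(scaled_legendre_sum k (2 * K\<^sup>2 - p))\<^sup>2 \<le> 3 / (1 + q)" .
      have "(scaled_legendre_sum k (2 * K\<^sup>2 - q))\<^sup>2 \<le> 3 / (1 + (2 * K\<^sup>2 - q))"
        using True by (intro scaled_legendre_sum_sq_le) (auto simp: K_def)
      also have "\<dots> \<le> 3 / (1 + p)" using True by (intro divide_left_mono) auto
      finally show "(scaled_legendre_sum k (2 * K\<^sup>2 - q))\<^sup>2 \<le> 3 / (1 + p)" .
    qed (use True in auto)
    moreover have "((a + b) / 2)\<^sup>2 \<le> (a\<^sup>2 + b\<^sup>2) / 2"
      using sum_squares_ge_zero[of "a - b" 0] by (simp add: power2_eq_square algebra_simps)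
    ultimately have ab: "((a + b) / 2)\<^sup>2 \<le> 9 / ((1 + p) * (1 + q))" by (simp add: mult.commute)
    have "p * q \<le> ((p + q) / 2)\<^sup>2"
      using sum_squares_ge_zero[of "p - q" 0] by (simp add: power2_eq_square algebra_simps)
    also have "\<dots> = (p + q) / 4 * (p + q)" by (simp add: power2_eq_square)
    also have "\<dots> \<le> (p + q) / 4 * (2 * K\<^sup>2)" using True by (intro mult_left_mono) auto
    finally have "p * q / K\<^sup>2 \<le> (p + q) / 2" using K by (simp add: field_simps)
    moreover have "sqrt (p * q) \<le> (p + q) / 2" using True arith_geo_mean_sqrt[of p q] by simp
    ultimately have le: "sqrt (p * q) \<le> p + q - p * q / K\<^sup>2" by simp
    have "w \<le> sqrt (p * q) powr (- (s / 2))"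
      unfolding w_def using True s le by (intro powr_mono2') auto
    also have "\<dots> = p powr (- (s / 4)) * q powr (- (s / 4))"
      using True by (simp add: powr_half_sqrt[symmetric] powr_powr powr_mult)
    finally have w: "w \<le> p powr (- (s / 4)) * q powr (- (s / 4))" .
    have "\<bar>scaled_energy_density s k (p, q)\<bar> = c * ((a + b) / 2)\<^sup>2 * w"
      using c unfolding eq by (simp add: w_def)
    also have "\<dots> \<le> 2 * (9 / ((1 + p) * (1 + q))) * (p powr (- (s / 4)) * q powr (- (s / 4)))"
      using c ab w True by (intro mult_mono) (auto simp: w_def)
    finally show ?thesis using True by (simp add: indicator_def field_simps)
  qed
qed

lemma scaled_energy_density_tendsto:
  "(\<lambda>k. scaled_energy_density s k z) \<longlonglongrightarrow> limit_energy_density s z"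
proof -
  obtain p q where z: "z = (p, q)" by force
  show ?thesis
  proof (cases "0 < p \<and> 0 < q")
    case False
    then show ?thesis by (auto simp: z scaled_energy_density_def limit_energy_density_def)
  next
    case True
    have K: "filterlim (\<lambda>k. 2 * (real k + 1)\<^sup>2) at_top sequentially" by real_asymp
    \<comment> \<open>The reflected sums disappear in the limit: their argument tends to infinity,
      and so the bound 3 / (1 + argument) tends to 0.\<close>
    have z0: "(\<lambda>k. scaled_legendre_sum k (2 * (real k + 1)\<^sup>2 - p)) \<longlonglongrightarrow> 0" if "p > 0" for p
    proof -
      have "(\<lambda>k. (scaled_legendre_sum k (2 * (real k + 1)\<^sup>2 - p))\<^sup>2) \<longlonglongrightarrow> 0"
      proof (rule tendsto_sandwich[OF _ _ tendsto_const])
        show "(\<lambda>k. 3 / (1 + (2 * (real k + 1)\<^sup>2 - p))) \<longlonglongrightarrow> 0" by real_asymp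
        have "eventually (\<lambda>k. p \<le> 2 * (real k + 1)\<^sup>2) sequentially"
          using K by (simp add: filterlim_at_top)
        then show "eventually (\<lambda>k. (scaled_legendre_sum k (2 * (real k + 1)\<^sup>2 - p))\<^sup>2 \<le> 3 / (1 + (2 * (real k + 1)\<^sup>2 - p))) sequentially"
          by eventually_elim (use that in \<open>intro scaled_legendre_sum_sq_le; simp\<close>)
      qed auto
      from tendsto_real_sqrt[OF this] show ?thesis by (simp add: tendsto_rabs_zero_iff)
    qed
    \<comment> \<open>From some k on both \<open>of_bool\<close> weights are 1. The resulting 2
      times (1/2)^2 is the factor 1/2 of \<open>limit_energy_density\<close>.\<close>
    have ev: "eventually (\<lambda>k. p + q < 2 * (real k + 1)\<^sup>2) sequentially"
      using filterlim_at_top_dense[THEN iffD1, OF K] by blast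
    have lim: "(\<lambda>k. 2 * ((scaled_legendre_sum k p * scaled_legendre_sum k q
          + scaled_legendre_sum k (2 * (real k + 1)\<^sup>2 - p) * scaled_legendre_sum k (2 * (real k + 1)\<^sup>2 - q)) / 2)\<^sup>2 *
        (p + q - p * q / (real k + 1)\<^sup>2) powr (- (s / 2)))
       \<longlonglongrightarrow> 2 * ((bessel_ratio p * bessel_ratio q + 0 * 0) / 2)\<^sup>2 * (p + q - 0) powr (- (s / 2))"
    proof (intro tendsto_mult tendsto_power tendsto_divide tendsto_add tendsto_powr tendsto_diff tendsto_const scaled_legendre_sum_tendsto z0)
      show "(\<lambda>k. p * q / (real k + 1)\<^sup>2) \<longlonglongrightarrow> 0" by real_asymp
    qed (use True in auto)
    have "2 * ((bessel_ratio p * bessel_ratio q + 0 * 0) / 2)\<^sup>2 * (p + q - 0) powr (- (s / 2)) = limit_energy_density s z"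
      using True by (simp add: z limit_energy_density_def power_mult_distrib power_divide)
    moreover have "eventually (\<lambda>k. 2 * ((scaled_legendre_sum k p * scaled_legendre_sum k q
          + scaled_legendre_sum k (2 * (real k + 1)\<^sup>2 - p) * scaled_legendre_sum k (2 * (real k + 1)\<^sup>2 - q)) / 2)\<^sup>2 *
        (p + q - p * q / (real k + 1)\<^sup>2) powr (- (s / 2)) = scaled_energy_density s k z) sequentially"
      using ev by eventually_elim (use True in \<open>auto simp: z scaled_energy_density_def\<close>)
    ultimately show ?thesis using Lim_transform_eventually[OF lim] by simp
  qed
qed

lemma scaled_energy_limit:
  assumes s: "0 < s" "s < 4"
  shows "integrable lborel (scaled_energy_density s k)"
    and "integrable lborel (limit_energy_density s)"
    and "(\<lambda>k. \<integral>z. scaled_energy_density s k z \<partial>lborel) \<longlonglongrightarrow> (\<integral>z. limit_energy_density s z \<partial>lborel)"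
proof -
  define g where "g = (\<lambda>p::real. indicator {0<..} p * (p powr (- (s/4)) / (1 + p)))"
  have "integrable lborel g"
    unfolding g_def using s by (intro integrable_powr_over_one_plus) auto
  then have D: "integrable lborel (\<lambda>z. 18 * (g (fst z) * g (snd z)))"
    by (intro Bochner_Integration.integrable_mult_right integrable_product_real) auto
  have bd: "AE z in lborel. norm (scaled_energy_density s k z) \<le> 18 * (g (fst z) * g (snd z))" for k
    using scaled_energy_density_bound[OF s(1)] by (auto simp: g_def)
  have lim: "AE z in lborel. (\<lambda>k. scaled_energy_density s k z) \<longlonglongrightarrow> limit_energy_density s z"
    using scaled_energy_density_tendsto by auto
  show "integrable lborel (scaled_energy_density s k)"
    by (rule integrable_dominated_convergence2[OF _ _ D lim bd]) measurable
  show "integrable lborel (limit_energy_density s)"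
    by (rule integrable_dominated_convergence[OF _ _ D lim bd]) measurable
  show "(\<lambda>k. \<integral>z. scaled_energy_density s k z \<partial>lborel) \<longlonglongrightarrow> (\<integral>z. limit_energy_density s z \<partial>lborel)"
    by (rule integral_dominated_convergence[OF _ _ D lim bd]) measurable
qed

section \<open>The correction to the mean energy and its exact scaling\<close>

definition harmonic_square_energy :: "real \<Rightarrow> nat \<Rightarrow> ennreal" where
  "harmonic_square_energy s k = (\<integral>\<^sup>+z. indicator ({-1<..<1} \<times> {-1<..<1}) z *
     ennreal ((harmonic_poly k (fst z) (snd z))\<^sup>2 * (1 - fst z * snd z) powr (- (s / 2))) \<partial>lborel)"

text \<open>The part with x + y < 0 is reflected onto x + y > 0. The weight is 2 off the line x + y
  = 0 and 1 on it, so the identity is exact and no null set has to be discarded.\<close>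

lemma nn_integral_fold_symmetric:
  fixes F :: "real \<times> real \<Rightarrow> ennreal"
  assumes [measurable]: "F \<in> borel_measurable borel"
    and sym: "\<And>x y. F (- x, - y) = F (x, y)"
  shows "(\<integral>\<^sup>+z. F z \<partial>lborel)
     = (\<integral>\<^sup>+z. F z * ennreal (of_bool (fst z + snd z \<ge> 0) + of_bool (fst z + snd z > 0)) \<partial>lborel)"
proof -
  have "(\<integral>\<^sup>+z. F z \<partial>lborel) = (\<integral>\<^sup>+z. F z * ennreal (of_bool (fst z + snd z \<ge> 0)) + F z * ennreal (of_bool (fst z + snd z < 0)) \<partial>lborel)"
    by (intro nn_integral_cong) auto
  also have "\<dots> = (\<integral>\<^sup>+z. F z * ennreal (of_bool (fst z + snd z \<ge> 0)) \<partial>lborel) + (\<integral>\<^sup>+z. F z * ennreal (of_bool (fst z + snd z < 0)) \<partial>lborel)"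
    by (intro nn_integral_add) auto
  also have "(\<integral>\<^sup>+z. F z * ennreal (of_bool (fst z + snd z < 0)) \<partial>lborel)
     = (\<integral>\<^sup>+z. F (0 + (-1) * fst z, 0 + (-1) * snd z) * ennreal (of_bool ((0 + (-1) * fst z) + (0 + (-1) * snd z) < 0)) \<partial>lborel)"
    by (subst nn_integral_affine_pair[where c="-1" and t=0]) auto
  also have "\<dots> = (\<integral>\<^sup>+z. F z * ennreal (of_bool (fst z + snd z > 0)) \<partial>lborel)"
    by (intro nn_integral_cong) (auto simp: sym)
  also have "(\<integral>\<^sup>+z. F z * ennreal (of_bool (fst z + snd z \<ge> 0)) \<partial>lborel) + (\<integral>\<^sup>+z. F z * ennreal (of_bool (fst z + snd z > 0)) \<partial>lborel)
     = (\<integral>\<^sup>+z. F z * ennreal (of_bool (fst z + snd z \<ge> 0)) + F z * ennreal (of_bool (fst z + snd z > 0)) \<partial>lborel)"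
    by (intro nn_integral_add[symmetric]) auto
  also have "\<dots> = (\<integral>\<^sup>+z. F z * ennreal (of_bool (fst z + snd z \<ge> 0) + of_bool (fst z + snd z > 0)) \<partial>lborel)"
    by (intro nn_integral_cong) (auto simp: distrib_left[symmetric] ennreal_plus[symmetric] simp del: ennreal_plus)
  finally show ?thesis .
qed

text \<open>Counting powers of K = k + 1 under x = 1 - p / K^2: the area element gives K^(-4), the
  squared kernel K^8, and the Riesz factor K^s.\<close>

lemma harmonic_square_energy_eq:
  assumes s: "0 < s" "s < 4"
  shows "harmonic_square_energy s k
    = ennreal ((real k + 1) powr (4 + s) * (\<integral>z. scaled_energy_density s k z \<partial>lborel))"
proof -
  define K where "K = real k + 1"
  have K: "K > 0" by (simp add: K_def)
  define F where "F = (\<lambda>z. indicator ({-1<..<1} \<times> {-1<..<1}) z *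
     ennreal ((harmonic_poly k (fst z) (snd z))\<^sup>2 * (1 - fst z * snd z) powr (- (s / 2))))"
  have [measurable]: "F \<in> borel_measurable borel"
    unfolding F_def by (auto intro!: borel_measurable_times_ennreal borel_measurable_indicator borel_Times)
  have sym: "F (- x, - y) = F (x, y)" for x y
    by (auto simp: F_def harmonic_poly_minus indicator_def)
  have "harmonic_square_energy s k = (\<integral>\<^sup>+z. F z * ennreal (of_bool (fst z + snd z \<ge> 0) + of_bool (fst z + snd z > 0)) \<partial>lborel)"
    unfolding harmonic_square_energy_def F_def[symmetric]
    using nn_integral_fold_symmetric[OF _ sym] by simp
  also have "\<dots> = ennreal ((- 1 / K\<^sup>2)\<^sup>2) *
     (\<integral>\<^sup>+z. F (1 + (- 1 / K\<^sup>2) * fst z, 1 + (- 1 / K\<^sup>2) * snd z) * ennreal (of_bool ((1 + (- 1 / K\<^sup>2) * fst z) + (1 + (- 1 / K\<^sup>2) * snd z) \<ge> 0) + of_bool ((1 + (- 1 / K\<^sup>2) * fst z) + (1 + (- 1 / K\<^sup>2) * snd z) > 0)) \<partial>lborel)"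
    using K by (subst nn_integral_affine_pair[where c="- 1 / K\<^sup>2" and t=1]) auto
  also have "\<dots> = ennreal ((- 1 / K\<^sup>2)\<^sup>2) * (\<integral>\<^sup>+z. ennreal (K powr (8 + s) * scaled_energy_density s k z) \<partial>lborel)"
  proof (intro arg_cong2[where f="(*)"] refl nn_integral_cong)
    fix z :: "real \<times> real"
    obtain p q where z: "z = (p, q)" by force
    show "F (1 + (- 1 / K\<^sup>2) * fst z, 1 + (- 1 / K\<^sup>2) * snd z) * ennreal (of_bool ((1 + (- 1 / K\<^sup>2) * fst z) + (1 + (- 1 / K\<^sup>2) * snd z) \<ge> 0) + of_bool ((1 + (- 1 / K\<^sup>2) * fst z) + (1 + (- 1 / K\<^sup>2) * snd z) > 0))
      = ennreal (K powr (8 + s) * scaled_energy_density s k z)"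
    proof (cases "0 < p \<and> 0 < q \<and> p < 2 * K\<^sup>2 \<and> q < 2 * K\<^sup>2")
      case False
      then have "F (1 + (- 1 / K\<^sup>2) * fst z, 1 + (- 1 / K\<^sup>2) * snd z) = 0"
        using K by (auto simp: F_def z indicator_def field_simps)
      moreover have "scaled_energy_density s k z = 0"
        using False by (auto simp: scaled_energy_density_def z K_def)
      ultimately show ?thesis by simp
    next
      case True
      define x y where "x = 1 - p / K\<^sup>2" and "y = 1 - q / K\<^sup>2"
      have xy: "1 + (- 1 / K\<^sup>2) * fst z = x" "1 + (- 1 / K\<^sup>2) * snd z = y"
        by (simp_all add: x_def y_def z)
      have rng: "-1 < x" "x < 1" "-1 < y" "y < 1" using True K by (auto simp: x_def y_def field_simps)
      have L: "legendre_sum k x = K\<^sup>2 * scaled_legendre_sum k p" "legendre_sum k y = K\<^sup>2 * scaled_legendre_sum k q"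
        using K by (simp_all add: scaled_legendre_sum_def K_def x_def y_def)
      have "- x = 1 - (2 * K\<^sup>2 - p) / K\<^sup>2" "- y = 1 - (2 * K\<^sup>2 - q) / K\<^sup>2"
        using K by (simp_all add: x_def y_def field_simps)
      then have L': "legendre_sum k (- x) = K\<^sup>2 * scaled_legendre_sum k (2 * K\<^sup>2 - p)"
        "legendre_sum k (- y) = K\<^sup>2 * scaled_legendre_sum k (2 * K\<^sup>2 - q)"
        using K by (simp_all add: scaled_legendre_sum_def K_def)
      define H where "H = (scaled_legendre_sum k p * scaled_legendre_sum k q
          + scaled_legendre_sum k (2 * K\<^sup>2 - p) * scaled_legendre_sum k (2 * K\<^sup>2 - q)) / 2"
      have hp: "harmonic_poly k x y = K ^ 4 * H"
        unfolding harmonic_poly_eq L L' H_def by (simp add: field_simps power2_eq_square power4_eq_xxxx)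
      define W where "W = p + q - p * q / K\<^sup>2"
      have w: "1 - x * y = W / K\<^sup>2" using K by (simp add: x_def y_def W_def field_simps power2_eq_square)
      have "\<bar>x\<bar> * \<bar>y\<bar> < 1 * 1" using rng by (intro mult_strict_mono') auto
      then have "x * y < 1" by (simp add: abs_mult[symmetric])
      then have "W / K\<^sup>2 > 0" using w by linarith
      then have W: "W > 0" using K by (simp add: zero_less_divide_iff)
      have KK: "K\<^sup>2 powr (s / 2) = K powr s"
      proof -
        have "K\<^sup>2 powr a = K powr (2 * a)" for a using K powr_powr[of K 2 a] by simp
        from this[of "s / 2"] show ?thesis by simp
      qed
      have "(1 - x * y) powr (- (s / 2)) = K powr s * W powr (- (s / 2))"
        unfolding w using K W by (simp add: powr_divide KK powr_minus field_simps)
      then have "(harmonic_poly k x y)\<^sup>2 * (1 - x * y) powr (- (s / 2)) = K powr (8 + s) * (H\<^sup>2 * W powr (- (s / 2)))"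
      proof -
        have "K powr (8 + s) = K ^ 8 * K powr s" using K by (simp add: powr_add)
        moreover have "(K ^ 4 * H)\<^sup>2 = K ^ 8 * H\<^sup>2" by (simp add: power_mult_distrib)
        moreover assume "(1 - x * y) powr (- (s / 2)) = K powr s * W powr (- (s / 2))"
        ultimately show ?thesis by (simp add: hp)
      qed
      moreover have "x + y \<ge> 0 \<longleftrightarrow> p + q \<le> 2 * K\<^sup>2" "x + y > 0 \<longleftrightarrow> p + q < 2 * K\<^sup>2"
      proof -
        have "x + y = (2 * K\<^sup>2 - (p + q)) / K\<^sup>2" using K by (simp add: x_def y_def field_simps)
        then show "x + y \<ge> 0 \<longleftrightarrow> p + q \<le> 2 * K\<^sup>2" "x + y > 0 \<longleftrightarrow> p + q < 2 * K\<^sup>2"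
          using K by (simp_all add: zero_le_divide_iff zero_less_divide_iff)
      qed
      moreover have "scaled_energy_density s k z = (of_bool (p + q \<le> 2 * K\<^sup>2) + of_bool (p + q < 2 * K\<^sup>2)) * H\<^sup>2 * W powr (- (s / 2))"
        using True by (simp add: scaled_energy_density_def z H_def W_def K_def)
      ultimately show ?thesis
        unfolding xy using rng by (simp add: F_def ennreal_mult''[symmetric] mult_ac del: ennreal_plus)
    qed
  qed
  also have "\<dots> = ennreal ((- 1 / K\<^sup>2)\<^sup>2) * ennreal (\<integral>z. K powr (8 + s) * scaled_energy_density s k z \<partial>lborel)"
  proof -
    have "0 \<le> scaled_energy_density s k z" for z
      by (cases z) (auto simp: scaled_energy_density_def)
    then show ?thesis using scaled_energy_limit(1)[OF s]
      by (subst nn_integral_eq_integral) auto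
  qed
  also have "\<dots> = ennreal (K powr (4 + s) * (\<integral>z. scaled_energy_density s k z \<partial>lborel))"
  proof -
    have "(- 1 / K\<^sup>2)\<^sup>2 * K powr (8 + s) = K powr (4 + s)"
    proof -
      have "K powr (8 + s) = K powr (4 + (4 + s))" by simp
      also have "\<dots> = K ^ 4 * K powr (4 + s)" using K by (subst powr_add) simp
      finally show ?thesis using K by (simp add: power_divide)
    qed
    then show ?thesis by (simp add: ennreal_mult'[symmetric] mult.assoc[symmetric])
  qed
  finally show ?thesis unfolding K_def .
qed

text \<open>The substitution p = t^2 / 2 that passes from the argument of
  \<open>bessel_ratio\<close> to that of the Bessel function. It is done on [0, i] and extended to
  the half line by monotone limits.\<close>

lemma nn_integral_half_square:
  fixes g :: "real \<Rightarrow> ennreal"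
  assumes [measurable]: "g \<in> borel_measurable borel"
  shows "(\<integral>\<^sup>+p. g p * indicator {0<..} p \<partial>lborel) = (\<integral>\<^sup>+t. g (t\<^sup>2 / 2) * ennreal t * indicator {0<..} t \<partial>lborel)"
proof -
  have SUP: "(\<integral>\<^sup>+x. h x * indicator (\<Union>i. A i) x \<partial>lborel) = (SUP i. \<integral>\<^sup>+x. h x * indicator (A i) x \<partial>lborel)"
    if [measurable]: "h \<in> borel_measurable borel" and A: "\<And>i. A i \<in> sets borel" "incseq A"
    for h :: "real \<Rightarrow> ennreal" and A :: "nat \<Rightarrow> real set"
  proof -
    have "(SUP i. emeasure (density lborel h) (A i)) = emeasure (density lborel h) (\<Union>i. A i)"
      using A by (intro SUP_emeasure_incseq) auto
    moreover have "emeasure (density lborel h) B = (\<integral>\<^sup>+x. h x * indicator B x \<partial>lborel)" if "B \<in> sets borel" for B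
      using that by (intro emeasure_density) auto
    ultimately show ?thesis using A by simp
  qed
  define h where "h = (\<lambda>p. g p * indicator {0<..} p)"
  have [measurable]: "h \<in> borel_measurable borel" unfolding h_def by measurable
  have inc: "incseq (\<lambda>i. {0..(real i)\<^sup>2 / 2})" "incseq (\<lambda>i. {0..real i})"
    by (auto simp: incseq_def intro: order_trans divide_right_mono power_mono)
  have U: "(\<Union>i. {0..(real i)\<^sup>2 / 2}) = {0..}" "(\<Union>i. {0..real i}) = {0..}"
  proof -
    have "\<exists>i. p \<le> (real i)\<^sup>2 / 2" if "p \<ge> 0" for p
    proof -
      obtain i where "2 * p + 1 \<le> real i" using real_arch_simple by blast
      moreover from this that have "real i * 1 \<le> real i * real i" by (intro mult_left_mono) auto
      ultimately show ?thesis by (intro exI[of _ i]) (auto simp: power2_eq_square)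
    qed
    then show "(\<Union>i. {0..(real i)\<^sup>2 / 2}) = {0..}" by auto
    show "(\<Union>i. {0..real i}) = {0..}" using real_arch_simple by auto
  qed
  have "(\<integral>\<^sup>+p. g p * indicator {0<..} p \<partial>lborel) = (\<integral>\<^sup>+p. h p * indicator {0..} p \<partial>lborel)"
    by (intro nn_integral_cong) (auto simp: h_def indicator_def)
  also have "\<dots> = (SUP i. \<integral>\<^sup>+p. h p * indicator {0..(real i)\<^sup>2 / 2} p \<partial>lborel)"
    unfolding U(1)[symmetric] by (rule SUP[OF _ _ inc(1)]) auto
  also have "\<dots> = (SUP i. \<integral>\<^sup>+t. (h (t\<^sup>2 / 2) * ennreal t) * indicator {0..real i} t \<partial>lborel)"
  proof (rule SUP_cong[OF refl])
    fix i :: nat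
    have der: "((\<lambda>t. t\<^sup>2 / 2) has_real_derivative x) (at x)" for x :: real
      by (auto intro!: derivative_eq_intros)
    show "(\<integral>\<^sup>+p. h p * indicator {0..(real i)\<^sup>2 / 2} p \<partial>lborel)
        = (\<integral>\<^sup>+t. (h (t\<^sup>2 / 2) * ennreal t) * indicator {0..real i} t \<partial>lborel)"
    proof (cases "i = 0")
      case False
      then show ?thesis
        using nn_integral_substitution_aux[of h 0 "real i" "\<lambda>t. t\<^sup>2 / 2" "\<lambda>t. t"] der
        by (auto intro!: continuous_intros)
    next
      case True
      have "(\<integral>\<^sup>+p. h p * indicator {0..(real i)\<^sup>2 / 2} p \<partial>lborel) = (\<integral>\<^sup>+p. 0 \<partial>(lborel :: real measure))"
        by (intro nn_integral_cong) (auto simp: True h_def indicator_def)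
      moreover have "(\<integral>\<^sup>+t. (h (t\<^sup>2 / 2) * ennreal t) * indicator {0..real i} t \<partial>lborel) = (\<integral>\<^sup>+p. 0 \<partial>(lborel :: real measure))"
        by (intro nn_integral_cong) (auto simp: True h_def indicator_def)
      ultimately show ?thesis by simp
    qed
  qed
  also have "\<dots> = (\<integral>\<^sup>+t. (h (t\<^sup>2 / 2) * ennreal t) * indicator {0..} t \<partial>lborel)"
    unfolding U(2)[symmetric] by (rule SUP[OF _ _ inc(2), symmetric]) auto
  also have "\<dots> = (\<integral>\<^sup>+t. g (t\<^sup>2 / 2) * ennreal t * indicator {0<..} t \<partial>lborel)"
    by (intro nn_integral_cong) (auto simp: h_def indicator_def)
  finally show ?thesis .
qed

text \<open>With p = x^2/2 and q = y^2/2 the Bessel numerator over x y is x y / 16 times the two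
  squared ratios, and (x^2 + y^2)^(s/2) = 2^(s/2) (p + q)^(s/2). Together with the factor 1/2 in
  \<open>limit_energy_density\<close> this leaves the constant 2 / (16 * 2^(s/2)).\<close>

lemma nn_integral_limit_energy_density:
  assumes s: "0 < s" "s < 4"
  shows "(\<integral>\<^sup>+x. (\<integral>\<^sup>+y. ennreal (indicator {0<..} x * (indicator {0<..} y *
            ((bessel_J1 x)\<^sup>2 * (bessel_J1 y)\<^sup>2 / (x * y * (x\<^sup>2 + y\<^sup>2) powr (s / 2))))) \<partial>lborel) \<partial>lborel)
    = ennreal (2 powr (- 3 - s / 2) * (\<integral>z. limit_energy_density s z \<partial>lborel))"
proof -
  define r where "r = (\<lambda>p. (bessel_ratio p)\<^sup>2)"
  have [measurable]: "r \<in> borel_measurable borel" unfolding r_def by measurable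
  have nn: "0 \<le> limit_energy_density s z" for z by (cases z) (simp add: limit_energy_density_def)
  have "(\<integral>\<^sup>+x. (\<integral>\<^sup>+y. ennreal (indicator {0<..} x * (indicator {0<..} y *
            ((bessel_J1 x)\<^sup>2 * (bessel_J1 y)\<^sup>2 / (x * y * (x\<^sup>2 + y\<^sup>2) powr (s / 2))))) \<partial>lborel) \<partial>lborel)
    = (\<integral>\<^sup>+x. (\<integral>\<^sup>+y. ennreal (2 powr (- 3 - s / 2)) * (ennreal (limit_energy_density s (x\<^sup>2/2, y\<^sup>2/2)) * ennreal y * indicator {0<..} y * (ennreal x * indicator {0<..} x)) \<partial>lborel) \<partial>lborel)"
  proof (intro nn_integral_cong)
    fix x y :: real
    show "ennreal (indicator {0<..} x * (indicator {0<..} y *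
            ((bessel_J1 x)\<^sup>2 * (bessel_J1 y)\<^sup>2 / (x * y * (x\<^sup>2 + y\<^sup>2) powr (s / 2)))))
       = ennreal (2 powr (- 3 - s / 2)) * (ennreal (limit_energy_density s (x\<^sup>2/2, y\<^sup>2/2)) * ennreal y * indicator {0<..} y * (ennreal x * indicator {0<..} x))"
    proof (cases "0 < x \<and> 0 < y")
      case True
      have "x\<^sup>2 + y\<^sup>2 = 2 * (x\<^sup>2/2 + y\<^sup>2/2)" by simp
      then have e: "(x\<^sup>2 + y\<^sup>2) powr (s / 2) = 2 powr (s / 2) * (x\<^sup>2/2 + y\<^sup>2/2) powr (s / 2)"
        using powr_mult[of 2 "x\<^sup>2/2 + y\<^sup>2/2" "s/2"] True by simp
      define w where "w = (x\<^sup>2/2 + y\<^sup>2/2) powr (s / 2)"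
      have "x\<^sup>2/2 + y\<^sup>2/2 > 0" using True by (intro add_pos_pos) auto
      then have w: "w > 0" by (simp add: w_def)
      define c a b where "c = 2 powr (s / 2)" and "a = bessel_ratio (x\<^sup>2/2)" and "b = bessel_ratio (y\<^sup>2/2)"
      have c: "c > 0" by (simp add: c_def)
      have lim: "limit_energy_density s (x\<^sup>2/2, y\<^sup>2/2) = a\<^sup>2 * b\<^sup>2 * (1 / w) / 2"
        using True by (simp add: limit_energy_density_def powr_minus_divide w_def a_def b_def)
      have t': "2 powr (- 3 - s / 2) = 1 / (8 * c)"
      proof -
        have "2 powr (- 3 - s / 2) = inverse (2 powr (3 + s / 2))" by (subst powr_minus[symmetric]) simp
        also have "\<dots> = inverse (2 powr 3 * 2 powr (s / 2))" by (subst powr_add) simp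
        finally show ?thesis by (simp add: c_def inverse_eq_divide)
      qed
      have "(bessel_J1 x)\<^sup>2 * (bessel_J1 y)\<^sup>2 / (x * y * (x\<^sup>2 + y\<^sup>2) powr (s / 2))
        = 2 powr (- 3 - s / 2) * (limit_energy_density s (x\<^sup>2/2, y\<^sup>2/2) * y * x)"
        using True w c unfolding bessel_J1_eq e lim t' w_def[symmetric] c_def[symmetric] a_def[symmetric] b_def[symmetric]
        by (simp add: field_simps power2_eq_square)
      then show ?thesis using True nn by (simp add: ennreal_mult mult_ac)
    qed (auto simp: indicator_def)
  qed
  also have "\<dots> = (\<integral>\<^sup>+x. ennreal (2 powr (- 3 - s / 2)) * ((\<integral>\<^sup>+y. ennreal (limit_energy_density s (x\<^sup>2/2, y\<^sup>2/2)) * ennreal y * indicator {0<..} y \<partial>lborel) * (ennreal x * indicator {0<..} x)) \<partial>lborel)"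
    by (intro nn_integral_cong) (simp add: nn_integral_cmult nn_integral_multc)
  also have "\<dots> = (\<integral>\<^sup>+x. ennreal (2 powr (- 3 - s / 2)) * ((\<integral>\<^sup>+q. ennreal (limit_energy_density s (x\<^sup>2/2, q)) * indicator {0<..} q \<partial>lborel) * (ennreal x * indicator {0<..} x)) \<partial>lborel)"
  proof (rule nn_integral_cong)
    fix x :: real
    have "(\<integral>\<^sup>+y. ennreal (limit_energy_density s (x\<^sup>2/2, y\<^sup>2/2)) * ennreal y * indicator {0<..} y \<partial>lborel)
        = (\<integral>\<^sup>+q. ennreal (limit_energy_density s (x\<^sup>2/2, q)) * indicator {0<..} q \<partial>lborel)"
      using nn_integral_half_square[of "\<lambda>q. ennreal (limit_energy_density s (x\<^sup>2/2, q))"] by simp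
    then show "ennreal (2 powr (- 3 - s / 2)) * ((\<integral>\<^sup>+y. ennreal (limit_energy_density s (x\<^sup>2/2, y\<^sup>2/2)) * ennreal y * indicator {0<..} y \<partial>lborel) * (ennreal x * indicator {0<..} x))
      = ennreal (2 powr (- 3 - s / 2)) * ((\<integral>\<^sup>+q. ennreal (limit_energy_density s (x\<^sup>2/2, q)) * indicator {0<..} q \<partial>lborel) * (ennreal x * indicator {0<..} x))"
      by (rule arg_cong)
  qed
  also have "\<dots> = ennreal (2 powr (- 3 - s / 2)) * (\<integral>\<^sup>+x. (\<integral>\<^sup>+q. ennreal (limit_energy_density s (x\<^sup>2/2, q)) * indicator {0<..} q \<partial>lborel) * ennreal x * indicator {0<..} x \<partial>lborel)"
    by (simp add: nn_integral_cmult mult.assoc)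
  also have "(\<integral>\<^sup>+x. (\<integral>\<^sup>+q. ennreal (limit_energy_density s (x\<^sup>2/2, q)) * indicator {0<..} q \<partial>lborel) * ennreal x * indicator {0<..} x \<partial>lborel)
    = (\<integral>\<^sup>+p. (\<integral>\<^sup>+q. ennreal (limit_energy_density s (p, q)) * indicator {0<..} q \<partial>lborel) * indicator {0<..} p \<partial>lborel)"
    using nn_integral_half_square[of "\<lambda>p. \<integral>\<^sup>+q. ennreal (limit_energy_density s (p, q)) * indicator {0<..} q \<partial>lborel"] by simp
  also have "\<dots> = (\<integral>\<^sup>+p. (\<integral>\<^sup>+q. ennreal (limit_energy_density s (p, q)) \<partial>lborel) \<partial>lborel)"
  proof (rule nn_integral_cong)
    fix p :: real
    have "ennreal (limit_energy_density s (p, q)) * indicator {0<..} q = ennreal (limit_energy_density s (p, q))" for q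
      by (simp add: limit_energy_density_def indicator_def)
    then show "(\<integral>\<^sup>+q. ennreal (limit_energy_density s (p, q)) * indicator {0<..} q \<partial>lborel) * indicator {0<..} p
      = (\<integral>\<^sup>+q. ennreal (limit_energy_density s (p, q)) \<partial>lborel)"
      by (simp add: limit_energy_density_def indicator_def)
  qed
  also have "\<dots> = (\<integral>\<^sup>+z. ennreal (limit_energy_density s z) \<partial>lborel)"
    by (subst nn_integral_lborel_pair) auto
  also have "\<dots> = ennreal (\<integral>z. limit_energy_density s z \<partial>lborel)"
    using scaled_energy_limit(2)[OF s] nn by (intro nn_integral_eq_integral) auto
  finally show ?thesis by (simp add: ennreal_mult')
qed

lemma bessel_J1_measurable [measurable]: "bessel_J1 \<in> borel_measurable borel"
  unfolding bessel_J1_eq[abs_def] by measurable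

lemma energy_const_eq:
  assumes s: "0 < s" "s < 4"
  shows "energy_const s = 2 powr (s / 4 - 1) * (\<integral>z. limit_energy_density s z \<partial>lborel)"
proof -
  define h where "h = (\<lambda>z. indicator {0<..} (fst z) * (indicator {0<..} (snd z) *
     ((bessel_J1 (fst z))\<^sup>2 * (bessel_J1 (snd z))\<^sup>2 / (fst z * snd z * ((fst z)\<^sup>2 + (snd z)\<^sup>2) powr (s / 2)))) :: real)"
  have [measurable]: "h \<in> borel_measurable borel" unfolding h_def by measurable
  have h0: "0 \<le> h z" for z by (auto simp: h_def indicator_def)
  define I where "I = (\<integral>z. limit_energy_density s z \<partial>lborel)"
  have "0 \<le> limit_energy_density s z" for z by (cases z) (simp add: limit_energy_density_def)
  then have I0: "0 \<le> I" by (simp add: I_def)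
  have nn: "(\<integral>\<^sup>+z. ennreal (h z) \<partial>lborel) = ennreal (2 powr (- 3 - s / 2) * I)"
    unfolding I_def nn_integral_limit_energy_density[OF s, symmetric]
    by (subst nn_integral_lborel_pair) (auto simp: h_def)
  have int: "integrable lborel h"
    by (rule integrableI_nn_integral_finite[OF _ _ nn]) (use h0 I0 in auto)
  have "(LBINT x:{0<..}. LBINT y:{0<..}.
        (bessel_J1 x)\<^sup>2 * (bessel_J1 y)\<^sup>2 / (x * y * (x\<^sup>2 + y\<^sup>2) powr (s / 2)))
      = (\<integral>x. (\<integral>y. h (x, y) \<partial>lborel) \<partial>lborel)"
    unfolding set_lebesgue_integral_def h_def
    by (intro Bochner_Integration.integral_cong refl)
       (simp only: real_scaleR_def integral_mult_right_zero fst_conv snd_conv)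
  also have "\<dots> = integral\<^sup>L (lborel \<Otimes>\<^sub>M lborel) h"
    using int by (intro lborel_pair.integral_fst') (simp add: lborel_prod)
  also have "\<dots> = 2 powr (- 3 - s / 2) * I"
    using nn_integral_eq_integral[OF int] nn h0 I0 by (simp add: lborel_prod integral_nonneg)
  finally have "energy_const s = 2 powr (2 + 3 * s / 4) * (2 powr (- 3 - s / 2) * I)"
    by (simp add: energy_const_def)
  also have "\<dots> = 2 powr (s / 4 - 1) * I"
  proof -
    have "2 powr (2 + 3 * s / 4) * 2 powr (- 3 - s / 2) = 2 powr ((2 + 3 * s / 4) + (- 3 - s / 2))"
      by (rule powr_add[symmetric])
    also have "(2 + 3 * s / 4) + (- 3 - s / 2) = s / 4 - 1" by simp
    finally show ?thesis by (simp only: mult.assoc[symmetric])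
  qed
  finally show ?thesis by (simp add: I_def)
qed

text \<open>K^(4+s) is (K^4)^(1+s/4), and K^4 divided by the dimension tends to 2. The limit is thus
  2^(1+s/4) / 4 times the integral of the limit density, and 2^(s/4-1) is exactly the factor in
  \<open>energy_const_eq\<close>.\<close>

lemma harmonic_square_energy_asymp:
  assumes s: "0 < s" "s < 4"
  shows "harmonic_square_energy s k < \<infinity>"
    and "(\<lambda>k. enn2real (harmonic_square_energy s k) / 4 / real (harmonic_dim k) powr (1 + s / 4)) \<longlonglongrightarrow> energy_const s"
proof -
  show "harmonic_square_energy s k < \<infinity>"
    by (simp add: harmonic_square_energy_eq[OF s])
  define J where "J = (\<lambda>k. \<integral>z. scaled_energy_density s k z \<partial>lborel)"
  define I where "I = (\<integral>z. limit_energy_density s z \<partial>lborel)"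
  have J: "J \<longlonglongrightarrow> I" unfolding J_def I_def by (rule scaled_energy_limit(3)[OF s])
  have "0 \<le> scaled_energy_density s k z" for k z
    by (cases z) (auto simp: scaled_energy_density_def)
  then have J0: "0 \<le> J k" for k by (simp add: J_def)
  have "(\<lambda>k. J k / 4 * (2 / (1 + 1 / (real k + 1)\<^sup>2)) powr (1 + s / 4)) \<longlonglongrightarrow> I / 4 * (2 / (1 + 0)) powr (1 + s / 4)"
  proof (intro tendsto_intros J)
    show "(\<lambda>k. 1 / (real k + 1)\<^sup>2) \<longlonglongrightarrow> 0" by real_asymp
  qed auto
  also have "I / 4 * (2 / (1 + 0)) powr (1 + s / 4) = energy_const s"
  proof -
    have "2 powr (2 + (s / 4 - 1)) = 2 powr 2 * 2 powr (s / 4 - 1)" by (rule powr_add)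
    then show ?thesis by (simp add: energy_const_eq[OF s] I_def)
  qed
  also have "(\<lambda>k. J k / 4 * (2 / (1 + 1 / (real k + 1)\<^sup>2)) powr (1 + s / 4))
     = (\<lambda>k. enn2real (harmonic_square_energy s k) / 4 / real (harmonic_dim k) powr (1 + s / 4))"
  proof
    fix k
    define K where "K = real k + 1"
    have K: "K > 0" by (simp add: K_def)
    have KK: "K powr (4 + s) = (K ^ 4) powr (1 + s / 4)"
    proof -
      have "(K ^ 4) powr (1 + s / 4) = (K powr 4) powr (1 + s / 4)" using K by simp
      then show ?thesis by (simp add: powr_powr)
    qed
    have d: "2 / (1 + 1 / K\<^sup>2) = K ^ 4 / real (harmonic_dim k)"
    proof -
      have "K\<^sup>2 + 1 > 0" using K by (simp add: add_pos_pos)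
      then have "2 / (1 + 1 / K\<^sup>2) = 2 * K\<^sup>2 / (K\<^sup>2 + 1)" using K by (simp add: divide_simps)
      also have "\<dots> = (K\<^sup>2 * (2 * K\<^sup>2)) / (K\<^sup>2 * (K\<^sup>2 + 1))" using K by simp
      also have "\<dots> = K ^ 4 / real (harmonic_dim k)"
        unfolding harmonic_dim_eq K_def[symmetric] by (simp add: algebra_simps power2_eq_square power4_eq_xxxx)
      finally show ?thesis .
    qed
    have "real (harmonic_dim k) > 0"
      using K unfolding harmonic_dim_eq K_def[symmetric] by (simp add: add_pos_pos)
    then have "J k / 4 * (2 / (1 + 1 / K\<^sup>2)) powr (1 + s / 4) = J k / 4 * (K powr (4 + s) / real (harmonic_dim k) powr (1 + s / 4))"
      using K by (simp add: d powr_divide KK)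
    moreover have "harmonic_square_energy s k = ennreal (K powr (4 + s) * J k)"
      unfolding harmonic_square_energy_eq[OF s] J_def K_def by simp
    ultimately show "J k / 4 * (2 / (1 + 1 / (real k + 1)\<^sup>2)) powr (1 + s / 4)
       = enn2real (harmonic_square_energy s k) / 4 / real (harmonic_dim k) powr (1 + s / 4)"
      using J0[of k] by (simp add: K_def mult_ac)
  qed
  finally show "(\<lambda>k. enn2real (harmonic_square_energy s k) / 4 / real (harmonic_dim k) powr (1 + s / 4)) \<longlonglongrightarrow> energy_const s" .
qed

section \<open>Self-dual and anti-self-dual parts of a plane\<close>

definition pluecker :: "real^2^4 \<Rightarrow> 4 \<Rightarrow> 4 \<Rightarrow> real" where
  "pluecker A i j = A $ i $ 1 * A $ j $ 2 - A $ j $ 1 * A $ i $ 2"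

text \<open>Coordinates with respect to e12 + e34, e13 - e24, e14 + e23 without the normalising
  factor 1 / sqrt 2, so that an orthonormal frame yields a unit vector and not one of length 1 /
  sqrt 2.\<close>

definition self_dual :: "real^2^4 \<Rightarrow> real^3" where
  "self_dual A = vector [pluecker A 1 2 + pluecker A 3 4, pluecker A 1 3 - pluecker A 2 4, pluecker A 1 4 + pluecker A 2 3]"

definition anti_self_dual :: "real^2^4 \<Rightarrow> real^3" where
  "anti_self_dual A = vector [pluecker A 1 2 - pluecker A 3 4, pluecker A 1 3 + pluecker A 2 4, pluecker A 1 4 - pluecker A 2 3]"

lemma inner_vec3: "(x :: real^3) \<bullet> y = x $ 1 * y $ 1 + x $ 2 * y $ 2 + x $ 3 * y $ 3"
  by (simp add: inner_vec_def sum_3)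

lemma self_dual_nth [simp]:
  "self_dual A $ 1 = pluecker A 1 2 + pluecker A 3 4"
  "self_dual A $ 2 = pluecker A 1 3 - pluecker A 2 4"
  "self_dual A $ 3 = pluecker A 1 4 + pluecker A 2 3"
  "anti_self_dual A $ 1 = pluecker A 1 2 - pluecker A 3 4"
  "anti_self_dual A $ 2 = pluecker A 1 3 + pluecker A 2 4"
  "anti_self_dual A $ 3 = pluecker A 1 4 - pluecker A 2 3"
  by (simp_all add: self_dual_def anti_self_dual_def)

lemma gram_nth:
  "(transpose A ** B) $ i $ j = A $ 1 $ i * B $ 1 $ j + A $ 2 $ i * B $ 2 $ j + A $ 3 $ i * B $ 3 $ j + A $ 4 $ i * (B $ 4 $ j :: real)"
  for A B :: "real^2^4"
  by (simp add: matrix_matrix_mult_def transpose_def sum_4)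

lemma stiefel24_iff:
  "A \<in> stiefel24 \<longleftrightarrow>
     A $ 1 $ 1 * A $ 1 $ 1 + A $ 2 $ 1 * A $ 2 $ 1 + A $ 3 $ 1 * A $ 3 $ 1 + A $ 4 $ 1 * A $ 4 $ 1 = 1 \<and>
     A $ 1 $ 2 * A $ 1 $ 2 + A $ 2 $ 2 * A $ 2 $ 2 + A $ 3 $ 2 * A $ 3 $ 2 + A $ 4 $ 2 * A $ 4 $ 2 = 1 \<and>
     A $ 1 $ 1 * A $ 1 $ 2 + A $ 2 $ 1 * A $ 2 $ 2 + A $ 3 $ 1 * A $ 3 $ 2 + A $ 4 $ 1 * A $ 4 $ 2 = 0"
  unfolding stiefel24_def mem_Collect_eq vec_eq_iff forall_2 gram_nth
  by (auto simp: mat_def mult.commute)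

text \<open>By Cauchy-Binet the determinant is the inner product of the two Pluecker vectors, and
  the self-dual and anti-self-dual parts are orthogonal to each other.\<close>

lemma det_gram:
  "det (transpose A ** B) = (self_dual A \<bullet> self_dual B + anti_self_dual A \<bullet> anti_self_dual B) / 2"
  for A B :: "real^2^4"
  unfolding det_2 gram_nth inner_vec3 self_dual_nth pluecker_def by (simp add: field_simps)

lemma pluecker_relation:
  "pluecker A 1 2 * pluecker A 3 4 - pluecker A 1 3 * pluecker A 2 4 + pluecker A 1 4 * pluecker A 2 3 = 0"
  unfolding pluecker_def by (simp add: algebra_simps)

text \<open>Cauchy-Binet with B = A gives 2 for the sum of the two squared lengths; the Pluecker
  relation gives 0 for their difference.\<close>

lemma
  assumes "A \<in> stiefel24"
  shows self_dual_unit: "self_dual A \<bullet> self_dual A = 1"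
    and anti_self_dual_unit: "anti_self_dual A \<bullet> anti_self_dual A = 1"
proof -
  have "transpose A ** A = mat 1" using assms by (simp add: stiefel24_def)
  then have "det (transpose A ** A) = 1" by simp
  then have "self_dual A \<bullet> self_dual A + anti_self_dual A \<bullet> anti_self_dual A = 2"
    unfolding det_gram by simp
  moreover have "self_dual A \<bullet> self_dual A - anti_self_dual A \<bullet> anti_self_dual A
     = 4 * (pluecker A 1 2 * pluecker A 3 4 - pluecker A 1 3 * pluecker A 2 4 + pluecker A 1 4 * pluecker A 2 3)"
    unfolding inner_vec3 self_dual_nth by (simp add: algebra_simps)
  ultimately show "self_dual A \<bullet> self_dual A = 1" "anti_self_dual A \<bullet> anti_self_dual A = 1"
    unfolding pluecker_relation by simp_all
qed

text \<open>In quaternionic terms the matrix is \<open>\<plusminus> L\<^sub>u R\<^sub>v\<close>, and \<open>(1 + L\<^sub>u R\<^sub>v) / 2\<close> is the orthogonal projection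
  onto the plane with self-dual part \<open>u\<close> and anti-self-dual part \<open>v\<close>.\<close>

definition duality_matrix :: "real^3 \<Rightarrow> real^3 \<Rightarrow> real^4^4" where
  "duality_matrix u v = vector
     [vector [u$1* v$1 + u$2* v$2 + u$3* v$3, u$3* v$2 - u$2* v$3, u$1* v$3 - u$3* v$1, u$2* v$1 - u$1* v$2],
      vector [u$3* v$2 - u$2* v$3, u$1* v$1 - u$2* v$2 - u$3* v$3, u$1* v$2 + u$2* v$1, u$1* v$3 + u$3* v$1],
      vector [u$1* v$3 - u$3* v$1, u$1* v$2 + u$2* v$1, u$2* v$2 - u$1* v$1 - u$3* v$3, u$2* v$3 + u$3* v$2],
      vector [u$2* v$1 - u$1* v$2, u$1* v$3 + u$3* v$1, u$2* v$3 + u$3* v$2, u$3* v$3 - u$1* v$1 - u$2* v$2]]"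

lemma vector_4_nth:
  "(vector [a, b, c, d] :: ('a::zero)^4) $ 1 = a"
  "(vector [a, b, c, d] :: ('a::zero)^4) $ 2 = b"
  "(vector [a, b, c, d] :: ('a::zero)^4) $ 3 = c"
  "(vector [a, b, c, d] :: ('a::zero)^4) $ 4 = d"
  unfolding vector_def by simp_all

text \<open>The left side is the trace of the product of the orthogonal projections onto the two
  planes. Each projection is (1 + D) / 2 with a traceless symmetric matrix D, and the trace of the
  product of two such D is 4 (u . u') (v . v').\<close>

lemma sum_gram_squares:
  fixes A B :: "real^2^4"
  assumes A: "A \<in> stiefel24" and B: "B \<in> stiefel24"
  shows "(\<Sum>i\<in>UNIV. \<Sum>j\<in>UNIV. ((transpose A ** B) $ i $ j)\<^sup>2)
     = 1 + (self_dual A \<bullet> self_dual B) * (anti_self_dual A \<bullet> anti_self_dual B)"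
proof -
  let ?D = "\<lambda>A. duality_matrix (self_dual A) (anti_self_dual A)"
  have proj: "2 * (A $ i $ 1 * A $ j $ 1 + A $ i $ 2 * A $ j $ 2) = (if i = j then 1 else 0) + ?D A $ i $ j"
    if "A \<in> stiefel24" for A :: "real^2^4" and i j
  proof -
    \<comment> \<open>The identity is homogenised with the entries \<open>X\<close>,
      \<open>Y\<close>, \<open>Z\<close> of the Gram matrix. It then holds for every 4 by 2 matrix
      and is checked by expansion; orthonormality specialises it to X = Y = 1, Z = 0.\<close>
    define X where "X = A $ 1 $ 1 * A $ 1 $ 1 + A $ 2 $ 1 * A $ 2 $ 1 + A $ 3 $ 1 * A $ 3 $ 1 + A $ 4 $ 1 * A $ 4 $ 1"
    define Y where "Y = A $ 1 $ 2 * A $ 1 $ 2 + A $ 2 $ 2 * A $ 2 $ 2 + A $ 3 $ 2 * A $ 3 $ 2 + A $ 4 $ 2 * A $ 4 $ 2"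
    define Z where "Z = A $ 1 $ 1 * A $ 1 $ 2 + A $ 2 $ 1 * A $ 2 $ 2 + A $ 3 $ 1 * A $ 3 $ 2 + A $ 4 $ 1 * A $ 4 $ 2"
    have XYZ: "X = 1" "Y = 1" "Z = 0" using that by (simp_all add: stiefel24_iff X_def Y_def Z_def)
    have "\<forall>i j. 2 * (Y * (A $ i $ 1 * A $ j $ 1) + X * (A $ i $ 2 * A $ j $ 2) - Z * (A $ i $ 1 * A $ j $ 2 + A $ j $ 1 * A $ i $ 2))
       = (if i = j then 1 else 0) * (X * Y - Z * Z) + ?D A $ i $ j"
      unfolding forall_4 duality_matrix_def vector_4_nth self_dual_nth pluecker_def X_def Y_def Z_def
      by (simp add: algebra_simps)
    then show ?thesis unfolding XYZ by simp
  qed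
  have "(\<Sum>i\<in>UNIV. \<Sum>j\<in>UNIV. ((transpose A ** B) $ i $ j)\<^sup>2)
     = (\<Sum>i\<in>UNIV. \<Sum>j\<in>UNIV. (A $ i $ 1 * A $ j $ 1 + A $ i $ 2 * A $ j $ 2) * (B $ i $ 1 * B $ j $ 1 + B $ i $ 2 * B $ j $ 2))"
    unfolding sum_2 sum_4 gram_nth by (simp add: algebra_simps power2_eq_square)
  also have "\<dots> = (\<Sum>i\<in>UNIV. \<Sum>j\<in>UNIV. ((if i = j then 1 else 0) + ?D A $ i $ j) * ((if i = j then 1 else 0) + ?D B $ i $ j)) / 4"
    unfolding proj[OF A, symmetric] proj[OF B, symmetric] sum_divide_distrib
    by (intro sum.cong refl) (simp add: algebra_simps)
  also have "\<dots> = 1 + (self_dual A \<bullet> self_dual B) * (anti_self_dual A \<bullet> anti_self_dual B)"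
  proof -
    have "(\<Sum>i\<in>UNIV. \<Sum>j\<in>UNIV. ((if i = j then 1 else 0) + duality_matrix u v $ i $ j) * ((if i = j then 1 else 0) + duality_matrix u' v' $ i $ j))
       = 4 + 4 * ((u \<bullet> u') * (v \<bullet> v'))" for u v u' v'
      unfolding sum_4 duality_matrix_def vector_4_nth inner_vec3 by (simp add: algebra_simps)
    then show ?thesis by simp
  qed
  finally show ?thesis .
qed

lemma pluecker_mult:
  "pluecker (A ** C) i j = det C * pluecker A i j" for C :: "real^2^2"
  unfolding pluecker_def det_2 matrix_matrix_mult_def by (simp add: sum_2 algebra_simps)

lemma duals_mult:
  "self_dual (A ** C) = det C *\<^sub>R self_dual A" "anti_self_dual (A ** C) = det C *\<^sub>R anti_self_dual A" for C :: "real^2^2"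
  by (simp_all add: vec_eq_iff forall_3 pluecker_mult algebra_simps)

lemma span_columns_eq: "span (columns A) = range ((*v) A)" for A :: "real^2^4"
proof -
  have c: "columns A = {column 1 A, column 2 A}" by (auto simp: columns_def UNIV_2)
  have "A *v x = x $ 1 *\<^sub>R column 1 A + x $ 2 *\<^sub>R column 2 A" for x
    by (simp add: matrix_vector_mult_def vec_eq_iff sum_2 column_def mult.commute)
  then show ?thesis
    apply (auto simp: c span_insert span_singleton image_def)
    subgoal for x k l
      by (rule exI[of _ "vector [k, l]"]) (simp add: vector_2 eq_diff_eq diff_eq_eq add.commute)
    subgoal for x by (rule exI[of _ "x $ 1"], rule exI[of _ "x $ 2"]) simp
    done
qed

text \<open>The transpose of A inverts A on the common plane, so the change of basis is the
  transpose of A times B. It is orthogonal; its determinant \<plusminus>1 is the sign ambiguity of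
  the dual pair.\<close>

lemma same_span_factor:
  fixes A B :: "real^2^4"
  assumes A: "A \<in> stiefel24" and B: "B \<in> stiefel24" and s: "span (columns A) = span (columns B)"
  obtains C :: "real^2^2" where "B = A ** C" "det C = 1 \<or> det C = -1"
proof -
  have AA: "transpose A ** A = mat 1" and BB: "transpose B ** B = mat 1"
    using A B by (auto simp: stiefel24_def)
  define C where "C = transpose A ** B"
  have "A *v (C *v x) = B *v x" for x
  proof -
    have "B *v x \<in> range ((*v) A)" using s unfolding span_columns_eq by auto
    then obtain y where y: "B *v x = A *v y" by auto
    have "C *v x = transpose A *v (B *v x)" by (simp add: C_def matrix_vector_mul_assoc)
    also have "\<dots> = y" by (simp add: y matrix_vector_mul_assoc AA)
    finally show ?thesis using y by simp
  qed
  then have BC: "B = A ** C"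
    by (subst matrix_eq) (simp add: matrix_vector_mul_assoc[symmetric])
  have "transpose C ** C = mat 1"
    using BB unfolding BC by (simp add: matrix_transpose_mul matrix_mul_assoc[symmetric])
      (simp add: matrix_mul_assoc AA)
  then have "det (transpose C ** C) = 1" by simp
  then have "det C * det C = 1" by (simp add: det_mul)
  then have "det C = 1 \<or> det C = -1" by (metis mult_cancel_left2 mult_minus1_right square_eq_iff mult_1)
  with BC show ?thesis using that by blast
qed

text \<open>The first column is, up to scale, (1 + u . v, v \<times> u): the first column of 1 +
  \<open>duality_matrix u v\<close>, that is, the projection of the first basis vector to the plane.
  The second column is proportional to (0, u + v). Both have squared length 2 (1 + u . v) before
  scaling, so the construction degenerates only for v = -u, when the first basis vector is
  orthogonal to the plane.\<close>

lemma exists_stiefel24: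
  fixes u v :: "real^3"
  assumes u: "u \<bullet> u = 1" and v: "v \<bullet> v = 1" and uv: "u \<bullet> v \<noteq> -1"
  shows "\<exists>A\<in>stiefel24. self_dual A = u \<and> anti_self_dual A = v"
proof -
  define d where "d = u \<bullet> v"
  have nu: "norm u = 1" "norm v = 1" using u v by (simp_all add: norm_eq_sqrt_inner)
  then have "\<bar>d\<bar> \<le> 1" using Cauchy_Schwarz_ineq2[of u v] by (simp add: d_def)
  with uv have d: "1 + d > 0" by (auto simp: d_def)
  define r where "r = sqrt (2 * (1 + d))"
  have r: "r > 0" "r * r = 2 * (1 + d)" using d by (simp_all add: r_def)
  define A :: "real^2^4" where "A = (1 / r) *\<^sub>R vector
     [vector [1 + d, 0], vector [u$3* v$2 - u$2* v$3, u$1 + v$1], vector [u$1* v$3 - u$3* v$1, u$2 + v$2],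
      vector [u$2* v$1 - u$1* v$2, u$3 + v$3]]"
  have nth: "A $ 1 $ 1 = (1 + d) / r" "A $ 1 $ 2 = 0"
    "A $ 2 $ 1 = (u$3* v$2 - u$2* v$3) / r" "A $ 2 $ 2 = (u$1 + v$1) / r"
    "A $ 3 $ 1 = (u$1* v$3 - u$3* v$1) / r" "A $ 3 $ 2 = (u$2 + v$2) / r"
    "A $ 4 $ 1 = (u$2* v$1 - u$1* v$2) / r" "A $ 4 $ 2 = (u$3 + v$3) / r"
    by (simp_all add: A_def vector_4_nth)
  have U: "u$1*u$1 + u$2*u$2 + u$3*u$3 = 1" and V: "v$1* v$1 + v$2* v$2 + v$3* v$3 = 1"
    and D: "u$1* v$1 + u$2* v$2 + u$3* v$3 = d"
    using u v by (simp_all add: inner_vec3 d_def)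
  have rr: "x / r * (y / r) = x * y / (2 * (1 + d))" for x y using r by simp
  have div1: "x = 2 * (1 + d) \<Longrightarrow> x / (2 * (1 + d)) = 1" for x using d by simp
  have half: "x / (2 * (1 + d)) = y / 2" if "x = (1 + d) * y" for x y
  proof -
    have "(1 + d) * y / ((1 + d) * 2) = y / 2" using d by (intro nonzero_mult_divide_mult_cancel_left) auto
    then show ?thesis using that by (simp only: mult.commute)
  qed
  have "A \<in> stiefel24"
    unfolding stiefel24_iff nth
  proof (intro conjI)
    have "(1 + d) * (1 + d) + (u$3* v$2 - u$2* v$3) * (u$3* v$2 - u$2* v$3) + (u$1* v$3 - u$3* v$1) * (u$1* v$3 - u$3* v$1) + (u$2* v$1 - u$1* v$2) * (u$2* v$1 - u$1* v$2)
       = (1 + d) * (1 + d) + (u$1*u$1 + u$2*u$2 + u$3*u$3) * (v$1* v$1 + v$2* v$2 + v$3* v$3) - (u$1* v$1 + u$2* v$2 + u$3* v$3) * (u$1* v$1 + u$2* v$2 + u$3* v$3)"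
      by (simp add: algebra_simps)
    also have "\<dots> = 2 * (1 + d)" unfolding U V D by (simp add: algebra_simps)
    finally have "(1 + d) * (1 + d) + (u$3 * v$2 - u$2 * v$3) * (u$3 * v$2 - u$2 * v$3) + (u$1 * v$3 - u$3 * v$1) * (u$1 * v$3 - u$3 * v$1) + (u$2 * v$1 - u$1 * v$2) * (u$2 * v$1 - u$1 * v$2) = 2 * (1 + d)" .
    from div1[OF this] show "(1 + d) / r * ((1 + d) / r) + (u$3 * v$2 - u$2 * v$3) / r * ((u$3 * v$2 - u$2 * v$3) / r) + (u$1 * v$3 - u$3 * v$1) / r * ((u$1 * v$3 - u$3 * v$1) / r) + (u$2 * v$1 - u$1 * v$2) / r * ((u$2 * v$1 - u$1 * v$2) / r) = 1"
      unfolding rr by (simp only: add_divide_distrib)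
    have "(u$1 + v$1) * (u$1 + v$1) + (u$2 + v$2) * (u$2 + v$2) + (u$3 + v$3) * (u$3 + v$3)
      = (u$1*u$1 + u$2*u$2 + u$3*u$3) + (v$1* v$1 + v$2* v$2 + v$3* v$3) + 2 * (u$1* v$1 + u$2* v$2 + u$3* v$3)"
      by (simp add: algebra_simps)
    also have "\<dots> = 2 * (1 + d)" unfolding U V D by simp
    finally have "(u$1 + v$1) * (u$1 + v$1) + (u$2 + v$2) * (u$2 + v$2) + (u$3 + v$3) * (u$3 + v$3) = 2 * (1 + d)" .
    from div1[OF this] show "0 * 0 + (u$1 + v$1) / r * ((u$1 + v$1) / r) + (u$2 + v$2) / r * ((u$2 + v$2) / r) + (u$3 + v$3) / r * ((u$3 + v$3) / r) = 1"
      unfolding rr by (simp only: add_divide_distrib mult_zero_left add_0)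
    show "(1 + d) / r * 0 + (u$3 * v$2 - u$2 * v$3) / r * ((u$1 + v$1) / r) + (u$1 * v$3 - u$3 * v$1) / r * ((u$2 + v$2) / r) + (u$2 * v$1 - u$1 * v$2) / r * ((u$3 + v$3) / r) = 0"
      unfolding rr add_divide_distrib[symmetric] by (simp add: algebra_simps flip: add_divide_distrib)
  qed
  moreover have "self_dual A = u \<and> anti_self_dual A = v"
  proof -
    have p1: "pluecker A 1 2 = (u$1 + v$1) / 2" "pluecker A 1 3 = (u$2 + v$2) / 2" "pluecker A 1 4 = (u$3 + v$3) / 2"
      unfolding pluecker_def nth rr by (simp_all only: half[OF refl] mult_zero_right diff_0_right)
    have "(u$1* v$3 - u$3* v$1) * (u$3 + v$3) - (u$2* v$1 - u$1* v$2) * (u$2 + v$2)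
       = u$1 * (v$1* v$1 + v$2* v$2 + v$3* v$3) - v$1 * (u$1*u$1 + u$2*u$2 + u$3*u$3) + (u$1* v$1 + u$2* v$2 + u$3* v$3) * (u$1 - v$1)"
      by (simp add: algebra_simps)
    also have "\<dots> = (1 + d) * (u$1 - v$1)" unfolding U V D by (simp add: algebra_simps)
    finally have p34: "pluecker A 3 4 = (u$1 - v$1) / 2"
      unfolding pluecker_def nth rr diff_divide_distrib[symmetric] by (rule half)
    have "(u$3* v$2 - u$2* v$3) * (u$3 + v$3) - (u$2* v$1 - u$1* v$2) * (u$1 + v$1)
       = v$2 * (u$1*u$1 + u$2*u$2 + u$3*u$3) - u$2 * (v$1* v$1 + v$2* v$2 + v$3* v$3) + (u$1* v$1 + u$2* v$2 + u$3* v$3) * (v$2 - u$2)"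
      by (simp add: algebra_simps)
    also have "\<dots> = (1 + d) * (v$2 - u$2)" unfolding U V D by (simp add: algebra_simps)
    finally have p24: "pluecker A 2 4 = (v$2 - u$2) / 2"
      unfolding pluecker_def nth rr diff_divide_distrib[symmetric] by (rule half)
    have "(u$3* v$2 - u$2* v$3) * (u$2 + v$2) - (u$1* v$3 - u$3* v$1) * (u$1 + v$1)
       = u$3 * (v$1* v$1 + v$2* v$2 + v$3* v$3) - v$3 * (u$1*u$1 + u$2*u$2 + u$3*u$3) + (u$1* v$1 + u$2* v$2 + u$3* v$3) * (u$3 - v$3)"
      by (simp add: algebra_simps)
    also have "\<dots> = (1 + d) * (u$3 - v$3)" unfolding U V D by (simp add: algebra_simps)
    finally have p23: "pluecker A 2 3 = (u$3 - v$3) / 2"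
      unfolding pluecker_def nth rr diff_divide_distrib[symmetric] by (rule half)
    show ?thesis
      unfolding vec_eq_iff forall_3 self_dual_nth p1 p34 p24 p23 by (simp add: field_simps)
  qed
  ultimately show ?thesis by blast
qed

lemma unit_inner_bound:
  fixes x y :: "'a::real_inner"
  assumes "x \<bullet> x = 1" "y \<bullet> y = 1" shows "\<bar>x \<bullet> y\<bar> \<le> 1"
proof -
  have "norm x = 1" "norm y = 1" using assms by (simp_all add: norm_eq_sqrt_inner)
  then show ?thesis using Cauchy_Schwarz_ineq2[of x y] by simp
qed

section \<open>Orthonormal frames and the dual pair of a plane\<close>

lemma gr24_obtains_stiefel:
  assumes "P \<in> gr24"
  obtains A where "A \<in> stiefel24" "span (columns A) = P"
proof -
  have P: "subspace P" "dim P = 2" using assms by (auto simp: gr24_def)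
  obtain B where B: "B \<subseteq> P" "pairwise orthogonal B" "\<And>x. x \<in> B \<Longrightarrow> norm x = 1" "card B = dim P" "span B = P"
    using orthonormal_basis_subspace[OF P(1)] by metis
  then obtain a b where ab: "B = {a, b}" "a \<noteq> b" using P(2) by (auto simp: card_2_iff)
  have o: "a \<bullet> b = 0" using B(2) ab by (auto simp: pairwise_def orthogonal_def)
  have n: "a \<bullet> a = 1" "b \<bullet> b = 1" using B(3) ab by (simp_all add: norm_eq_1)
  define A :: "real^2^4" where "A = (\<chi> i j. if j = 1 then a $ i else b $ i)"
  have "column 1 A = a" "column 2 A = b" by (simp_all add: column_def A_def vec_eq_iff)
  then have "columns A = {a, b}" by (auto simp: columns_def UNIV_2)
  moreover have "A \<in> stiefel24"
    using o n by (simp add: stiefel24_iff A_def inner_vec_def sum_4)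
  ultimately show ?thesis using that ab B(5) by metis
qed

lemma span_columns_in_gr24:
  assumes "A \<in> stiefel24" shows "span (columns A) \<in> gr24"
proof -
  define a b where "a = column 1 A" and "b = column 2 A"
  have c: "columns A = {a, b}" by (auto simp: columns_def UNIV_2 a_def b_def)
  have o: "a \<bullet> b = 0" "a \<bullet> a = 1" "b \<bullet> b = 1"
    using assms by (simp_all add: stiefel24_iff a_def b_def column_def inner_vec_def sum_4)
  then have "a \<noteq> b" "a \<noteq> 0" "b \<noteq> 0" by auto
  then have "independent {a, b}"
    using o by (intro pairwise_orthogonal_independent) (auto simp: pairwise_def orthogonal_def inner_commute)
  then have "dim {a, b} = 2" using \<open>a \<noteq> b\<close> by (simp add: dim_eq_card_independent)
  then show ?thesis by (simp add: gr24_def c dim_span)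
qed

definition frame :: "(real^4) set \<Rightarrow> real^2^4" where
  "frame P = (SOME A. A \<in> stiefel24 \<and> span (columns A) = P)"

lemma frame:
  assumes "P \<in> gr24" shows "frame P \<in> stiefel24" "span (columns (frame P)) = P"
  using someI_ex[of "\<lambda>A. A \<in> stiefel24 \<and> span (columns A) = P"] gr24_obtains_stiefel[OF assms]
  unfolding frame_def by metis+

definition sd :: "(real^4) set \<Rightarrow> real^3" where "sd P = self_dual (frame P)"
definition asd :: "(real^4) set \<Rightarrow> real^3" where "asd P = anti_self_dual (frame P)"

lemma sd_unit: "P \<in> gr24 \<Longrightarrow> sd P \<bullet> sd P = 1" and asd_unit: "P \<in> gr24 \<Longrightarrow> asd P \<bullet> asd P = 1"
  by (simp_all add: sd_def asd_def self_dual_unit anti_self_dual_unit frame)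

lemma duals_span_columns:
  assumes "A \<in> stiefel24"
  shows "(sd (span (columns A)) = self_dual A \<and> asd (span (columns A)) = anti_self_dual A) \<or>
     (sd (span (columns A)) = - self_dual A \<and> asd (span (columns A)) = - anti_self_dual A)"
proof -
  have P: "span (columns A) \<in> gr24" by (rule span_columns_in_gr24[OF assms])
  obtain C :: "real^2^2" where C: "frame (span (columns A)) = A ** C" "det C = 1 \<or> det C = -1"
    using same_span_factor[OF assms frame(1)[OF P]] frame(2)[OF P] by metis
  show ?thesis unfolding sd_def asd_def C(1) duals_mult using C(2) by auto
qed

text \<open>The choice of \<open>frame\<close> affects the common sign of \<open>sd P\<close> and \<open>asd P\<close>. The following even functions
  do not depend on it; they are \<open>\<xi>\<^sub>+ \<xi>\<^sub>-\<close> and \<open>((\<xi>\<^sub>+ + \<xi>\<^sub>-) / 2)\<^sup>2\<close>.\<close>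

definition xi_prod :: "(real^4) set \<Rightarrow> (real^4) set \<Rightarrow> real" where
  "xi_prod P Q = (sd P \<bullet> sd Q) * (asd P \<bullet> asd Q)"

definition xi_mean_sq :: "(real^4) set \<Rightarrow> (real^4) set \<Rightarrow> real" where
  "xi_mean_sq P Q = ((sd P \<bullet> sd Q + asd P \<bullet> asd Q) / 2)\<^sup>2"

lemma xi_prod_mean_sq_frames:
  assumes A: "A \<in> stiefel24" and B: "B \<in> stiefel24"
  shows "xi_prod (span (columns A)) (span (columns B)) = (self_dual A \<bullet> self_dual B) * (anti_self_dual A \<bullet> anti_self_dual B)"
    and "xi_mean_sq (span (columns A)) (span (columns B)) = ((self_dual A \<bullet> self_dual B + anti_self_dual A \<bullet> anti_self_dual B) / 2)\<^sup>2"
  using duals_span_columns[OF A] duals_span_columns[OF B]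
  by (auto simp: xi_prod_def xi_mean_sq_def power2_eq_square algebra_simps)

lemma xi_prod_mean_sq_gram:
  assumes A: "A \<in> stiefel24" and B: "B \<in> stiefel24"
  shows "(\<Sum>i\<in>UNIV. \<Sum>j\<in>UNIV. ((transpose A ** B) $ i $ j)\<^sup>2) = 1 + xi_prod (span (columns A)) (span (columns B))"
    and "(det (transpose A ** B))\<^sup>2 = xi_mean_sq (span (columns A)) (span (columns B))"
  unfolding xi_prod_mean_sq_frames[OF A B] sum_gram_squares[OF A B] det_gram by simp_all

text \<open>The trace and the determinant of the Gram matrix of M are the sum of the squared entries
  and (det M)^2, so comparing characteristic polynomials fixes the elementary symmetric functions of
  a^2 and b^2.\<close>

lemma singular_values2_iff:
  "singular_values2 M a b \<longleftrightarrow> 0 \<le> b \<and> b \<le> a \<and>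
     a\<^sup>2 + b\<^sup>2 = (\<Sum>i\<in>UNIV. \<Sum>j\<in>UNIV. (M $ i $ j)\<^sup>2) \<and> a\<^sup>2 * b\<^sup>2 = (det M)\<^sup>2"
proof -
  have d: "det (mat t - transpose M ** M) = t\<^sup>2 - (\<Sum>i\<in>UNIV. \<Sum>j\<in>UNIV. (M $ i $ j)\<^sup>2) * t + (det M)\<^sup>2" for t
    unfolding det_2 by (simp add: mat_def matrix_matrix_mult_def transpose_def sum_2 power2_eq_square algebra_simps)
  have "(\<forall>t. t\<^sup>2 - T * t + D = (t - x) * (t - y)) \<longleftrightarrow> x + y = T \<and> x * y = D" for T D x y :: real
  proof
    assume *: "\<forall>t. t\<^sup>2 - T * t + D = (t - x) * (t - y)"
    from *[rule_format, of 0] *[rule_format, of 1] show "x + y = T \<and> x * y = D"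
      by (simp add: algebra_simps)
  next
    assume "x + y = T \<and> x * y = D"
    then show "\<forall>t. t\<^sup>2 - T * t + D = (t - x) * (t - y)" by (auto simp: power2_eq_square algebra_simps)
  qed
  then show ?thesis unfolding singular_values2_def d by simp
qed

lemma is_principal_angles_iff:
  assumes P: "P \<in> gr24" and Q: "Q \<in> gr24"
  shows "is_principal_angles P Q \<theta>1 \<theta>2 \<longleftrightarrow> 0 \<le> \<theta>1 \<and> \<theta>1 \<le> \<theta>2 \<and> \<theta>2 \<le> pi / 2 \<and>
     (cos \<theta>1)\<^sup>2 + (cos \<theta>2)\<^sup>2 = 1 + xi_prod P Q \<and> (cos \<theta>1)\<^sup>2 * (cos \<theta>2)\<^sup>2 = xi_mean_sq P Q"
  (is "_ \<longleftrightarrow> ?R")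
proof
  assume "is_principal_angles P Q \<theta>1 \<theta>2"
  then show ?R
    unfolding is_principal_angles_def singular_values2_iff using xi_prod_mean_sq_gram by auto
next
  assume R: ?R
  then have "0 \<le> cos \<theta>2" by (intro cos_ge_zero) auto
  moreover have "cos \<theta>2 \<le> cos \<theta>1" using R by (intro cos_monotone_0_pi_le) auto
  ultimately have "singular_values2 (transpose (frame P) ** frame Q) (cos \<theta>1) (cos \<theta>2)"
    using R xi_prod_mean_sq_gram[OF frame(1)[OF P] frame(1)[OF Q]]
    by (simp add: singular_values2_iff frame(2)[OF P] frame(2)[OF Q])
  then have "\<exists>A\<in>stiefel24. \<exists>B\<in>stiefel24. span (columns A) = P \<and> span (columns B) = Q \<and>
      singular_values2 (transpose A ** B) (cos \<theta>1) (cos \<theta>2)"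
    using frame[OF P] frame[OF Q] by blast
  then show "is_principal_angles P Q \<theta>1 \<theta>2"
    using R by (simp add: is_principal_angles_def)
qed

lemma is_principal_angles_unique:
  assumes P: "P \<in> gr24" and Q: "Q \<in> gr24"
    and 1: "is_principal_angles P Q a b" and 2: "is_principal_angles P Q c d"
  shows "a = c \<and> b = d"
proof -
  define A B C D where "A = (cos a)\<^sup>2" and "B = (cos b)\<^sup>2" and "C = (cos c)\<^sup>2" and "D = (cos d)\<^sup>2"
  note 1 = 1[unfolded is_principal_angles_iff[OF P Q]] and 2 = 2[unfolded is_principal_angles_iff[OF P Q]]
  have nn: "0 \<le> cos a" "0 \<le> cos b" "0 \<le> cos c" "0 \<le> cos d"
    using 1 2 by (intro cos_ge_zero; linarith)+
  have "cos b \<le> cos a" "cos d \<le> cos c" using 1 2 by (intro cos_monotone_0_pi_le; linarith)+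
  then have le: "B \<le> A" "D \<le> C" using nn by (auto simp: A_def B_def C_def D_def intro: power_mono)
  have s: "A + B = C + D" "A * B = C * D" using 1 2 by (auto simp: A_def B_def C_def D_def)
  have "(A - C) * (A - D) = A * A - A * (C + D) + C * D" by (simp add: algebra_simps)
  also have "\<dots> = 0" unfolding s[symmetric] by (simp add: algebra_simps)
  finally have "(A - C) * (A - D) = 0" .
  then have "A = C \<and> B = D" using s(1) le by auto
  then have "cos a = cos c" "cos b = cos d" using nn by (auto simp: A_def B_def C_def D_def)
  then show ?thesis using 1 2 by (auto intro: cos_inj_pi)
qed

text \<open>If \<open>x = cos \<alpha>\<close> and \<open>y = cos \<beta>\<close> with \<open>x + y \<ge> 0\<close>, the principal angles are
  \<open>\<bar>\<alpha> - \<beta>\<bar> / 2\<close> and \<open>(\<alpha> + \<beta>) / 2\<close>.\<close>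

lemma xi_eq_aux:
  assumes P: "P \<in> gr24" and Q: "Q \<in> gr24"
    and xy: "\<bar>x\<bar> \<le> 1" "\<bar>y\<bar> \<le> 1" "x + y \<ge> 0" "xi_prod P Q = x * y" "xi_mean_sq P Q = ((x + y) / 2)\<^sup>2"
  shows "xi_plus P Q = min x y \<and> xi_minus P Q = max x y \<and> chordal_dist P Q = sqrt (1 - x * y)"
proof -
  define \<alpha> \<beta> where "\<alpha> = arccos x" and "\<beta> = arccos y"
  have c: "cos \<alpha> = x" "cos \<beta> = y" using xy by (auto simp: \<alpha>_def \<beta>_def intro: cos_arccos_abs)
  have r: "0 \<le> \<alpha>" "\<alpha> \<le> pi" "0 \<le> \<beta>" "\<beta> \<le> pi"
    using xy by (auto simp: \<alpha>_def \<beta>_def abs_le_iff intro: arccos_lbound arccos_ubound)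
  define a b where "a = \<bar>\<alpha> - \<beta>\<bar> / 2" and "b = (\<alpha> + \<beta>) / 2"
  \<comment> \<open>The hypothesis x + y \<ge> 0 is used here: it keeps (\<alpha> + \<beta>) / 2 at
    most pi / 2, as required of a principal angle.\<close>
  have "\<alpha> \<le> pi - \<beta>"
  proof (rule ccontr)
    assume "\<not> \<alpha> \<le> pi - \<beta>"
    then have "cos \<alpha> < cos (pi - \<beta>)" using r by (intro cos_monotone_0_pi) auto
    then show False using xy(3) c by simp
  qed
  then have ab: "0 \<le> a" "a \<le> b" "b \<le> pi / 2" using r by (auto simp: a_def b_def)
  have ca: "cos a = cos ((\<alpha> - \<beta>) / 2)" 
  proof -
    have "a = (\<alpha> - \<beta>) / 2 \<or> a = - ((\<alpha> - \<beta>) / 2)" by (auto simp: a_def abs_if field_simps)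
    then show ?thesis by (metis cos_minus)
  qed
  have sum: "(cos a)\<^sup>2 + (cos b)\<^sup>2 = 1 + x * y"
  proof -
    have half: "(cos (z / 2))\<^sup>2 = (1 + cos z) / 2" for z :: real using cos_double_cos[of "z / 2"] by simp
    have "(cos a)\<^sup>2 = (1 + cos (\<alpha> - \<beta>)) / 2" unfolding ca by (rule half)
    moreover have "(cos b)\<^sup>2 = (1 + cos (\<alpha> + \<beta>)) / 2" unfolding b_def by (rule half)
    ultimately show ?thesis by (simp add: cos_diff cos_add c field_simps)
  qed
  have pr: "cos a * cos b = (x + y) / 2"
    unfolding ca b_def cos_times_cos by (simp add: add_divide_distrib[symmetric] diff_divide_distrib[symmetric] c)
  have prod: "(cos a)\<^sup>2 * (cos b)\<^sup>2 = ((x + y) / 2)\<^sup>2" unfolding power_mult_distrib[symmetric] pr ..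
  have pa: "is_principal_angles P Q a b"
    unfolding is_principal_angles_iff[OF P Q] xy(4,5) using ab sum prod by simp
  have "principal_angles P Q = (a, b)"
    unfolding principal_angles_def
  proof (rule the_equality)
    show "is_principal_angles P Q (fst (a, b)) (snd (a, b))" using pa by simp
    fix \<theta> assume "is_principal_angles P Q (fst \<theta>) (snd \<theta>)"
    from is_principal_angles_unique[OF P Q pa this] show "\<theta> = (a, b)" by (simp add: prod_eq_iff)
  qed
  then have *: "xi_plus P Q = cos (a + b)" "xi_minus P Q = cos (a - b)" "chordal_dist P Q = sqrt ((sin a)\<^sup>2 + (sin b)\<^sup>2)"
    by (simp_all add: xi_plus_def xi_minus_def chordal_dist_def)
  have "(sin a)\<^sup>2 + (sin b)\<^sup>2 = 1 - x * y" using sum by (simp add: sin_squared_eq)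
  moreover have "cos (a + b) = min x y \<and> cos (a - b) = max x y"
  proof (cases "\<alpha> \<ge> \<beta>")
    case True
    then have "x \<le> y" using r c cos_monotone_0_pi_le[of \<beta> \<alpha>] by auto
    moreover have "a + b = \<alpha>" "a - b = - \<beta>" using True by (auto simp: a_def b_def field_simps)
    ultimately show ?thesis by (simp add: c)
  next
    case False
    then have "y \<le> x" using r c cos_monotone_0_pi_le[of \<alpha> \<beta>] by auto
    moreover have "a + b = \<beta>" "a - b = - \<alpha>" using False by (auto simp: a_def b_def field_simps)
    ultimately show ?thesis by (simp add: c)
  qed
  ultimately show ?thesis using * by simp
qed

text \<open>The two inner products of the dual pairs may be negated together without changing the
  invariants, so their sum may be taken nonnegative. The smaller one is then \<xi>+ and the larger
  one \<xi>-.\<close>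

lemma xi_eq:
  assumes P: "P \<in> gr24" and Q: "Q \<in> gr24"
  obtains x y where "\<bar>x\<bar> \<le> 1" "\<bar>y\<bar> \<le> 1" "xi_prod P Q = x * y" "xi_mean_sq P Q = ((x + y) / 2)\<^sup>2"
    "xi_plus P Q = x" "xi_minus P Q = y" "chordal_dist P Q = sqrt (1 - xi_prod P Q)" "x \<le> y" "0 \<le> x + y"
proof -
  define x y where "x = sd P \<bullet> sd Q" and "y = asd P \<bullet> asd Q"
  have b: "\<bar>x\<bar> \<le> 1" "\<bar>y\<bar> \<le> 1"
    unfolding x_def y_def using P Q by (auto intro!: unit_inner_bound sd_unit asd_unit)
  have e: "xi_prod P Q = x * y" "xi_mean_sq P Q = ((x + y) / 2)\<^sup>2"
    by (simp_all add: xi_prod_def xi_mean_sq_def x_def y_def)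
  have "\<exists>x y. \<bar>x\<bar> \<le> 1 \<and> \<bar>y\<bar> \<le> 1 \<and> x + y \<ge> 0 \<and> xi_prod P Q = x * y \<and> xi_mean_sq P Q = ((x + y) / 2)\<^sup>2"
  proof (cases "x + y \<ge> 0")
    case False
    then show ?thesis using b e by (intro exI[of _ "-x"] exI[of _ "-y"]) (auto simp: power2_eq_square algebra_simps)
  qed (use b e in blast)
  then obtain x y where xy: "\<bar>x\<bar> \<le> 1" "\<bar>y\<bar> \<le> 1" "x + y \<ge> 0" "xi_prod P Q = x * y" "xi_mean_sq P Q = ((x + y) / 2)\<^sup>2"
    by blast
  note r = xi_eq_aux[OF P Q xy]
  show ?thesis
    by (rule that[of "min x y" "max x y"]) (use xy r in \<open>auto simp: min_def max_def algebra_simps\<close>)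
qed

text \<open>\<xi>+ and \<xi>- are the roots of t^2 - 2 sqrt(m) t + p, where m is
  \<open>xi_mean_sq\<close> and p is \<open>xi_prod\<close>. This writes them as Borel functions of
  invariants that are measurable in the planes.\<close>

lemma xi_formula:
  assumes P: "P \<in> gr24" and Q: "Q \<in> gr24"
  shows "xi_plus P Q = sqrt (xi_mean_sq P Q) - sqrt (xi_mean_sq P Q - xi_prod P Q)"
    and "xi_minus P Q = sqrt (xi_mean_sq P Q) + sqrt (xi_mean_sq P Q - xi_prod P Q)"
    and "chordal_dist P Q = sqrt (1 - xi_prod P Q)"
    and "\<bar>xi_plus P Q\<bar> \<le> 1" "\<bar>xi_minus P Q\<bar> \<le> 1" "\<bar>xi_prod P Q\<bar> \<le> 1"
proof -
  obtain x y where xy: "\<bar>x\<bar> \<le> 1" "\<bar>y\<bar> \<le> 1" "xi_prod P Q = x * y" "xi_mean_sq P Q = ((x + y) / 2)\<^sup>2"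
    "xi_plus P Q = x" "xi_minus P Q = y" "chordal_dist P Q = sqrt (1 - xi_prod P Q)" "x \<le> y" "0 \<le> x + y"
    using xi_eq[OF P Q] by blast
  have "xi_mean_sq P Q - xi_prod P Q = ((y - x) / 2)\<^sup>2"
    by (simp add: xy(3,4) power2_eq_square field_simps)
  then have sq: "sqrt (xi_mean_sq P Q - xi_prod P Q) = (y - x) / 2" "sqrt (xi_mean_sq P Q) = (x + y) / 2"
    using xy by (simp_all add: real_sqrt_divide)
  show "xi_plus P Q = sqrt (xi_mean_sq P Q) - sqrt (xi_mean_sq P Q - xi_prod P Q)"
    "xi_minus P Q = sqrt (xi_mean_sq P Q) + sqrt (xi_mean_sq P Q - xi_prod P Q)"
    unfolding sq xy(5,6) by (simp_all add: field_simps)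
  show "chordal_dist P Q = sqrt (1 - xi_prod P Q)" "\<bar>xi_plus P Q\<bar> \<le> 1" "\<bar>xi_minus P Q\<bar> \<le> 1"
    using xy by auto
  show "\<bar>xi_prod P Q\<bar> \<le> 1" unfolding xy(3) abs_mult using xy by (intro mult_le_one) auto
qed

lemma xi_self:
  assumes "P \<in> gr24" shows "xi_plus P P = 1" "xi_minus P P = 1"
  unfolding xi_formula[OF assms assms] by (simp_all add: xi_mean_sq_def xi_prod_def sd_unit asd_unit assms)

section \<open>Borel measurability and the action of \<open>O(4)\<close>\<close>

lemma open_sets_gr24_subset: "{U. openin gr24_topology U} \<subseteq> Pow gr24"
  by (auto simp: openin_gr24_topology)

lemma space_gr24_borel [simp]: "space gr24_borel = gr24"
  unfolding gr24_borel_def using open_sets_gr24_subset by (rule space_measure_of)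

lemma sets_gr24_borel: "sets gr24_borel = sigma_sets gr24 {U. openin gr24_topology U}"
  unfolding gr24_borel_def using open_sets_gr24_subset by (rule sets_measure_of)

lemma borel_measurable_gr24I:
  fixes g :: "(real^4) set \<Rightarrow> real"
  assumes "continuous_on stiefel24 (\<lambda>A. g (span (columns A)))"
  shows "g \<in> borel_measurable gr24_borel"
proof (rule borel_measurableI)
  fix S :: "real set" assume "open S"
  have "openin (top_of_set stiefel24) (stiefel24 \<inter> (\<lambda>A. g (span (columns A))) -` S)"
    using continuous_openin_preimage_gen[OF assms \<open>open S\<close>] .
  also have "stiefel24 \<inter> (\<lambda>A. g (span (columns A))) -` S = {A \<in> stiefel24. span (columns A) \<in> g -` S \<inter> gr24}"
    using span_columns_in_gr24 by auto
  finally have "openin gr24_topology (g -` S \<inter> gr24)" by (simp add: openin_gr24_topology)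
  then show "g -` S \<inter> space gr24_borel \<in> sets gr24_borel"
    by (simp add: sets_gr24_borel)
qed

lemma stiefel24_orthogonal_mult:
  assumes U: "orthogonal_matrix (U :: real^4^4)" and A: "A \<in> stiefel24"
  shows "U ** A \<in> stiefel24" and "span (columns (U ** A)) = (*v) U ` span (columns A)"
proof -
  have "transpose (U ** A) ** (U ** A) = transpose A ** ((transpose U ** U) ** A)"
    by (simp add: matrix_transpose_mul matrix_mul_assoc)
  also have "\<dots> = mat 1" using U A by (simp add: orthogonal_matrix_def stiefel24_def)
  finally show "U ** A \<in> stiefel24" by (simp add: stiefel24_def)
  show "span (columns (U ** A)) = (*v) U ` span (columns A)"
    unfolding span_columns_eq by (auto simp: matrix_vector_mul_assoc image_image)
qed

lemma orthogonal_image_in_gr24: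
  assumes U: "orthogonal_matrix (U :: real^4^4)" and P: "P \<in> gr24" shows "(*v) U ` P \<in> gr24"
  using stiefel24_orthogonal_mult[OF U frame(1)[OF P]] frame(2)[OF P] span_columns_in_gr24 by metis

lemma measurable_orthogonal_image:
  assumes U: "orthogonal_matrix (U :: real^4^4)"
  shows "(\<lambda>P. (*v) U ` P) \<in> measurable gr24_borel gr24_borel"
proof (rule measurable_sigma_sets[OF sets_gr24_borel open_sets_gr24_subset])
  show "(\<lambda>P. (*v) U ` P) \<in> space gr24_borel \<rightarrow> gr24" using orthogonal_image_in_gr24[OF U] by auto
  fix V assume "V \<in> {U. openin gr24_topology U}"
  then have V: "openin (top_of_set stiefel24) {A \<in> stiefel24. span (columns A) \<in> V}"
    by (simp add: openin_gr24_topology)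
  have "continuous_on stiefel24 (\<lambda>A :: real^2^4. U ** A)"
    unfolding matrix_matrix_mult_def by (intro continuous_on_vec_lambda continuous_intros)
  then have "openin (top_of_set stiefel24) (stiefel24 \<inter> (\<lambda>A. U ** A) -` {A \<in> stiefel24. span (columns A) \<in> V})"
    using V stiefel24_orthogonal_mult(1)[OF U] by (intro continuous_openin_preimage[where T=stiefel24]) auto
  also have "stiefel24 \<inter> (\<lambda>A. U ** A) -` {A \<in> stiefel24. span (columns A) \<in> V}
     = {A \<in> stiefel24. span (columns A) \<in> (\<lambda>P. (*v) U ` P) -` V \<inter> gr24}"
    using stiefel24_orthogonal_mult[OF U] span_columns_in_gr24 by auto
  finally have "openin gr24_topology ((\<lambda>P. (*v) U ` P) -` V \<inter> gr24)" by (simp add: openin_gr24_topology)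
  then show "(\<lambda>P. (*v) U ` P) -` V \<inter> space gr24_borel \<in> sets gr24_borel"
    by (simp add: sets_gr24_borel)
qed

text \<open>Both invariants are functions of the Gram matrix of two frames, which is unchanged when
  the same orthogonal matrix acts on both frames.\<close>

lemma xi_orthogonal_image:
  assumes U: "orthogonal_matrix (U :: real^4^4)" and P: "P \<in> gr24" and Q: "Q \<in> gr24"
  shows "xi_prod ((*v) U ` P) ((*v) U ` Q) = xi_prod P Q"
    and "xi_mean_sq ((*v) U ` P) ((*v) U ` Q) = xi_mean_sq P Q"
proof -
  let ?A = "frame P" and ?B = "frame Q"
  note A = frame[OF P] and B = frame[OF Q]
  note UA = stiefel24_orthogonal_mult[OF U A(1), unfolded A(2)] and UB = stiefel24_orthogonal_mult[OF U B(1), unfolded B(2)]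
  have "transpose (U ** ?A) ** (U ** ?B) = transpose ?A ** ((transpose U ** U) ** ?B)"
    by (simp add: matrix_transpose_mul matrix_mul_assoc)
  then have g: "transpose (U ** ?A) ** (U ** ?B) = transpose ?A ** ?B" using U by (simp add: orthogonal_matrix_def)
  show "xi_prod ((*v) U ` P) ((*v) U ` Q) = xi_prod P Q" "xi_mean_sq ((*v) U ` P) ((*v) U ` Q) = xi_mean_sq P Q"
    using xi_prod_mean_sq_gram[OF UA(1) UB(1), unfolded g UA(2) UB(2)]
      xi_prod_mean_sq_gram[OF A(1) B(1), unfolded A(2) B(2)] by auto
qed

text \<open>The frame is an arbitrary choice, but it affects the dual pair only by a common sign. An
  even function therefore equals a continuous function of any frame and descends to the
  quotient.\<close>

lemma measurable_duals:
  assumes "continuous_on UNIV (\<lambda>z. F (fst z) (snd z) :: real)" and even: "\<And>u v. F (- u) (- v) = F u v"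
  shows "(\<lambda>P. F (sd P) (asd P)) \<in> borel_measurable gr24_borel"
proof (rule borel_measurable_gr24I)
  have p: "continuous_on stiefel24 (\<lambda>A. pluecker A i j)" for i j
    unfolding pluecker_def by (intro continuous_intros)
  have c: "continuous_on stiefel24 (\<lambda>A. self_dual A $ i)" "continuous_on stiefel24 (\<lambda>A. anti_self_dual A $ i)" for i
    using exhaust_3[of i] by (elim disjE; simp only: self_dual_nth; intro continuous_on_add continuous_on_diff p)+
  have s: "continuous_on stiefel24 self_dual" "continuous_on stiefel24 anti_self_dual"
  proof -
    have "continuous_on stiefel24 (\<lambda>A. \<chi> i. self_dual A $ i)" by (rule continuous_on_vec_lambda) (rule c)
    then show "continuous_on stiefel24 self_dual" by (simp only: vec_lambda_eta)
    have "continuous_on stiefel24 (\<lambda>A. \<chi> i. anti_self_dual A $ i)" by (rule continuous_on_vec_lambda) (rule c)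
    then show "continuous_on stiefel24 anti_self_dual" by (simp only: vec_lambda_eta)
  qed
  have "continuous_on stiefel24 (\<lambda>A. F (self_dual A) (anti_self_dual A))"
    using continuous_on_compose2[OF assms(1) continuous_on_Pair[OF s]] by simp
  moreover have "F (self_dual A) (anti_self_dual A) = F (sd (span (columns A))) (asd (span (columns A)))" if "A \<in> stiefel24" for A
    using duals_span_columns[OF that] even by auto
  ultimately show "continuous_on stiefel24 (\<lambda>A. F (sd (span (columns A))) (asd (span (columns A))))"
    by (simp cong: continuous_on_cong)
qed

section \<open>Uniform points of the sphere\<close>

definition vec_of_triple :: "(real \<times> real) \<times> real \<Rightarrow> real^3" where
  "vec_of_triple p = vector [fst (fst p), snd (fst p), snd p]"

lemma vec_of_triple_nth [simp]:
  "vec_of_triple p $ 1 = fst (fst p)" "vec_of_triple p $ 2 = snd (fst p)" "vec_of_triple p $ 3 = snd p"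
  by (simp_all add: vec_of_triple_def)

lemma vec_of_triple_measurable [measurable]: "vec_of_triple \<in> borel_measurable borel"
proof (rule borel_measurable_continuous_onI)
  have "continuous_on UNIV (\<lambda>p. vec_of_triple p $ i)" for i
    using exhaust_3[of i] by (elim disjE; simp only: vec_of_triple_nth; intro continuous_intros)
  then have "continuous_on UNIV (\<lambda>p. \<chi> i. vec_of_triple p $ i)" by (rule continuous_on_vec_lambda)
  then show "continuous_on UNIV vec_of_triple" by (simp only: vec_lambda_eta)
qed

text \<open>Presents Lebesgue measure on \<open>real^3\<close> as an iterated product, so that
  volumes can be computed from horizontal slices.\<close>

lemma lborel_vec_of_triple: "lborel = distr lborel borel vec_of_triple"
proof (rule lborel_eqI)
  fix l u :: "real^3" assume le: "\<And>b. b \<in> Basis \<Longrightarrow> l \<bullet> b \<le> u \<bullet> b"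
  have le': "l $ i \<le> u $ i" for i using le[of "axis i 1"] by (simp add: inner_axis)
  have "vec_of_triple -` box l u = ({l$1<..<u$1} \<times> {l$2<..<u$2}) \<times> {l$3<..<u$3}"
    by (auto simp: vec_of_triple_def mem_box_cart forall_3)
  then have "emeasure (distr lborel borel vec_of_triple) (box l u)
      = emeasure lborel (({l$1<..<u$1} \<times> {l$2<..<u$2}) \<times> {l$3<..<u$3})"
    by (subst emeasure_distr) auto
  also have "\<dots> = emeasure ((lborel \<Otimes>\<^sub>M lborel) \<Otimes>\<^sub>M lborel) (({l$1<..<u$1} \<times> {l$2<..<u$2}) \<times> {l$3<..<u$3})"
    by (simp only: lborel_prod)
  also have "\<dots> = emeasure lborel {l$1<..<u$1} * emeasure lborel {l$2<..<u$2} * emeasure lborel {l$3<..<u$3}"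
    by (subst lborel.emeasure_pair_measure_Times; (subst lborel.emeasure_pair_measure_Times)?) auto
  also have "\<dots> = ennreal ((u$1 - l$1) * (u$2 - l$2) * (u$3 - l$3))"
    using le' by (simp add: ennreal_mult)
  also have "(u$1 - l$1) * (u$2 - l$2) * (u$3 - l$3) = (\<Prod>b\<in>Basis. (u - l) \<bullet> b)"
  proof -
    have B: "Basis = (\<lambda>i. axis i 1 :: real^3) ` UNIV" by (auto simp: Basis_vec_def)
    have "inj (\<lambda>i::3. axis i 1 :: real^3)" by (auto simp: inj_on_def axis_eq_axis)
    have p3: "(\<Prod>i\<in>(UNIV :: 3 set). g i) = g 1 * g 2 * g 3" for g :: "3 \<Rightarrow> real"
      unfolding UNIV_3 by (simp add: ac_simps)
    have "(\<Prod>b\<in>Basis. (u - l) \<bullet> b) = (\<Prod>i\<in>(UNIV :: 3 set). (u - l) \<bullet> axis i 1)"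
      unfolding B using \<open>inj _\<close> by (rule prod.reindex_cong) simp_all
    then show ?thesis unfolding p3 by (simp add: inner_axis)
  qed
  finally show "emeasure (distr lborel borel vec_of_triple) (box l u) = ennreal (\<Prod>b\<in>Basis. (u - l) \<bullet> b)" .
qed simp

text \<open>The cone over a spherical cap, cut off at the unit sphere. A uniform point of the sphere
  is realised as the direction of a uniform point of the ball, so cap probabilities are ratios of
  such volumes.\<close>

definition ball_sector :: "real^3 \<Rightarrow> real \<Rightarrow> (real^3) set" where
  "ball_sector w c = {x \<in> ball 0 1. c * norm x < x \<bullet> w}"

lemma ball_sector_borel [measurable]: "ball_sector w c \<in> sets borel"
  unfolding ball_sector_def by measurable

text \<open>The slice at height z is a disk of squared radius min (1 - z^2) (a z^2), where a = 1/c^2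
  - 1 is the squared slope of the cone. Cone and sphere meet at z = c, where the minimum changes
  branch.\<close>

lemma emeasure_ball_sector_axis:
  assumes c: "0 < c" "c < 1"
  shows "emeasure lborel (ball_sector (axis 3 1) c) = ennreal (2 / 3 * pi * (1 - c))"
proof -
  define a where "a = 1 / c\<^sup>2 - 1"
  have a: "a > 0" using c by (simp add: a_def power_less_one_iff)
  define S where "S = {p :: (real \<times> real) \<times> real. vec_of_triple p \<in> ball_sector (axis 3 1) c}"
  have nrm: "norm (vec_of_triple p) = sqrt ((norm (fst p))\<^sup>2 + (snd p)\<^sup>2)" for p
    by (simp add: norm_eq_sqrt_inner inner_vec_def sum_3 vec_of_triple_def inner_prod_def power2_eq_square)
  have S_iff: "(q, z) \<in> S \<longleftrightarrow> 0 < z \<and> q \<in> ball 0 (sqrt (min (1 - z\<^sup>2) (a * z\<^sup>2)))" for q z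
  proof -
    have "(q, z) \<in> S \<longleftrightarrow> sqrt ((norm q)\<^sup>2 + z\<^sup>2) < 1 \<and> c * sqrt ((norm q)\<^sup>2 + z\<^sup>2) < z"
      by (simp add: S_def ball_sector_def dist_norm norm_minus_commute nrm inner_axis)
    also have "\<dots> \<longleftrightarrow> 0 < z \<and> (norm q)\<^sup>2 + z\<^sup>2 < 1 \<and> c\<^sup>2 * ((norm q)\<^sup>2 + z\<^sup>2) < z\<^sup>2"
    proof -
      have "c * sqrt ((norm q)\<^sup>2 + z\<^sup>2) < z \<longleftrightarrow> 0 < z \<and> c\<^sup>2 * ((norm q)\<^sup>2 + z\<^sup>2) < z\<^sup>2"
      proof (cases "0 < z")
        case True
        have "c * sqrt ((norm q)\<^sup>2 + z\<^sup>2) < z \<longleftrightarrow> (c * sqrt ((norm q)\<^sup>2 + z\<^sup>2))\<^sup>2 < z\<^sup>2"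
          using True c by (intro iffI power_strict_mono) (auto intro: power2_less_imp_less)
        then show ?thesis using True by (simp add: power_mult_distrib)
      next
        case False
        moreover have "0 \<le> c * sqrt ((norm q)\<^sup>2 + z\<^sup>2)" using c by simp
        ultimately show ?thesis by linarith
      qed
      then show ?thesis by auto
    qed
    also have "c\<^sup>2 * ((norm q)\<^sup>2 + z\<^sup>2) < z\<^sup>2 \<longleftrightarrow> (norm q)\<^sup>2 < a * z\<^sup>2"
      using c by (simp add: a_def field_simps)
    also have "(norm q)\<^sup>2 + z\<^sup>2 < 1 \<longleftrightarrow> (norm q)\<^sup>2 < 1 - z\<^sup>2" by linarith
    finally have "(q, z) \<in> S \<longleftrightarrow> 0 < z \<and> (norm q)\<^sup>2 < min (1 - z\<^sup>2) (a * z\<^sup>2)" by auto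
    also have "(norm q)\<^sup>2 < min (1 - z\<^sup>2) (a * z\<^sup>2) \<longleftrightarrow> norm q < sqrt (min (1 - z\<^sup>2) (a * z\<^sup>2))"
      using real_less_rsqrt real_sqrt_less_iff[of "(norm q)\<^sup>2"] by simp
    finally show ?thesis by simp
  qed
  have [measurable]: "S \<in> sets borel"
  proof -
    have "S = vec_of_triple -` ball_sector (axis 3 1) c \<inter> space borel" by (auto simp: S_def)
    then show ?thesis using measurable_sets[OF vec_of_triple_measurable ball_sector_borel] by simp
  qed
  have "emeasure lborel (ball_sector (axis 3 1) c) = emeasure lborel S"
    by (subst lborel_vec_of_triple, subst emeasure_distr) (auto simp: S_def vimage_def)
  also have "\<dots> = emeasure (lborel \<Otimes>\<^sub>M lborel) S" by (simp only: lborel_prod)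
  also have "\<dots> = (\<integral>\<^sup>+z. emeasure lborel ((\<lambda>q. (q, z)) -` S) \<partial>lborel)"
    using \<open>S \<in> sets borel\<close> by (intro lborel_pair.emeasure_pair_measure_alt2) (simp only: lborel_prod sets_lborel)
  also have "\<dots> = (\<integral>\<^sup>+z. ennreal (pi * min (1 - z\<^sup>2) (a * z\<^sup>2)) * indicator {0..1} z \<partial>lborel)"
  proof (rule nn_integral_cong)
    fix z :: real
    define m where "m = min (1 - z\<^sup>2) (a * z\<^sup>2)"
    show "emeasure lborel ((\<lambda>q. (q, z)) -` S) = ennreal (pi * min (1 - z\<^sup>2) (a * z\<^sup>2)) * indicator {0..1} z"
    proof (cases "0 < z \<and> m > 0")
      case True
      then have "z\<^sup>2 < 1" unfolding m_def by linarith
      then have "\<bar>z\<bar> < 1" by (simp only: abs_square_less_1)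
      then have "z < 1" by linarith
      have "(\<lambda>q. (q, z)) -` S = ball 0 (sqrt m)" using True by (auto simp: S_iff m_def)
      moreover have "emeasure lborel (ball (0::real\<times>real) (sqrt m)) = ennreal (unit_ball_vol (real DIM(real\<times>real)) * sqrt m ^ DIM(real\<times>real))"
        using True by (intro emeasure_ball) auto
      ultimately show ?thesis using True \<open>z < 1\<close> by (simp add: unit_ball_vol_2 m_def[symmetric])
    next
      case False
      have "m > 0 \<and> 0 < z" if "(q, z) \<in> S" for q
      proof -
        have "0 \<le> norm q" "norm q < sqrt m" "0 < z" using that by (auto simp: S_iff m_def)
        then have "0 < sqrt m" by linarith
        then show ?thesis using \<open>0 < z\<close> by simp
      qed
      then have "(\<lambda>q. (q, z)) -` S = {}" using False by auto
      moreover have "pi * m \<le> 0 \<or> z \<notin> {0..1} \<or> z = 0" using False by (auto simp: mult_le_0_iff)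
      moreover have "z = 0 \<Longrightarrow> m = 0" by (simp add: m_def)
      ultimately show ?thesis by (auto simp: m_def[symmetric] ennreal_neg)
    qed
  qed
  also have "\<dots> = ennreal (2 / 3 * pi * (1 - c))"
  proof (rule nn_integral_has_integral_lebesgue')
    fix z :: real assume z: "z \<in> {0..1}"
    have "z\<^sup>2 \<le> 1" using z by (simp add: power_le_one)
    then show "0 \<le> pi * min (1 - z\<^sup>2) (a * z\<^sup>2)" using a by auto
  next
    have mn: "min (1 - z\<^sup>2) (a * z\<^sup>2) = (if z \<le> c then a * z\<^sup>2 else 1 - z\<^sup>2)" if "0 \<le> z" for z
    proof -
      have "a * z\<^sup>2 \<le> 1 - z\<^sup>2 \<longleftrightarrow> z\<^sup>2 \<le> c\<^sup>2" using c by (simp add: a_def field_simps)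
      also have "\<dots> \<longleftrightarrow> z \<le> c" using that c by (simp add: power2_le_iff_abs_le)
      finally show ?thesis by (auto simp: min_def)
    qed
    have "((\<lambda>z. a * z\<^sup>2) has_integral (a * c ^ 3 / 3 - a * 0 ^ 3 / 3)) {0..c}"
      using c by (intro fundamental_theorem_of_calculus)
        (auto intro!: derivative_eq_intros simp flip: has_real_derivative_iff_has_vector_derivative)
    then have "((\<lambda>z. a * z\<^sup>2) has_integral (a * c ^ 3 / 3)) {0..c}" by simp
    then have 1: "((\<lambda>z. min (1 - z\<^sup>2) (a * z\<^sup>2)) has_integral (a * c ^ 3 / 3)) {0..c}"
      by (rule has_integral_eq[rotated]) (auto simp: mn)
    have "((\<lambda>z. 1 - z\<^sup>2) has_integral ((1 - 1 ^ 3 / 3) - (c - c ^ 3 / 3))) {c..1}"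
      using c by (intro fundamental_theorem_of_calculus)
        (auto intro!: derivative_eq_intros simp flip: has_real_derivative_iff_has_vector_derivative)
    then have 2: "((\<lambda>z. min (1 - z\<^sup>2) (a * z\<^sup>2)) has_integral ((1 - 1 ^ 3 / 3) - (c - c ^ 3 / 3))) {c..1}"
    proof (rule has_integral_spike_finite[of "{c}", rotated 2])
      fix x assume "x \<in> {c..1} - {c}"
      then show "min (1 - x\<^sup>2) (a * x\<^sup>2) = 1 - x\<^sup>2" using c by (auto simp: mn)
    qed simp
    have "((\<lambda>z. min (1 - z\<^sup>2) (a * z\<^sup>2)) has_integral (a * c ^ 3 / 3 + ((1 - 1 ^ 3 / 3) - (c - c ^ 3 / 3)))) {0..1}"
      using c by (intro has_integral_combine[OF _ _ 1 2]) auto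
    also have "a * c ^ 3 / 3 + ((1 - 1 ^ 3 / 3) - (c - c ^ 3 / 3)) = 2 / 3 * (1 - c)"
      using c by (simp add: a_def field_simps power2_eq_square power3_eq_cube)
    finally show "((\<lambda>z. pi * min (1 - z\<^sup>2) (a * z\<^sup>2)) has_integral (2 / 3 * pi * (1 - c))) {0..1}"
      by (drule_tac c=pi in has_integral_mult_right) (simp add: mult_ac)
  qed
  finally show ?thesis .
qed

lemma emeasure_ball_sector:
  assumes w: "norm w = 1" and c: "0 < c" "c < 1"
  shows "emeasure lborel (ball_sector w c) = ennreal (2 / 3 * pi * (1 - c))"
proof -
  obtain f where f: "orthogonal_transformation f" "f (axis 3 1 :: real^3) = w"
    using orthogonal_transformation_exists[of "axis 3 1 :: real^3" w] w by auto
  have bd: "ball_sector v c \<in> lmeasurable" for v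
    by (rule bounded_set_imp_lmeasurable) (auto simp: ball_sector_def intro: bounded_subset[OF bounded_ball[of 0 1]])
  have "f ` ball_sector (axis 3 1) c = ball_sector w c"
  proof
    show "f ` ball_sector (axis 3 1) c \<subseteq> ball_sector w c"
      using f by (auto simp: ball_sector_def orthogonal_transformation_norm dist_norm orthogonal_transformation_def)
    show "ball_sector w c \<subseteq> f ` ball_sector (axis 3 1) c"
    proof
      fix y assume y: "y \<in> ball_sector w c"
      obtain x where x: "y = f x" using orthogonal_transformation_surj[OF f(1)] by (metis surjD)
      have "x \<bullet> axis 3 1 = y \<bullet> w" using f x by (metis orthogonal_transformation_def)
      then have "x \<in> ball_sector (axis 3 1) c"
        using y by (auto simp: ball_sector_def x orthogonal_transformation_norm[OF f(1)] dist_norm)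
      then show "y \<in> f ` ball_sector (axis 3 1) c" using x by auto
    qed
  qed
  then have "measure lebesgue (ball_sector w c) = measure lebesgue (ball_sector (axis 3 1) c)"
    using measure_orthogonal_image[OF f(1) bd] by metis
  then have "measure lborel (ball_sector w c) = measure lborel (ball_sector (axis 3 1) c)"
    by (simp add: measure_completion)
  moreover have "emeasure lborel (ball_sector v c) = ennreal (measure lborel (ball_sector v c))" for v
    using bd[of v] by (intro emeasure_eq_ennreal_measure) (auto simp: fmeasurable_def emeasure_completion)
  ultimately show ?thesis using emeasure_ball_sector_axis[OF c] by simp
qed

definition ball_measure :: "(real^3) measure" where
  "ball_measure = uniform_measure lborel (ball 0 1)"

definition direction :: "real^3 \<Rightarrow> real^3" where
  "direction x = (1 / norm x) *\<^sub>R x"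

lemma direction_measurable [measurable]: "direction \<in> borel_measurable borel"
  unfolding direction_def by measurable

lemma emeasure_unit_ball3: "emeasure lborel (ball (0::real^3) 1) = ennreal (4 / 3 * pi)"
  by (simp add: emeasure_ball unit_ball_vol_3)

lemma prob_space_ball_measure: "prob_space ball_measure"
  unfolding ball_measure_def by (rule prob_space_uniform_measure) (auto simp: emeasure_unit_ball3)

lemma sets_ball_measure [simp, measurable_cong]: "sets ball_measure = sets borel"
  by (simp add: ball_measure_def)

lemma space_ball_measure [simp]: "space ball_measure = UNIV"
  by (simp add: ball_measure_def)

lemma direction_prob_pos:
  assumes w: "norm w = 1" and c: "0 < c" "c < 1"
  shows "measure ball_measure {x. c < direction x \<bullet> w} = (1 - c) / 2"
proof -
  have "ball 0 1 \<inter> {x. c < direction x \<bullet> w} = ball_sector w c"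
  proof -
    have "c < direction x \<bullet> w \<longleftrightarrow> c * norm x < x \<bullet> w" for x
      using c by (cases "x = 0") (auto simp: direction_def field_simps)
    then show ?thesis by (auto simp: ball_sector_def)
  qed
  moreover have [measurable]: "{x. c < direction x \<bullet> w} \<in> sets borel" by measurable
  ultimately have "emeasure ball_measure {x. c < direction x \<bullet> w} = ennreal (2 / 3 * pi * (1 - c)) / ennreal (4 / 3 * pi)"
    unfolding ball_measure_def by (subst emeasure_uniform_measure) (auto simp: emeasure_unit_ball3 emeasure_ball_sector[OF w c])
  also have "\<dots> = ennreal ((1 - c) / 2)"
    using c by (subst divide_ennreal) (auto simp: field_simps)
  finally show ?thesis using c by (simp add: measure_def)
qed

text \<open>The volume computation covers 0 < c < 1. The other levels follow from monotonicity and
  from the opposite cap: the caps of w and -w at levels c and d are disjoint for d \<ge> -c and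
  cover everything for d < -c. Approximation by nearby levels absorbs a possible mass on a single
  level circle.\<close>

lemma direction_prob:
  assumes w: "norm w = 1"
  shows "measure ball_measure {x. c < direction x \<bullet> w} = (1 - max (-1) (min 1 c)) / 2"
proof -
  interpret prob_space ball_measure by (rule prob_space_ball_measure)
  define G where "G = (\<lambda>w c. measure ball_measure {x. c < direction x \<bullet> w})"
  have [measurable]: "{x. c < direction x \<bullet> w} \<in> sets borel" for c w by measurable
  have pos: "G w c = (1 - c) / 2" if "norm w = 1" "0 < c" "c < 1" for w c
    unfolding G_def using that by (rule direction_prob_pos)
  have anti: "G w d \<le> G w c" if "c \<le> d" for w c d
    unfolding G_def using that by (intro finite_measure_mono) auto
  have b: "0 \<le> G w c" "G w c \<le> 1" for w c by (auto simp: G_def)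
  have up: "G w c + G (- w) d \<le> 1" if "d \<ge> - c" for w c d
  proof -
    have "G w c + G (- w) d = measure ball_measure ({x. c < direction x \<bullet> w} \<union> {x. d < direction x \<bullet> (- w)})"
      unfolding G_def using that by (intro finite_measure_Union[symmetric]) auto
    then show ?thesis by simp
  qed
  have lo: "G w c + G (- w) d \<ge> 1" if "d < - c" for w c d
  proof -
    have "{x. c < direction x \<bullet> w} \<union> {x. d < direction x \<bullet> (- w)} = space ball_measure"
      using that by auto
    then have "1 = measure ball_measure ({x. c < direction x \<bullet> w} \<union> {x. d < direction x \<bullet> (- w)})"
      using prob_space by simp
    also have "\<dots> \<le> G w c + G (- w) d"
      unfolding G_def by (intro measure_subadditive) (auto simp: emeasure_eq_measure)
    finally show ?thesis .
  qed
  have w': "norm (- w) = 1" using w by simp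
  consider "c \<ge> 1" | "0 < c" "c < 1" | "c = 0" | "-1 < c" "c < 0" | "c \<le> -1" by linarith
  then have "G w c = (1 - max (-1) (min 1 c)) / 2"
  proof cases
    case 1
    have "G w c \<le> 0 + e" if "e > 0" for e
    proof -
      define d where "d = max (1/2) (1 - e)"
      have "G w c \<le> G w d" using 1 that by (intro anti) (auto simp: d_def)
      also have "\<dots> = (1 - d) / 2" using that by (intro pos[OF w]) (auto simp: d_def)
      finally show ?thesis using that by (auto simp: d_def max_def split: if_splits)
    qed
    then have "G w c \<le> 0" by (rule field_le_epsilon)
    then show ?thesis using b[of w c] 1 by simp
  next
    case 2 then show ?thesis using pos[OF w] by simp
  next
    case 3
    have *: "G w c \<le> 1/2 + e" "1/2 \<le> G w c + e" if "e > 0" for e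
    proof -
      define d where "d = min (1/2) e"
      have d: "0 < d" "d < 1" "d \<le> e" using that by (auto simp: d_def)
      show "G w c \<le> 1/2 + e" using up[of c d w] pos[OF w' d(1,2)] d 3 by (simp add: field_simps)
      show "1/2 \<le> G w c + e" using anti[of c d w] pos[OF w d(1,2)] d 3 by (simp add: field_simps)
    qed
    have "G w c \<le> 1/2" by (rule field_le_epsilon) (rule *)
    moreover have "1/2 \<le> G w c" by (rule field_le_epsilon) (rule *)
    ultimately have "G w c \<le> 1/2" "1/2 \<le> G w c" by auto
    then show ?thesis using 3 by simp
  next
    case 4
    have "G w c \<le> (1 - c) / 2" using up[of c "- c" w] pos[OF w', of "- c"] 4 by (simp add: field_simps)
    moreover have "(1 - c) / 2 \<le> G w c + e" if "e > 0" for e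
    proof -
      define d where "d = max (- c / 2) (- c - e)"
      have "d < - c" "0 < d" "d < 1" using 4 that by (auto simp: d_def)
      then show ?thesis using lo[of d c w] pos[OF w', of d] 4 that by (auto simp: d_def field_simps)
    qed
    then have "(1 - c) / 2 \<le> G w c" by (rule field_le_epsilon)
    ultimately show ?thesis using 4 by simp
  next
    case 5
    have "1 \<le> G w c + e" if "e > 0" for e
    proof -
      define d where "d = max (1/2) (1 - e)"
      have "d < - c" "0 < d" "d < 1" using 5 that by (auto simp: d_def)
      then show ?thesis using lo[of d c w] pos[OF w', of d] 5 that by (auto simp: d_def max_def field_simps split: if_splits)
    qed
    then have "1 \<le> G w c" by (rule field_le_epsilon)
    then show ?thesis using b[of w c] 5 by simp
  qed
  then show ?thesis by (simp add: G_def)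
qed

text \<open>Archimedes' hat-box theorem.\<close>

lemma distr_direction:
  assumes w: "norm w = 1"
  shows "distr ball_measure borel (\<lambda>x. direction x \<bullet> w) = uniform_measure lborel {-1<..<1}"
proof (rule measure_eqI_lessThan)
  interpret prob_space ball_measure by (rule prob_space_ball_measure)
  have m: "(\<lambda>x. direction x \<bullet> w) \<in> borel_measurable ball_measure" by measurable
  interpret D: prob_space "distr ball_measure borel (\<lambda>x. direction x \<bullet> w)" by (rule prob_space_distr[OF m])
  fix c :: real
  show "emeasure (distr ball_measure borel (\<lambda>x. direction x \<bullet> w)) {c<..} < \<infinity>"
    by (simp add: D.emeasure_eq_measure)
  have "emeasure (distr ball_measure borel (\<lambda>x. direction x \<bullet> w)) {c<..} = ennreal (measure ball_measure {x. c < direction x \<bullet> w})"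
    using m by (subst emeasure_distr) (auto simp: emeasure_eq_measure vimage_def)
  also have "\<dots> = ennreal ((1 - max (-1) (min 1 c)) / 2)" by (simp add: direction_prob[OF w])
  also have "\<dots> = emeasure lborel ({-1<..<1} \<inter> {c<..}) / emeasure lborel {-1<..<1::real}"
  proof -
    have "{-1<..<1} \<inter> {c<..} = {max (-1) (min 1 c)<..<1}" by auto
    moreover have "emeasure lborel {max (-1) (min 1 c)<..<1} = ennreal (1 - max (-1) (min 1 c))" by simp
    ultimately show ?thesis by (simp add: divide_ennreal[symmetric])
  qed
  also have "\<dots> = emeasure (uniform_measure lborel {-1<..<1}) {c<..}"
    by (subst emeasure_uniform_measure) auto
  finally show "emeasure (distr ball_measure borel (\<lambda>x. direction x \<bullet> w)) {c<..} = emeasure (uniform_measure lborel {-1<..<1}) {c<..}" .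
qed auto

lemma nn_integral_direction:
  assumes w: "norm w = 1" and [measurable]: "g \<in> borel_measurable borel"
  shows "(\<integral>\<^sup>+x. g (direction x \<bullet> w) \<partial>ball_measure) = (\<integral>\<^sup>+a. g a * indicator {-1<..<1} a \<partial>lborel) / 2"
proof -
  have "(\<integral>\<^sup>+x. g (direction x \<bullet> w) \<partial>ball_measure) = (\<integral>\<^sup>+a. g a \<partial>distr ball_measure borel (\<lambda>x. direction x \<bullet> w))"
    by (subst nn_integral_distr) auto
  also have "\<dots> = (\<integral>\<^sup>+a. g a * indicator {-1<..<1} a \<partial>lborel) / 2"
    unfolding distr_direction[OF w] by (subst nn_integral_uniform_measure) auto
  finally show ?thesis .
qed

section \<open>Transitivity of the orthogonal group on planes\<close>

lemma reflection_exists: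
  fixes a b :: "'a::euclidean_space"
  assumes "norm a = norm b"
  obtains f where "orthogonal_transformation f" "f a = b" "\<And>z. z \<bullet> (a - b) = 0 \<Longrightarrow> f z = z"
proof -
  define w where "w = a - b"
  define f where "f = (\<lambda>z. z - (2 * (z \<bullet> w) / (w \<bullet> w)) *\<^sub>R w)"
  have "linear f"
    by (rule linearI) (simp_all add: f_def inner_add_left algebra_simps add_divide_distrib)
  moreover have "f x \<bullet> f y = x \<bullet> y" for x y
  proof (cases "w = 0")
    case False
    define k p q where "k = w \<bullet> w" and "p = x \<bullet> w" and "q = y \<bullet> w"
    have k: "k \<noteq> 0" using False by (simp add: k_def)
    have "f x \<bullet> f y = x \<bullet> y - (2 * q / k) * p - (2 * p / k) * (q - (2 * q / k) * k)"
      by (simp add: f_def inner_diff_left inner_diff_right k_def p_def q_def inner_commute[of w y])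
    also have "\<dots> = x \<bullet> y" using k by simp
    finally show ?thesis .
  qed (simp add: f_def)
  ultimately have "orthogonal_transformation f" by (simp add: orthogonal_transformation_def)
  moreover have "f a = b"
  proof (cases "w = 0")
    case False
    have "a \<bullet> a = b \<bullet> b" using assms by (simp add: norm_eq)
    then have "2 * (a \<bullet> w) = w \<bullet> w" by (simp add: w_def inner_diff_left inner_diff_right inner_commute)
    then show ?thesis using False by (simp add: f_def) (simp add: w_def)
  qed (simp add: f_def w_def)
  moreover have "f z = z" if "z \<bullet> (a - b) = 0" for z using that by (simp add: f_def w_def)
  ultimately show ?thesis using that by blast
qed

text \<open>Two Householder reflections suffice: one moves the first frame vector to its target c,
  the other moves the image of the second one to d. The latter fixes c, since c is orthogonal to
  both the vector being moved and d; this is why \<open>reflection_exists\<close> also records which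
  vectors stay fixed.\<close>

lemma orthogonal_transitive_gr24:
  assumes P: "P \<in> gr24" and Q: "Q \<in> gr24"
  obtains U :: "real^4^4" where "orthogonal_matrix U" "(*v) U ` P = Q"
proof -
  have fr: "\<exists>a b. a \<bullet> a = 1 \<and> b \<bullet> b = 1 \<and> a \<bullet> b = 0 \<and> S = span {a, b}" if "S \<in> gr24" for S
  proof -
    note A = frame[OF that]
    define a b where "a = column 1 (frame S)" and "b = column 2 (frame S)"
    have c: "columns (frame S) = {a, b}" by (auto simp: columns_def UNIV_2 a_def b_def)
    have "a \<bullet> b = 0" "a \<bullet> a = 1" "b \<bullet> b = 1"
      using A(1) by (simp_all add: stiefel24_iff a_def b_def column_def inner_vec_def sum_4)
    then show ?thesis using A(2) c by metis
  qed
  obtain a b c d where ab: "a \<bullet> a = 1" "b \<bullet> b = 1" "a \<bullet> b = 0" "P = span {a, b}"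
    and cd: "c \<bullet> c = 1" "d \<bullet> d = 1" "c \<bullet> d = 0" "Q = span {c, d}" using fr[OF P] fr[OF Q] by metis
  obtain f where f: "orthogonal_transformation f" "f a = c"
    using reflection_exists[of a c] ab cd by (auto simp: norm_eq)
  have fb: "f b \<bullet> f b = 1" "c \<bullet> f b = 0"
    using f ab unfolding orthogonal_transformation_def by (metis, metis)
  obtain g where g: "orthogonal_transformation g" "g (f b) = d" "\<And>z. z \<bullet> (f b - d) = 0 \<Longrightarrow> g z = z"
    using reflection_exists[of "f b" d] fb cd by (auto simp: norm_eq)
  have gc: "g c = c" using g(3) fb cd by (simp add: inner_diff_right)
  define h where "h = g \<circ> f"
  have h: "orthogonal_transformation h" unfolding h_def using g(1) f(1) by (rule orthogonal_transformation_compose)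
  then have "linear h" "orthogonal_matrix (matrix h)" by (auto simp: orthogonal_transformation_matrix)
  have "(*v) (matrix h) ` P = h ` P" using \<open>linear h\<close> by (auto simp: matrix_works)
  also have "\<dots> = span (h ` {a, b})" unfolding ab(4) using linear_span_image[OF \<open>linear h\<close>] by metis
  also have "h ` {a, b} = {c, d}" using gc g(2) f(2) by (auto simp: h_def)
  finally show ?thesis using that[of "matrix h"] \<open>orthogonal_matrix (matrix h)\<close> cd(4) by simp
qed

section \<open>The joint law of the invariants of two planes\<close>

lemma measurable_dual_products:
  "(\<lambda>P. sd P $ i * asd P $ j) \<in> borel_measurable gr24_borel"
  "(\<lambda>P. sd P $ i * sd P $ j) \<in> borel_measurable gr24_borel"
  "(\<lambda>P. asd P $ i * asd P $ j) \<in> borel_measurable gr24_borel"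
  by (rule measurable_duals[of "\<lambda>u v. u $ i * v $ j"] measurable_duals[of "\<lambda>u v. u $ i * u $ j"]
      measurable_duals[of "\<lambda>u v. v $ i * v $ j"]; auto intro!: continuous_intros)+

text \<open>Only even functions of \<open>(sd P, asd P)\<close> are measurable in \<open>P\<close>, whence the expansion into products of two coordinates.\<close>

lemma invariants_expand:
  fixes u v x y :: "real^3"
  shows "(u \<bullet> x) * (v \<bullet> y) = (\<Sum>i\<in>UNIV. \<Sum>j\<in>UNIV. (u $ i * v $ j) * (x $ i * y $ j))"
    and "((u \<bullet> x + v \<bullet> y) / 2)\<^sup>2 = ((\<Sum>i\<in>UNIV. \<Sum>j\<in>UNIV. (u $ i * u $ j) * (x $ i * x $ j))
       + 2 * (\<Sum>i\<in>UNIV. \<Sum>j\<in>UNIV. (u $ i * v $ j) * (x $ i * y $ j))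
       + (\<Sum>i\<in>UNIV. \<Sum>j\<in>UNIV. (v $ i * v $ j) * (y $ i * y $ j))) / 4"
proof -
  have *: "(u \<bullet> x) * (v \<bullet> y) = (\<Sum>i\<in>UNIV. \<Sum>j\<in>UNIV. (u $ i * v $ j) * (x $ i * y $ j))" for u v x y :: "real^3"
    unfolding inner_vec_def sum_product by (intro sum.cong refl) (simp add: mult_ac)
  show "(u \<bullet> x) * (v \<bullet> y) = (\<Sum>i\<in>UNIV. \<Sum>j\<in>UNIV. (u $ i * v $ j) * (x $ i * y $ j))" by (rule *)
  show "((u \<bullet> x + v \<bullet> y) / 2)\<^sup>2 = ((\<Sum>i\<in>UNIV. \<Sum>j\<in>UNIV. (u $ i * u $ j) * (x $ i * x $ j))
       + 2 * (\<Sum>i\<in>UNIV. \<Sum>j\<in>UNIV. (u $ i * v $ j) * (x $ i * y $ j))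
       + (\<Sum>i\<in>UNIV. \<Sum>j\<in>UNIV. (v $ i * v $ j) * (y $ i * y $ j))) / 4"
    unfolding *[symmetric] by (simp add: power2_eq_square field_simps)
qed

lemma measurable_xi_prod [measurable (raw)]:
  assumes f: "f \<in> measurable M gr24_borel" and g: "g \<in> measurable M gr24_borel"
  shows "(\<lambda>z. xi_prod (f z) (g z)) \<in> borel_measurable M"
  unfolding xi_prod_def invariants_expand
  by (intro borel_measurable_sum borel_measurable_times measurable_compose[OF f] measurable_compose[OF g] measurable_dual_products)

lemma measurable_xi_mean_sq [measurable (raw)]:
  assumes f: "f \<in> measurable M gr24_borel" and g: "g \<in> measurable M gr24_borel"
  shows "(\<lambda>z. xi_mean_sq (f z) (g z)) \<in> borel_measurable M"
  unfolding xi_mean_sq_def invariants_expand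
  by (intro borel_measurable_sum borel_measurable_times borel_measurable_add borel_measurable_divide borel_measurable_const
      measurable_compose[OF f measurable_dual_products(1)] measurable_compose[OF g measurable_dual_products(1)]
      measurable_compose[OF f measurable_dual_products(2)] measurable_compose[OF g measurable_dual_products(2)]
      measurable_compose[OF f measurable_dual_products(3)] measurable_compose[OF g measurable_dual_products(3)])

lemma AE_ball_measure_direction:
  assumes w: "norm w = 1"
  shows "AE x in ball_measure. -1 < direction x \<bullet> w" and "AE x in ball_measure. norm (direction x) = 1"
proof -
  interpret prob_space ball_measure by (rule prob_space_ball_measure)
  have m: "(\<lambda>x. direction x \<bullet> w) \<in> borel_measurable ball_measure" by measurable
  then have "{x. -1 < direction x \<bullet> w} \<in> events" using measurable_sets[OF m, of "{-1<..}"] by (simp add: vimage_def)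
  moreover have "prob {x. -1 < direction x \<bullet> w} = 1" by (simp add: direction_prob[OF w])
  ultimately show "AE x in ball_measure. -1 < direction x \<bullet> w" by (auto simp: AE_prob_1 dest: AE_prob_1)
  have "AE x in lborel. x \<noteq> (0::real^3)" by (rule AE_lborel_singleton)
  then have "AE x in ball_measure. x \<noteq> 0"
    unfolding ball_measure_def by (intro AE_uniform_measureI) auto
  then show "AE x in ball_measure. norm (direction x) = 1"
    by eventually_elim (simp add: direction_def)
qed

lemma plane_with_duals:
  assumes u: "norm u = 1" and v: "norm v = 1" and uv: "-1 < u \<bullet> v"
  obtains Q where "Q \<in> gr24" "(sd Q = u \<and> asd Q = v) \<or> (sd Q = - u \<and> asd Q = - v)"
proof -
  obtain A where A: "A \<in> stiefel24" "self_dual A = u" "anti_self_dual A = v"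
    using exists_stiefel24[of u v] u v uv by (auto simp: norm_eq_1)
  show ?thesis using that[OF span_columns_in_gr24[OF A(1)]] duals_span_columns[OF A(1)] A(2,3) by auto
qed

lemma gr24_nonempty: "gr24 \<noteq> {}"
proof -
  have "norm (axis 1 1 :: real^3) = 1" by simp
  then show ?thesis using plane_with_duals[of "axis 1 1" "axis 1 1"] by (auto simp: inner_axis)
qed

lemma gr24_prob_measures_sets:
  assumes "\<sigma> \<in> gr24_prob_measures"
  shows "prob_space \<sigma>" "sets \<sigma> = sets gr24_borel" "space \<sigma> = gr24"
  using assms sets_eq_imp_space_eq[of \<sigma> gr24_borel] by (auto simp: gr24_prob_measures_def)

text \<open>Some orthogonal map carries \<open>Q\<close> to \<open>Q'\<close>. Applying it to the
  integration variable preserves the measure, and applying it to both planes preserves the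
  invariants.\<close>

lemma zonal_integral_const:
  fixes G :: "real \<times> real \<Rightarrow> ennreal"
  assumes \<sigma>: "\<sigma> \<in> gr24_prob_measures" and inv: "O4_invariant \<sigma>" and G [measurable]: "G \<in> borel_measurable borel"
    and Q: "Q \<in> gr24" and Q': "Q' \<in> gr24"
  shows "(\<integral>\<^sup>+P. G (xi_prod P Q', xi_mean_sq P Q') \<partial>\<sigma>) = (\<integral>\<^sup>+P. G (xi_prod P Q, xi_mean_sq P Q) \<partial>\<sigma>)"
proof -
  note s = gr24_prob_measures_sets[OF \<sigma>]
  obtain U :: "real^4^4" where U: "orthogonal_matrix U" "(*v) U ` Q = Q'"
    using orthogonal_transitive_gr24[OF Q Q'] by blast
  have m: "(\<lambda>P. G (xi_prod P Q', xi_mean_sq P Q')) \<in> borel_measurable gr24_borel"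
    using Q' by (intro measurable_compose[OF _ G] borel_measurable_Pair measurable_xi_prod measurable_xi_mean_sq) auto
  have mU: "(\<lambda>P. (*v) U ` P) \<in> measurable \<sigma> gr24_borel"
    using measurable_orthogonal_image[OF U(1)] by (simp cong: measurable_cong_sets add: s(2))
  have "(\<integral>\<^sup>+P. G (xi_prod P Q', xi_mean_sq P Q') \<partial>\<sigma>)
      = (\<integral>\<^sup>+P. G (xi_prod P Q', xi_mean_sq P Q') \<partial>distr \<sigma> gr24_borel (\<lambda>P. (*v) U ` P))"
    using inv U(1) by (simp add: O4_invariant_def)
  also have "\<dots> = (\<integral>\<^sup>+P. G (xi_prod ((*v) U ` P) Q', xi_mean_sq ((*v) U ` P) Q') \<partial>\<sigma>)"
    using mU m by (subst nn_integral_distr) auto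
  also have "\<dots> = (\<integral>\<^sup>+P. G (xi_prod P Q, xi_mean_sq P Q) \<partial>\<sigma>)"
    by (intro nn_integral_cong) (use U Q xi_orthogonal_image[OF U(1) _ Q] s(3) in auto)
  finally show ?thesis .
qed

text \<open>Since the integral does not depend on \<open>Q\<close>, it equals its average over
  planes \<open>Q\<close> whose dual pair consists of two independent uniform directions; almost
  every pair of directions belongs to a plane. After exchanging the integrals the plane
  \<open>P\<close> is fixed, and the hat-box theorem makes the two inner products independent and
  uniform, whatever \<open>P\<close> is.\<close>

theorem zonal_integral:
  fixes G :: "real \<times> real \<Rightarrow> ennreal"
  assumes \<sigma>: "\<sigma> \<in> gr24_prob_measures" and inv: "O4_invariant \<sigma>" and G [measurable]: "G \<in> borel_measurable borel"
    and Q: "Q \<in> gr24"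
  shows "(\<integral>\<^sup>+P. G (xi_prod P Q, xi_mean_sq P Q) \<partial>\<sigma>)
     = (\<integral>\<^sup>+x. (\<integral>\<^sup>+y. G (x * y, ((x + y) / 2)\<^sup>2) * indicator {-1<..<1} y \<partial>lborel) / 2 * indicator {-1<..<1} x \<partial>lborel) / 2"
    (is "?c = ?K")
proof -
  note s = gr24_prob_measures_sets[OF \<sigma>]
  interpret S: prob_space \<sigma> by (rule s(1))
  interpret B: prob_space ball_measure by (rule prob_space_ball_measure)
  interpret SB: pair_sigma_finite \<sigma> ball_measure ..
  define H where "H = (\<lambda>P x y. G ((sd P \<bullet> direction x) * (asd P \<bullet> direction y), ((sd P \<bullet> direction x + asd P \<bullet> direction y) / 2)\<^sup>2))"
  have dn [measurable]: "(\<lambda>x. direction x $ i) \<in> borel_measurable borel" for i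
  proof -
    have "(\<lambda>x. direction x \<bullet> axis i 1) \<in> borel_measurable borel" by measurable
    then show ?thesis by (simp add: inner_axis)
  qed
  have mH: "(\<lambda>z. H (f z) (g z) (h z)) \<in> borel_measurable M"
    if f: "f \<in> measurable M gr24_borel" and g: "g \<in> measurable M borel" and h: "h \<in> measurable M borel"
    for f g h and M :: "'z measure"
    unfolding H_def invariants_expand
    by (intro measurable_compose[OF _ G] borel_measurable_Pair borel_measurable_sum borel_measurable_times borel_measurable_add
      borel_measurable_divide borel_measurable_const
      measurable_compose[OF f measurable_dual_products(1)] measurable_compose[OF f measurable_dual_products(2)]
      measurable_compose[OF f measurable_dual_products(3)] measurable_compose[OF g dn] measurable_compose[OF h dn])
  have Hc: "(\<integral>\<^sup>+P. H P x y \<partial>\<sigma>) = ?c"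
    if dirs: "norm (direction x) = 1" "norm (direction y) = 1" "-1 < direction y \<bullet> direction x" for x y
  proof -
    obtain Q' where Q': "Q' \<in> gr24" "(sd Q' = direction x \<and> asd Q' = direction y) \<or> (sd Q' = - direction x \<and> asd Q' = - direction y)"
      using plane_with_duals[of "direction x" "direction y"] dirs(1,2) dirs(3)[unfolded inner_commute[of "direction y"]] by blast
    have "H P x y = G (xi_prod P Q', xi_mean_sq P Q')" for P
      using Q'(2) by (auto simp: H_def xi_prod_def xi_mean_sq_def power2_eq_square algebra_simps)
    then show ?thesis using zonal_integral_const[OF \<sigma> inv G Q Q'(1)] by simp
  qed
  have "?c = (\<integral>\<^sup>+x. (\<integral>\<^sup>+y. ?c \<partial>ball_measure) \<partial>ball_measure)"
    using B.emeasure_space_1 by simp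
  also have "\<dots> = (\<integral>\<^sup>+x. (\<integral>\<^sup>+y. (\<integral>\<^sup>+P. H P x y \<partial>\<sigma>) \<partial>ball_measure) \<partial>ball_measure)"
  proof (rule nn_integral_cong_AE)
    have "norm (axis 1 1 :: real^3) = 1" by simp
    note n1 = AE_ball_measure_direction(2)[OF this]
    show "AE x in ball_measure. (\<integral>\<^sup>+y. ?c \<partial>ball_measure) = (\<integral>\<^sup>+y. (\<integral>\<^sup>+P. H P x y \<partial>\<sigma>) \<partial>ball_measure)"
      using n1
    proof eventually_elim
      case (elim x)
      show ?case
      proof (rule nn_integral_cong_AE)
        show "AE y in ball_measure. ?c = (\<integral>\<^sup>+P. H P x y \<partial>\<sigma>)"
          using n1 AE_ball_measure_direction(1)[OF elim] by eventually_elim (simp add: Hc elim)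
      qed
    qed
  qed
  also have "\<dots> = (\<integral>\<^sup>+x. (\<integral>\<^sup>+P. (\<integral>\<^sup>+y. H P x y \<partial>ball_measure) \<partial>\<sigma>) \<partial>ball_measure)"
  proof (rule nn_integral_cong)
    fix x
    have "(\<lambda>z. H (fst z) x (snd z)) \<in> borel_measurable (\<sigma> \<Otimes>\<^sub>M ball_measure)"
      by (rule mH) (auto intro: measurable_cong_sets[THEN equalityD1, THEN subsetD] simp: s(2) cong: measurable_cong_sets)
    from SB.Fubini[OF this] show "(\<integral>\<^sup>+y. (\<integral>\<^sup>+P. H P x y \<partial>\<sigma>) \<partial>ball_measure) = (\<integral>\<^sup>+P. (\<integral>\<^sup>+y. H P x y \<partial>ball_measure) \<partial>\<sigma>)"
      by simp
  qed
  also have "\<dots> = (\<integral>\<^sup>+P. (\<integral>\<^sup>+x. (\<integral>\<^sup>+y. H P x y \<partial>ball_measure) \<partial>ball_measure) \<partial>\<sigma>)"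
  proof -
    have "(\<lambda>w. H (fst (fst w)) (snd (fst w)) (snd w)) \<in> borel_measurable ((\<sigma> \<Otimes>\<^sub>M ball_measure) \<Otimes>\<^sub>M ball_measure)"
      by (rule mH) (auto simp: s(2) cong: measurable_cong_sets)
    from B.borel_measurable_nn_integral_fst[OF this]
    have "(\<lambda>z. \<integral>\<^sup>+y. H (fst z) (snd z) y \<partial>ball_measure) \<in> borel_measurable (\<sigma> \<Otimes>\<^sub>M ball_measure)" by simp
    from SB.Fubini[OF this] show ?thesis by simp
  qed
  also have "\<dots> = (\<integral>\<^sup>+P. ?K \<partial>\<sigma>)"
  proof (rule nn_integral_cong)
    fix P assume "P \<in> space \<sigma>"
    then have P: "P \<in> gr24" by (simp add: s(3))
    have n: "norm (sd P) = 1" "norm (asd P) = 1" using sd_unit[OF P] asd_unit[OF P] by (simp_all add: norm_eq_1)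
    define g where "g = (\<lambda>a b. G (a * b, ((a + b) / 2)\<^sup>2))"
    have mg: "(\<lambda>z. g (f z) (h z)) \<in> borel_measurable M"
      if [measurable]: "f \<in> borel_measurable M" "h \<in> borel_measurable M" for f h and M :: "'z measure"
      unfolding g_def by (intro measurable_compose[OF _ G] borel_measurable_Pair) measurable
    have "(\<integral>\<^sup>+x. (\<integral>\<^sup>+y. H P x y \<partial>ball_measure) \<partial>ball_measure)
      = (\<integral>\<^sup>+x. (\<integral>\<^sup>+y. g (direction x \<bullet> sd P) (direction y \<bullet> asd P) \<partial>ball_measure) \<partial>ball_measure)"
      by (simp add: H_def g_def inner_commute)
    also have "\<dots> = (\<integral>\<^sup>+x. (\<integral>\<^sup>+b. g (direction x \<bullet> sd P) b * indicator {-1<..<1} b \<partial>lborel) / 2 \<partial>ball_measure)"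
      by (intro nn_integral_cong nn_integral_direction[OF n(2)] mg) auto
    also have "\<dots> = (\<integral>\<^sup>+a. (\<integral>\<^sup>+b. g a b * indicator {-1<..<1} b \<partial>lborel) / 2 * indicator {-1<..<1} a \<partial>lborel) / 2"
    proof (rule nn_integral_direction[OF n(1)])
      have "(\<lambda>z. g (fst z) (snd z) * indicator {-1<..<1} (snd z)) \<in> borel_measurable (borel \<Otimes>\<^sub>M lborel)"
        by (intro borel_measurable_times_ennreal mg) auto
      from lborel.borel_measurable_nn_integral_fst[OF this]
      show "(\<lambda>a. (\<integral>\<^sup>+b. g a b * indicator {-1<..<1} b \<partial>lborel) / 2) \<in> borel_measurable borel"
        by (intro borel_measurable_divide_ennreal) simp_all
    qed
    finally show "(\<integral>\<^sup>+x. (\<integral>\<^sup>+y. H P x y \<partial>ball_measure) \<partial>ball_measure) = ?K" by (simp add: g_def)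
  qed
  also have "\<dots> = ?K" by (simp add: S.emeasure_space_1)
  finally show ?thesis .
qed

section \<open>Energies as integrals over the square\<close>

definition riesz_profile :: "real \<Rightarrow> real \<Rightarrow> ennreal" where
  "riesz_profile s t = inverse (ennreal (sqrt (1 - t) powr s))"

lemma riesz_profile_measurable [measurable]: "riesz_profile s \<in> borel_measurable borel"
  unfolding riesz_profile_def by measurable

lemma riesz_kernel_eq: "P \<in> gr24 \<Longrightarrow> Q \<in> gr24 \<Longrightarrow> riesz_kernel s P Q = riesz_profile s (xi_prod P Q)"
  by (simp add: riesz_kernel_def riesz_profile_def xi_formula)

lemma riesz_profile_less_1:
  assumes "t < 1" shows "riesz_profile s t = ennreal ((1 - t) powr (- (s / 2)))"
proof -
  have "sqrt (1 - t) powr s = (1 - t) powr (s / 2)"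
    using assms by (simp add: powr_half_sqrt[symmetric] powr_powr)
  moreover have "(1 - t) powr (s / 2) > 0" using assms by simp
  ultimately show ?thesis
    by (simp add: riesz_profile_def inverse_ennreal powr_minus)
qed

text \<open>Mean value of \<open>g(\<xi>\<^sub>+, \<xi>\<^sub>-)\<close> for a symmetric even function \<open>g\<close> and independent uniform planes.\<close>

definition square_mean :: "(real \<times> real \<Rightarrow> ennreal) \<Rightarrow> ennreal" where
  "square_mean g = (\<integral>\<^sup>+z. indicator ({-1<..<1} \<times> {-1<..<1}) z * g z \<partial>lborel) / 4"

lemma indicator_square_measurable [measurable]:
  "(indicator ({-1<..<1::real} \<times> {-1<..<1::real}) :: _ \<Rightarrow> ennreal) \<in> borel_measurable borel"
  by (intro borel_measurable_indicator borel_Times) auto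

lemma zonal_integral_square_mean:
  fixes G :: "real \<times> real \<Rightarrow> ennreal"
  assumes \<sigma>: "\<sigma> \<in> gr24_prob_measures" and inv: "O4_invariant \<sigma>" and G [measurable]: "G \<in> borel_measurable borel"
    and Q: "Q \<in> gr24"
  shows "(\<integral>\<^sup>+P. G (xi_prod P Q, xi_mean_sq P Q) \<partial>\<sigma>) = square_mean (\<lambda>(x, y). G (x * y, ((x + y) / 2)\<^sup>2))"
proof -
  define g where "g = (\<lambda>z. indicator ({-1<..<1} \<times> {-1<..<1}) z * G (fst z * snd z, ((fst z + snd z) / 2)\<^sup>2))"
  have [measurable]: "g \<in> borel_measurable borel"
    unfolding g_def by (intro borel_measurable_times_ennreal measurable_compose[OF _ G] borel_measurable_Pair indicator_square_measurable) measurable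
  have i: "(\<integral>\<^sup>+y. G (x * y, ((x + y) / 2)\<^sup>2) * indicator {-1<..<1} y \<partial>lborel) / 2 * indicator {-1<..<1} x
     = (\<integral>\<^sup>+y. g (x, y) \<partial>lborel) / 2" for x
    by (cases "x \<in> {-1<..<1}") (auto simp: g_def indicator_def mult.commute intro!: arg_cong2[where f="(/)"] nn_integral_cong)
  have "(\<integral>\<^sup>+P. G (xi_prod P Q, xi_mean_sq P Q) \<partial>\<sigma>) = (\<integral>\<^sup>+x. (\<integral>\<^sup>+y. g (x, y) \<partial>lborel) / 2 \<partial>lborel) / 2"
    unfolding zonal_integral[OF \<sigma> inv G Q] i ..
  also have "\<dots> = (\<integral>\<^sup>+z. g z \<partial>lborel) / 2 / 2"
  proof -
    have "(\<integral>\<^sup>+x. (\<integral>\<^sup>+y. g (x, y) \<partial>lborel) / 2 \<partial>lborel) = (\<integral>\<^sup>+z. g z \<partial>lborel) / 2"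
      by (subst nn_integral_divide) (auto simp: nn_integral_lborel_pair)
    then show ?thesis by simp
  qed
  also have "\<dots> = (\<integral>\<^sup>+z. g z \<partial>lborel) / 4"
    by (simp add: divide_ennreal_def mult.assoc ennreal_inverse_mult[symmetric] flip: ennreal_numeral)
       (simp add: inverse_ennreal ennreal_mult[symmetric])
  also have "(\<lambda>z. g z) = (\<lambda>z. indicator ({-1<..<1} \<times> {-1<..<1}) z * (case z of (x, y) \<Rightarrow> G (x * y, ((x + y) / 2)\<^sup>2)))"
    by (auto simp: g_def)
  finally show ?thesis by (simp add: square_mean_def)
qed

lemma square_mean_cong:
  assumes "\<And>x y. \<bar>x\<bar> < 1 \<Longrightarrow> \<bar>y\<bar> < 1 \<Longrightarrow> f (x, y) = g (x, y)"
  shows "square_mean f = square_mean g"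
  unfolding square_mean_def using assms
  by (intro arg_cong2[where f="(/)"] refl nn_integral_cong) (auto simp: indicator_def abs_less_iff)

lemma abs_mult_less_1: "\<bar>x\<bar> < 1 \<Longrightarrow> \<bar>y\<bar> < 1 \<Longrightarrow> x * y < (1::real)"
proof -
  assume "\<bar>x\<bar> < 1" "\<bar>y\<bar> < 1"
  then have "\<bar>x\<bar> * \<bar>y\<bar> < 1 * 1" by (intro mult_strict_mono') auto
  moreover have "x * y \<le> \<bar>x\<bar> * \<bar>y\<bar>" by (simp add: abs_mult[symmetric])
  ultimately show ?thesis by linarith
qed

definition uniform_energy :: "real \<Rightarrow> ennreal" where
  "uniform_energy s = square_mean (\<lambda>(x, y). ennreal ((1 - x * y) powr (- (s / 2))))"

text \<open>For k = 0 the kernel is constantly 1, so the uniform energy is the correction term at k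
  = 0, whose finiteness is already known.\<close>

lemma uniform_energy_finite:
  assumes "0 < s" "s < 4" shows "uniform_energy s < \<infinity>"
proof -
  have "legendre_sum 0 x = 1" for x by (simp add: legendre_sum_def)
  then have "harmonic_poly 0 x y = 1" for x y by (simp add: harmonic_poly_eq)
  then have "uniform_energy s = harmonic_square_energy s 0 / 4"
    unfolding uniform_energy_def square_mean_def harmonic_square_energy_def by (simp add: case_prod_beta)
  then show ?thesis
    using harmonic_square_energy_asymp(1)[OF assms, of 0] by (simp add: ennreal_divide_eq_top_iff less_top[symmetric])
qed

lemma measurable_gr24_pair:
  assumes "\<mu> \<in> gr24_prob_measures" "\<nu> \<in> gr24_prob_measures"
  shows "fst \<in> measurable (\<mu> \<Otimes>\<^sub>M \<nu>) gr24_borel" "snd \<in> measurable (\<mu> \<Otimes>\<^sub>M \<nu>) gr24_borel"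
  using gr24_prob_measures_sets(2)[OF assms(1)] gr24_prob_measures_sets(2)[OF assms(2)]
  by (auto cong: measurable_cong_sets)

lemma riesz_energy_uniform:
  assumes \<sigma>: "\<sigma> \<in> gr24_prob_measures" and inv: "O4_invariant \<sigma>"
  shows "(\<integral>\<^sup>+P. (\<integral>\<^sup>+Q. riesz_kernel s P Q \<partial>\<sigma>) \<partial>\<sigma>) = uniform_energy s"
proof -
  note s = gr24_prob_measures_sets[OF \<sigma>]
  interpret prob_space \<sigma> by (rule s(1))
  have sym: "xi_prod P Q = xi_prod Q P" for P Q by (simp add: xi_prod_def inner_commute)
  have "(\<integral>\<^sup>+Q. riesz_kernel s P Q \<partial>\<sigma>) = uniform_energy s" if P: "P \<in> gr24" for P
  proof -
    have "(\<integral>\<^sup>+Q. riesz_kernel s P Q \<partial>\<sigma>) = (\<integral>\<^sup>+Q. (\<lambda>z. riesz_profile s (fst z)) (xi_prod Q P, xi_mean_sq Q P) \<partial>\<sigma>)"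
      by (intro nn_integral_cong) (use P s(3) in \<open>simp add: riesz_kernel_eq sym[of P]\<close>)
    also have "\<dots> = square_mean (\<lambda>(x, y). riesz_profile s (x * y))"
      by (subst zonal_integral_square_mean[OF \<sigma> inv _ P]) auto
    also have "\<dots> = uniform_energy s"
      unfolding uniform_energy_def by (intro square_mean_cong) (simp add: riesz_profile_less_1 abs_mult_less_1)
    finally show ?thesis .
  qed
  then have "(\<integral>\<^sup>+P. (\<integral>\<^sup>+Q. riesz_kernel s P Q \<partial>\<sigma>) \<partial>\<sigma>) = (\<integral>\<^sup>+P. uniform_energy s \<partial>\<sigma>)"
    by (intro nn_integral_cong) (simp add: s(3))
  then show ?thesis by (simp add: emeasure_space_1)
qed

section \<open>Minimality of the invariant measure\<close>

text \<open>The coordinates of the n-fold tensor power of \<open>sd P\<close> \<otimes>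
  \<open>asd P\<close>, for lists of length n. They exhibit the powers of \<open>xi_prod\<close> as
  Gram kernels, and the common sign cancels in every factor.\<close>

definition dual_monomial :: "(3 \<times> 3) list \<Rightarrow> (real^4) set \<Rightarrow> real" where
  "dual_monomial l P = prod_list (map (\<lambda>(i, j). sd P $ i * asd P $ j) l)"

lemma xi_prod_power:
  "xi_prod P Q ^ n = (\<Sum>l\<in>{l. length l = n}. dual_monomial l P * dual_monomial l Q)"
proof (induction n)
  case 0
  show ?case by (simp add: dual_monomial_def)
next
  case (Suc n)
  have "xi_prod P Q = (\<Sum>a\<in>UNIV. dual_monomial [a] P * dual_monomial [a] Q)"
    unfolding xi_prod_def invariants_expand by (simp add: dual_monomial_def sum.cartesian_product case_prod_beta mult_ac)
  then have "xi_prod P Q ^ Suc n = (\<Sum>a\<in>UNIV. \<Sum>l\<in>{l. length l = n}. (dual_monomial [a] P * dual_monomial [a] Q) * (dual_monomial l P * dual_monomial l Q))"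
    unfolding power_Suc Suc by (subst \<open>xi_prod P Q = _\<close>) (rule sum_product)
  also have "\<dots> = (\<Sum>(a, l)\<in>UNIV \<times> {l. length l = n}. dual_monomial (a # l) P * dual_monomial (a # l) Q)"
    unfolding sum.cartesian_product by (intro sum.cong refl) (auto simp: dual_monomial_def)
  also have "\<dots> = (\<Sum>l\<in>{l. length l = Suc n}. dual_monomial l P * dual_monomial l Q)"
    by (rule sum.reindex_bij_witness[where j="\<lambda>(a, l). a # l" and i="\<lambda>l. (hd l, tl l)"])
       (auto simp: length_Suc_conv)
  finally show ?case .
qed

lemma dual_monomial_measurable: "dual_monomial l \<in> borel_measurable gr24_borel"
proof (induction l)
  case Nil
  show ?case by (simp add: dual_monomial_def[abs_def])
next
  case (Cons a l)
  have "dual_monomial (a # l) = (\<lambda>P. (sd P $ fst a * asd P $ snd a) * dual_monomial l P)"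
    by (rule ext) (simp add: dual_monomial_def case_prod_beta)
  then show ?case using Cons measurable_dual_products(1) by simp
qed

lemma abs_dual_monomial_le:
  assumes P: "P \<in> gr24" shows "\<bar>dual_monomial l P\<bar> \<le> 1"
proof (induction l)
  case (Cons a l)
  have "norm (sd P) = 1" "norm (asd P) = 1" using sd_unit[OF P] asd_unit[OF P] by (simp_all add: norm_eq_1)
  then have "\<bar>sd P $ i\<bar> \<le> 1" "\<bar>asd P $ i\<bar> \<le> 1" for i
    using component_le_norm_cart[of "sd P" i] component_le_norm_cart[of "asd P" i] by auto
  then have "\<bar>sd P $ fst a\<bar> * \<bar>asd P $ snd a\<bar> * \<bar>dual_monomial l P\<bar> \<le> 1"
    using Cons by (intro mult_le_one) auto
  then show ?case by (simp add: dual_monomial_def case_prod_beta abs_mult mult_ac)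
qed (simp add: dual_monomial_def)

lemma integrable_gr24_bounded:
  assumes \<mu>: "\<mu> \<in> gr24_prob_measures" and f: "f \<in> borel_measurable gr24_borel" and b: "\<And>P. P \<in> gr24 \<Longrightarrow> \<bar>f P\<bar> \<le> (B::real)"
  shows "integrable \<mu> f"
proof -
  note s = gr24_prob_measures_sets[OF \<mu>]
  interpret prob_space \<mu> by (rule s(1))
  show ?thesis
    by (rule integrable_const_bound[of _ B]) (use f b s in \<open>auto cong: measurable_cong_sets\<close>)
qed

lemma integrable_gr24_pair_bounded:
  assumes \<mu>: "\<mu> \<in> gr24_prob_measures" and \<nu>: "\<nu> \<in> gr24_prob_measures"
    and f: "f \<in> borel_measurable (\<mu> \<Otimes>\<^sub>M \<nu>)" and b: "\<And>P Q. P \<in> gr24 \<Longrightarrow> Q \<in> gr24 \<Longrightarrow> \<bar>f (P, Q)\<bar> \<le> (B::real)"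
  shows "integrable (\<mu> \<Otimes>\<^sub>M \<nu>) f"
proof -
  interpret M: prob_space \<mu> by (rule gr24_prob_measures_sets[OF \<mu>])
  interpret N: prob_space \<nu> by (rule gr24_prob_measures_sets[OF \<nu>])
  interpret pair_prob_space \<mu> \<nu> ..
  show ?thesis
    by (rule P.integrable_const_bound[of _ B])
       (use f b gr24_prob_measures_sets(3)[OF \<mu>] gr24_prob_measures_sets(3)[OF \<nu>] in \<open>auto simp: space_pair_measure\<close>)
qed

lemma integral_xi_prod_power:
  assumes \<mu>: "\<mu> \<in> gr24_prob_measures" and \<nu>: "\<nu> \<in> gr24_prob_measures"
  shows "(\<integral>z. xi_prod (fst z) (snd z) ^ n \<partial>(\<mu> \<Otimes>\<^sub>M \<nu>))
     = (\<Sum>l\<in>{l. length l = n}. (\<integral>P. dual_monomial l P \<partial>\<mu>) * (\<integral>P. dual_monomial l P \<partial>\<nu>))"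
proof -
  interpret M: prob_space \<mu> by (rule gr24_prob_measures_sets[OF \<mu>])
  interpret N: prob_space \<nu> by (rule gr24_prob_measures_sets[OF \<nu>])
  interpret pair_prob_space \<mu> \<nu> ..
  have int: "integrable (\<mu> \<Otimes>\<^sub>M \<nu>) (\<lambda>z. dual_monomial l (fst z) * dual_monomial l (snd z))" for l
  proof (rule integrable_gr24_pair_bounded[OF \<mu> \<nu>, of _ 1])
    show "(\<lambda>z. dual_monomial l (fst z) * dual_monomial l (snd z)) \<in> borel_measurable (\<mu> \<Otimes>\<^sub>M \<nu>)"
      by (intro borel_measurable_times measurable_compose[OF _ dual_monomial_measurable] measurable_gr24_pair \<mu> \<nu>)
    show "\<bar>dual_monomial l (fst (P, Q)) * dual_monomial l (snd (P, Q))\<bar> \<le> 1" if "P \<in> gr24" "Q \<in> gr24" for P Q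
      using that abs_dual_monomial_le by (simp add: abs_mult mult_le_one)
  qed
  have "(\<integral>z. xi_prod (fst z) (snd z) ^ n \<partial>(\<mu> \<Otimes>\<^sub>M \<nu>))
     = (\<Sum>l\<in>{l. length l = n}. (\<integral>z. dual_monomial l (fst z) * dual_monomial l (snd z) \<partial>(\<mu> \<Otimes>\<^sub>M \<nu>)))"
    unfolding xi_prod_power using int by (intro Bochner_Integration.integral_sum) auto
  also have "\<dots> = (\<Sum>l\<in>{l. length l = n}. (\<integral>P. dual_monomial l P \<partial>\<mu>) * (\<integral>P. dual_monomial l P \<partial>\<nu>))"
    by (intro sum.cong refl, subst integral_fst'[symmetric, OF int]) simp
  finally show ?thesis .
qed

text \<open>The potential of an invariant measure is constant, so its mixed energy with any
  probability measure equals its own energy.\<close>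

lemma integral_xi_prod_power_invariant:
  assumes \<sigma>: "\<sigma> \<in> gr24_prob_measures" and inv: "O4_invariant \<sigma>"
    and \<mu>: "\<mu> \<in> gr24_prob_measures"
  shows "(\<integral>z. xi_prod (fst z) (snd z) ^ n \<partial>(\<sigma> \<Otimes>\<^sub>M \<mu>)) = (\<integral>z. xi_prod (fst z) (snd z) ^ n \<partial>(\<sigma> \<Otimes>\<^sub>M \<sigma>))"
proof -
  obtain P0 where P0: "P0 \<in> gr24" using gr24_nonempty by auto
  have c: "(\<integral>P. xi_prod P Q ^ n \<partial>\<sigma>) = (\<integral>P. xi_prod P P0 ^ n \<partial>\<sigma>)" if Q: "Q \<in> gr24" for Q
  proof -
    interpret S: prob_space \<sigma> by (rule gr24_prob_measures_sets[OF \<sigma>])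
    note s = gr24_prob_measures_sets[OF \<sigma>]
    have b: "\<bar>xi_prod P R ^ n\<bar> \<le> 1" if "P \<in> gr24" "R \<in> gr24" for P R
      using xi_formula(6)[OF that] by (simp add: power_abs power_le_one)
    have m: "(\<lambda>P. xi_prod P R ^ n) \<in> borel_measurable gr24_borel" if "R \<in> gr24" for R
      using that by (intro borel_measurable_power measurable_xi_prod) auto
    \<comment> \<open>The powers have absolute value at most 1. Adding 1 makes the integrand
      nonnegative, as the constancy of zonal integrals is stated for nonnegative integrands.\<close>
    have e: "ennreal (1 + (\<integral>P. xi_prod P R ^ n \<partial>\<sigma>)) = (\<integral>\<^sup>+P. (\<lambda>z. ennreal (1 + fst z ^ n)) (xi_prod P R, xi_mean_sq P R) \<partial>\<sigma>)"
      and ge: "0 \<le> 1 + (\<integral>P. xi_prod P R ^ n \<partial>\<sigma>)" if R: "R \<in> gr24" for R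
    proof -
      have int: "integrable \<sigma> (\<lambda>P. xi_prod P R ^ n)"
        by (rule integrable_gr24_bounded[OF \<sigma> m[OF R], of 1]) (use b R in auto)
      have nn: "AE P in \<sigma>. 0 \<le> 1 + xi_prod P R ^ n"
      proof (rule AE_I2)
        fix P assume "P \<in> space \<sigma>"
        then have "\<bar>xi_prod P R ^ n\<bar> \<le> 1" using b[OF _ R] s(3) by simp
        then show "0 \<le> 1 + xi_prod P R ^ n" by linarith
      qed
      have "(\<integral>P. 1 + xi_prod P R ^ n \<partial>\<sigma>) = 1 + (\<integral>P. xi_prod P R ^ n \<partial>\<sigma>)"
        using int by (simp add: S.prob_space)
      then show "ennreal (1 + (\<integral>P. xi_prod P R ^ n \<partial>\<sigma>)) = (\<integral>\<^sup>+P. (\<lambda>z. ennreal (1 + fst z ^ n)) (xi_prod P R, xi_mean_sq P R) \<partial>\<sigma>)"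
        "0 \<le> 1 + (\<integral>P. xi_prod P R ^ n \<partial>\<sigma>)"
        using nn_integral_eq_integral[OF _ nn] int integral_nonneg_AE[OF nn] by auto
    qed
    have "ennreal (1 + (\<integral>P. xi_prod P Q ^ n \<partial>\<sigma>)) = ennreal (1 + (\<integral>P. xi_prod P P0 ^ n \<partial>\<sigma>))"
      unfolding e[OF Q] e[OF P0] by (rule zonal_integral_const[OF \<sigma> inv _ P0 Q]) measurable
    then show ?thesis using ge[OF Q] ge[OF P0] by simp
  qed
  have "(\<integral>z. xi_prod (fst z) (snd z) ^ n \<partial>(\<sigma> \<Otimes>\<^sub>M \<nu>)) = (\<integral>P. xi_prod P P0 ^ n \<partial>\<sigma>)" if \<nu>: "\<nu> \<in> gr24_prob_measures" for \<nu>
  proof -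
    interpret M: prob_space \<sigma> by (rule gr24_prob_measures_sets[OF \<sigma>])
    interpret N: prob_space \<nu> by (rule gr24_prob_measures_sets[OF \<nu>])
    interpret pair_prob_space \<sigma> \<nu> ..
    have "integrable (\<sigma> \<Otimes>\<^sub>M \<nu>) (\<lambda>z. xi_prod (fst z) (snd z) ^ n)"
      by (rule integrable_gr24_pair_bounded[OF \<sigma> \<nu>, of _ 1])
         (use xi_formula(6) in \<open>auto simp: power_abs power_le_one intro!: borel_measurable_power measurable_xi_prod measurable_gr24_pair \<sigma> \<nu>\<close>)
    then have "(\<integral>z. xi_prod (fst z) (snd z) ^ n \<partial>(\<sigma> \<Otimes>\<^sub>M \<nu>)) = (\<integral>Q. (\<integral>P. xi_prod P Q ^ n \<partial>\<sigma>) \<partial>\<nu>)"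
      by (subst integral_snd[where f="\<lambda>P Q. xi_prod P Q ^ n"]) (simp_all add: case_prod_unfold)
    also have "\<dots> = (\<integral>Q. (\<integral>P. xi_prod P P0 ^ n \<partial>\<sigma>) \<partial>\<nu>)"
      by (intro Bochner_Integration.integral_cong refl c) (simp add: gr24_prob_measures_sets(3)[OF \<nu>])
    finally show ?thesis by (simp add: N.prob_space)
  qed
  then show ?thesis using \<mu> \<sigma> by simp
qed

text \<open>The sum of the squared differences of the moments of the two measures is nonnegative,
  and its cross term equals the energy of the invariant measure.\<close>

lemma xi_prod_power_energy_ge:
  assumes \<sigma>: "\<sigma> \<in> gr24_prob_measures" and inv: "O4_invariant \<sigma>" and \<mu>: "\<mu> \<in> gr24_prob_measures"
  shows "(\<integral>z. xi_prod (fst z) (snd z) ^ n \<partial>(\<sigma> \<Otimes>\<^sub>M \<sigma>)) \<le> (\<integral>z. xi_prod (fst z) (snd z) ^ n \<partial>(\<mu> \<Otimes>\<^sub>M \<mu>))"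
proof -
  define a where "a = (\<lambda>\<nu> l. \<integral>P. dual_monomial l P \<partial>\<nu>)"
  define I :: "(3 \<times> 3) list set" where "I = {l. length l = n}"
  have 1: "(\<Sum>l\<in>I. a \<sigma> l * a \<mu> l) = (\<Sum>l\<in>I. a \<sigma> l * a \<sigma> l)"
    using integral_xi_prod_power_invariant[OF \<sigma> inv \<mu>, of n]
    unfolding integral_xi_prod_power[OF \<sigma> \<mu>] integral_xi_prod_power[OF \<sigma> \<sigma>] by (simp add: a_def I_def)
  have "0 \<le> (\<Sum>l\<in>I. (a \<mu> l - a \<sigma> l)\<^sup>2)" by (intro sum_nonneg) auto
  also have "\<dots> = (\<Sum>l\<in>I. a \<mu> l * a \<mu> l) - 2 * (\<Sum>l\<in>I. a \<sigma> l * a \<mu> l) + (\<Sum>l\<in>I. a \<sigma> l * a \<sigma> l)"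
    by (simp add: power2_eq_square algebra_simps sum.distrib sum_subtractf sum_distrib_left)
  finally show ?thesis
    unfolding 1 integral_xi_prod_power[OF \<mu> \<mu>] integral_xi_prod_power[OF \<sigma> \<sigma>] by (simp add: a_def I_def)
qed

text \<open>The binomial series of (1 - r t)^(-s/2) has nonnegative coefficients. For r < 1 it is
  dominated on |t| \<le> 1 by its value at t = 1, so termwise integration is legitimate for every
  probability measure, and the inequality holds term by term.\<close>

lemma abel_kernel_energy_ge:
  assumes \<sigma>: "\<sigma> \<in> gr24_prob_measures" and inv: "O4_invariant \<sigma>" and \<mu>: "\<mu> \<in> gr24_prob_measures"
    and s: "0 < s" and r: "0 < r" "r < 1"
  shows "(\<integral>\<^sup>+P. (\<integral>\<^sup>+Q. ennreal ((1 - r * xi_prod P Q) powr (- (s / 2))) \<partial>\<sigma>) \<partial>\<sigma>)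
     \<le> (\<integral>\<^sup>+P. (\<integral>\<^sup>+Q. ennreal ((1 - r * xi_prod P Q) powr (- (s / 2))) \<partial>\<mu>) \<partial>\<mu>)"
proof -
  define c where "c = (\<lambda>n. pochhammer (s / 2) n / fact n * r ^ n)"
  have c0: "0 \<le> c n" for n using s r by (simp add: c_def pochhammer_nonneg)
  have ser: "(\<lambda>n. c n * t ^ n) sums ((1 - r * t) powr (- (s / 2)))" if "\<bar>t\<bar> \<le> 1" for t
  proof -
    have "\<bar>r * t\<bar> \<le> r" using that r by (simp add: abs_mult mult_left_le)
    then have "\<bar>- (r * t)\<bar> < 1" using r by simp
    from gen_binomial_real[OF this, of "- (s / 2)"]
    have "(\<lambda>n. ((- (s / 2)) gchoose n) * (- (r * t)) ^ n) sums ((1 - r * t) powr (- (s / 2)))" by simp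
    moreover have "((- (s / 2)) gchoose n) * (- (r * t)) ^ n = c n * t ^ n" for n
    proof -
      have "(- (r * t)) ^ n = (- 1) ^ n * (r ^ n * t ^ n)"
        by (subst power_mult_distrib[symmetric])+ simp
      then show ?thesis unfolding gbinomial_pochhammer c_def by (simp add: mult_ac power_mult_distrib[symmetric])
    qed
    ultimately show ?thesis by simp
  qed
  have sumc: "summable c" using sums_summable[OF ser[of 1]] by simp
  have E: "(\<integral>\<^sup>+P. (\<integral>\<^sup>+Q. ennreal ((1 - r * xi_prod P Q) powr (- (s / 2))) \<partial>\<nu>) \<partial>\<nu>)
      = ennreal (\<Sum>n. c n * (\<integral>z. xi_prod (fst z) (snd z) ^ n \<partial>(\<nu> \<Otimes>\<^sub>M \<nu>)))"
    and S: "summable (\<lambda>n. c n * (\<integral>z. xi_prod (fst z) (snd z) ^ n \<partial>(\<nu> \<Otimes>\<^sub>M \<nu>)))"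
    if \<nu>: "\<nu> \<in> gr24_prob_measures" for \<nu>
  proof -
    interpret N: prob_space \<nu> by (rule gr24_prob_measures_sets[OF \<nu>])
    interpret pair_prob_space \<nu> \<nu> ..
    note sp = gr24_prob_measures_sets(3)[OF \<nu>]
    have m: "(\<lambda>z. xi_prod (fst z) (snd z)) \<in> borel_measurable (\<nu> \<Otimes>\<^sub>M \<nu>)"
      by (intro measurable_xi_prod measurable_gr24_pair \<nu>)
    have b: "\<bar>xi_prod (fst z) (snd z)\<bar> \<le> 1" if "z \<in> space (\<nu> \<Otimes>\<^sub>M \<nu>)" for z
      using that xi_formula(6) by (auto simp: space_pair_measure sp)
    have int: "integrable (\<nu> \<Otimes>\<^sub>M \<nu>) (\<lambda>z. c n * xi_prod (fst z) (snd z) ^ n)" for n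
      by (intro integrable_mult_right integrable_gr24_pair_bounded[OF \<nu> \<nu>, of _ 1] borel_measurable_power m)
         (use xi_formula(6) in \<open>auto simp: power_abs power_le_one\<close>)
    have le: "\<bar>c n * xi_prod (fst z) (snd z) ^ n\<bar> \<le> c n" if "z \<in> space (\<nu> \<Otimes>\<^sub>M \<nu>)" for z n
      using b[OF that] c0[of n] by (simp add: abs_mult power_abs mult_left_le power_le_one)
    have AEs: "AE z in \<nu> \<Otimes>\<^sub>M \<nu>. summable (\<lambda>n. norm (c n * xi_prod (fst z) (snd z) ^ n))"
      using le by (intro AE_I2 summable_comparison_test'[OF sumc, of 0]) auto
    have Es: "summable (\<lambda>n. \<integral>z. norm (c n * xi_prod (fst z) (snd z) ^ n) \<partial>(\<nu> \<Otimes>\<^sub>M \<nu>))"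
    proof (rule summable_comparison_test'[OF sumc, of 0])
      fix n
      have "(\<integral>z. norm (c n * xi_prod (fst z) (snd z) ^ n) \<partial>(\<nu> \<Otimes>\<^sub>M \<nu>)) \<le> (\<integral>z. c n \<partial>(\<nu> \<Otimes>\<^sub>M \<nu>))"
        using le int by (intro integral_mono_AE integrable_norm AE_I2) auto
      then show "norm (\<integral>z. norm (c n * xi_prod (fst z) (snd z) ^ n) \<partial>(\<nu> \<Otimes>\<^sub>M \<nu>)) \<le> c n"
        by (simp add: P.prob_space)
    qed
    have eq: "(\<Sum>n. c n * xi_prod (fst z) (snd z) ^ n) = (1 - r * xi_prod (fst z) (snd z)) powr (- (s / 2))"
      if "z \<in> space (\<nu> \<Otimes>\<^sub>M \<nu>)" for z
      using ser[OF b[OF that]] by (simp add: sums_iff)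
    have I: "integrable (\<nu> \<Otimes>\<^sub>M \<nu>) (\<lambda>z. (1 - r * xi_prod (fst z) (snd z)) powr (- (s / 2)))"
      using integrable_suminf[OF int AEs Es] eq by (subst (asm) Bochner_Integration.integrable_cong[OF refl]) auto
    have "(\<integral>z. (1 - r * xi_prod (fst z) (snd z)) powr (- (s / 2)) \<partial>(\<nu> \<Otimes>\<^sub>M \<nu>))
        = (\<integral>z. (\<Sum>n. c n * xi_prod (fst z) (snd z) ^ n) \<partial>(\<nu> \<Otimes>\<^sub>M \<nu>))"
      by (intro Bochner_Integration.integral_cong refl) (simp add: eq)
    also have "\<dots> = (\<Sum>n. \<integral>z. c n * xi_prod (fst z) (snd z) ^ n \<partial>(\<nu> \<Otimes>\<^sub>M \<nu>))"
      by (rule integral_suminf[OF int AEs Es])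
    finally have II: "(\<integral>z. (1 - r * xi_prod (fst z) (snd z)) powr (- (s / 2)) \<partial>(\<nu> \<Otimes>\<^sub>M \<nu>))
        = (\<Sum>n. c n * (\<integral>z. xi_prod (fst z) (snd z) ^ n \<partial>(\<nu> \<Otimes>\<^sub>M \<nu>)))" by simp
    show "summable (\<lambda>n. c n * (\<integral>z. xi_prod (fst z) (snd z) ^ n \<partial>(\<nu> \<Otimes>\<^sub>M \<nu>)))"
      using summable_integral[OF int AEs Es] by simp
    have "(\<integral>\<^sup>+P. (\<integral>\<^sup>+Q. ennreal ((1 - r * xi_prod P Q) powr (- (s / 2))) \<partial>\<nu>) \<partial>\<nu>)
        = (\<integral>\<^sup>+z. ennreal ((1 - r * xi_prod (fst z) (snd z)) powr (- (s / 2))) \<partial>(\<nu> \<Otimes>\<^sub>M \<nu>))"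
      using N.nn_integral_fst[OF measurable_compose[OF borel_measurable_integrable[OF I] measurable_ennreal]] by simp
    then show "(\<integral>\<^sup>+P. (\<integral>\<^sup>+Q. ennreal ((1 - r * xi_prod P Q) powr (- (s / 2))) \<partial>\<nu>) \<partial>\<nu>)
      = ennreal (\<Sum>n. c n * (\<integral>z. xi_prod (fst z) (snd z) ^ n \<partial>(\<nu> \<Otimes>\<^sub>M \<nu>)))"
      using nn_integral_eq_integral[OF I] II by simp
  qed
  show ?thesis
    unfolding E[OF \<sigma>] E[OF \<mu>]
    by (intro ennreal_leI suminf_le S[OF \<sigma>] S[OF \<mu>] mult_left_mono xi_prod_power_energy_ge[OF \<sigma> inv \<mu>] c0)
qed

text \<open>The regularisation is removed from both sides. Since 1 - r t \<ge> r (1 - t), the energy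
  of the regularised kernel for the competitor is at most r^(-s/2) times its Riesz energy; for the
  uniform measure Fatou's lemma gives the limit r to 1. Infinite energy of the competitor is
  trivial.\<close>

lemma uniform_energy_le:
  assumes \<sigma>: "\<sigma> \<in> gr24_prob_measures" and inv: "O4_invariant \<sigma>" and \<mu>: "\<mu> \<in> gr24_prob_measures" and s: "0 < s"
  shows "uniform_energy s \<le> (\<integral>\<^sup>+P. (\<integral>\<^sup>+Q. riesz_kernel s P Q \<partial>\<mu>) \<partial>\<mu>)" (is "_ \<le> ?C")
proof (cases "?C = \<infinity>")
  case False
  define r where "r = (\<lambda>j::nat. 1 - 1 / (real j + 2))"
  have r: "0 < r j" "r j < 1" for j by (auto simp: r_def field_simps)
  have rl: "r \<longlonglongrightarrow> 1" unfolding r_def by real_asymp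
  define k where "k = (\<lambda>j t. ennreal ((1 - r j * t) powr (- (s / 2))))"
  have [measurable]: "k j \<in> borel_measurable borel" for j unfolding k_def by measurable
  interpret S: prob_space \<sigma> by (rule gr24_prob_measures_sets[OF \<sigma>])
  interpret M: prob_space \<mu> by (rule gr24_prob_measures_sets[OF \<mu>])
  have k_le: "k j t \<le> ennreal (r j powr (- (s / 2))) * riesz_profile s t" if "\<bar>t\<bar> \<le> 1" for j t
  proof (cases "t = 1")
    case True
    then show ?thesis using r[of j] s by (simp add: riesz_profile_def ennreal_mult_top)
  next
    case False
    then have t: "t < 1" using that by auto
    have "r j * (1 - t) \<le> 1 - r j * t" using r[of j] by (simp add: algebra_simps)
    then have "(1 - r j * t) powr (- (s / 2)) \<le> (r j * (1 - t)) powr (- (s / 2))"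
      using s r[of j] t by (intro powr_mono2') auto
    also have "\<dots> = r j powr (- (s / 2)) * (1 - t) powr (- (s / 2))"
      using r[of j] t by (simp add: powr_mult)
    finally show ?thesis using t by (simp add: k_def riesz_profile_less_1 ennreal_mult[symmetric] ennreal_leI)
  qed
  have Z: "(\<integral>\<^sup>+P. (\<integral>\<^sup>+Q. k j (xi_prod P Q) \<partial>\<sigma>) \<partial>\<sigma>) = square_mean (\<lambda>(x, y). k j (x * y))" for j
  proof -
    have sym: "xi_prod P Q = xi_prod Q P" for P Q by (simp add: xi_prod_def inner_commute)
    have "(\<integral>\<^sup>+Q. k j (xi_prod P Q) \<partial>\<sigma>) = square_mean (\<lambda>(x, y). k j (x * y))" if P: "P \<in> gr24" for P
      using zonal_integral_square_mean[OF \<sigma> inv _ P, of "\<lambda>z. k j (fst z)"] by (simp add: sym[of P])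
    then have "(\<integral>\<^sup>+P. (\<integral>\<^sup>+Q. k j (xi_prod P Q) \<partial>\<sigma>) \<partial>\<sigma>) = (\<integral>\<^sup>+P. square_mean (\<lambda>(x, y). k j (x * y)) \<partial>\<sigma>)"
      by (intro nn_integral_cong) (simp add: gr24_prob_measures_sets(3)[OF \<sigma>])
    then show ?thesis by (simp add: S.emeasure_space_1)
  qed
  have le: "square_mean (\<lambda>(x, y). k j (x * y)) \<le> ennreal (r j powr (- (s / 2))) * ?C" for j
  proof -
    have "square_mean (\<lambda>(x, y). k j (x * y)) \<le> (\<integral>\<^sup>+P. (\<integral>\<^sup>+Q. k j (xi_prod P Q) \<partial>\<mu>) \<partial>\<mu>)"
      using abel_kernel_energy_ge[OF \<sigma> inv \<mu> s r(1)[of j] r(2)[of j]] Z[of j] by (simp add: k_def)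
    also have "\<dots> \<le> (\<integral>\<^sup>+P. (\<integral>\<^sup>+Q. ennreal (r j powr (- (s / 2))) * riesz_profile s (xi_prod P Q) \<partial>\<mu>) \<partial>\<mu>)"
      using gr24_prob_measures_sets(3)[OF \<mu>] by (intro nn_integral_mono k_le xi_formula(6)) auto
    also have "\<dots> = ennreal (r j powr (- (s / 2))) * (\<integral>\<^sup>+P. (\<integral>\<^sup>+Q. riesz_profile s (xi_prod P Q) \<partial>\<mu>) \<partial>\<mu>)"
    proof -
      have m: "(\<lambda>z. riesz_profile s (xi_prod (fst z) (snd z))) \<in> borel_measurable (\<mu> \<Otimes>\<^sub>M \<mu>)"
        by (intro measurable_compose[OF _ riesz_profile_measurable] measurable_xi_prod measurable_gr24_pair \<mu>)
      have "(\<lambda>P. \<integral>\<^sup>+Q. riesz_profile s (xi_prod P Q) \<partial>\<mu>) \<in> borel_measurable \<mu>"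
        using M.borel_measurable_nn_integral_fst[OF m] by simp
      moreover have "(\<lambda>Q. riesz_profile s (xi_prod P Q)) \<in> borel_measurable \<mu>" if "P \<in> space \<mu>" for P
        using measurable_compose[OF measurable_Pair1'[OF that] m] by simp
      ultimately show ?thesis by (simp add: nn_integral_cmult cong: nn_integral_cong)
    qed
    also have "(\<integral>\<^sup>+P. (\<integral>\<^sup>+Q. riesz_profile s (xi_prod P Q) \<partial>\<mu>) \<partial>\<mu>) = ?C"
      by (intro nn_integral_cong) (simp add: gr24_prob_measures_sets(3)[OF \<mu>] riesz_kernel_eq)
    finally show ?thesis .
  qed
  have lim: "(\<lambda>j. ennreal (r j powr (- (s / 2))) * ?C) \<longlonglongrightarrow> ?C"
  proof -
    have "(\<lambda>j. ennreal (r j powr (- (s / 2)))) \<longlonglongrightarrow> ennreal (1 powr (- (s / 2)))"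
      by (intro tendsto_ennrealI tendsto_powr rl tendsto_const) auto
    then have "(\<lambda>j. ennreal (r j powr (- (s / 2))) * ?C) \<longlonglongrightarrow> ennreal (1 powr (- (s / 2))) * ?C"
      using False by (intro tendsto_mult_ennreal tendsto_const) auto
    then show ?thesis by simp
  qed
  define h where "h = (\<lambda>j z. indicator ({-1<..<1} \<times> {-1<..<1}) z * k j (fst z * snd z))"
  have [measurable]: "h j \<in> borel_measurable borel" for j
    unfolding h_def by (intro borel_measurable_times_ennreal indicator_square_measurable) measurable
  have "uniform_energy s = (\<integral>\<^sup>+z. liminf (\<lambda>j. h j z) \<partial>lborel) / 4"
    unfolding uniform_energy_def square_mean_def
  proof (intro arg_cong2[where f="(/)"] refl nn_integral_cong)
    fix z :: "real \<times> real"
    obtain x y where z: "z = (x, y)" by force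
    have "(\<lambda>j. h j z) \<longlonglongrightarrow> indicator ({-1<..<1} \<times> {-1<..<1}) z * (case z of (x, y) \<Rightarrow> ennreal ((1 - x * y) powr (- (s / 2))))"
    proof (cases "z \<in> {-1<..<1} \<times> {-1<..<1}")
      case True
      then have "x * y < 1" by (intro abs_mult_less_1) (auto simp: z)
      then have "(\<lambda>j. (1 - r j * (x * y)) powr (- (s / 2))) \<longlonglongrightarrow> (1 - 1 * (x * y)) powr (- (s / 2))"
        by (intro tendsto_intros rl) auto
      then show ?thesis using True by (simp add: h_def k_def z tendsto_ennrealI)
    qed (simp add: h_def)
    then show "indicator ({-1<..<1} \<times> {-1<..<1}) z * (case z of (x, y) \<Rightarrow> ennreal ((1 - x * y) powr (- (s / 2)))) = liminf (\<lambda>j. h j z)"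
      by (intro lim_imp_Liminf[symmetric]) auto
  qed
  also have "\<dots> \<le> liminf (\<lambda>j. \<integral>\<^sup>+z. h j z \<partial>lborel) / 4"
    by (intro divide_right_mono_ennreal nn_integral_liminf) auto
  also have "\<dots> \<le> ?C"
  proof -
    have "4 * (ennreal (r j powr (- (s / 2))) * ?C) \<ge> (\<integral>\<^sup>+z. h j z \<partial>lborel)" for j
    proof -
      have "(\<integral>\<^sup>+z. h j z \<partial>lborel) / 4 \<le> ennreal (r j powr (- (s / 2))) * ?C"
        using le[of j] by (simp add: square_mean_def h_def case_prod_beta)
      then have "4 * ((\<integral>\<^sup>+z. h j z \<partial>lborel) / 4) \<le> 4 * (ennreal (r j powr (- (s / 2))) * ?C)"
        by (rule mult_left_mono) simp
      moreover have "4 * ((\<integral>\<^sup>+z. h j z \<partial>lborel) / 4) = (\<integral>\<^sup>+z. h j z \<partial>lborel)"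
        using mult_divide_eq_ennreal[of 4 "\<integral>\<^sup>+z. h j z \<partial>lborel"] by (simp add: ennreal_times_divide mult.commute)
      ultimately show ?thesis by simp
    qed
    then have "liminf (\<lambda>j. \<integral>\<^sup>+z. h j z \<partial>lborel) \<le> liminf (\<lambda>j. 4 * (ennreal (r j powr (- (s / 2))) * ?C))"
      by (intro Liminf_mono) auto
    also have "\<dots> = 4 * ?C"
      using lim False by (intro lim_imp_Liminf ennreal_tendsto_cmult) auto
    finally have "liminf (\<lambda>j. \<integral>\<^sup>+z. h j z \<partial>lborel) / 4 \<le> 4 * ?C / 4"
      by (rule divide_right_mono_ennreal)
    moreover have "4 * ?C / 4 = ?C" by (subst mult.commute) (rule mult_divide_eq_ennreal; simp)
    ultimately show ?thesis by (simp only:)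
  qed
  finally show ?thesis .
qed simp

lemma wiener_const_eq:
  assumes \<sigma>: "\<sigma> \<in> gr24_prob_measures" and inv: "O4_invariant \<sigma>" and s: "0 < s"
  shows "wiener_const s = uniform_energy s"
  unfolding wiener_const_def
proof (rule antisym)
  show "(INF \<mu>\<in>gr24_prob_measures. \<integral>\<^sup>+P. (\<integral>\<^sup>+Q. riesz_kernel s P Q \<partial>\<mu>) \<partial>\<mu>) \<le> uniform_energy s"
    by (rule INF_lower2[OF \<sigma>]) (simp add: riesz_energy_uniform[OF \<sigma> inv])
  show "uniform_energy s \<le> (INF \<mu>\<in>gr24_prob_measures. \<integral>\<^sup>+P. (\<integral>\<^sup>+Q. riesz_kernel s P Q \<partial>\<mu>) \<partial>\<mu>)"
    by (rule INF_greatest) (rule uniform_energy_le[OF \<sigma> inv _ s])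
qed

section \<open>The second intensity of the harmonic ensemble\<close>

lemma det_mat_2: "Determinant.det (Matrix.mat 2 2 f) = f (0, 0) * f (1, 1) - f (0, 1) * f (1, 0)"
  for f :: "nat \<times> nat \<Rightarrow> real"
proof -
  have "{0..<2::nat} = {0, 1}" by auto
  then have "{p. p permutes {0..<2::nat}} = {id, Transposition.transpose 0 1}"
    by (auto simp: permutes_doubleton_iff)
  moreover have "id \<noteq> Transposition.transpose 0 (1::nat)"
    by (metis id_apply transpose_apply_first zero_neq_one)
  ultimately show ?thesis
    by (subst Determinant.det_def'[of _ 2]) (auto simp: sign_swap_id numeral_2_eq_2)
qed

lemma harmonic_kernel_eq: "harmonic_kernel k P Q = harmonic_poly k (xi_plus P Q) (xi_minus P Q)"
  by (simp add: harmonic_kernel_def harmonic_poly_def)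

text \<open>The argument is the pair of \<open>xi_prod\<close> and \<open>xi_mean_sq\<close>. The
  two roots recovered from it make the harmonic kernel a Borel function of measurable
  invariants.\<close>

definition harmonic_profile :: "nat \<Rightarrow> real \<times> real \<Rightarrow> real" where
  "harmonic_profile k z = harmonic_poly k (sqrt (snd z) - sqrt (snd z - fst z)) (sqrt (snd z) + sqrt (snd z - fst z))"

lemma harmonic_profile_measurable [measurable]: "harmonic_profile k \<in> borel_measurable borel"
  unfolding harmonic_profile_def by measurable

lemma harmonic_kernel_profile:
  "P \<in> gr24 \<Longrightarrow> Q \<in> gr24 \<Longrightarrow> harmonic_kernel k P Q = harmonic_profile k (xi_prod P Q, xi_mean_sq P Q)"
  by (simp add: harmonic_kernel_eq harmonic_profile_def xi_formula)

text \<open>The two roots are the minimum and maximum of x and y, up to a common sign. The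
  polynomial is symmetric and invariant under changing both signs, so order and sign do not
  matter.\<close>

lemma harmonic_profile_square:
  "harmonic_profile k (x * y, ((x + y) / 2)\<^sup>2) = harmonic_poly k x y"
proof -
  have "((x + y) / 2)\<^sup>2 - x * y = ((x - y) / 2)\<^sup>2" by (simp add: power2_eq_square field_simps)
  then have "harmonic_profile k (x * y, ((x + y) / 2)\<^sup>2) = harmonic_poly k (\<bar>x + y\<bar> / 2 - \<bar>x - y\<bar> / 2) (\<bar>x + y\<bar> / 2 + \<bar>x - y\<bar> / 2)"
    by (simp add: harmonic_profile_def real_sqrt_abs)
  moreover consider "x + y \<ge> 0" "x \<ge> y" | "x + y \<ge> 0" "x < y" | "x + y < 0" "x \<ge> y" | "x + y < 0" "x < y" by linarith
  then have "harmonic_poly k (\<bar>x + y\<bar> / 2 - \<bar>x - y\<bar> / 2) (\<bar>x + y\<bar> / 2 + \<bar>x - y\<bar> / 2) = harmonic_poly k x y"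
  proof cases
    case 1
    then have "\<bar>x + y\<bar> / 2 - \<bar>x - y\<bar> / 2 = y" "\<bar>x + y\<bar> / 2 + \<bar>x - y\<bar> / 2 = x" by (auto simp: abs_if field_simps)
    then show ?thesis by (simp add: harmonic_poly_commute)
  next
    case 2
    then have "\<bar>x + y\<bar> / 2 - \<bar>x - y\<bar> / 2 = x" "\<bar>x + y\<bar> / 2 + \<bar>x - y\<bar> / 2 = y" by (auto simp: abs_if field_simps)
    then show ?thesis by simp
  next
    case 3
    then have "\<bar>x + y\<bar> / 2 - \<bar>x - y\<bar> / 2 = - x" "\<bar>x + y\<bar> / 2 + \<bar>x - y\<bar> / 2 = - y" by (auto simp: abs_if field_simps)
    then show ?thesis by (simp add: harmonic_poly_minus)
  next
    case 4
    then have "\<bar>x + y\<bar> / 2 - \<bar>x - y\<bar> / 2 = - y" "\<bar>x + y\<bar> / 2 + \<bar>x - y\<bar> / 2 = - x" by (auto simp: abs_if field_simps)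
    then show ?thesis by (simp add: harmonic_poly_minus harmonic_poly_commute)
  qed
  ultimately show ?thesis by simp
qed

lemma sum_pairs_distinct:
  assumes "finite X"
  shows "(\<Sum>p\<in>{p \<in> {..<2::nat} \<rightarrow>\<^sub>E X. inj_on p {..<2}}. f (p 0) (p 1)) = (\<Sum>P\<in>X. \<Sum>Q\<in>X - {P}. f P Q)"
proof -
  have "(\<Sum>P\<in>X. \<Sum>Q\<in>X - {P}. f P Q) = (\<Sum>z\<in>Sigma X (\<lambda>P. X - {P}). f (fst z) (snd z))"
    using assms by (subst sum.Sigma) (auto simp: case_prod_beta)
  also have "\<dots> = (\<Sum>p\<in>{p \<in> {..<2::nat} \<rightarrow>\<^sub>E X. inj_on p {..<2}}. f (p 0) (p 1))"
  \<comment> \<open>The value \<open>undefined\<close> is forced outside {0, 1}, since the elements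
    of the function space are extensional.\<close>
  proof (rule sum.reindex_bij_witness[where i="\<lambda>p. (p 0, p 1)" and j="\<lambda>z n. if n = 0 then fst z else if n = 1 then snd z else undefined"])
    fix p :: "nat \<Rightarrow> _" assume p: "p \<in> {p \<in> {..<2::nat} \<rightarrow>\<^sub>E X. inj_on p {..<2}}"
    show "(\<lambda>n. if n = 0 then fst (p 0, p 1) else if n = 1 then snd (p 0, p 1) else undefined) = p"
      using p by (auto simp: fun_eq_iff PiE_def extensional_def)
    have "p 0 \<noteq> p 1"
    proof
      assume eq: "p 0 = p 1"
      have "inj_on p {..<2}" using p by simp
      from inj_onD[OF this eq] show False by simp
    qed
    then show "(p 0, p 1) \<in> Sigma X (\<lambda>P. X - {P})" using p by (auto simp: PiE_def Pi_def)
  next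
    fix z assume z: "z \<in> Sigma X (\<lambda>P. X - {P})"
    have *: "n < 2 \<longleftrightarrow> n = 0 \<or> n = 1" for n :: nat by auto
    show "(\<lambda>n. if n = 0 then fst z else if n = 1 then snd z else undefined) \<in> {p \<in> {..<2::nat} \<rightarrow>\<^sub>E X. inj_on p {..<2}}"
      using z by (auto simp: PiE_def Pi_def extensional_def inj_on_def *)
  qed auto
  finally show ?thesis by simp
qed

text \<open>The energy is a sum over injective pairs of points, so only the intensity of order 2
  enters. Its density, the squared dimension minus the squared kernel, depends on the two invariants
  alone, and the double integral collapses to a mean over the square.\<close>

lemma expected_riesz_energy:
  fixes M :: "'w measure"
  assumes \<sigma>: "\<sigma> \<in> gr24_prob_measures" and inv: "O4_invariant \<sigma>"
    and ens: "harmonic_ensemble \<sigma> k M X"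
  shows "(\<integral>\<^sup>+\<omega>. riesz_energy s (X \<omega>) \<partial>M)
    = square_mean (\<lambda>(x, y). ennreal ((1 - x * y) powr (- (s / 2))) * ennreal ((real (harmonic_dim k))\<^sup>2 - (harmonic_poly k x y)\<^sup>2))"
proof -
  note sp = gr24_prob_measures_sets[OF \<sigma>]
  interpret S: prob_space \<sigma> by (rule sp(1))
  interpret pair_prob_space \<sigma> \<sigma> ..
  interpret product_sigma_finite "\<lambda>_::nat. \<sigma>" ..
  have rfs: "random_finite_subset M X" and
    ji: "joint_intensity \<sigma> M X 2 (\<lambda>p. Determinant.det (Matrix.mat 2 2 (\<lambda>(i, j). harmonic_kernel k (p i) (p j))))"
    using ens by (auto simp: harmonic_ensemble_def determinantal_process_def)
  define G where "G = (\<lambda>z. riesz_profile s (fst z) * ennreal ((real (harmonic_dim k))\<^sup>2 - (harmonic_profile k z)\<^sup>2))"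
  have [measurable]: "G \<in> borel_measurable borel"
  proof -
    have "fst \<in> borel_measurable (borel :: (real \<times> real) measure)" by measurable
    then show ?thesis unfolding G_def by measurable
  qed
  have mf: "(\<lambda>p. p i) \<in> measurable (PiM {..<2} (\<lambda>_. \<sigma>)) gr24_borel" if "i < 2" for i :: nat
    using measurable_component_singleton[of i "{..<2}" "\<lambda>_. \<sigma>"] that by (simp cong: measurable_cong_sets add: sp(2))
  define f where "f = (\<lambda>p :: nat \<Rightarrow> (real^4) set. riesz_profile s (xi_prod (p 0) (p 1)))"
  have f: "f \<in> borel_measurable (PiM {..<2} (\<lambda>_. \<sigma>))"
    unfolding f_def by (intro measurable_compose[OF _ riesz_profile_measurable] measurable_xi_prod mf) auto
  have "(\<integral>\<^sup>+\<omega>. riesz_energy s (X \<omega>) \<partial>M) = (\<integral>\<^sup>+\<omega>. (\<Sum>p\<in>{p \<in> {..<2} \<rightarrow>\<^sub>E X \<omega>. inj_on p {..<2}}. f p) \<partial>M)"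
  proof (rule nn_integral_cong)
    fix \<omega> assume "\<omega> \<in> space M"
    then have X: "finite (X \<omega>)" "X \<omega> \<subseteq> gr24" using rfs by (auto simp: random_finite_subset_def)
    have "riesz_energy s (X \<omega>) = (\<Sum>P\<in>X \<omega>. \<Sum>Q\<in>X \<omega> - {P}. riesz_profile s (xi_prod P Q))"
      unfolding riesz_energy_def using X(2) by (intro sum.cong refl riesz_kernel_eq) auto
    also have "\<dots> = (\<Sum>p\<in>{p \<in> {..<2} \<rightarrow>\<^sub>E X \<omega>. inj_on p {..<2}}. f p)"
      unfolding f_def by (rule sum_pairs_distinct[symmetric, OF X(1)])
    finally show "riesz_energy s (X \<omega>) = (\<Sum>p\<in>{p \<in> {..<2} \<rightarrow>\<^sub>E X \<omega>. inj_on p {..<2}}. f p)" .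
  qed
  also have "\<dots> = (\<integral>\<^sup>+p. f p * ennreal (Determinant.det (Matrix.mat 2 2 (\<lambda>(i, j). harmonic_kernel k (p i) (p j)))) \<partial>PiM {..<2} (\<lambda>_. \<sigma>))"
    using ji f unfolding joint_intensity_def by blast
  also have "\<dots> = (\<integral>\<^sup>+p. (\<lambda>P Q. G (xi_prod P Q, xi_mean_sq P Q)) (p 0) (p 1) \<partial>PiM {..<2::nat} (\<lambda>_. \<sigma>))"
  proof (rule nn_integral_cong)
    fix p assume "p \<in> space (PiM {..<2::nat} (\<lambda>_. \<sigma>))"
    then have p: "p 0 \<in> gr24" "p 1 \<in> gr24" by (auto simp: space_PiM sp(3) PiE_def Pi_def)
    have d: "harmonic_kernel k P P = real (harmonic_dim k)" if "P \<in> gr24" for P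
      using that by (simp add: harmonic_kernel_eq xi_self harmonic_poly_1_1)
    have sym: "harmonic_kernel k (p 1) (p 0) = harmonic_kernel k (p 0) (p 1)"
      using p by (simp add: harmonic_kernel_profile xi_prod_def xi_mean_sq_def inner_commute)
    show "f p * ennreal (Determinant.det (Matrix.mat 2 2 (\<lambda>(i, j). harmonic_kernel k (p i) (p j)))) = G (xi_prod (p 0) (p 1), xi_mean_sq (p 0) (p 1))"
      unfolding det_mat_2 prod.case d[OF p(1)] d[OF p(2)] sym
      using p by (simp add: f_def G_def harmonic_kernel_profile power2_eq_square)
  qed
  also have "{..<2::nat} = {0, 1}" by auto
  also have "(\<integral>\<^sup>+p. (\<lambda>P Q. G (xi_prod P Q, xi_mean_sq P Q)) (p 0) (p 1) \<partial>PiM {0, 1::nat} (\<lambda>_. \<sigma>))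
     = (\<integral>\<^sup>+z. (\<lambda>P Q. G (xi_prod P Q, xi_mean_sq P Q)) (fst z) (snd z) \<partial>(\<sigma> \<Otimes>\<^sub>M \<sigma>))"
  proof (rule product_nn_integral_pair)
    show "(\<lambda>(P, Q). G (xi_prod P Q, xi_mean_sq P Q)) \<in> borel_measurable (\<sigma> \<Otimes>\<^sub>M \<sigma>)"
      unfolding case_prod_beta
      by (intro measurable_compose[OF _ \<open>G \<in> _\<close>] borel_measurable_Pair measurable_xi_prod measurable_xi_mean_sq measurable_gr24_pair \<sigma>)
  qed simp
  also have "\<dots> = (\<integral>\<^sup>+Q. (\<integral>\<^sup>+P. G (xi_prod P Q, xi_mean_sq P Q) \<partial>\<sigma>) \<partial>\<sigma>)"
  proof -
    have "(\<lambda>z. G (xi_prod (fst z) (snd z), xi_mean_sq (fst z) (snd z))) \<in> borel_measurable (\<sigma> \<Otimes>\<^sub>M \<sigma>)"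
      by (intro measurable_compose[OF _ \<open>G \<in> _\<close>] borel_measurable_Pair measurable_xi_prod measurable_xi_mean_sq measurable_gr24_pair \<sigma>)
    from nn_integral_snd[OF this] show ?thesis by simp
  qed
  also have "\<dots> = (\<integral>\<^sup>+Q. square_mean (\<lambda>(x, y). G (x * y, ((x + y) / 2)\<^sup>2)) \<partial>\<sigma>)"
    by (intro nn_integral_cong zonal_integral_square_mean[OF \<sigma> inv \<open>G \<in> _\<close>]) (simp add: sp(3))
  also have "\<dots> = square_mean (\<lambda>(x, y). G (x * y, ((x + y) / 2)\<^sup>2))" by (simp add: S.emeasure_space_1)
  also have "\<dots> = square_mean (\<lambda>(x, y). ennreal ((1 - x * y) powr (- (s / 2))) * ennreal ((real (harmonic_dim k))\<^sup>2 - (harmonic_poly k x y)\<^sup>2))"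
    by (intro square_mean_cong) (simp add: G_def harmonic_profile_square riesz_profile_less_1 abs_mult_less_1)
  finally show ?thesis .
qed

lemma square_mean_add:
  assumes "f \<in> borel_measurable borel" "g \<in> borel_measurable borel"
  shows "square_mean (\<lambda>z. f z + g z) = square_mean f + square_mean g"
  unfolding square_mean_def using assms indicator_square_measurable
  by (simp add: distrib_left nn_integral_add add_divide_distrib_ennreal)

lemma square_mean_cmult:
  assumes "f \<in> borel_measurable borel"
  shows "square_mean (\<lambda>z. c * f z) = c * square_mean f"
proof -
  have "(\<integral>\<^sup>+z. indicator ({-1<..<1} \<times> {-1<..<1}) z * (c * f z) \<partial>lborel) = (\<integral>\<^sup>+z. c * (indicator ({-1<..<1} \<times> {-1<..<1}) z * f z) \<partial>lborel)"
    by (simp add: mult_ac)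
  also have "\<dots> = c * (\<integral>\<^sup>+z. indicator ({-1<..<1} \<times> {-1<..<1}) z * f z \<partial>lborel)"
    using assms indicator_square_measurable by (intro nn_integral_cmult) simp
  finally show ?thesis by (simp add: square_mean_def ennreal_times_divide)
qed

text \<open>Stated as a sum because the values may be infinite at this stage; the two weights add up
  to the squared dimension pointwise on the square.\<close>

lemma expected_riesz_energy_split:
  fixes M :: "'w measure"
  assumes \<sigma>: "\<sigma> \<in> gr24_prob_measures" and inv: "O4_invariant \<sigma>"
    and ens: "harmonic_ensemble \<sigma> k M X"
  shows "(\<integral>\<^sup>+\<omega>. riesz_energy s (X \<omega>) \<partial>M) + harmonic_square_energy s k / 4
     = ennreal ((real (harmonic_dim k))\<^sup>2) * uniform_energy s"
proof -
  define w where "w = (\<lambda>z. ennreal ((1 - fst z * snd z) powr (- (s / 2))))"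
  define h where "h = (\<lambda>z. harmonic_poly k (fst z) (snd z))"
  have [measurable]: "w \<in> borel_measurable borel" "h \<in> borel_measurable borel"
    unfolding w_def h_def by measurable
  have 1: "(\<integral>\<^sup>+\<omega>. riesz_energy s (X \<omega>) \<partial>M) = square_mean (\<lambda>z. w z * ennreal ((real (harmonic_dim k))\<^sup>2 - (h z)\<^sup>2))"
    unfolding expected_riesz_energy[OF \<sigma> inv ens] by (simp add: w_def h_def case_prod_beta')
  have 2: "harmonic_square_energy s k / 4 = square_mean (\<lambda>z. w z * ennreal ((h z)\<^sup>2))"
    unfolding harmonic_square_energy_def square_mean_def w_def h_def
    by (intro arg_cong2[where f="(/)"] refl nn_integral_cong) (simp add: ennreal_mult mult_ac)
  have "square_mean (\<lambda>z. w z * ennreal ((real (harmonic_dim k))\<^sup>2 - (h z)\<^sup>2)) + square_mean (\<lambda>z. w z * ennreal ((h z)\<^sup>2))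
     = square_mean (\<lambda>z. w z * ennreal ((real (harmonic_dim k))\<^sup>2 - (h z)\<^sup>2) + w z * ennreal ((h z)\<^sup>2))"
    by (rule square_mean_add[symmetric]) measurable
  also have "\<dots> = square_mean (\<lambda>z. ennreal ((real (harmonic_dim k))\<^sup>2) * w z)"
  proof (rule square_mean_cong)
    fix x y :: real assume xy: "\<bar>x\<bar> < 1" "\<bar>y\<bar> < 1"
    have "(harmonic_poly k x y)\<^sup>2 \<le> (real (harmonic_dim k))\<^sup>2"
      using abs_harmonic_poly_le[of x y k] xy by (simp add: abs_le_square_iff[symmetric])
    then show "w (x, y) * ennreal ((real (harmonic_dim k))\<^sup>2 - (h (x, y))\<^sup>2) + w (x, y) * ennreal ((h (x, y))\<^sup>2)
       = ennreal ((real (harmonic_dim k))\<^sup>2) * w (x, y)"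
      by (simp add: h_def distrib_left[symmetric] ennreal_plus[symmetric] mult.commute del: ennreal_plus)
  qed
  also have "\<dots> = ennreal ((real (harmonic_dim k))\<^sup>2) * uniform_energy s"
    unfolding uniform_energy_def case_prod_beta' w_def[symmetric] by (rule square_mean_cmult) measurable
  finally show ?thesis unfolding 1 2 .
qed

section \<open>Wallis series\<close>

text \<open>This is C(2m, m) / 4^m, which is also the mean of cos^(2m) over a period.\<close>

definition wallis_ratio :: "nat \<Rightarrow> real" where
  "wallis_ratio m = pochhammer (1/2) m / fact m"

lemma wallis_ratio_0 [simp]: "wallis_ratio 0 = 1"
  by (simp add: wallis_ratio_def)

lemma wallis_ratio_Suc: "wallis_ratio (Suc m) = wallis_ratio m * ((2 * real m + 1) / (2 * real m + 2))"
  by (simp add: wallis_ratio_def pochhammer_Suc field_simps)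

lemma wallis_ratio_pos: "wallis_ratio m > 0"
  by (induction m) (auto simp: wallis_ratio_Suc intro!: mult_pos_pos divide_pos_pos)

lemma wallis_ratio_le_1: "wallis_ratio m \<le> 1"
proof (induction m)
  case (Suc m)
  have "wallis_ratio m * ((2 * real m + 1) / (2 * real m + 2)) \<le> 1 * 1"
    using Suc wallis_ratio_pos[of m] by (intro mult_mono) auto
  then show ?case by (simp add: wallis_ratio_Suc)
qed simp

text \<open>(2m + 1) times the squared ratio is the reciprocal of the m-th partial Wallis
  product.\<close>

lemma wallis_ratio_limit: "(\<lambda>m. (2 * real m + 1) * (wallis_ratio m)\<^sup>2) \<longlonglongrightarrow> 2 / pi"
proof -
  have e: "(\<Prod>k=1..m. 4 * real k ^ 2 / (4 * real k ^ 2 - 1)) = inverse ((2 * real m + 1) * (wallis_ratio m)\<^sup>2)" for m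
  proof (induction m)
    case (Suc m)
    define K where "K = real m + 1"
    define W where "W = (wallis_ratio m)\<^sup>2"
    have p: "K \<ge> 1" "W > 0" using wallis_ratio_pos[of m] by (auto simp: K_def W_def)
    have n: "2 * K - 1 \<noteq> 0" "2 * K + 1 \<noteq> 0" "K \<noteq> 0" "W \<noteq> 0" using p by auto
    have "(\<Prod>k=1..Suc m. 4 * real k ^ 2 / (4 * real k ^ 2 - 1)) = inverse ((2 * real m + 1) * W) * (4 * real (Suc m) ^ 2 / (4 * real (Suc m) ^ 2 - 1))"
    proof -
      have "(\<Prod>k=1..Suc m. 4 * real k ^ 2 / (4 * real k ^ 2 - 1)) = (\<Prod>k=1..m. 4 * real k ^ 2 / (4 * real k ^ 2 - 1)) * (4 * real (Suc m) ^ 2 / (4 * real (Suc m) ^ 2 - 1))"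
        by simp
      then show ?thesis unfolding Suc W_def .
    qed
    also have "\<dots> = inverse ((2 * K - 1) * W) * (4 * K\<^sup>2 / ((2 * K - 1) * (2 * K + 1)))"
      by (simp add: K_def power2_eq_square algebra_simps)
    also have "\<dots> = inverse ((2 * K + 1) * (W * ((2 * K - 1) / (2 * K))\<^sup>2))"
      using n by (simp add: field_simps power2_eq_square)
    also have "\<dots> = inverse ((2 * real (Suc m) + 1) * (wallis_ratio (Suc m))\<^sup>2)"
    proof -
      have "wallis_ratio (Suc m) = wallis_ratio m * ((2 * K - 1) / (2 * K))"
        by (simp add: wallis_ratio_Suc K_def algebra_simps)
      then have "(wallis_ratio (Suc m))\<^sup>2 = W * ((2 * K - 1) / (2 * K))\<^sup>2"
        by (simp only: W_def power_mult_distrib)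
      then show ?thesis by (simp add: K_def algebra_simps)
    qed
    finally show ?case .
  qed simp
  have "(\<lambda>m. inverse (\<Prod>k=1..m. 4 * real k ^ 2 / (4 * real k ^ 2 - 1))) \<longlonglongrightarrow> inverse (pi / 2)"
    using wallis by (intro tendsto_inverse) auto
  then show ?thesis unfolding e by simp
qed

text \<open>Supplies the boundary term at infinity of telescoping sums whose weight \<open>g\<close>
  grows at most linearly.\<close>

lemma wallis_ratio_sq_mult_limit:
  assumes "(\<lambda>m. g m / (2 * real m + 1)) \<longlonglongrightarrow> c"
  shows "(\<lambda>m. g m * (wallis_ratio m)\<^sup>2) \<longlonglongrightarrow> c * (2 / pi)"
proof -
  have "(\<lambda>m. (g m / (2 * real m + 1)) * ((2 * real m + 1) * (wallis_ratio m)\<^sup>2)) \<longlonglongrightarrow> c * (2 / pi)"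
    by (rule tendsto_mult[OF assms wallis_ratio_limit])
  moreover have "(g m / (2 * real m + 1)) * ((2 * real m + 1) * (wallis_ratio m)\<^sup>2) = g m * (wallis_ratio m)\<^sup>2" for m
    by (simp add: add_nonneg_eq_0_iff)
  ultimately show ?thesis by simp
qed

lemma wallis_ratio_tendsto_0: "wallis_ratio \<longlonglongrightarrow> 0"
proof -
  have "(\<lambda>m. 1 * (wallis_ratio m)\<^sup>2) \<longlonglongrightarrow> 0 * (2 / pi)"
    by (rule wallis_ratio_sq_mult_limit) real_asymp
  from tendsto_real_sqrt[OF this] show ?thesis
    using wallis_ratio_pos by (simp add: less_imp_le abs_of_pos)
qed

text \<open>The sums below telescope: each summand is \<open>w (m + 1)\<^sup>2 g (m + 1) - w m\<^sup>2 g m\<close> for a rational \<open>g\<close>,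
  namely \<open>g m = m\<close>, \<open>g m = 1\<close> and \<open>g m = m\<^sup>2 / (2 m - 1)\<close>.\<close>

lemma wallis_sq_sums:
  "(\<lambda>m. (wallis_ratio m)\<^sup>2 / (real m + 1)) sums (4 / pi)"
  "(\<lambda>m. (wallis_ratio m)\<^sup>2 * ((4 * real m + 3) / (4 * (real m + 1)\<^sup>2))) sums 1"
  "(\<lambda>m. (wallis_ratio m)\<^sup>2 / (2 * real m - 1)) sums (- 2 / pi)"
proof -
  define w where "w = (\<lambda>m. (wallis_ratio m)\<^sup>2)"
  have wS: "w (Suc m) = w m * ((2 * real m + 1) / (2 * real m + 2))\<^sup>2" for m
    by (simp only: w_def wallis_ratio_Suc power_mult_distrib)
  have "(\<lambda>m. real m * w m) \<longlonglongrightarrow> 1/2 * (2 / pi)"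
    unfolding w_def by (rule wallis_ratio_sq_mult_limit) real_asymp
  from telescope_sums[OF this] have "(\<lambda>m. real (Suc m) * w (Suc m) - real m * w m) sums (1 / pi)" by simp
  also have "(\<lambda>m. real (Suc m) * w (Suc m) - real m * w m) = (\<lambda>m. (1/4) * (w m / (real m + 1)))"
  proof
    fix m
    define K where "K = real m + 1"
    have K: "K \<noteq> 0" "real m = K - 1" by (auto simp: K_def)
    show "real (Suc m) * w (Suc m) - real m * w m = (1/4) * (w m / (real m + 1))"
      unfolding wS of_nat_Suc K(2) using K(1) by (simp add: field_simps power2_eq_square)
  qed
  finally have "(\<lambda>m. (1/4) * (w m / (real m + 1))) sums ((1/4) * (4 / pi))" by simp
  then have "(\<lambda>m. w m / (real m + 1)) sums (4 / pi)" by (subst (asm) sums_mult_iff) simp_all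
  then show "(\<lambda>m. (wallis_ratio m)\<^sup>2 / (real m + 1)) sums (4 / pi)" by (simp add: w_def)
  have "(\<lambda>m. 1 * w m) \<longlonglongrightarrow> 0 * (2 / pi)"
    unfolding w_def by (rule wallis_ratio_sq_mult_limit) real_asymp
  then have "w \<longlonglongrightarrow> 0" by simp
  from telescope_sums'[OF this] have "(\<lambda>m. w m - w (Suc m)) sums 1" by (simp add: w_def)
  also have "(\<lambda>m. w m - w (Suc m)) = (\<lambda>m. w m * ((4 * real m + 3) / (4 * (real m + 1)\<^sup>2)))"
  proof
    fix m
    define K where "K = real m + 1"
    have K: "K \<noteq> 0" "real m = K - 1" by (auto simp: K_def)
    show "w m - w (Suc m) = w m * ((4 * real m + 3) / (4 * (real m + 1)\<^sup>2))"
      unfolding wS K(2) using K(1) by (simp add: field_simps power2_eq_square)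
  qed
  finally show "(\<lambda>m. (wallis_ratio m)\<^sup>2 * ((4 * real m + 3) / (4 * (real m + 1)\<^sup>2))) sums 1" by (simp add: w_def)
  define g where "g = (\<lambda>m. (real m)\<^sup>2 / (2 * real m - 1))"
  have "(\<lambda>m. g m * w m) \<longlonglongrightarrow> 1/4 * (2 / pi)"
    unfolding w_def g_def by (rule wallis_ratio_sq_mult_limit) real_asymp
  from telescope_sums[OF this] have "(\<lambda>m. g (Suc m) * w (Suc m) - g m * w m) sums (1 / (2 * pi))" by (simp add: g_def)
  also have "(\<lambda>m. g (Suc m) * w (Suc m) - g m * w m) = (\<lambda>m. (-1/4) * (w m / (2 * real m - 1)))"
  proof
    fix m
    have n: "2 * real m - 1 \<noteq> 0"
    proof
      assume "2 * real m - 1 = 0"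
      then have "real (2 * m) = real 1" by simp
      then have "2 * m = 1" by (subst (asm) of_nat_eq_iff)
      then show False by presburger
    qed
    define K where "K = real m + 1"
    have K: "K \<noteq> 0" "2 * K - 1 \<noteq> 0" "2 * K - 3 \<noteq> 0" "real m = K - 1" using n by (auto simp: K_def)
    have "g (Suc m) * w (Suc m) = w m * (2 * K - 1) / 4"
      unfolding wS g_def of_nat_Suc K(4) using K(1,2) by (simp add: field_simps power2_eq_square)
    moreover have "w m * (2 * K - 1) / 4 - g m * w m = (-1/4) * (w m / (2 * K - 3))"
      unfolding g_def K(4) using K(3) by (simp add: field_simps power2_eq_square)
    ultimately show "g (Suc m) * w (Suc m) - g m * w m = (-1/4) * (w m / (2 * real m - 1))"
      by (simp add: K_def)
  qed
  finally have "(\<lambda>m. (-1/4) * (w m / (2 * real m - 1))) sums ((-1/4) * (- 2 / pi))" by simp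
  then have "(\<lambda>m. w m / (2 * real m - 1)) sums (- 2 / pi)" by (subst (asm) sums_mult_iff) simp_all
  then show "(\<lambda>m. (wallis_ratio m)\<^sup>2 / (2 * real m - 1)) sums (- 2 / pi)" by (simp add: w_def)
qed

lemma summable_wallis_sq_div: "summable (\<lambda>m. (wallis_ratio (Suc m))\<^sup>2 / real (Suc m))"
proof (rule summable_comparison_test')
  show "summable (\<lambda>m. 2 * ((wallis_ratio (Suc m))\<^sup>2 / (real (Suc m) + 1)))"
    using summable_mult[OF summable_Suc_iff[THEN iffD2, OF sums_summable[OF wallis_sq_sums(1)]]] .
  fix n :: nat assume "n \<ge> 0"
  have "1 / real (Suc n) \<le> 2 / (real (Suc n) + 1)" by (simp add: field_simps)
  from mult_left_mono[OF this, of "(wallis_ratio (Suc n))\<^sup>2"]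
  show "norm ((wallis_ratio (Suc n))\<^sup>2 / real (Suc n)) \<le> 2 * ((wallis_ratio (Suc n))\<^sup>2 / (real (Suc n) + 1))"
    by (simp add: algebra_simps)
qed

text \<open>Partial fractions of the summand against the telescoping sums above.\<close>

lemma wallis_mixed_sums:
  "(\<lambda>m. wallis_ratio (Suc m) * wallis_ratio (Suc (Suc m)) / (real (Suc m) * (2 * real m + 1))
      + (wallis_ratio (Suc (Suc m)))\<^sup>2 / ((2 * real m + 3) * real (Suc m)))
   sums (1/2 - 1 / (3 * pi) - (\<Sum>m. (wallis_ratio (Suc m))\<^sup>2 / real (Suc m)) / 4)"
proof -
  define w where "w = (\<lambda>m. (wallis_ratio m)\<^sup>2)"
  \<comment> \<open>The weights are partial fraction coefficients: -1 matches the double pole at -1,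
    4/3 the pole at 1/2, and 7/12 corrects the simple pole at -1. The pole at 0, with coefficient
    -1/4, is what remains as the logarithmic series.\<close>
  define R where "R = (\<lambda>m. - (w m * ((4 * real m + 3) / (4 * (real m + 1)\<^sup>2))) + 7/12 * (w m / (real m + 1)) + 4/3 * (w m / (2 * real m - 1)))"
  have "R sums (- 1 + 7/12 * (4 / pi) + 4/3 * (- 2 / pi))"
    unfolding R_def w_def by (intro sums_add sums_minus sums_mult wallis_sq_sums)
  then have "(\<lambda>m. R (Suc m)) sums (- 1 + 7/12 * (4 / pi) + 4/3 * (- 2 / pi) - R 0)"
    by (simp add: sums_Suc_iff)
  also have "- 1 + 7/12 * (4 / pi) + 4/3 * (- 2 / pi) - R 0 = 1/2 - 1 / (3 * pi)"
    by (simp add: R_def w_def field_simps)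
  finally have "(\<lambda>m. R (Suc m) - (w (Suc m) / real (Suc m)) / 4) sums (1/2 - 1 / (3 * pi) - (\<Sum>m. w (Suc m) / real (Suc m)) / 4)"
    by (intro sums_diff sums_divide summable_sums) (simp_all add: w_def summable_wallis_sq_div del: of_nat_Suc)
  also have "(\<lambda>m. R (Suc m) - (w (Suc m) / real (Suc m)) / 4) = (\<lambda>m. wallis_ratio (Suc m) * wallis_ratio (Suc (Suc m)) / (real (Suc m) * (2 * real m + 1))
      + (wallis_ratio (Suc (Suc m)))\<^sup>2 / ((2 * real m + 3) * real (Suc m)))"
  proof
    fix m
    define K where "K = real m + 1"
    define a where "a = wallis_ratio (Suc m)"
    have K: "K \<noteq> 0" "2 * K - 1 \<noteq> 0" "2 * K + 1 \<noteq> 0" "K + 1 \<noteq> 0" "real m = K - 1" by (auto simp: K_def)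
    have S: "wallis_ratio (Suc (Suc m)) = a * ((2 * K + 1) / (2 * (K + 1)))"
      unfolding wallis_ratio_Suc[of "Suc m"] a_def of_nat_Suc K(5) by (simp add: algebra_simps)
    have "R (Suc m) - (w (Suc m) / real (Suc m)) / 4
       = a\<^sup>2 * (- ((4 * K + 3) / (4 * (K + 1)\<^sup>2)) + 7/12 * (1 / (K + 1)) + 4/3 * (1 / (2 * K - 1)) - 1 / (4 * K))"
      by (simp add: R_def w_def a_def K_def algebra_simps)
    also have "- ((4 * K + 3) / (4 * (K + 1)\<^sup>2)) + 7/12 * (1 / (K + 1)) + 4/3 * (1 / (2 * K - 1)) - 1 / (4 * K)
       = ((2 * K + 1) / (2 * (K + 1))) / (K * (2 * K - 1)) + ((2 * K + 1) / (2 * (K + 1)))\<^sup>2 / ((2 * K + 1) * K)"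
      using K(1-4) by (simp add: divide_simps power2_eq_square) (simp add: algebra_simps)
    also have "a\<^sup>2 * (((2 * K + 1) / (2 * (K + 1))) / (K * (2 * K - 1)) + ((2 * K + 1) / (2 * (K + 1)))\<^sup>2 / ((2 * K + 1) * K))
      = a * wallis_ratio (Suc (Suc m)) / (K * (2 * K - 1)) + (wallis_ratio (Suc (Suc m)))\<^sup>2 / ((2 * K + 1) * K)"
      unfolding S by (simp add: power_mult_distrib power2_eq_square algebra_simps)
    finally show "R (Suc m) - (w (Suc m) / real (Suc m)) / 4 = wallis_ratio (Suc m) * wallis_ratio (Suc (Suc m)) / (real (Suc m) * (2 * real m + 1))
      + (wallis_ratio (Suc (Suc m)))\<^sup>2 / ((2 * real m + 3) * real (Suc m))"
      by (simp add: a_def K_def algebra_simps)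
  qed
  finally show ?thesis by (simp add: w_def)
qed

lemma wallis_sums_half: "(\<lambda>n. wallis_ratio n / (real n + 1)) sums 2"
proof -
  have "(\<lambda>n. wallis_ratio n - wallis_ratio (Suc n)) sums 1"
    using telescope_sums'[OF wallis_ratio_tendsto_0] by simp
  from sums_mult[OF this, of 2] have "(\<lambda>n. 2 * (wallis_ratio n - wallis_ratio (Suc n))) sums 2" by simp
  also have "(\<lambda>n. 2 * (wallis_ratio n - wallis_ratio (Suc n))) = (\<lambda>n. wallis_ratio n / (real n + 1))"
    by (rule ext) (simp add: wallis_ratio_Suc field_simps)
  finally show ?thesis .
qed

lemma summable_wallis_div: "summable (\<lambda>n. wallis_ratio (Suc n) / real (Suc n))"
proof (rule summable_comparison_test')
  show "summable (\<lambda>m. 2 * (wallis_ratio (Suc m) / (real (Suc m) + 1)))"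
    using summable_mult[OF summable_Suc_iff[THEN iffD2, OF sums_summable[OF wallis_sums_half]]] .
  fix n :: nat assume "n \<ge> 0"
  have "1 / real (Suc n) \<le> 2 / (real (Suc n) + 1)" by (simp add: field_simps)
  from mult_left_mono[OF this, of "wallis_ratio (Suc n)"]
  show "norm (wallis_ratio (Suc n) / real (Suc n)) \<le> 2 * (wallis_ratio (Suc n) / (real (Suc n) + 1))"
    using wallis_ratio_pos[of "Suc n"] by (simp add: algebra_simps)
qed

text \<open>Partial fractions in terms of w_(n+2): the weights 3/4, -1/8 and -1/4 belong to a
  telescoping sum, to the tail of the logarithmic series, and to the tail of
  \<open>wallis_sums_half\<close>.\<close>

lemma wallis_log_sums:
  "(\<lambda>n. wallis_ratio (n + 3) / ((real n + 2) * (real n + 1))) sums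
     (7/16 - (\<Sum>n. wallis_ratio (Suc n) / real (Suc n)) / 8)"
proof -
  define M where "M = (\<Sum>n. wallis_ratio (Suc n) / real (Suc n))"
  define v where "v = (\<lambda>n. wallis_ratio (n + 2))"
  have w1: "wallis_ratio (Suc 0) = 1/2" "wallis_ratio (Suc (Suc 0)) = 3/8"
    using wallis_ratio_Suc[of 0] wallis_ratio_Suc[of "Suc 0"] by simp_all
  have vS: "v (Suc n) = v n * ((2 * real n + 5) / (2 * real n + 6))" for n
    using wallis_ratio_Suc[of "n + 2"] by (simp add: v_def algebra_simps)
  have "v \<longlonglongrightarrow> 0" unfolding v_def using LIMSEQ_ignore_initial_segment[OF wallis_ratio_tendsto_0] .
  then have "(\<lambda>n. ((real n + 2) / (real n + 1)) * v n) \<longlonglongrightarrow> 1 * 0"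
    by (intro tendsto_mult) (auto, real_asymp)
  from telescope_sums'[OF this] have 1: "(\<lambda>n. ((real n + 2) / (real n + 1)) * v n - ((real (Suc n) + 2) / (real (Suc n) + 1)) * v (Suc n)) sums (3/4)"
    by (simp add: v_def w1)
  have "(\<lambda>n. wallis_ratio (Suc n) / real (Suc n)) sums M"
    unfolding M_def using summable_wallis_div by (rule summable_sums)
  then have 2: "(\<lambda>n. v n / (real n + 2)) sums (M - 1/2)"
    using sums_Suc_iff[of "\<lambda>n. wallis_ratio (Suc n) / real (Suc n)" "M - 1/2"] by (simp add: v_def w1 add.commute)
  have "(\<lambda>n. wallis_ratio (Suc n) / (real (Suc n) + 1)) sums (2 - 1)"
    using wallis_sums_half by (subst sums_Suc_iff) (simp add: add.commute)
  then have "(\<lambda>n. wallis_ratio (Suc (Suc n)) / (real (Suc (Suc n)) + 1)) sums (2 - 1 - 1/4)"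
    using sums_Suc_iff[of "\<lambda>n. wallis_ratio (Suc n) / (real (Suc n) + 1)" "2 - 1 - 1/4"] by (simp add: w1 add.commute)
  then have 3: "(\<lambda>n. v n / (real n + 3)) sums (3/4)" by (simp add: v_def add.commute)
  have "(\<lambda>n. 3/4 * (((real n + 2) / (real n + 1)) * v n - ((real (Suc n) + 2) / (real (Suc n) + 1)) * v (Suc n))
      + (- 1/8) * (v n / (real n + 2)) + (- 1/4) * (v n / (real n + 3))) sums (3/4 * (3/4) + (- 1/8) * (M - 1/2) + (- 1/4) * (3/4))"
    by (intro sums_add sums_mult 1 2 3)
  also have "(\<lambda>n. 3/4 * (((real n + 2) / (real n + 1)) * v n - ((real (Suc n) + 2) / (real (Suc n) + 1)) * v (Suc n))
      + (- 1/8) * (v n / (real n + 2)) + (- 1/4) * (v n / (real n + 3))) = (\<lambda>n. wallis_ratio (n + 3) / ((real n + 2) * (real n + 1)))"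
  proof
    fix n
    define K where "K = real n + 1"
    have K: "K \<noteq> 0" "K + 1 \<noteq> 0" "K + 2 \<noteq> 0" "real n = K - 1" by (auto simp: K_def)
    have w3: "wallis_ratio (n + 3) = v (Suc n)" by (simp add: v_def numeral_3_eq_3)
    show "3/4 * (((real n + 2) / (real n + 1)) * v n - ((real (Suc n) + 2) / (real (Suc n) + 1)) * v (Suc n))
      + (- 1/8) * (v n / (real n + 2)) + (- 1/4) * (v n / (real n + 3)) = wallis_ratio (n + 3) / ((real n + 2) * (real n + 1))"
      unfolding w3 vS of_nat_Suc K(4) using K(1-3) by (simp add: divide_simps) (simp add: algebra_simps)
  qed
  also have "3/4 * (3/4) + (- 1/8) * (M - 1/2) + (- 1/4) * (3/4) = 7/16 - M / 8" by (simp add: field_simps)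
  finally show ?thesis by (simp add: M_def)
qed

section \<open>Averages over the circle and the torus\<close>

text \<open>The uniform probability measure on one period. With a half-open interval, translated
  periods can be cut and reassembled without counting an endpoint twice.\<close>

definition circ :: "real measure" where
  "circ = density lborel (\<lambda>x. ennreal (indicator {0..<2 * pi} x / (2 * pi)))"

lemma sets_circ [simp, measurable_cong]: "sets circ = sets borel"
  by (simp add: circ_def)

lemma space_circ [simp]: "space circ = UNIV"
  by (simp add: circ_def)

lemma nn_integral_circ:
  assumes [measurable]: "g \<in> borel_measurable borel"
  shows "(\<integral>\<^sup>+x. g x \<partial>circ) = ennreal (1 / (2 * pi)) * (\<integral>\<^sup>+x. g x * indicator {0..<2 * pi} x \<partial>lborel)"
proof -
  have "(\<integral>\<^sup>+x. g x \<partial>circ) = (\<integral>\<^sup>+x. ennreal (1 / (2 * pi)) * (g x * indicator {0..<2 * pi} x) \<partial>lborel)"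
    unfolding circ_def by (subst nn_integral_density) (auto intro!: nn_integral_cong simp: indicator_def mult.commute)
  then show ?thesis by (simp add: nn_integral_cmult)
qed

lemma prob_space_circ: "prob_space circ"
proof
  have "(\<integral>\<^sup>+x. 1 \<partial>circ) = ennreal (1 / (2 * pi)) * ennreal (2 * pi)"
    by (subst nn_integral_circ) simp_all
  also have "\<dots> = 1" by (subst ennreal_mult[symmetric]) simp_all
  finally show "emeasure circ (space circ) = 1" by simp
qed

lemma integral_circ:
  fixes f :: "real \<Rightarrow> real"
  assumes f: "continuous_on UNIV f"
  shows "(\<integral>x. f x \<partial>circ) = integral {0..2 * pi} f / (2 * pi)"
proof -
  have m [measurable]: "f \<in> borel_measurable borel" using f by (rule borel_measurable_continuous_onI)
  have "(\<integral>x. f x \<partial>circ) = (\<integral>x. (indicator {0..<2 * pi} x / (2 * pi)) *\<^sub>R f x \<partial>lborel)"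
    unfolding circ_def by (subst integral_density) auto
  also have "\<dots> = (\<integral>x. (indicator {0..2 * pi} x *\<^sub>R f x) / (2 * pi) \<partial>lborel)"
  proof (rule integral_cong_AE)
    show "AE x in lborel. (indicator {0..<2 * pi} x / (2 * pi)) *\<^sub>R f x = (indicator {0..2 * pi} x *\<^sub>R f x) / (2 * pi)"
      using AE_lborel_singleton[of "2 * pi"] by eventually_elim (auto simp: indicator_def)
  qed measurable
  also have "\<dots> = (LBINT x:{0..2 * pi}. f x) / (2 * pi)"
    by (simp add: set_lebesgue_integral_def)
  also have "\<dots> = integral {0..2 * pi} f / (2 * pi)"
  proof -
    have "continuous_on {0..2 * pi} f" using f by (rule continuous_on_subset) simp
    then have "set_integrable lborel {0..2 * pi} f" by (rule borel_integrable_atLeastAtMost')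
    then show ?thesis by (simp only: set_borel_integral_eq_integral(2))
  qed
  finally show ?thesis .
qed

interpretation circ: prob_space circ by (rule prob_space_circ)

lemma measure_circ_UNIV [simp]: "measure circ UNIV = 1"
  using circ.prob_space by simp

interpretation circ2: pair_prob_space circ circ ..

lemma nn_integral_Ico_shift:
  fixes g :: "real \<Rightarrow> ennreal"
  assumes [measurable]: "g \<in> borel_measurable borel"
  shows "(\<integral>\<^sup>+x. g (x + b) * indicator {c..<d} x \<partial>lborel) = (\<integral>\<^sup>+x. g x * indicator {c + b..<d + b} x \<partial>lborel)"
  by (subst nn_integral_real_affine[where c=1 and t=b, of "\<lambda>x. g x * indicator {c + b..<d + b} x"])
     (auto intro!: nn_integral_cong simp: indicator_def add.commute)

lemma nn_integral_Ico_split: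
  fixes g :: "real \<Rightarrow> ennreal"
  assumes [measurable]: "g \<in> borel_measurable borel" and "a \<le> b" "b \<le> c"
  shows "(\<integral>\<^sup>+x. g x * indicator {a..<c} x \<partial>lborel) = (\<integral>\<^sup>+x. g x * indicator {a..<b} x \<partial>lborel) + (\<integral>\<^sup>+x. g x * indicator {b..<c} x \<partial>lborel)"
proof -
  have "(\<integral>\<^sup>+x. g x * indicator {a..<c} x \<partial>lborel) = (\<integral>\<^sup>+x. g x * indicator {a..<b} x + g x * indicator {b..<c} x \<partial>lborel)"
    using assms by (intro nn_integral_cong) (auto simp: indicator_def)
  then show ?thesis by (simp add: nn_integral_add)
qed

lemma periodic_of_int:
  assumes p: "\<And>x. g (x + p) = g (x :: real)" shows "g (x + of_int k * p) = g x"
proof (induction k arbitrary: x rule: int_induct[where k=0])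
  case (step1 i)
  have "g (x + of_int (i + 1) * p) = g ((x + of_int i * p) + p)" by (simp add: algebra_simps)
  then show ?case using p step1 by simp
next
  case (step2 i)
  have "g (x + of_int i * p) = g ((x + of_int (i - 1) * p) + p)" by (simp add: algebra_simps)
  then show ?case using p step2 by simp
qed simp

lemma nn_integral_periodic_shift:
  fixes g :: "real \<Rightarrow> ennreal"
  assumes [measurable]: "g \<in> borel_measurable borel" and p: "\<And>x. g (x + p) = g x" and "p > 0"
  shows "(\<integral>\<^sup>+x. g (x + b) * indicator {0..<p} x \<partial>lborel) = (\<integral>\<^sup>+x. g x * indicator {0..<p} x \<partial>lborel)"
proof -
  define k where "k = \<lfloor>b / p\<rfloor>"
  define c where "c = b - of_int k * p"
  have "of_int k \<le> b / p" "b / p < of_int k + 1" unfolding k_def by linarith+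
  then have c: "0 \<le> c" "c \<le> p" using \<open>p > 0\<close> by (auto simp: c_def field_simps)
  have e: "g (x + b) = g (x + c)" for x
    using periodic_of_int[of g p "x + c" k, OF p] by (simp add: c_def)
  have "(\<integral>\<^sup>+x. g (x + b) * indicator {0..<p} x \<partial>lborel) = (\<integral>\<^sup>+x. g x * indicator {c..<p + c} x \<partial>lborel)"
    unfolding e using nn_integral_Ico_shift[of g c 0 p] by simp
  also have "\<dots> = (\<integral>\<^sup>+x. g x * indicator {c..<p} x \<partial>lborel) + (\<integral>\<^sup>+x. g x * indicator {p..<p + c} x \<partial>lborel)"
    using c by (intro nn_integral_Ico_split) auto
  also have "(\<integral>\<^sup>+x. g x * indicator {p..<p + c} x \<partial>lborel) = (\<integral>\<^sup>+x. g x * indicator {0..<c} x \<partial>lborel)"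
    using nn_integral_Ico_shift[of g p 0 c] by (simp add: p add.commute)
  also have "(\<integral>\<^sup>+x. g x * indicator {c..<p} x \<partial>lborel) + (\<integral>\<^sup>+x. g x * indicator {0..<c} x \<partial>lborel) = (\<integral>\<^sup>+x. g x * indicator {0..<p} x \<partial>lborel)"
    using nn_integral_Ico_split[of g 0 c p] c by (simp add: add.commute)
  finally show ?thesis .
qed

lemma nn_integral_circ_shift:
  fixes g :: "real \<Rightarrow> ennreal"
  assumes [measurable]: "g \<in> borel_measurable borel" and p: "\<And>x. g (x + 2 * pi) = g x"
  shows "(\<integral>\<^sup>+x. g (x + b) \<partial>circ) = (\<integral>\<^sup>+x. g x \<partial>circ)"
  using nn_integral_periodic_shift[OF assms(1) p, of b] by (simp add: nn_integral_circ)

lemma nn_integral_half_period: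
  fixes g :: "real \<Rightarrow> ennreal"
  assumes [measurable]: "g \<in> borel_measurable borel" and p: "\<And>x. g (x + pi) = g x"
  shows "(\<integral>\<^sup>+x. g x * indicator {0..<2 * pi} x \<partial>lborel) = 2 * (\<integral>\<^sup>+x. g x * indicator {0..<pi} x \<partial>lborel)"
proof -
  have "(\<integral>\<^sup>+x. g x * indicator {pi..<2 * pi} x \<partial>lborel) = (\<integral>\<^sup>+x. g x * indicator {0..<pi} x \<partial>lborel)"
    using nn_integral_Ico_shift[of g pi 0 pi] unfolding p add_0 mult_2 by simp
  moreover have "(\<integral>\<^sup>+x. g x * indicator {0..<2 * pi} x \<partial>lborel) = (\<integral>\<^sup>+x. g x * indicator {0..<pi} x \<partial>lborel) + (\<integral>\<^sup>+x. g x * indicator {pi..<2 * pi} x \<partial>lborel)"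
    by (rule nn_integral_Ico_split) simp_all
  ultimately show ?thesis by (simp only: mult_2)
qed

lemma nn_integral_circ_double:
  fixes g :: "real \<Rightarrow> ennreal"
  assumes [measurable]: "g \<in> borel_measurable borel" and p: "\<And>x. g (x + 2 * pi) = g x"
  shows "(\<integral>\<^sup>+x. g (2 * x + b) \<partial>circ) = (\<integral>\<^sup>+x. g x \<partial>circ)"
proof -
  have "(\<integral>\<^sup>+x. g (2 * x + b) * indicator {0..<2 * pi} x \<partial>lborel) = 2 * (\<integral>\<^sup>+x. g (2 * x + b) * indicator {0..<pi} x \<partial>lborel)"
  proof (rule nn_integral_half_period)
    fix x have "g (2 * (x + pi) + b) = g ((2 * x + b) + 2 * pi)" by (simp add: algebra_simps)
    then show "g (2 * (x + pi) + b) = g (2 * x + b)" using p by simp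
  qed measurable
  also have "\<dots> = (\<integral>\<^sup>+y. g (y + b) * indicator {0..<2 * pi} y \<partial>lborel)"
    by (subst nn_integral_real_affine[where c=2 and t=0, of "\<lambda>y. g (y + b) * indicator {0..<2 * pi} y"])
       (auto intro!: arg_cong2[where f="(*)"] nn_integral_cong simp: indicator_def)
  also have "\<dots> = (\<integral>\<^sup>+x. g x * indicator {0..<2 * pi} x \<partial>lborel)"
    using assms by (intro nn_integral_periodic_shift) auto
  finally show ?thesis by (simp add: nn_integral_circ)
qed

lemma measurable_circ_pair: "borel_measurable (circ \<Otimes>\<^sub>M circ) = borel_measurable (borel :: (real \<times> real) measure)"
  by (intro measurable_cong_sets) (simp_all add: borel_prod[symmetric] cong: sets_pair_measure_cong)

text \<open>The map \<open>(a, b) \<mapsto> (a + b, a - b)\<close> of the torus preserves the uniform measure, although it is two-to-one.\<close>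

lemma nn_integral_torus_rotation:
  fixes H :: "real \<times> real \<Rightarrow> ennreal"
  assumes [measurable]: "H \<in> borel_measurable borel"
    and p1: "\<And>x y. H (x + 2 * pi, y) = H (x, y)" and p2: "\<And>x y. H (x, y + 2 * pi) = H (x, y)"
  shows "(\<integral>\<^sup>+z. H (fst z + snd z, fst z - snd z) \<partial>(circ \<Otimes>\<^sub>M circ)) = (\<integral>\<^sup>+z. H z \<partial>(circ \<Otimes>\<^sub>M circ))"
proof -
  have m1: "(\<lambda>z. H (fst z + snd z, fst z - snd z)) \<in> borel_measurable (circ \<Otimes>\<^sub>M circ)"
    unfolding measurable_circ_pair by measurable
  have m2: "(\<lambda>z. H (fst z + 2 * snd z, fst z)) \<in> borel_measurable (circ \<Otimes>\<^sub>M circ)"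
    unfolding measurable_circ_pair by measurable
  have m3: "H \<in> borel_measurable (circ \<Otimes>\<^sub>M circ)"
    unfolding measurable_circ_pair by measurable
  have "(\<integral>\<^sup>+z. H (fst z + snd z, fst z - snd z) \<partial>(circ \<Otimes>\<^sub>M circ)) = (\<integral>\<^sup>+b. (\<integral>\<^sup>+a. H (a + b, a - b) \<partial>circ) \<partial>circ)"
    using circ2.nn_integral_snd[OF m1] by simp
  \<comment> \<open>For fixed b, translating a by b turns the arguments into (a + 2 b, a). For fixed
    a, the map b to a + 2 b then preserves the uniform measure of the circle.\<close>
  also have "\<dots> = (\<integral>\<^sup>+b. (\<integral>\<^sup>+a. H (a + 2 * b, a) \<partial>circ) \<partial>circ)"
  proof (rule nn_integral_cong)
    fix b :: real
    have "(\<integral>\<^sup>+a. (\<lambda>a. H (a + b, a - b)) (a + b) \<partial>circ) = (\<integral>\<^sup>+a. H (a + b, a - b) \<partial>circ)"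
    proof (rule nn_integral_circ_shift)
      fix x have "H (x + 2 * pi + b, x + 2 * pi - b) = H ((x + b) + 2 * pi, (x - b) + 2 * pi)" by (simp add: algebra_simps)
      then show "H (x + 2 * pi + b, x + 2 * pi - b) = H (x + b, x - b)" by (simp only: p1 p2)
    qed measurable
    then show "(\<integral>\<^sup>+a. H (a + b, a - b) \<partial>circ) = (\<integral>\<^sup>+a. H (a + 2 * b, a) \<partial>circ)" by (simp add: algebra_simps)
  qed
  also have "\<dots> = (\<integral>\<^sup>+a. (\<integral>\<^sup>+b. H (a + 2 * b, a) \<partial>circ) \<partial>circ)"
    using circ2.Fubini[OF m2] by simp
  also have "\<dots> = (\<integral>\<^sup>+a. (\<integral>\<^sup>+b. H (b, a) \<partial>circ) \<partial>circ)"
  proof (rule nn_integral_cong)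
    fix a :: real
    show "(\<integral>\<^sup>+b. H (a + 2 * b, a) \<partial>circ) = (\<integral>\<^sup>+b. H (b, a) \<partial>circ)"
      using nn_integral_circ_double[of "\<lambda>b. H (b, a)" a] by (simp add: p1 add.commute)
  qed
  also have "\<dots> = (\<integral>\<^sup>+z. H z \<partial>(circ \<Otimes>\<^sub>M circ))"
    using circ2.nn_integral_snd[OF m3] by simp
  finally show ?thesis .
qed

lemma integrable_circ2_bounded:
  fixes f :: "real \<times> real \<Rightarrow> real"
  assumes "f \<in> borel_measurable borel" "\<And>z. \<bar>f z\<bar> \<le> C"
  shows "integrable (circ \<Otimes>\<^sub>M circ) f"
  by (rule circ2.P.integrable_const_bound[of _ C]) (use assms in \<open>auto simp: measurable_circ_pair\<close>)

lemma integrable_circ_bounded: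
  fixes f :: "real \<Rightarrow> real"
  assumes "f \<in> borel_measurable borel" "\<And>z. \<bar>f z\<bar> \<le> C"
  shows "integrable circ f"
  by (rule circ.integrable_const_bound[of _ C]) (use assms in auto)

lemma integral_torus_rotation:
  fixes H :: "real \<times> real \<Rightarrow> real"
  assumes [measurable]: "H \<in> borel_measurable borel" and C: "\<And>z. \<bar>H z\<bar> \<le> C"
    and p1: "\<And>x y. H (x + 2 * pi, y) = H (x, y)" and p2: "\<And>x y. H (x, y + 2 * pi) = H (x, y)"
  shows "(\<integral>z. H (fst z + snd z, fst z - snd z) \<partial>(circ \<Otimes>\<^sub>M circ)) = (\<integral>z. H z \<partial>(circ \<Otimes>\<^sub>M circ))"
proof -
  have i1: "integrable (circ \<Otimes>\<^sub>M circ) (\<lambda>z. H (fst z + snd z, fst z - snd z))"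
    by (rule integrable_circ2_bounded[of _ C]) (use C in auto)
  have i2: "integrable (circ \<Otimes>\<^sub>M circ) H"
    by (rule integrable_circ2_bounded[of _ C]) (use C in auto)
  have nn: "0 \<le> C + H z" for z using C[of z] by (simp add: abs_le_iff)
  have "ennreal (\<integral>z. C + H (fst z + snd z, fst z - snd z) \<partial>(circ \<Otimes>\<^sub>M circ)) = ennreal (\<integral>z. C + H z \<partial>(circ \<Otimes>\<^sub>M circ))"
    using nn_integral_torus_rotation[of "\<lambda>z. ennreal (C + H z)"] nn i1 i2
    by (subst (1 2) nn_integral_eq_integral[symmetric]) (auto simp: p1 p2)
  then have "(\<integral>z. C + H (fst z + snd z, fst z - snd z) \<partial>(circ \<Otimes>\<^sub>M circ)) = (\<integral>z. C + H z \<partial>(circ \<Otimes>\<^sub>M circ))"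
    using nn by (subst (asm) ennreal_inj) (auto intro!: integral_nonneg)
  then show ?thesis using i1 i2 by (simp add: circ2.P.prob_space)
qed

text \<open>The derivative of sin x cos^(n+1) x has mean zero over a period.\<close>

lemma cos_moment_rec:
  "(real n + 2) * (\<integral>x. cos x ^ (n + 2) \<partial>circ) = (real n + 1) * (\<integral>x. cos x ^ n \<partial>circ)"
proof -
  have "((\<lambda>x. (real n + 2) * cos x ^ (n + 2) - (real n + 1) * cos x ^ n) has_integral
      (sin (2 * pi) * cos (2 * pi) ^ (n + 1) - sin 0 * cos 0 ^ (n + 1))) {0..2 * pi}"
  proof (rule fundamental_theorem_of_calculus)
    fix x :: real
    have s: "sin x * sin x = 1 - cos x * cos x" by (simp add: sin_squared_eq flip: power2_eq_square)
    have "((\<lambda>x. sin x * cos x ^ Suc n) has_real_derivative cos x * cos x ^ Suc n + sin x * (real (Suc n) * (cos x ^ n * - sin x))) (at x)"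
      by (rule DERIV_cong, rule DERIV_mult, rule DERIV_sin, rule DERIV_power_Suc, rule DERIV_cos) (simp add: algebra_simps)
    moreover have "cos x * cos x ^ Suc n + sin x * (real (Suc n) * (cos x ^ n * - sin x)) = (real n + 2) * cos x ^ (n + 2) - (real n + 1) * cos x ^ n"
    proof -
      have "c * c ^ Suc n + d * (real (Suc n) * (c ^ n * - d)) = (real n + 2) * c ^ (n + 2) - (real n + 1) * c ^ n"
        if "d * d = 1 - c * c" for c d :: real
      proof -
        have e: "d * (real (Suc n) * (c ^ n * - d)) = - (real (Suc n) * c ^ n * (d * d))" by (simp add: algebra_simps)
        show ?thesis unfolding e that by (simp add: algebra_simps)
      qed
      then show ?thesis using s by blast
    qed
    ultimately have "((\<lambda>x. sin x * cos x ^ Suc n) has_real_derivative (real n + 2) * cos x ^ (n + 2) - (real n + 1) * cos x ^ n) (at x)" by simp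
    then show "((\<lambda>x. sin x * cos x ^ (n + 1)) has_vector_derivative (real n + 2) * cos x ^ (n + 2) - (real n + 1) * cos x ^ n) (at x within {0..2 * pi})"
      by (simp add: has_real_derivative_iff_has_vector_derivative[symmetric] has_field_derivative_at_within)
  qed simp
  then have "integral {0..2 * pi} (\<lambda>x. (real n + 2) * cos x ^ (n + 2) - (real n + 1) * cos x ^ n) = 0"
    by (simp add: integral_unique)
  moreover have "integral {0..2 * pi} (\<lambda>x. (real n + 2) * cos x ^ (n + 2) - (real n + 1) * cos x ^ n)
     = (real n + 2) * integral {0..2 * pi} (\<lambda>x. cos x ^ (n + 2)) - (real n + 1) * integral {0..2 * pi} (\<lambda>x. cos x ^ n)"
    by (subst Henstock_Kurzweil_Integration.integral_diff) (auto intro!: integrable_continuous_interval continuous_intros)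
  ultimately show ?thesis by (simp add: integral_circ continuous_intros)
qed

lemma cos_moment_even: "(\<integral>x. cos x ^ (2 * m) \<partial>circ) = wallis_ratio m"
proof (induction m)
  case 0
  show ?case using circ.prob_space by simp
next
  case (Suc m)
  have "(2 * real m + 2) * (\<integral>x. cos x ^ (2 * Suc m) \<partial>circ) = (2 * real m + 1) * wallis_ratio m"
    using cos_moment_rec[of "2 * m"] Suc by simp
  then show ?case by (simp add: wallis_ratio_Suc field_simps)
qed

lemma cos_moment_odd: "(\<integral>x. cos x ^ (2 * m + 1) \<partial>circ) = 0"
proof (induction m)
  case 0
  have "(cos has_integral (sin (2 * pi) - sin 0)) {0..2 * pi}"
    by (rule fundamental_theorem_of_calculus) (auto intro!: derivative_eq_intros simp flip: has_real_derivative_iff_has_vector_derivative)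
  then show ?case by (simp add: integral_circ continuous_intros integral_unique)
next
  case (Suc m)
  then show ?case using cos_moment_rec[of "2 * m + 1"] by simp
qed

lemma sin_moment_even: "(\<integral>x. sin x ^ (2 * m) \<partial>circ) = wallis_ratio m"
proof -
  have i: "integrable circ (\<lambda>x. sin x ^ (2 * m))" "integrable circ (\<lambda>x. cos x ^ (2 * m))"
    by (rule integrable_circ_bounded[of _ 1]; simp add: power_abs power_le_one)+
  have c: "cos (x + (- pi / 2)) = sin x" for x :: real by (simp add: cos_diff)
  have "(\<integral>\<^sup>+x. ennreal (cos (x + (- pi / 2)) ^ (2 * m)) \<partial>circ) = (\<integral>\<^sup>+x. ennreal (cos x ^ (2 * m)) \<partial>circ)"
    by (rule nn_integral_circ_shift) simp_all
  then have "ennreal (\<integral>x. sin x ^ (2 * m) \<partial>circ) = ennreal (\<integral>x. cos x ^ (2 * m) \<partial>circ)"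
    unfolding c using i by (subst (1 2) nn_integral_eq_integral[symmetric]) (auto simp: power_mult)
  then have "(\<integral>x. sin x ^ (2 * m) \<partial>circ) = (\<integral>x. cos x ^ (2 * m) \<partial>circ)"
    by (subst (asm) ennreal_inj) (auto intro!: integral_nonneg simp: power_mult)
  then show ?thesis by (simp add: cos_moment_even)
qed

section \<open>The function t ln t: series and averages\<close>

definition xlogx :: "real \<Rightarrow> real" where "xlogx x = x * ln x"

lemma xlogx_measurable [measurable]: "xlogx \<in> borel_measurable borel"
  unfolding xlogx_def by measurable

lemma inverse_consecutive_sums: "(\<lambda>n. 1 / ((real n + 2) * (real n + 1))) sums 1"
proof -
  have "(\<lambda>n. 1 / (real n + 1)) \<longlonglongrightarrow> 0" by real_asymp
  from telescope_sums'[OF this] have "(\<lambda>n. 1 / (real n + 1) - 1 / (real (Suc n) + 1)) sums 1" by simp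
  also have "(\<lambda>n. 1 / (real n + 1) - 1 / (real (Suc n) + 1)) = (\<lambda>n. 1 / ((real n + 2) * (real n + 1)))"
    by (rule ext) (simp add: field_simps)
  finally show ?thesis .
qed

text \<open>The coefficients decay like 1 / n^2, so the expansion holds up to both endpoints t = -1
  and t = 1. The endpoints are attained on the circle and on the torus, where 1 + t ranges over
  [0, 2].\<close>

lemma xlogx_sums:
  assumes "\<bar>t\<bar> \<le> 1"
  shows "(\<lambda>n. (- t) ^ (n + 2) / ((real n + 2) * (real n + 1))) sums (xlogx (1 + t) - t)"
proof (cases "t = -1")
  case True
  then show ?thesis using inverse_consecutive_sums by (simp add: xlogx_def)
next
  case False
  have "(\<lambda>n. - ((- t) ^ n) / real n) sums ln (1 + t)"
  proof (cases "t = 1")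
    case True
    have "(\<lambda>n. - ((- t) ^ Suc n) / real (Suc n)) sums ln (1 + t)"
      using alternating_harmonic_series_sums True by simp
    then show ?thesis by (subst (asm) sums_Suc_iff) simp
  next
    case t1: False
    then have "\<bar>t\<bar> < 1" using assms False by auto
    then show ?thesis by (rule ln_series')
  qed
  note s0 = this
  have s1: "(\<lambda>n. - ((- t) ^ Suc (Suc n)) / real (Suc (Suc n))) sums (ln (1 + t) - t)"
    using s0 by (subst sums_Suc_iff, subst sums_Suc_iff) simp
  have "(\<lambda>n. - ((- t) ^ Suc n) / real (Suc n)) sums ln (1 + t)"
    using s0 by (subst sums_Suc_iff) simp
  from sums_mult[OF this, of t] have "(\<lambda>n. t * (- ((- t) ^ Suc n) / real (Suc n))) sums (t * ln (1 + t))" .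
  from sums_add[OF s1 this]
  have "(\<lambda>n. - ((- t) ^ Suc (Suc n)) / real (Suc (Suc n)) + t * (- ((- t) ^ Suc n) / real (Suc n))) sums (xlogx (1 + t) - t)"
    by (simp add: xlogx_def algebra_simps)
  also have "(\<lambda>n. - ((- t) ^ Suc (Suc n)) / real (Suc (Suc n)) + t * (- ((- t) ^ Suc n) / real (Suc n)))
     = (\<lambda>n. (- t) ^ (n + 2) / ((real n + 2) * (real n + 1)))"
  proof
    fix n
    define p where "p = (- t) ^ Suc (Suc n)"
    have "t * (- ((- t) ^ Suc n) / real (Suc n)) = p / (real n + 1)" by (simp add: p_def add.commute)
    moreover have "- p / (real n + 2) + p / (real n + 1) = p / ((real n + 2) * (real n + 1))"
      by (simp add: field_simps)
    ultimately show "- ((- t) ^ Suc (Suc n)) / real (Suc (Suc n)) + t * (- ((- t) ^ Suc n) / real (Suc n))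
      = (- t) ^ (n + 2) / ((real n + 2) * (real n + 1))"
      by (simp add: p_def add.commute)
  qed
  finally show ?thesis .
qed

lemma abs_xlogx_le:
  assumes "0 \<le> x" "x \<le> 2" shows "\<bar>xlogx x\<bar> \<le> 2"
proof -
  define t where "t = x - 1"
  have t: "\<bar>t\<bar> \<le> 1" using assms by (simp add: t_def abs_le_iff)
  have b: "norm ((- t) ^ (n + 2) / ((real n + 2) * (real n + 1))) \<le> 1 / ((real n + 2) * (real n + 1))" for n
  proof -
    have "\<bar>(- t) ^ (n + 2)\<bar> \<le> 1" using t unfolding power_abs by (intro power_le_one) auto
    then have "\<bar>(- t) ^ (n + 2)\<bar> / ((real n + 2) * (real n + 1)) \<le> 1 / ((real n + 2) * (real n + 1))"
      by (rule divide_right_mono) simp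
    then show ?thesis unfolding real_norm_def abs_divide by (simp del: power_Suc add_2_eq_Suc')
  qed
  have "norm (\<Sum>n. (- t) ^ (n + 2) / ((real n + 2) * (real n + 1))) \<le> (\<Sum>n. 1 / ((real n + 2) * (real n + 1)))"
    using b by (intro norm_suminf_le sums_summable[OF inverse_consecutive_sums]) 
  then have "\<bar>xlogx (1 + t) - t\<bar> \<le> 1"
    using xlogx_sums[OF t] inverse_consecutive_sums by (simp add: sums_iff)
  then show ?thesis using t by (simp add: t_def abs_le_iff)
qed

text \<open>The terms are dominated by C / ((n + 2) (n + 1)), a summable sequence. The lemma is used
  on the circle with T = - sin^2 and on the torus with the product of two cosines.\<close>

lemma (in prob_space) xlogx_expectation_sums:
  fixes T W :: "'a \<Rightarrow> real"
  assumes T [measurable]: "T \<in> borel_measurable M" and W [measurable]: "W \<in> borel_measurable M"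
    and bT: "\<And>x. \<bar>T x\<bar> \<le> 1" and bW: "\<And>x. \<bar>W x\<bar> \<le> C"
  shows "(\<lambda>n. expectation (\<lambda>x. W x * (- T x) ^ (n + 2)) / ((real n + 2) * (real n + 1)))
     sums (expectation (\<lambda>x. W x * xlogx (1 + T x)) - expectation (\<lambda>x. W x * T x))"
proof -
  define f where "f = (\<lambda>n x. W x * (- T x) ^ (n + 2) / ((real n + 2) * (real n + 1)))"
  have C: "0 \<le> C" using bW[of undefined] by linarith
  have bf: "\<bar>f n x\<bar> \<le> C * (1 / ((real n + 2) * (real n + 1)))" for n x
  proof -
    have "\<bar>W x * (- T x) ^ (n + 2)\<bar> \<le> C * 1"
      unfolding abs_mult power_abs using bT bW C by (intro mult_mono power_le_one) auto
    then show ?thesis by (simp add: f_def divide_right_mono abs_mult)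
  qed
  have sC: "summable (\<lambda>n. C * (1 / ((real n + 2) * (real n + 1))))"
    using sums_summable[OF sums_mult[OF inverse_consecutive_sums]] .
  have int: "integrable M (f n)" for n
    by (rule integrable_const_bound[of _ "C * (1 / ((real n + 2) * (real n + 1)))"]) (use bf in \<open>auto simp: f_def\<close>)
  have iT: "integrable M (\<lambda>x. W x * T x)"
  proof (rule integrable_const_bound[of _ "C * 1"])
    show "AE x in M. norm (W x * T x) \<le> C * 1"
      unfolding real_norm_def abs_mult using bT bW C by (intro AE_I2 mult_mono) auto
  qed measurable
  have iX: "integrable M (\<lambda>x. W x * xlogx (1 + T x))"
  proof (rule integrable_const_bound[of _ "C * 2"])
    have bX: "\<bar>xlogx (1 + T x)\<bar> \<le> 2" for x using bT[of x] by (intro abs_xlogx_le) (auto simp: abs_le_iff)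
    show "AE x in M. norm (W x * xlogx (1 + T x)) \<le> C * 2"
      unfolding real_norm_def abs_mult using bX bW C by (intro AE_I2 mult_mono) auto
  qed measurable
  have "(\<lambda>n. expectation (f n)) sums expectation (\<lambda>x. \<Sum>n. f n x)"
  proof (rule sums_integral[OF int])
    show "AE x in M. summable (\<lambda>n. norm (f n x))"
      using bf by (intro AE_I2 summable_comparison_test'[OF sC, of 0]) auto
    show "summable (\<lambda>n. expectation (\<lambda>x. norm (f n x)))"
    proof (rule summable_comparison_test'[OF sC, of 0])
      fix n :: nat
      have "expectation (\<lambda>x. norm (f n x)) \<le> expectation (\<lambda>x. C * (1 / ((real n + 2) * (real n + 1))))"
        using bf int by (intro integral_mono_AE integrable_norm AE_I2) auto
      then show "norm (expectation (\<lambda>x. norm (f n x))) \<le> C * (1 / ((real n + 2) * (real n + 1)))"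
        by (simp add: prob_space)
    qed
  qed
  also have "(\<lambda>n. expectation (f n)) = (\<lambda>n. expectation (\<lambda>x. W x * (- T x) ^ (n + 2)) / ((real n + 2) * (real n + 1)))"
    by (simp add: f_def[abs_def])
  also have "expectation (\<lambda>x. \<Sum>n. f n x) = expectation (\<lambda>x. W x * xlogx (1 + T x) - W x * T x)"
  proof (intro Bochner_Integration.integral_cong refl)
    fix x
    have "(\<lambda>n. W x * ((- T x) ^ (n + 2) / ((real n + 2) * (real n + 1)))) sums (W x * (xlogx (1 + T x) - T x))"
      by (intro sums_mult xlogx_sums bT)
    then show "(\<Sum>n. f n x) = W x * xlogx (1 + T x) - W x * T x"
      by (simp add: f_def sums_iff algebra_simps)
  qed
  also have "\<dots> = expectation (\<lambda>x. W x * xlogx (1 + T x)) - expectation (\<lambda>x. W x * T x)"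
    by (rule Bochner_Integration.integral_diff[OF iX iT])
  finally show ?thesis .
qed

lemma integral_circ2_prod:
  fixes f g :: "real \<Rightarrow> real"
  assumes [measurable]: "f \<in> borel_measurable borel" "g \<in> borel_measurable borel"
    and "\<And>x. \<bar>f x\<bar> \<le> A" "\<And>x. \<bar>g x\<bar> \<le> B"
  shows "(\<integral>z. f (fst z) * g (snd z) \<partial>(circ \<Otimes>\<^sub>M circ)) = (\<integral>x. f x \<partial>circ) * (\<integral>x. g x \<partial>circ)"
proof -
  have "0 \<le> A" using assms(3)[of 0] by linarith
  then have "\<bar>f (fst z) * g (snd z)\<bar> \<le> A * B" for z
    unfolding abs_mult using assms by (intro mult_mono) auto
  then have "integrable (circ \<Otimes>\<^sub>M circ) (\<lambda>z. f (fst z) * g (snd z))"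
    by (intro integrable_circ2_bounded[of _ "A * B"]) auto
  from circ2.integral_fst'[OF this] show ?thesis by simp
qed

text \<open>Although the value turns out to be 2 ln 2, the series is kept as a symbol: in the torus
  average it cancels against the same term in \<open>wallis_sq_log\<close>, and no logarithm
  survives in the final constant.\<close>

definition wallis_log :: real where
  "wallis_log = (\<Sum>n. wallis_ratio (Suc n) / real (Suc n))"

definition wallis_sq_log :: real where
  "wallis_sq_log = (\<Sum>n. (wallis_ratio (Suc n))\<^sup>2 / real (Suc n))"

lemma integral_sin_sq_xlogx:
  "(\<integral>x. (sin x)\<^sup>2 * xlogx ((cos x)\<^sup>2) \<partial>circ) = 1/16 - wallis_log / 8"
proof -
  have b: "\<bar>(sin x)\<^sup>2\<bar> \<le> 1" for x :: real by (simp add: abs_square_le_1)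
  have "(\<lambda>n. (\<integral>x. (sin x)\<^sup>2 * (- (- (sin x)\<^sup>2)) ^ (n + 2) \<partial>circ) / ((real n + 2) * (real n + 1)))
     sums ((\<integral>x. (sin x)\<^sup>2 * xlogx (1 + - (sin x)\<^sup>2) \<partial>circ) - (\<integral>x. (sin x)\<^sup>2 * - (sin x)\<^sup>2 \<partial>circ))"
    by (rule circ.xlogx_expectation_sums[of _ _ 1]) (use b in auto)
  also have "(\<lambda>n. (\<integral>x. (sin x)\<^sup>2 * (- (- (sin x)\<^sup>2)) ^ (n + 2) \<partial>circ) / ((real n + 2) * (real n + 1)))
     = (\<lambda>n. wallis_ratio (n + 3) / ((real n + 2) * (real n + 1)))"
  proof
    fix n
    have "(sin x)\<^sup>2 * (- (- (sin x)\<^sup>2)) ^ (n + 2) = sin x ^ (2 * (n + 3))" for x :: real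
    proof -
      have "2 * (n + 3) = 2 + 2 * (n + 2)" by simp
      then show ?thesis unfolding minus_minus by (simp only: power_add power_mult)
    qed
    then show "(\<integral>x. (sin x)\<^sup>2 * (- (- (sin x)\<^sup>2)) ^ (n + 2) \<partial>circ) / ((real n + 2) * (real n + 1)) = wallis_ratio (n + 3) / ((real n + 2) * (real n + 1))"
      using sin_moment_even[of "n + 3"] by simp
  qed
  finally have "7/16 - wallis_log / 8 = (\<integral>x. (sin x)\<^sup>2 * xlogx (1 + - (sin x)\<^sup>2) \<partial>circ) - (\<integral>x. (sin x)\<^sup>2 * - (sin x)\<^sup>2 \<partial>circ)"
    using sums_unique2[OF wallis_log_sums] by (simp add: wallis_log_def)
  moreover have "(\<integral>x. (sin x)\<^sup>2 * - (sin x)\<^sup>2 \<partial>circ) = - wallis_ratio 2"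
  proof -
    have "(sin x)\<^sup>2 * - (sin x)\<^sup>2 = - (sin x ^ (2 * 2))" for x :: real by (simp add: power2_eq_square power4_eq_xxxx)
    then show ?thesis using sin_moment_even[of 2] by simp
  qed
  moreover have "wallis_ratio 2 = 3/8"
    using wallis_ratio_Suc[of 0] wallis_ratio_Suc[of "Suc 0"] by (simp add: numeral_2_eq_2)
  moreover have "1 + - (sin x)\<^sup>2 = (cos x)\<^sup>2" for x :: real by (simp add: cos_squared_eq)
  ultimately show ?thesis by simp
qed

lemma torus_moment:
  "(\<integral>z. (cos (snd z) - cos (fst z))\<^sup>2 * (cos (fst z) * cos (snd z)) ^ n \<partial>(circ \<Otimes>\<^sub>M circ))
     = 2 * ((\<integral>x. cos x ^ (n + 2) \<partial>circ) * (\<integral>x. cos x ^ n \<partial>circ) - (\<integral>x. cos x ^ (n + 1) \<partial>circ)\<^sup>2)"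
proof -
  have b: "\<bar>cos x ^ k\<bar> \<le> 1" for x :: real and k by (simp add: power_abs power_le_one)
  have P: "(\<integral>z. cos (fst z) ^ i * cos (snd z) ^ j \<partial>(circ \<Otimes>\<^sub>M circ)) = (\<integral>x. cos x ^ i \<partial>circ) * (\<integral>x. cos x ^ j \<partial>circ)" for i j
    by (rule integral_circ2_prod[of _ _ 1 1]) (use b in auto)
  have I: "integrable (circ \<Otimes>\<^sub>M circ) (\<lambda>z. cos (fst z) ^ i * cos (snd z) ^ j)" for i j
    by (rule integrable_circ2_bounded[of _ 1]) (use b in \<open>auto simp: abs_mult intro!: mult_le_one\<close>)
  have "(cos (snd z) - cos (fst z))\<^sup>2 * (cos (fst z) * cos (snd z)) ^ n
     = cos (fst z) ^ (n + 2) * cos (snd z) ^ n + cos (fst z) ^ n * cos (snd z) ^ (n + 2) - 2 * (cos (fst z) ^ (n + 1) * cos (snd z) ^ (n + 1))"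
    for z :: "real \<times> real"
    by (simp add: power_mult_distrib power2_eq_square algebra_simps)
  then show ?thesis
    by (simp only: Bochner_Integration.integral_diff[OF Bochner_Integration.integrable_add[OF I I] integrable_mult_right[OF I]]
        Bochner_Integration.integral_add[OF I I] integral_mult_right_zero P) (simp add: power2_eq_square algebra_simps)
qed

text \<open>Odd cosine moments vanish. Even powers of the product therefore retain a product of two
  consecutive Wallis ratios, and odd powers a squared ratio whose minus sign is cancelled by the
  sign of the power. Grouping the terms in pairs gives the series of
  \<open>wallis_mixed_sums\<close>.\<close>

lemma integral_torus_xlogx:
  "(\<integral>z. (cos (snd z) - cos (fst z))\<^sup>2 * xlogx (1 + cos (fst z) * cos (snd z)) \<partial>(circ \<Otimes>\<^sub>M circ))
     = - 1 / (3 * pi) - wallis_sq_log / 4"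
proof -
  define c where "c = (\<lambda>n. \<integral>x. cos x ^ n \<partial>circ)"
  have ce: "c (2 * m) = wallis_ratio m" "c (2 * m + 1) = 0" for m
    by (simp_all only: c_def cos_moment_even cos_moment_odd)
  define W where "W = (\<lambda>z::real\<times>real. (cos (snd z) - cos (fst z))\<^sup>2)"
  define T where "T = (\<lambda>z::real\<times>real. cos (fst z) * cos (snd z))"
  have [measurable]: "W \<in> borel_measurable borel" "T \<in> borel_measurable borel" unfolding W_def T_def by measurable
  have bT: "\<bar>T z\<bar> \<le> 1" for z by (simp add: T_def abs_mult mult_le_one)
  have bW: "\<bar>W z\<bar> \<le> 4" for z
  proof -
    have "\<bar>cos (snd z) - cos (fst z)\<bar> \<le> 2" using abs_cos_le_one[of "fst z"] abs_cos_le_one[of "snd z"] by linarith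
    then have "\<bar>cos (snd z) - cos (fst z)\<bar>\<^sup>2 \<le> 2\<^sup>2" by (intro power_mono) auto
    then show ?thesis by (simp add: W_def)
  qed
  have mom: "(\<integral>z. W z * T z ^ n \<partial>(circ \<Otimes>\<^sub>M circ)) = 2 * (c (n + 2) * c n - (c (n + 1))\<^sup>2)" for n
    unfolding W_def T_def c_def by (rule torus_moment)
  have mom': "(\<integral>z. W z * (- T z) ^ (n + 2) \<partial>(circ \<Otimes>\<^sub>M circ)) = (-1) ^ n * (2 * (c (n + 4) * c (n + 2) - (c (n + 3))\<^sup>2))" for n
  proof -
    have "W z * (- T z) ^ (n + 2) = (-1) ^ n * (W z * T z ^ (n + 2))" for z
      unfolding power_minus[of "T z" "n + 2"] power_add[of "-1" n 2] by (simp del: power_Suc add_2_eq_Suc')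
    moreover have "n + 2 + 2 = n + 4" "n + 2 + 1 = n + 3" by simp_all
    ultimately show ?thesis using mom[of "n + 2"] by (simp only: integral_mult_right_zero)
  qed
  have "(\<lambda>n. (\<integral>z. W z * (- T z) ^ (n + 2) \<partial>(circ \<Otimes>\<^sub>M circ)) / ((real n + 2) * (real n + 1)))
     sums ((\<integral>z. W z * xlogx (1 + T z) \<partial>(circ \<Otimes>\<^sub>M circ)) - (\<integral>z. W z * T z \<partial>(circ \<Otimes>\<^sub>M circ)))"
    by (rule circ2.P.xlogx_expectation_sums[of _ _ 4]) (use bT bW in \<open>auto simp: measurable_circ_pair\<close>)
  from sums_group[OF this, of 2]
  have "(\<lambda>n. \<Sum>j=n * 2..<n * 2 + 2. (-1) ^ j * (2 * (c (j + 4) * c (j + 2) - (c (j + 3))\<^sup>2)) / ((real j + 2) * (real j + 1)))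
     sums ((\<integral>z. W z * xlogx (1 + T z) \<partial>(circ \<Otimes>\<^sub>M circ)) - (\<integral>z. W z * T z \<partial>(circ \<Otimes>\<^sub>M circ)))"
    unfolding mom' by simp
  also have "(\<lambda>n. \<Sum>j=n * 2..<n * 2 + 2. (-1) ^ j * (2 * (c (j + 4) * c (j + 2) - (c (j + 3))\<^sup>2)) / ((real j + 2) * (real j + 1)))
    = (\<lambda>m. wallis_ratio (Suc m) * wallis_ratio (Suc (Suc m)) / (real (Suc m) * (2 * real m + 1))
      + (wallis_ratio (Suc (Suc m)))\<^sup>2 / ((2 * real m + 3) * real (Suc m)))"
  proof
    fix m :: nat
    have set: "{m * 2..<m * 2 + 2} = {2 * m, 2 * m + 1}" by auto
    have c1: "c (2 * m + 4) = wallis_ratio (Suc (Suc m))" "c (2 * m + 2) = wallis_ratio (Suc m)" "c (2 * m + 3) = 0"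
      using ce(1)[of "Suc (Suc m)"] ce(1)[of "Suc m"] ce(2)[of "Suc m"] by (simp_all add: numeral_eq_Suc)
    have c2: "c (2 * m + 1 + 4) = 0" "c (2 * m + 1 + 3) = wallis_ratio (Suc (Suc m))"
      using ce(2)[of "Suc (Suc m)"] ce(1)[of "Suc (Suc m)"] by (simp_all add: numeral_eq_Suc)
    have "(\<Sum>j=m * 2..<m * 2 + 2. (-1) ^ j * (2 * (c (j + 4) * c (j + 2) - (c (j + 3))\<^sup>2)) / ((real j + 2) * (real j + 1)))
      = 2 * (wallis_ratio (Suc (Suc m)) * wallis_ratio (Suc m)) / ((real (2 * m) + 2) * (real (2 * m) + 1))
       + 2 * (wallis_ratio (Suc (Suc m)))\<^sup>2 / ((real (2 * m + 1) + 2) * (real (2 * m + 1) + 1))"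
    proof -
      define g where "g = (\<lambda>j. (-1) ^ j * (2 * (c (j + 4) * c (j + 2) - (c (j + 3))\<^sup>2)) / ((real j + 2) * (real j + 1)))"
      have "sum g {2 * m, 2 * m + 1} = g (2 * m) + g (2 * m + 1)" by simp
      also have "g (2 * m) = 2 * (wallis_ratio (Suc (Suc m)) * wallis_ratio (Suc m)) / ((real (2 * m) + 2) * (real (2 * m) + 1))"
        unfolding g_def c1 by simp
      also have "g (2 * m + 1) = 2 * (wallis_ratio (Suc (Suc m)))\<^sup>2 / ((real (2 * m + 1) + 2) * (real (2 * m + 1) + 1))"
        unfolding g_def c2 by simp
      finally show ?thesis unfolding set g_def .
    qed
    also have "(real (2 * m) + 2) * (real (2 * m) + 1) = 2 * (real (Suc m) * (2 * real m + 1))" by (simp add: algebra_simps)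
    also have "(real (2 * m + 1) + 2) * (real (2 * m + 1) + 1) = 2 * ((2 * real m + 3) * real (Suc m))" by (simp add: algebra_simps)
    finally show "(\<Sum>j=m * 2..<m * 2 + 2. (-1) ^ j * (2 * (c (j + 4) * c (j + 2) - (c (j + 3))\<^sup>2)) / ((real j + 2) * (real j + 1)))
      = wallis_ratio (Suc m) * wallis_ratio (Suc (Suc m)) / (real (Suc m) * (2 * real m + 1))
      + (wallis_ratio (Suc (Suc m)))\<^sup>2 / ((2 * real m + 3) * real (Suc m))"
      unfolding mult_divide_mult_cancel_left_if by (simp only: mult.commute) simp
  qed
  finally have tot: "(\<lambda>m. wallis_ratio (Suc m) * wallis_ratio (Suc (Suc m)) / (real (Suc m) * (2 * real m + 1))
      + (wallis_ratio (Suc (Suc m)))\<^sup>2 / ((2 * real m + 3) * real (Suc m)))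
    sums ((\<integral>z. W z * xlogx (1 + T z) \<partial>(circ \<Otimes>\<^sub>M circ)) - (\<integral>z. W z * T z \<partial>(circ \<Otimes>\<^sub>M circ)))" .
  have "(\<integral>z. W z * xlogx (1 + T z) \<partial>(circ \<Otimes>\<^sub>M circ)) - (\<integral>z. W z * T z \<partial>(circ \<Otimes>\<^sub>M circ)) = 1/2 - 1 / (3 * pi) - wallis_sq_log / 4"
    unfolding wallis_sq_log_def by (rule sums_unique2[OF tot wallis_mixed_sums])
  moreover have "(\<integral>z. W z * T z \<partial>(circ \<Otimes>\<^sub>M circ)) = - 1/2"
  proof -
    have "c 1 = 0" using ce(2)[of 0] by simp
    moreover have "c (1 + 1) = 1/2"
    proof -
      have "c (1 + 1) = wallis_ratio 1" using ce(1)[of 1] by (simp only: one_add_one mult_1_right)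
      then show ?thesis using wallis_ratio_Suc[of 0] by simp
    qed
    ultimately have "(\<integral>z. W z * T z ^ 1 \<partial>(circ \<Otimes>\<^sub>M circ)) = 2 * (c (1 + 2) * 0 - (1/2)\<^sup>2)" using mom[of 1] by (simp only:)
    then show ?thesis by (simp add: power2_eq_square)
  qed
  ultimately show ?thesis by (simp add: W_def T_def)
qed

lemma integral_torus_kernel:
  "(\<integral>z. (sin (fst z))\<^sup>2 * (sin (snd z))\<^sup>2 * (xlogx ((cos (fst z))\<^sup>2 + (cos (snd z))\<^sup>2) - xlogx ((cos (fst z))\<^sup>2) - xlogx ((cos (snd z))\<^sup>2)) \<partial>(circ \<Otimes>\<^sub>M circ))
     = - 1 / (12 * pi) - wallis_sq_log / 16 - 1/16 + wallis_log / 8"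
proof -
  have sb: "\<bar>(sin x)\<^sup>2\<bar> \<le> 1" and cb: "0 \<le> (cos x)\<^sup>2" "(cos x)\<^sup>2 \<le> 1" for x :: real by (simp_all add: abs_square_le_1)
  have xb: "\<bar>xlogx ((cos x)\<^sup>2 + (cos y)\<^sup>2)\<bar> \<le> 2" "\<bar>xlogx ((cos x)\<^sup>2)\<bar> \<le> 2" for x y :: real
    using cb[of x] cb[of y] by (auto intro!: abs_xlogx_le)
  define S where "S = (\<lambda>z::real\<times>real. (sin (fst z))\<^sup>2 * (sin (snd z))\<^sup>2)"
  have [measurable]: "S \<in> borel_measurable borel" unfolding S_def by measurable
  have Sb: "\<bar>S z\<bar> \<le> 1" for z using sb[of "fst z"] sb[of "snd z"] by (simp only: S_def abs_mult) (intro mult_le_one; simp)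
  have prodb: "\<bar>S z * r\<bar> \<le> 2" if "\<bar>r\<bar> \<le> 2" for z r
    using mult_mono[OF Sb[of z] that] by (simp add: abs_mult)
  \<comment> \<open>The factor 1/4 compensates for (cos (x - y) - cos (x + y))^2 = 4 sin^2 x sin^2
    y.\<close>
  define H where "H = (\<lambda>z::real\<times>real. (1/4) * ((cos (snd z) - cos (fst z))\<^sup>2 * xlogx (1 + cos (fst z) * cos (snd z))))"
  have [measurable]: "H \<in> borel_measurable borel" unfolding H_def by measurable
  have Hb: "\<bar>H z\<bar> \<le> 2" for z
  proof -
    have "\<bar>cos (snd z) - cos (fst z)\<bar> \<le> 2" using abs_cos_le_one[of "fst z"] abs_cos_le_one[of "snd z"] by linarith
    then have 1: "\<bar>cos (snd z) - cos (fst z)\<bar>\<^sup>2 \<le> 2\<^sup>2" by (intro power_mono) auto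
    have "\<bar>cos (fst z) * cos (snd z)\<bar> \<le> 1" by (simp add: abs_mult mult_le_one)
    then have 2: "\<bar>xlogx (1 + cos (fst z) * cos (snd z))\<bar> \<le> 2" by (intro abs_xlogx_le) (auto simp: abs_le_iff)
    have "\<bar>cos (snd z) - cos (fst z)\<bar>\<^sup>2 * \<bar>xlogx (1 + cos (fst z) * cos (snd z))\<bar> \<le> 2\<^sup>2 * 2"
      using 1 2 by (intro mult_mono) auto
    then show ?thesis by (simp add: H_def abs_mult)
  qed
  have HS: "H (x + y, x - y) = S (x, y) * xlogx ((cos x)\<^sup>2 + (cos y)\<^sup>2)" for x y
  proof -
    have "cos (x - y) - cos (x + y) = 2 * (sin x * sin y)" by (simp add: cos_diff cos_add)
    moreover have "cos (x + y) * cos (x - y) = (cos x)\<^sup>2 + (cos y)\<^sup>2 - 1"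
    proof -
      have s: "sin u * sin u = 1 - cos u * cos u" for u :: real by (simp add: sin_squared_eq flip: power2_eq_square)
      have "cos (x + y) * cos (x - y) = (cos x * cos x) * (cos y * cos y) - (sin x * sin x) * (sin y * sin y)"
        by (simp add: cos_diff cos_add algebra_simps)
      then show ?thesis unfolding s by (simp add: power2_eq_square algebra_simps)
    qed
    ultimately show ?thesis by (simp add: H_def S_def power_mult_distrib)
  qed
  have T1: "(\<integral>z. S z * xlogx ((cos (fst z))\<^sup>2 + (cos (snd z))\<^sup>2) \<partial>(circ \<Otimes>\<^sub>M circ)) = (- 1 / (3 * pi) - wallis_sq_log / 4) / 4"
  proof -
    have "(\<integral>z. S z * xlogx ((cos (fst z))\<^sup>2 + (cos (snd z))\<^sup>2) \<partial>(circ \<Otimes>\<^sub>M circ)) = (\<integral>z. H (fst z + snd z, fst z - snd z) \<partial>(circ \<Otimes>\<^sub>M circ))"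
      by (simp add: HS)
    also have "\<dots> = (\<integral>z. H z \<partial>(circ \<Otimes>\<^sub>M circ))"
      by (rule integral_torus_rotation[of _ 2]) (use Hb in \<open>auto simp: H_def\<close>)
    also have "\<dots> = (1/4) * (\<integral>z. (cos (snd z) - cos (fst z))\<^sup>2 * xlogx (1 + cos (fst z) * cos (snd z)) \<partial>(circ \<Otimes>\<^sub>M circ))"
      unfolding H_def by (rule integral_mult_right_zero)
    finally show ?thesis unfolding integral_torus_xlogx by simp
  qed
  have s2: "(\<integral>x. (sin x)\<^sup>2 \<partial>circ) = 1/2" using sin_moment_even[of 1] wallis_ratio_Suc[of 0] by simp
  define Y where "Y = (\<lambda>x::real. (sin x)\<^sup>2 * xlogx ((cos x)\<^sup>2))"
  have [measurable]: "Y \<in> borel_measurable borel" unfolding Y_def by measurable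
  have Yb: "\<bar>Y x\<bar> \<le> 2" for x
    using mult_mono[OF sb[of x] xb(2)[of x]] by (simp add: Y_def abs_mult)
  have T2: "(\<integral>z. S z * xlogx ((cos (fst z))\<^sup>2) \<partial>(circ \<Otimes>\<^sub>M circ)) = (1/16 - wallis_log / 8) / 2"
  proof -
    have "(\<integral>z. S z * xlogx ((cos (fst z))\<^sup>2) \<partial>(circ \<Otimes>\<^sub>M circ)) = (\<integral>z. Y (fst z) * (sin (snd z))\<^sup>2 \<partial>(circ \<Otimes>\<^sub>M circ))"
      by (simp add: S_def Y_def mult_ac)
    also have "\<dots> = (\<integral>x. Y x \<partial>circ) * (\<integral>x. (sin x)\<^sup>2 \<partial>circ)"
      by (rule integral_circ2_prod[of _ _ 2 1]) (use Yb sb in auto)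
    finally show ?thesis using integral_sin_sq_xlogx s2 by (simp add: Y_def)
  qed
  have T3: "(\<integral>z. S z * xlogx ((cos (snd z))\<^sup>2) \<partial>(circ \<Otimes>\<^sub>M circ)) = (1/16 - wallis_log / 8) / 2"
  proof -
    have "(\<integral>z. S z * xlogx ((cos (snd z))\<^sup>2) \<partial>(circ \<Otimes>\<^sub>M circ)) = (\<integral>z. (sin (fst z))\<^sup>2 * Y (snd z) \<partial>(circ \<Otimes>\<^sub>M circ))"
      by (simp add: S_def Y_def mult_ac)
    also have "\<dots> = (\<integral>x. (sin x)\<^sup>2 \<partial>circ) * (\<integral>x. Y x \<partial>circ)"
      by (rule integral_circ2_prod[of _ _ 1 2]) (use Yb sb in auto)
    finally show ?thesis using integral_sin_sq_xlogx s2 by (simp add: Y_def)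
  qed
  have i: "integrable (circ \<Otimes>\<^sub>M circ) (\<lambda>z. S z * xlogx ((cos (fst z))\<^sup>2 + (cos (snd z))\<^sup>2))"
    "integrable (circ \<Otimes>\<^sub>M circ) (\<lambda>z. S z * xlogx ((cos (fst z))\<^sup>2))" "integrable (circ \<Otimes>\<^sub>M circ) (\<lambda>z. S z * xlogx ((cos (snd z))\<^sup>2))"
    by (rule integrable_circ2_bounded[of _ 2]; use prodb xb in auto)+
  have "(\<integral>z. S z * (xlogx ((cos (fst z))\<^sup>2 + (cos (snd z))\<^sup>2) - xlogx ((cos (fst z))\<^sup>2) - xlogx ((cos (snd z))\<^sup>2)) \<partial>(circ \<Otimes>\<^sub>M circ))
     = (- 1 / (3 * pi) - wallis_sq_log / 4) / 4 - (1/16 - wallis_log / 8) / 2 - (1/16 - wallis_log / 8) / 2"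
    unfolding right_diff_distrib using i by (simp only: Bochner_Integration.integral_diff[OF Bochner_Integration.integrable_diff] Bochner_Integration.integral_diff T1 T2 T3)
  then show ?thesis by (simp add: S_def field_simps)
qed

section \<open>Logarithmic series and Catalan's constant\<close>

text \<open>Extends an identity to the endpoint, in the manner of Abel's theorem, for series that
  converge uniformly up to 1.\<close>

lemma continuous_unit_interval_eq_at_1:
  fixes f g :: "real \<Rightarrow> real"
  assumes "continuous_on {0..1} f" "continuous_on {0..1} g" and eq: "\<And>x. 0 \<le> x \<Longrightarrow> x < 1 \<Longrightarrow> f x = g x"
  shows "f 1 = g 1"
proof -
  define u where "u = (\<lambda>n. 1 - 1 / (real n + 1))"
  have u: "u \<longlonglongrightarrow> 1" unfolding u_def by real_asymp
  have r: "u n \<in> {0..1}" "u n < 1" for n by (auto simp: u_def field_simps)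
  have "(\<lambda>n. f (u n)) \<longlonglongrightarrow> f 1" "(\<lambda>n. g (u n)) \<longlonglongrightarrow> g 1"
    using assms(1,2) u r by (auto simp: continuous_on_sequentially o_def)
  moreover have "f (u n) = g (u n)" for n using r[of n] by (intro eq) auto
  ultimately show ?thesis using LIMSEQ_unique by (metis (no_types, lifting) ext)
qed

lemma wallis_power_sums:
  assumes "\<bar>x\<bar> < 1" shows "(\<lambda>n. wallis_ratio n * x ^ n) sums (1 / sqrt (1 - x))"
proof -
  have "(\<lambda>n. ((- (1/2)) gchoose n) * (- x) ^ n) sums (1 + - x) powr (- (1/2))"
    using assms by (intro gen_binomial_real) simp
  moreover have "((- (1/2)) gchoose n) * (- x) ^ n = wallis_ratio n * x ^ n" for n
  proof -
    have "(-1) ^ n * (- x) ^ n = x ^ n" by (simp flip: power_mult_distrib)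
    then show ?thesis by (simp add: gbinomial_pochhammer wallis_ratio_def mult.commute mult.left_commute)
  qed
  moreover have "(1 + - x) powr (- (1/2)) = 1 / sqrt (1 - x)"
    using assms by (simp add: powr_minus_divide powr_half_sqrt)
  ultimately show ?thesis by simp
qed

section \<open>Closed form of the logarithmic Wallis series\<close>

definition wallis_log_series :: "real \<Rightarrow> real" where
  "wallis_log_series x = (\<Sum>n. wallis_ratio (Suc n) / real (Suc n) * x ^ Suc n)"

lemma norm_wallis_log_term_le:
  assumes "0 \<le> x" "x \<le> 1"
  shows "norm (wallis_ratio (Suc n) / real (Suc n) * x ^ Suc n) \<le> wallis_ratio (Suc n) / real (Suc n)"
proof -
  have "wallis_ratio (Suc n) / real (Suc n) * x ^ Suc n \<le> wallis_ratio (Suc n) / real (Suc n) * 1"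
    using assms wallis_ratio_pos[of "Suc n"] by (intro mult_left_mono power_le_one) auto
  moreover have "0 \<le> wallis_ratio (Suc n) / real (Suc n) * x ^ Suc n"
    using assms wallis_ratio_pos[of "Suc n"] by (intro mult_nonneg_nonneg) auto
  ultimately show ?thesis by simp
qed

lemma continuous_wallis_log_series: "continuous_on {0..1} wallis_log_series"
proof (rule uniform_limit_theorem)
  show "uniform_limit {0..1} (\<lambda>N x. \<Sum>n<N. wallis_ratio (Suc n) / real (Suc n) * x ^ Suc n) wallis_log_series sequentially"
    unfolding wallis_log_series_def
    by (rule Weierstrass_m_test[OF _ summable_wallis_div]) (rule norm_wallis_log_term_le; simp)
  show "\<forall>\<^sub>F N in sequentially. continuous_on {0..1} (\<lambda>x::real. \<Sum>n<N. wallis_ratio (Suc n) / real (Suc n) * x ^ Suc n)"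
    by (intro always_eventually allI continuous_intros)
qed simp

text \<open>For x > 0 the series differentiates to (1 / sqrt (1 - x) - 1) / x. With q = sqrt (1 - x)
  this is 1 / (q (1 + q)), the negative of the derivative of the logarithmic term; x = 0 is treated
  apart because of the division.\<close>

lemma wallis_log_series_deriv:
  assumes "0 \<le> x" "x < 1"
  shows "((\<lambda>x. wallis_log_series x + 2 * ln ((1 + sqrt (1 - x)) / 2)) has_real_derivative 0) (at x)"
proof -
  have s: "summable (\<lambda>n. wallis_ratio (Suc n) * x ^ n)" if "\<bar>x\<bar> < 1" for x
  proof (cases "x = 0")
    case False
    have "summable (\<lambda>n. wallis_ratio (Suc n) * x ^ Suc n)"
      using sums_summable[OF wallis_power_sums[OF that]] by (subst summable_Suc_iff)
    from summable_mult[OF this, of "1 / x"] show ?thesis using False by simp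
  qed (auto intro!: summable_finite[of "{0}"])
  have e: "wallis_ratio (Suc n) / real (Suc n) * real (Suc n) * y ^ n = wallis_ratio (Suc n) * y ^ n" for n y by simp
  have "((\<lambda>x. \<Sum>n. wallis_ratio (Suc n) / real (Suc n) * x ^ Suc n) has_real_derivative
      (\<Sum>n. wallis_ratio (Suc n) / real (Suc n) * real (Suc n) * x ^ n)) (at x)"
    by (rule DERIV_power_series'[of 1]) (use assms s in \<open>auto simp only: e greaterThanLessThan_iff abs_less_iff\<close>, auto)
  then have d: "(wallis_log_series has_real_derivative (\<Sum>n. wallis_ratio (Suc n) * x ^ n)) (at x)"
    unfolding wallis_log_series_def[abs_def] e .
  define q where "q = sqrt (1 - x)"
  have q: "q > 0" "q * q = 1 - x" using assms by (auto simp: q_def)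
  have "((\<lambda>x. 2 * ln ((1 + sqrt (1 - x)) / 2)) has_real_derivative (- (1 / (q * (1 + q))))) (at x)"
    using assms q by (auto intro!: derivative_eq_intros simp: q_def[symmetric] field_simps)
  moreover have "(\<Sum>n. wallis_ratio (Suc n) * x ^ n) = 1 / (q * (1 + q))"
  proof (cases "x = 0")
    case True
    have "(\<Sum>n. wallis_ratio (Suc n) * x ^ n) = wallis_ratio (Suc 0)"
      using suminf_finite[of "{0}" "\<lambda>n. wallis_ratio (Suc n) * x ^ n"] True by simp
    moreover have "q = 1" using True by (simp add: q_def)
    ultimately show ?thesis using wallis_ratio_Suc[of 0] by simp
  next
    case False
    have "(\<lambda>n. wallis_ratio n * x ^ n) sums (1 / q)" using wallis_power_sums[of x] assms by (simp add: q_def)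
    then have "(\<lambda>n. wallis_ratio (Suc n) * x ^ Suc n) sums (1 / q - 1)" by (subst sums_Suc_iff) simp
    from sums_mult[OF this, of "1 / x"] have "(\<lambda>n. wallis_ratio (Suc n) * x ^ n) sums (1 / x * (1 / q - 1))"
      using False by simp
    moreover have "1 / x * (1 / q - 1) = 1 / (q * (1 + q))"
    proof -
      have x: "x = (1 - q) * (1 + q)" using q(2) by (simp add: algebra_simps)
      have "1 - q \<noteq> 0" using False x by auto
      moreover have "1 / q - 1 = (1 - q) / q" using q(1) by (simp add: field_simps)
      ultimately show ?thesis unfolding x using q(1) by (simp add: divide_simps)
    qed
    ultimately show ?thesis by (simp add: sums_iff)
  qed
  ultimately show ?thesis using DERIV_add[OF d] by fastforce
qed

lemma wallis_log_series_eq: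
  assumes "0 \<le> x" "x \<le> 1"
  shows "wallis_log_series x = - 2 * ln ((1 + sqrt (1 - x)) / 2)"
proof -
  have nz: "1 + sqrt (1 - y) \<noteq> 0" if "y \<le> 1" for y :: real
    using real_sqrt_ge_zero[of "1 - y"] that by linarith
  have lt: "wallis_log_series x = - 2 * ln ((1 + sqrt (1 - x)) / 2)" if "0 \<le> x" "x < 1" for x
  proof -
    have "wallis_log_series x + 2 * ln ((1 + sqrt (1 - x)) / 2) = wallis_log_series 0 + 2 * ln ((1 + sqrt (1 - 0)) / 2)"
    proof (cases "x = 0")
      case False
      show ?thesis
      proof (rule DERIV_isconst_end[where f="\<lambda>x. wallis_log_series x + 2 * ln ((1 + sqrt (1 - x)) / 2)"])
        show "0 < x" using that False by simp
        have "continuous_on {0..x} wallis_log_series"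
          by (rule continuous_on_subset[OF continuous_wallis_log_series]) (use that in auto)
        then show "continuous_on {0..x} (\<lambda>x. wallis_log_series x + 2 * ln ((1 + sqrt (1 - x)) / 2))"
          using nz that by (intro continuous_intros) auto
        fix y assume "0 < y" "y < x"
        then show "((\<lambda>x. wallis_log_series x + 2 * ln ((1 + sqrt (1 - x)) / 2)) has_real_derivative 0) (at y)"
          using that by (intro wallis_log_series_deriv) auto
      qed
    qed simp
    then show ?thesis by (simp add: wallis_log_series_def)
  qed
  have "wallis_log_series 1 = - 2 * ln ((1 + sqrt (1 - 1)) / 2)"
  proof (rule continuous_unit_interval_eq_at_1[where g = "\<lambda>x. - 2 * ln ((1 + sqrt (1 - x)) / 2)", OF continuous_wallis_log_series _ lt])
    show "continuous_on {0..1} (\<lambda>x::real. - 2 * ln ((1 + sqrt (1 - x)) / 2))"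
      using nz by (intro continuous_intros) auto
  qed
  with lt[of x] assms show ?thesis by (cases "x = 1") auto
qed

lemma wallis_log_eq: "wallis_log = 2 * ln 2"
  using wallis_log_series_eq[of 1] by (simp add: wallis_log_series_def wallis_log_def ln_div)

section \<open>Catalan's constant as the integral of a logarithm\<close>

lemma ln_trig_series_sums:
  assumes "0 \<le> r" "r < 1"
  shows "(\<lambda>n. 2 * ((-1) ^ Suc n / real n * r ^ n) * cos (real n * (t - pi / 2))) sums ln (1 + 2 * r * sin t + r\<^sup>2)"
proof -
  \<comment> \<open>The real part of ln (1 + z) is ln |1 + z|. The rotation by pi / 2 turns the
    cosine in |1 + z|^2 = 1 + 2 r cos (t - pi / 2) + r^2 into a sine.\<close>
  define z where "z = rcis r (t - pi / 2)"
  have nz: "norm z < 1" using assms by (simp add: z_def)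
  from bounded_linear.sums[OF bounded_linear_Re Ln_series[OF nz]]
  have "(\<lambda>n. Re ((-1) ^ Suc n / of_nat n * z ^ n)) sums Re (ln (1 + z))" .
  also have "Re (ln (1 + z)) = ln (norm (1 + z))"
  proof -
    have "1 + z \<noteq> 0" using nz by (metis add.inverse_inverse add_eq_0_iff less_irrefl norm_minus_cancel norm_one)
    then show ?thesis by simp
  qed
  also have "(\<lambda>n. Re ((-1) ^ Suc n / of_nat n * z ^ n)) = (\<lambda>n. (-1) ^ Suc n / real n * r ^ n * cos (real n * (t - pi / 2)))"
  proof
    fix n
    have "(-1) ^ Suc n / of_nat n = complex_of_real ((-1) ^ Suc n / real n)" by simp
    moreover have "Re (complex_of_real c * w) = c * Re w" for c w by simp
    ultimately show "Re ((-1) ^ Suc n / of_nat n * z ^ n) = (-1) ^ Suc n / real n * r ^ n * cos (real n * (t - pi / 2))"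
      by (simp only: z_def DeMoivre2 Re_rcis mult.assoc)
  qed
  finally have "(\<lambda>n. 2 * ((-1) ^ Suc n / real n * r ^ n * cos (real n * (t - pi / 2)))) sums (2 * ln (norm (1 + z)))"
    by (rule sums_mult)
  moreover have "2 * ln (norm (1 + z)) = ln (1 + 2 * r * sin t + r\<^sup>2)"
  proof -
    have "(norm (1 + z))\<^sup>2 = 1 + 2 * r * sin t + r\<^sup>2 * ((sin t)\<^sup>2 + (cos t)\<^sup>2)"
    proof -
      have "Re (1 + z) = 1 + r * sin t" "Im (1 + z) = - r * cos t"
        by (simp_all add: z_def rcis_def cos_diff sin_diff)
      then show ?thesis unfolding cmod_power2
        by (simp add: power2_eq_square algebra_simps del: sin_cos_squared_add sin_cos_squared_add2 sin_cos_squared_add3)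
    qed
    then have e: "(norm (1 + z))\<^sup>2 = 1 + 2 * r * sin t + r\<^sup>2" by simp
    have "norm (1 + z) > 0" using nz by (metis add.inverse_inverse add_eq_0_iff less_irrefl norm_minus_cancel norm_one zero_less_norm_iff)
    then show ?thesis unfolding e[symmetric] by (simp add: ln_realpow)
  qed
  ultimately show ?thesis by (simp only: mult.assoc)
qed

lemma integral_cos_shifted:
  "((\<lambda>t. cos (real n * (t - pi / 2))) has_integral (if n = 0 then pi else 2 * sin (real n * (pi / 2)) / real n)) {0..pi}"
proof (cases "n = 0")
  case True
  then show ?thesis using has_integral_const_real[of "1::real" 0 pi] by simp
next
  case False
  have "((\<lambda>t. cos (real n * (t - pi / 2))) has_integral
     (sin (real n * (pi - pi / 2)) / real n - sin (real n * (0 - pi / 2)) / real n)) {0..pi}"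
  proof (rule fundamental_theorem_of_calculus)
    fix x :: real
    show "((\<lambda>t. sin (real n * (t - pi / 2)) / real n) has_vector_derivative cos (real n * (x - pi / 2))) (at x within {0..pi})"
      using False unfolding has_real_derivative_iff_has_vector_derivative[symmetric]
      by (auto intro!: derivative_eq_intros)
  qed simp
  moreover have "pi - pi / 2 = pi / 2" by simp
  ultimately show ?thesis using False by simp
qed

lemma integral_ln_trig_sums:
  assumes r: "0 \<le> r" "r < 1"
  shows "(\<lambda>k. 4 * ((-1) ^ k * r ^ (2 * k + 1) / (2 * real k + 1)\<^sup>2)) sums integral {0..pi} (\<lambda>t. ln (1 + 2 * r * sin t + r\<^sup>2))"
proof -
  define a where "a = (\<lambda>n. 2 * ((-1) ^ Suc n / real n * r ^ n))"
  define I where "I = (\<lambda>n. if n = 0 then pi else 2 * sin (real n * (pi / 2)) / real n)"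
  define f where "f = (\<lambda>n t. a n * cos (real n * (t - pi / 2)))"
  have "uniform_limit {0..pi} (\<lambda>N t. \<Sum>n<N. f n t) (\<lambda>t. suminf (\<lambda>n. f n t)) sequentially"
  proof (rule Weierstrass_m_test)
    fix n t
    have "\<bar>a n\<bar> \<le> 2 * r ^ n"
    proof (cases n)
      case (Suc m)
      have "r ^ n / real n \<le> r ^ n / 1" using r Suc by (intro divide_left_mono) auto
      then show ?thesis using r by (simp add: a_def abs_mult power_abs)
    qed (simp add: a_def)
    then have "\<bar>a n\<bar> * \<bar>cos (real n * (t - pi / 2))\<bar> \<le> (2 * r ^ n) * 1"
      using r by (intro mult_mono) auto
    then show "norm (f n t) \<le> 2 * r ^ n" by (simp add: f_def abs_mult)
    show "summable (\<lambda>n. 2 * r ^ n)" using r by (intro summable_mult summable_geometric) simp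
  qed
  moreover have "suminf (\<lambda>n. f n t) = ln (1 + 2 * r * sin t + r\<^sup>2)" for t
    using ln_trig_series_sums[OF r, of t] unfolding f_def a_def by (rule sums_unique[symmetric])
  ultimately have u: "uniform_limit {0..pi} (\<lambda>N t. \<Sum>n<N. f n t) (\<lambda>t. ln (1 + 2 * r * sin t + r\<^sup>2)) sequentially" by simp
  have c: "continuous_on {0..pi} (\<lambda>t. \<Sum>n<N. f n t)" for N unfolding f_def by (intro continuous_intros)
  obtain K J where K: "\<And>N. ((\<lambda>t. \<Sum>n<N. f n t) has_integral K N) {0..pi}"
    and J: "((\<lambda>t. ln (1 + 2 * r * sin t + r\<^sup>2)) has_integral J) {0..pi}" "K \<longlonglongrightarrow> J"
    using uniform_limit_integral[OF u c] by auto
  have "((\<lambda>t. \<Sum>n<N. f n t) has_integral (\<Sum>n<N. a n * I n)) {0..pi}" for N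
    unfolding f_def I_def by (intro has_integral_sum has_integral_mult_right integral_cos_shifted) simp
  then have "K = (\<lambda>N. \<Sum>n<N. a n * I n)" using K has_integral_unique by blast
  then have "(\<lambda>n. a n * I n) sums J" using J(2) by (simp add: sums_def)
  from sums_group[OF this, of 2] have "(\<lambda>k. \<Sum>n=k * 2..<k * 2 + 2. a n * I n) sums J" by simp
  also have "(\<lambda>k. \<Sum>n=k * 2..<k * 2 + 2. a n * I n) = (\<lambda>k. 4 * ((-1) ^ k * r ^ (2 * k + 1) / (2 * real k + 1)\<^sup>2))"
  proof
    fix k :: nat
    have set: "{k * 2..<k * 2 + 2} = {2 * k, 2 * k + 1}" by auto
    \<comment> \<open>For k > 0 the sine of a multiple of pi vanishes; for k = 0 the coefficient
      \<open>a 0\<close> is 0 because division by 0 yields 0.\<close>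
    have "a (2 * k) * I (2 * k) = 0"
    proof (cases "k = 0")
      case False
      have "real (2 * k) * (pi / 2) = real k * pi" by simp
      then have "I (2 * k) = 0" using False unfolding I_def by (simp only:) simp
      then show ?thesis by simp
    qed (simp add: a_def)
    moreover have "a (2 * k + 1) * I (2 * k + 1) = 4 * ((-1) ^ k * r ^ (2 * k + 1) / (2 * real k + 1)\<^sup>2)"
    proof -
      have "real (2 * k + 1) * (pi / 2) = real k * pi + pi / 2" by (simp add: algebra_simps)
      then have "sin (real (2 * k + 1) * (pi / 2)) = (-1) ^ k" by (simp only: sin_add) simp
      moreover have "(-1::real) ^ Suc (2 * k + 1) = 1" by simp
      moreover have "real (2 * k + 1) = 2 * real k + 1" "2 * k + 1 \<noteq> 0" by simp_all
      ultimately show ?thesis unfolding a_def I_def by (simp only: if_False power2_eq_square) (simp add: field_simps)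
    qed
    moreover have "(\<Sum>n\<in>{2 * k, 2 * k + 1}. a n * I n) = a (2 * k) * I (2 * k) + a (2 * k + 1) * I (2 * k + 1)" by simp
    ultimately show "(\<Sum>n=k * 2..<k * 2 + 2. a n * I n) = 4 * ((-1) ^ k * r ^ (2 * k + 1) / (2 * real k + 1)\<^sup>2)"
      unfolding set by (simp only: add_0)
  qed
  also have "J = integral {0..pi} (\<lambda>t. ln (1 + 2 * r * sin t + r\<^sup>2))" using J(1) by (simp add: integral_unique)
  finally show ?thesis .
qed

text \<open>At r = 1 the argument of the logarithm becomes 2 (1 + sin t). The geometric domination
  available for r < 1 is lost there, but the integrated series has coefficients of order 1 / (2 k +
  1)^2, so both sides are continuous up to r = 1.\<close>

lemma integral_ln_1_plus_sin: "integral {0..pi} (\<lambda>t. ln (1 + sin t)) = 4 * catalan_const - pi * ln 2"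
proof -
  define F where "F = (\<lambda>r. integral {0..pi} (\<lambda>t. ln (1 + 2 * r * sin t + r\<^sup>2)))"
  define S where "S = (\<lambda>r::real. \<Sum>k. 4 * ((-1) ^ k * r ^ (2 * k + 1) / (2 * real k + 1)\<^sup>2))"
  have pos: "1 + 2 * r * sin t + r\<^sup>2 \<ge> 1" if "r \<in> {0..1}" "t \<in> {0..pi}" for r t :: real
    using that by (simp add: sin_ge_zero)
  have "continuous_on {0..1} F"
  proof -
    have "continuous_on ({0..1} \<times> cbox 0 pi) (\<lambda>z. ln (1 + 2 * fst z * sin (snd z) + (fst z)\<^sup>2))"
    proof (intro continuous_intros ballI)
      fix z :: "real \<times> real" assume "z \<in> {0..1} \<times> cbox 0 pi"
      then show "1 + 2 * fst z * sin (snd z) + (fst z)\<^sup>2 \<noteq> 0" using pos[of "fst z" "snd z"] by (auto simp: mem_Times_iff)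
    qed
    then have "continuous_on ({0..1} \<times> cbox 0 pi) (\<lambda>(r, t). ln (1 + 2 * r * sin t + r\<^sup>2))" by (simp add: case_prod_beta)
    from integral_continuous_on_param[OF this] show ?thesis by (simp add: F_def)
  qed
  moreover have "continuous_on {0..1} S"
  proof (rule uniform_limit_theorem)
    have sm: "summable (\<lambda>k. 4 * (1 / (real (Suc k))\<^sup>2))"
      by (intro summable_mult) (use inverse_squares_sums in \<open>auto simp: sums_iff add.commute\<close>)
    show "uniform_limit {0..1} (\<lambda>N r. \<Sum>k<N. 4 * ((-1) ^ k * r ^ (2 * k + 1) / (2 * real k + 1)\<^sup>2)) S sequentially"
      unfolding S_def
    proof (rule Weierstrass_m_test[OF _ sm])
      fix k and r :: real assume "r \<in> {0..1}"
      then have "\<bar>r ^ (2 * k + 1)\<bar> \<le> 1" unfolding power_abs by (intro power_le_one) auto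
      then have "\<bar>r ^ (2 * k + 1)\<bar> / (2 * real k + 1)\<^sup>2 \<le> 1 / (real (Suc k))\<^sup>2"
        by (intro frac_le power_mono) auto
      then show "norm (4 * ((-1) ^ k * r ^ (2 * k + 1) / (2 * real k + 1)\<^sup>2)) \<le> 4 * (1 / (real (Suc k))\<^sup>2)"
        unfolding real_norm_def abs_mult abs_divide power_abs[of "-1"] by (simp del: power_Suc add: power_abs)
    qed
    show "\<forall>\<^sub>F N in sequentially. continuous_on {0..1} (\<lambda>r::real. \<Sum>k<N. 4 * ((-1) ^ k * r ^ (2 * k + 1) / (2 * real k + 1)\<^sup>2))"
      by (intro always_eventually allI continuous_intros) auto
  qed simp
  moreover have "F r = S r" if "0 \<le> r" "r < 1" for r
    using sums_unique[OF integral_ln_trig_sums[OF that]] by (simp add: F_def S_def)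
  ultimately have "F 1 = S 1" by (rule continuous_unit_interval_eq_at_1)
  moreover have "S 1 = 4 * catalan_const"
  proof -
    have "summable (\<lambda>k. (-1) ^ k / (2 * real k + 1)\<^sup>2)"
    proof (rule summable_comparison_test'[of "\<lambda>k. 1 / (real (Suc k))\<^sup>2" 0])
      show "summable (\<lambda>k. 1 / (real (Suc k))\<^sup>2)" using inverse_squares_sums by (auto simp: sums_iff add.commute)
      fix k :: nat
      have "1 / (2 * real k + 1)\<^sup>2 \<le> 1 / (real (Suc k))\<^sup>2" by (intro frac_le power_mono) auto
      then show "norm ((-1) ^ k / (2 * real k + 1)\<^sup>2) \<le> 1 / (real (Suc k))\<^sup>2" by (simp add: power_abs abs_divide)
    qed
    from suminf_mult[OF this, of 4] show ?thesis by (simp add: S_def catalan_const_def)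
  qed
  moreover have "F 1 = pi * ln 2 + integral {0..pi} (\<lambda>t. ln (1 + sin t))"
  proof -
    have nz: "1 + sin t \<noteq> 0" if "t \<in> {0..pi}" for t :: real using sin_ge_zero[of t] that by auto
    have "F 1 = integral {0..pi} (\<lambda>t. ln 2 + ln (1 + sin t))" unfolding F_def
    proof (rule Henstock_Kurzweil_Integration.integral_cong)
      fix t assume "t \<in> {0..pi}"
      then have "1 + sin t > 0" using sin_ge_zero[of t] by auto
      then have "ln (2 * (1 + sin t)) = ln 2 + ln (1 + sin t)" by (intro ln_mult_pos) auto
      moreover have "1 + 2 * 1 * sin t + 1\<^sup>2 = 2 * (1 + sin t)" by simp
      ultimately show "ln (1 + 2 * 1 * sin t + 1\<^sup>2) = ln 2 + ln (1 + sin t)" by (simp only:)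
    qed
    also have "\<dots> = integral {0..pi} (\<lambda>t. ln 2) + integral {0..pi} (\<lambda>t. ln (1 + sin t))"
      using nz by (intro Henstock_Kurzweil_Integration.integral_add integrable_continuous_interval continuous_intros) auto
    finally show ?thesis by simp
  qed
  ultimately show ?thesis by simp
qed

lemma expectation_ln_1_plus_abs_sin: "(\<integral>x. ln (1 + \<bar>sin x\<bar>) \<partial>circ) = 4 * catalan_const / pi - ln 2"
proof -
  define f where "f = (\<lambda>x::real. ln (1 + \<bar>sin x\<bar>))"
  have c: "continuous_on A f" for A
  proof -
    have "1 + \<bar>sin x\<bar> > 0" for x :: real by (simp add: add_pos_nonneg)
    then show ?thesis unfolding f_def by (intro continuous_intros ballI) (metis less_irrefl)
  qed
  have i: "f integrable_on {a..b}" for a b by (rule integrable_continuous_interval[OF c])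
  have "integral {0..pi} f = integral {0..pi} (\<lambda>t. ln (1 + sin t))"
    unfolding f_def by (rule Henstock_Kurzweil_Integration.integral_cong) (simp add: sin_ge_zero)
  then have 1: "integral {0..pi} f = 4 * catalan_const - pi * ln 2" by (simp only: integral_ln_1_plus_sin)
  have "f \<circ> (+) pi = f" by (auto simp: f_def fun_eq_iff add.commute[of pi])
  then have 2: "integral {pi..2 * pi} f = integral {0..pi} f"
    using integral_shift_Icc_real[of 0 pi f pi] by simp
  have "integral {0..2 * pi} f = integral {0..pi} f + integral {pi..2 * pi} f"
    using Henstock_Kurzweil_Integration.integral_combine[of 0 pi "2 * pi" f] i by simp
  then have "integral {0..2 * pi} f / (2 * pi) = 4 * catalan_const / pi - ln 2"
    using 1 2 by (simp add: field_simps)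
  then show ?thesis using integral_circ[OF c] by (simp add: f_def)
qed

text \<open>One of the two Wallis ratios is read as a moment of cos^2. What remains under the
  integral is \<open>wallis_log_series\<close> at cos^2 x, that is, 2 ln 2 - 2 ln (1 + |sin
  x|).\<close>

lemma wallis_sq_log_eq: "wallis_sq_log = 2 * wallis_log - 8 * catalan_const / pi"
proof -
  define f where "f = (\<lambda>n x. wallis_ratio (Suc n) / real (Suc n) * ((cos x)\<^sup>2) ^ Suc n)"
  have cb: "0 \<le> (cos x)\<^sup>2" "(cos x)\<^sup>2 \<le> 1" for x :: real by (simp_all add: abs_square_le_1)
  have fb: "norm (f n x) \<le> wallis_ratio (Suc n) / real (Suc n)" for n x
    unfolding f_def by (rule norm_wallis_log_term_le[OF cb])
  have int: "integrable circ (f n)" for n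
    by (rule integrable_circ_bounded) (use fb in \<open>auto simp: f_def\<close>)
  have "(\<lambda>n. \<integral>x. f n x \<partial>circ) sums (\<integral>x. (\<Sum>n. f n x) \<partial>circ)"
  proof (rule sums_integral[OF int])
    show "AE x in circ. summable (\<lambda>n. norm (f n x))"
      using fb by (intro AE_I2 summable_comparison_test'[OF summable_wallis_div, of 0]) auto
    show "summable (\<lambda>n. \<integral>x. norm (f n x) \<partial>circ)"
    proof (rule summable_comparison_test'[OF summable_wallis_div, of 0])
      fix n :: nat
      have "(\<integral>x. norm (f n x) \<partial>circ) \<le> (\<integral>x. wallis_ratio (Suc n) / real (Suc n) \<partial>circ)"
        using fb int by (intro integral_mono_AE integrable_norm AE_I2) auto
      then show "norm (\<integral>x. norm (f n x) \<partial>circ) \<le> wallis_ratio (Suc n) / real (Suc n)"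
        by (simp add: circ.prob_space)
    qed
  qed
  moreover have "(\<integral>x. f n x \<partial>circ) = (wallis_ratio (Suc n))\<^sup>2 / real (Suc n)" for n
    unfolding f_def power_mult[symmetric] integral_mult_right_zero cos_moment_even by (simp add: power2_eq_square)
  moreover have "(\<Sum>n. f n x) = 2 * ln 2 - 2 * ln (1 + \<bar>sin x\<bar>)" for x
  proof -
    have "(\<Sum>n. f n x) = - 2 * ln ((1 + sqrt (1 - (cos x)\<^sup>2)) / 2)"
      using wallis_log_series_eq[OF cb] by (simp only: wallis_log_series_def f_def)
    moreover have "sqrt (1 - (cos x)\<^sup>2) = \<bar>sin x\<bar>" by (simp flip: sin_squared_eq)
    moreover have "0 < 1 + \<bar>sin x\<bar>" by (simp add: add_pos_nonneg)
    ultimately show ?thesis by (simp add: ln_div)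
  qed
  ultimately have "wallis_sq_log = (\<integral>x. 2 * ln 2 - 2 * ln (1 + \<bar>sin x\<bar>) \<partial>circ)"
    unfolding wallis_sq_log_def by (simp add: sums_iff)
  also have "\<dots> = 2 * ln 2 - 2 * (\<integral>x. ln (1 + \<bar>sin x\<bar>) \<partial>circ)"
  proof -
    have "integrable circ (\<lambda>x. ln (1 + \<bar>sin x\<bar>))"
    proof (rule integrable_circ_bounded[of _ "ln 2"])
      fix x :: real
      have "ln (1 + \<bar>sin x\<bar>) \<le> ln 2" by (subst ln_le_cancel_iff) (auto simp: add_pos_nonneg)
      moreover have "0 \<le> ln (1 + \<bar>sin x\<bar>)" by simp
      ultimately show "\<bar>ln (1 + \<bar>sin x\<bar>)\<bar> \<le> ln 2" by simp
    qed measurable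
    then show ?thesis by (simp add: circ.prob_space)
  qed
  finally show ?thesis unfolding expectation_ln_1_plus_abs_sin wallis_log_eq by (simp add: algebra_simps)
qed

lemma integral_torus_kernel_catalan:
  "(\<integral>z. (sin (fst z))\<^sup>2 * (sin (snd z))\<^sup>2 * (xlogx ((cos (fst z))\<^sup>2 + (cos (snd z))\<^sup>2) - xlogx ((cos (fst z))\<^sup>2) - xlogx ((cos (snd z))\<^sup>2)) \<partial>(circ \<Otimes>\<^sub>M circ))
     = catalan_const / (2 * pi) - 1 / (12 * pi) - 1/16"
  unfolding integral_torus_kernel wallis_sq_log_eq by (simp add: field_simps)

section \<open>The limiting energy for exponent two\<close>

lemma nn_integral_FTC_einterval:
  fixes F f :: "real \<Rightarrow> real" and a b :: ereal
  assumes "a < b" "\<And>x. a < ereal x \<Longrightarrow> ereal x < b \<Longrightarrow> DERIV F x :> f x"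
    "\<And>x. a < ereal x \<Longrightarrow> ereal x < b \<Longrightarrow> isCont f x"
    "\<And>x. a < ereal x \<Longrightarrow> ereal x < b \<Longrightarrow> 0 \<le> f x"
    "((F \<circ> real_of_ereal) \<longlongrightarrow> A) (at_right a)" "((F \<circ> real_of_ereal) \<longlongrightarrow> B) (at_left b)"
  shows "(\<integral>\<^sup>+x. ennreal (indicator (einterval a b) x * f x) \<partial>lborel) = ennreal (B - A)"
proof -
  have nn: "AE x in lborel. a < ereal x \<longrightarrow> ereal x < b \<longrightarrow> 0 \<le> f x" using assms(4) by auto
  note ftc = interval_integral_FTC_nonneg[OF assms(1-3) nn assms(5,6)]
  have "(\<integral>\<^sup>+x. ennreal (indicator (einterval a b) x * f x) \<partial>lborel) = ennreal (\<integral>x. indicator (einterval a b) x * f x \<partial>lborel)"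
    using ftc(1) assms(4) by (intro nn_integral_eq_integral) (auto simp: set_integrable_def indicator_def einterval_def)
  also have "(\<integral>x. indicator (einterval a b) x * f x \<partial>lborel) = B - A"
    using ftc(2) assms(1) by (simp add: interval_lebesgue_integral_def set_lebesgue_integral_def less_imp_le)
  finally show ?thesis .
qed

lemma nn_integral_FTC_Ioo:
  fixes F f :: "real \<Rightarrow> real"
  assumes "a < b" "\<And>x. a < x \<Longrightarrow> x < b \<Longrightarrow> DERIV F x :> f x"
    "\<And>x. a < x \<Longrightarrow> x < b \<Longrightarrow> isCont f x" "\<And>x. a < x \<Longrightarrow> x < b \<Longrightarrow> 0 \<le> f x"
    "(F \<longlongrightarrow> A) (at_right a)" "(F \<longlongrightarrow> B) (at_left b)"
  shows "(\<integral>\<^sup>+x. ennreal (indicator {a<..<b} x * f x) \<partial>lborel) = ennreal (B - A)"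
  using nn_integral_FTC_einterval[of "ereal a" "ereal b" F f A B] assms
  by (simp add: ereal_tendsto_simps1 einterval_eq)

lemma nn_integral_FTC_Ioi:
  fixes F f :: "real \<Rightarrow> real"
  assumes "\<And>x. a < x \<Longrightarrow> DERIV F x :> f x" "\<And>x. a < x \<Longrightarrow> isCont f x" "\<And>x. a < x \<Longrightarrow> 0 \<le> f x"
    "(F \<longlongrightarrow> A) (at_right a)" "(F \<longlongrightarrow> B) at_top"
  shows "(\<integral>\<^sup>+x. ennreal (indicator {a<..} x * f x) \<partial>lborel) = ennreal (B - A)"
  using nn_integral_FTC_einterval[of "ereal a" "\<infinity>" F f A B] assms
  by (simp add: ereal_tendsto_simps1 einterval_eq)

text \<open>Moves the Laplace parameter \<open>l\<close> from the outermost to the innermost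
  integral while the product of two integrals becomes a double one. It is applied on the half line,
  on the circle, and to the variables that represent 1 - exp.\<close>

lemma nn_integral_mult_Tonelli:
  fixes g h :: "'l \<Rightarrow> 'a \<Rightarrow> ennreal"
  assumes L: "sigma_finite_measure L" and M: "sigma_finite_measure M"
    and g [measurable]: "case_prod g \<in> borel_measurable (L \<Otimes>\<^sub>M M)" and h [measurable]: "case_prod h \<in> borel_measurable (L \<Otimes>\<^sub>M M)"
  shows "(\<integral>\<^sup>+l. (\<integral>\<^sup>+a. g l a \<partial>M) * (\<integral>\<^sup>+b. h l b \<partial>M) \<partial>L) = (\<integral>\<^sup>+z. (\<integral>\<^sup>+l. g l (fst z) * h l (snd z) \<partial>L) \<partial>(M \<Otimes>\<^sub>M M))"
proof -
  interpret L: sigma_finite_measure L by fact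
  interpret M: sigma_finite_measure M by fact
  interpret MM: pair_sigma_finite M M ..
  interpret P: pair_sigma_finite L "M \<Otimes>\<^sub>M M" ..
  have m: "(\<lambda>y. g (fst y) (fst (snd y)) * h (fst y) (snd (snd y))) \<in> borel_measurable (L \<Otimes>\<^sub>M (M \<Otimes>\<^sub>M M))"
    by measurable
  have "(\<integral>\<^sup>+z. (\<integral>\<^sup>+l. g l (fst z) * h l (snd z) \<partial>L) \<partial>(M \<Otimes>\<^sub>M M)) = (\<integral>\<^sup>+l. (\<integral>\<^sup>+z. g l (fst z) * h l (snd z) \<partial>(M \<Otimes>\<^sub>M M)) \<partial>L)"
    using P.Fubini[OF m] by simp
  also have "\<dots> = (\<integral>\<^sup>+l. (\<integral>\<^sup>+a. g l a \<partial>M) * (\<integral>\<^sup>+b. h l b \<partial>M) \<partial>L)"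
  proof (rule nn_integral_cong)
    fix l assume [measurable]: "l \<in> space L"
    have "(\<integral>\<^sup>+z. g l (fst z) * h l (snd z) \<partial>(M \<Otimes>\<^sub>M M)) = (\<integral>\<^sup>+a. (\<integral>\<^sup>+b. g l a * h l b \<partial>M) \<partial>M)"
      by (subst M.nn_integral_fst[symmetric]) simp_all
    also have "\<dots> = (\<integral>\<^sup>+a. g l a * (\<integral>\<^sup>+b. h l b \<partial>M) \<partial>M)"
      by (intro nn_integral_cong nn_integral_cmult) measurable
    also have "\<dots> = (\<integral>\<^sup>+a. g l a \<partial>M) * (\<integral>\<^sup>+b. h l b \<partial>M)"
      by (intro nn_integral_multc) measurable
    finally show "(\<integral>\<^sup>+z. g l (fst z) * h l (snd z) \<partial>(M \<Otimes>\<^sub>M M)) = (\<integral>\<^sup>+a. g l a \<partial>M) * (\<integral>\<^sup>+b. h l b \<partial>M)" .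
  qed
  finally show ?thesis by simp
qed

section \<open>Laplace transform of the squared Bessel kernel\<close>

lemma central_binomial_wallis: "real ((2 * n) choose n) = 4 ^ n * wallis_ratio n"
proof (induction n)
  case (Suc n)
  define A B :: real where "A = fact (2 * n)" and "B = fact n"
  have pos: "B > 0" by (simp add: B_def)
  have e: "A / (B * B) = 4 ^ n * wallis_ratio n"
    using Suc binomial_fact[of n "2 * n", where 'a=real] by (simp add: A_def B_def)
  have "real ((2 * Suc n) choose Suc n) = fact (2 * Suc n) / (fact (Suc n) * fact (Suc n))"
    using binomial_fact[of "Suc n" "2 * Suc n", where 'a=real] by simp
  also have "fact (2 * Suc n) = (2 * real n + 2) * (2 * real n + 1) * A" by (simp add: A_def algebra_simps)
  also have "fact (Suc n) = (real n + 1) * B" by (simp add: B_def algebra_simps)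
  also have "(2 * real n + 2) * (2 * real n + 1) * A / ((real n + 1) * B * ((real n + 1) * B)) = 4 * ((2 * real n + 1) / (2 * real n + 2)) * (A / (B * B))"
    using pos by (simp add: divide_simps) (simp add: algebra_simps)
  finally show ?case unfolding e wallis_ratio_Suc by simp
qed simp

text \<open>The numerator is the central binomial coefficient C(2m + 2, m + 1). The quotient is the
  coefficient of (-p/2)^m in the square of \<open>bessel_ratio p\<close>.\<close>

definition bessel_sq_coeff :: "nat \<Rightarrow> real" where
  "bessel_sq_coeff m = 4 ^ Suc m * wallis_ratio (Suc m) / (fact m * fact (m + 2))"

lemma bessel_sq_coeff_nonneg: "0 \<le> bessel_sq_coeff m"
  using wallis_ratio_pos[of "Suc m"] by (simp add: bessel_sq_coeff_def)

text \<open>Multiplied by k! (k + 2)!, the i-th term is C(k, i) C(k + 2, k + 1 - i), and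
  Vandermonde's identity sums these to C(2k + 2, k + 1).\<close>

lemma bessel_sq_coeff_convolution:
  "(\<Sum>i\<le>k. 1 / (fact i * fact (Suc i) * (fact (k - i) * fact (Suc (k - i)))) ) = bessel_sq_coeff k"
proof -
  have "1 / (fact i * fact (Suc i) * (fact (k - i) * fact (Suc (k - i)))) =
      real ((k choose i) * ((k + 2) choose (k + 1 - i))) / (fact k * fact (k + 2))" if "i \<le> k" for i
  proof -
    have a: "real (k choose i) = fact k / (fact i * fact (k - i))" using that by (simp add: binomial_fact)
    have "k + 2 - (k + 1 - i) = Suc i" "k + 1 - i = Suc (k - i)" using that by auto
    then have b: "real ((k + 2) choose (k + 1 - i)) = fact (k + 2) / (fact (Suc (k - i)) * fact (Suc i))"
      using binomial_fact[of "k + 1 - i" "k + 2", where 'a=real] by (simp del: fact_Suc)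
    show ?thesis unfolding of_nat_mult a b by (simp del: fact_Suc add: field_simps)
  qed
  then have "(\<Sum>i\<le>k. 1 / (fact i * fact (Suc i) * (fact (k - i) * fact (Suc (k - i))))) =
      real (\<Sum>i\<le>k. (k choose i) * ((k + 2) choose (k + 1 - i))) / (fact k * fact (k + 2))"
    by (simp add: sum_divide_distrib)
  \<comment> \<open>The added term i = k + 1 is 0 because C(k, k + 1) = 0; it completes the range
    required by Vandermonde's identity.\<close>
  also have "(\<Sum>i\<le>k. (k choose i) * ((k + 2) choose (k + 1 - i))) = (\<Sum>i\<le>k + 1. (k choose i) * ((k + 2) choose (k + 1 - i)))"
    by simp
  also have "\<dots> = (k + (k + 2)) choose (k + 1)" by (rule vandermonde)
  also have "k + (k + 2) = 2 * Suc k" by simp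
  also have "k + 1 = Suc k" by simp
  finally show ?thesis unfolding central_binomial_wallis bessel_sq_coeff_def .
qed

lemma bessel_ratio_sq_sums: "(\<lambda>m. (- p / 2) ^ m * bessel_sq_coeff m) sums (bessel_ratio p)\<^sup>2"
proof -
  define a where "a = (\<lambda>i. (- p / 2) ^ i / (fact i * fact (Suc i)))"
  have s: "summable (\<lambda>i. norm (a i))"
    using bessel_ratio_abs_summable[of "p / 2"] by (simp add: a_def power_abs abs_mult abs_divide del: fact_Suc)
  have "(\<Sum>i\<le>k. a i * a (k - i)) = (- p / 2) ^ k * bessel_sq_coeff k" for k
  proof -
    have "a i * a (k - i) = (- p / 2) ^ k * (1 / (fact i * fact (Suc i) * (fact (k - i) * fact (Suc (k - i)))))" if "i \<le> k" for i
    proof -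
      have "(- p / 2) ^ k = (- p / 2) ^ i * (- p / 2) ^ (k - i)" using that by (simp flip: power_add)
      then show ?thesis by (simp add: a_def del: fact_Suc)
    qed
    then show ?thesis by (simp add: sum_distrib_left flip: bessel_sq_coeff_convolution)
  qed
  then show ?thesis
    using Cauchy_product_sums[OF s s] by (simp add: a_def bessel_ratio_def power2_eq_square)
qed

lemma laplace_power:
  fixes l :: real
  assumes l: "l > 0"
  shows "integrable lborel (\<lambda>p. indicator {0<..} p * (p ^ m * exp (- l * p)))" (is "integrable _ ?f")
    and "(\<integral>p. indicator {0<..} p * (p ^ m * exp (- l * p)) \<partial>lborel) = fact m / l ^ Suc m"
proof -
  have "(\<integral>\<^sup>+p. ennreal (?f p) \<partial>lborel) = (\<integral>\<^sup>+p. ennreal (1 / l) * ennreal (erlang_density 0 l p * p ^ m) \<partial>lborel)"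
  proof (rule nn_integral_cong_AE)
    show "AE p in lborel. ennreal (?f p) = ennreal (1 / l) * ennreal (erlang_density 0 l p * p ^ m)"
      using AE_lborel_singleton[of 0]
      by eventually_elim (use l in \<open>auto simp: erlang_density_def indicator_def ennreal_mult[symmetric]\<close>)
  qed
  also have "\<dots> = ennreal (1 / l) * ennreal (fact (0 + m) / (fact 0 * l ^ m))"
    using nn_integral_erlang_ith_moment[OF l, of 0 m] by (simp add: nn_integral_cmult)
  also have "\<dots> = ennreal (fact m / l ^ Suc m)"
    using l by (simp add: ennreal_mult[symmetric])
  finally have e: "(\<integral>\<^sup>+p. ennreal (?f p) \<partial>lborel) = ennreal (fact m / l ^ Suc m)" .
  have nn: "AE p in lborel. 0 \<le> ?f p" by (auto simp: indicator_def)
  have [measurable]: "?f \<in> borel_measurable lborel" by measurable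
  have "integrable lborel ?f \<and> integral\<^sup>L lborel ?f = fact m / l ^ Suc m"
    using nn_integral_eq_integrable[of ?f lborel "fact m / l ^ Suc m"] e nn l by simp
  then show "integrable lborel ?f" "integral\<^sup>L lborel ?f = fact m / l ^ Suc m" by auto
qed

text \<open>The moment m! / l^(m+1) cancels the m! of the coefficient. The factor 1 / (m + 2)! that
  is left makes the transformed series converge absolutely for every l > 0, which justifies
  integrating termwise.\<close>

lemma laplace_bessel_ratio_sq_sums:
  assumes l: "l > 0"
  shows "integrable lborel (\<lambda>p. indicator {0<..} p * ((bessel_ratio p)\<^sup>2 * exp (- l * p)))"
    and "(\<lambda>m. 2 * ((-1) ^ m * (2 / l) ^ Suc m * wallis_ratio (Suc m) / fact (m + 2)))
      sums (\<integral>p. indicator {0<..} p * ((bessel_ratio p)\<^sup>2 * exp (- l * p)) \<partial>lborel)"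
proof -
  define e where "e = (\<lambda>m p. indicator {0<..} p * (p ^ m * exp (- l * p)))"
  define f where "f = (\<lambda>m p. (- (1/2)) ^ m * bessel_sq_coeff m * e m p)"
  have int_e: "integrable lborel (e m)" "integral\<^sup>L lborel (e m) = fact m / l ^ Suc m" for m
    unfolding e_def by (rule laplace_power[OF l])+
  have int: "integrable lborel (f m)" for m unfolding f_def by (intro integrable_mult_right int_e)
  have s0: "(\<lambda>m. f m p) sums (indicator {0<..} p * ((bessel_ratio p)\<^sup>2 * exp (- l * p)))" for p
  proof -
    have "f m p = indicator {0<..} p * exp (- l * p) * ((- p / 2) ^ m * bessel_sq_coeff m)" for m
    proof -
      have "(- p / 2) ^ m = (- (1/2)) ^ m * p ^ m" by (simp flip: power_mult_distrib)
      then show ?thesis by (simp add: f_def e_def)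
    qed
    then show ?thesis
      using sums_mult[OF bessel_ratio_sq_sums[of p], of "indicator {0<..} p * exp (- l * p)"] by (simp add: mult_ac)
  qed
  have moment: "(1/2) ^ m * bessel_sq_coeff m * (fact m / l ^ Suc m) = 2 * ((2 / l) ^ Suc m * wallis_ratio (Suc m) / fact (m + 2))" for m
  proof -
    have "(1/2 :: real) ^ m * 4 ^ Suc m = 2 * 2 ^ Suc m" by (simp add: power_mult_distrib[symmetric])
    moreover have "(1/2) ^ m * bessel_sq_coeff m * (fact m / l ^ Suc m) = ((1/2) ^ m * 4 ^ Suc m) * wallis_ratio (Suc m) / (l ^ Suc m * fact (m + 2))"
      by (simp add: bessel_sq_coeff_def mult_ac del: power_Suc fact_Suc)
    ultimately show ?thesis by (simp add: power_divide del: power_Suc fact_Suc)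
  qed
  have abs_f: "norm (f m p) = (1/2) ^ m * bessel_sq_coeff m * e m p" for m p
    using bessel_sq_coeff_nonneg[of m] by (simp add: f_def e_def abs_mult power_abs indicator_def)
  have summ: "AE p in lborel. summable (\<lambda>m. norm (f m p))"
  proof (rule AE_I2)
    fix p
    have "(\<lambda>m. (p / 2) ^ m * bessel_sq_coeff m) sums (bessel_ratio (- p))\<^sup>2" using bessel_ratio_sq_sums[of "- p"] by simp
    from summable_mult[OF sums_summable[OF this], of "indicator {0<..} p * exp (- l * p)"]
    have "summable (\<lambda>m. indicator {0<..} p * exp (- l * p) * ((p / 2) ^ m * bessel_sq_coeff m))" .
    also have "(\<lambda>m. indicator {0<..} p * exp (- l * p) * ((p / 2) ^ m * bessel_sq_coeff m)) = (\<lambda>m. norm (f m p))"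
      unfolding abs_f e_def by (rule ext) (simp add: power_divide)
    finally show "summable (\<lambda>m. norm (f m p))" .
  qed
  have sums: "summable (\<lambda>m. \<integral>p. norm (f m p) \<partial>lborel)"
  proof (rule summable_comparison_test')
    show "summable (\<lambda>m. 2 * ((2 / l) * ((2 / l) ^ m / fact m)))"
      using summable_exp[of "2 / l"] by (intro summable_mult) (simp add: divide_inverse mult.commute)
    fix m :: nat
    define t where "t = (2 / l) ^ Suc m * wallis_ratio (Suc m) / fact (m + 2)"
    have "(\<integral>p. norm (f m p) \<partial>lborel) = 2 * t"
      unfolding abs_f t_def by (simp only: integral_mult_right_zero int_e moment)
    moreover have "t \<le> (2 / l) ^ Suc m * 1 / fact m"
      unfolding t_def using l wallis_ratio_pos[of "Suc m"] by (intro frac_le mult_left_mono wallis_ratio_le_1 fact_mono) auto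
    moreover have "0 \<le> t"
      unfolding t_def using l wallis_ratio_pos[of "Suc m"] by (intro divide_nonneg_pos mult_nonneg_nonneg) auto
    ultimately show "norm (\<integral>p. norm (f m p) \<partial>lborel) \<le> 2 * ((2 / l) * ((2 / l) ^ m / fact m))" by simp
  qed
  have e: "(\<lambda>p. \<Sum>m. f m p) = (\<lambda>p. indicator {0<..} p * ((bessel_ratio p)\<^sup>2 * exp (- l * p)))"
    using s0 by (simp add: sums_iff)
  show "integrable lborel (\<lambda>p. indicator {0<..} p * ((bessel_ratio p)\<^sup>2 * exp (- l * p)))"
    using integrable_suminf[OF int summ sums] unfolding e .
  have "integral\<^sup>L lborel (f m) = 2 * ((-1) ^ m * (2 / l) ^ Suc m * wallis_ratio (Suc m) / fact (m + 2))" for m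
  proof -
    have "integral\<^sup>L lborel (f m) = (-1) ^ m * ((1/2) ^ m * bessel_sq_coeff m * (fact m / l ^ Suc m))"
      unfolding f_def integral_mult_right_zero int_e(2) by (simp add: power_minus[of "1/2"])
    then show ?thesis unfolding moment by simp
  qed
  then show "(\<lambda>m. 2 * ((-1) ^ m * (2 / l) ^ Suc m * wallis_ratio (Suc m) / fact (m + 2)))
      sums (\<integral>p. indicator {0<..} p * ((bessel_ratio p)\<^sup>2 * exp (- l * p)) \<partial>lborel)"
    using sums_integral[OF int summ sums] unfolding e by simp
qed

lemma sin_sq_cos_moment: "(\<integral>x. (sin x)\<^sup>2 * ((cos x)\<^sup>2) ^ n \<partial>circ) = wallis_ratio n / (2 * real n + 2)"
proof -
  have i: "integrable circ (\<lambda>x. cos x ^ k)" for k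
    by (rule integrable_circ_bounded[of _ 1]) (simp_all add: power_abs power_le_one)
  have "(sin x)\<^sup>2 * ((cos x)\<^sup>2) ^ n = cos x ^ (2 * n) - cos x ^ (2 * Suc n)" for x :: real
    by (simp only: sin_squared_eq power_mult power_Suc) (simp add: algebra_simps)
  then have "(\<integral>x. (sin x)\<^sup>2 * ((cos x)\<^sup>2) ^ n \<partial>circ) = (\<integral>x. cos x ^ (2 * n) \<partial>circ) - (\<integral>x. cos x ^ (2 * Suc n) \<partial>circ)"
    by (simp only: Bochner_Integration.integral_diff[OF i i])
  then show ?thesis unfolding cos_moment_even wallis_ratio_Suc by (simp add: field_simps)
qed

text \<open>The exponential contributes 1 / (m + 1)! and the mean of sin^2 cos^(2m+2) the Wallis
  ratio over 2 (m + 2). Together they form the 1 / (m + 2)! of the transformed Bessel series, with z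
  = 2 / l.\<close>

lemma one_minus_exp_expectation_sums:
  assumes z: "0 \<le> z"
  shows "(\<lambda>m. (-1) ^ m * z ^ Suc m * wallis_ratio (Suc m) / fact (m + 2) / 2)
    sums (\<integral>x. (sin x)\<^sup>2 * (1 - exp (- z * (cos x)\<^sup>2)) \<partial>circ)"
proof -
  define f where "f = (\<lambda>m x. (-1) ^ m * z ^ Suc m / fact (Suc m) * ((sin x)\<^sup>2 * ((cos x)\<^sup>2) ^ Suc m))"
  have sm: "summable (\<lambda>m. z ^ Suc m / fact (Suc m))"
    using summable_exp[of z] by (subst summable_Suc_iff) (simp add: divide_inverse mult.commute)
  have bf: "norm (f m x) \<le> z ^ Suc m / fact (Suc m)" for m x
  proof -
    have a: "\<bar>(sin x)\<^sup>2\<bar> \<le> 1" "\<bar>(cos x)\<^sup>2\<bar> \<le> 1" by (simp_all add: abs_square_le_1)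
    then have "\<bar>(sin x)\<^sup>2\<bar> * \<bar>(cos x)\<^sup>2\<bar> ^ Suc m \<le> 1 * 1" by (intro mult_mono power_le_one) auto
    then have "\<bar>(sin x)\<^sup>2 * ((cos x)\<^sup>2) ^ Suc m\<bar> \<le> 1" unfolding abs_mult power_abs[symmetric] by simp
    then have "z ^ Suc m / fact (Suc m) * \<bar>(sin x)\<^sup>2 * ((cos x)\<^sup>2) ^ Suc m\<bar> \<le> z ^ Suc m / fact (Suc m) * 1"
      using z by (intro mult_left_mono) auto
    moreover have "norm (f m x) = z ^ Suc m / fact (Suc m) * \<bar>(sin x)\<^sup>2 * ((cos x)\<^sup>2) ^ Suc m\<bar>"
      using z unfolding f_def by (simp add: abs_mult abs_divide power_abs del: fact_Suc power_Suc)
    ultimately show ?thesis by simp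
  qed
  have int: "integrable circ (f m)" for m
    by (rule integrable_circ_bounded) (use bf in \<open>auto simp: f_def\<close>)
  have "(\<lambda>m. \<integral>x. f m x \<partial>circ) sums (\<integral>x. (\<Sum>m. f m x) \<partial>circ)"
  proof (rule sums_integral[OF int])
    show "AE x in circ. summable (\<lambda>m. norm (f m x))"
      using bf by (intro AE_I2 summable_comparison_test'[OF sm, of 0]) auto
    show "summable (\<lambda>m. \<integral>x. norm (f m x) \<partial>circ)"
    proof (rule summable_comparison_test'[OF sm, of 0])
      fix m :: nat
      have "(\<integral>x. norm (f m x) \<partial>circ) \<le> (\<integral>x. z ^ Suc m / fact (Suc m) \<partial>circ)"
        using bf int by (intro integral_mono_AE integrable_norm AE_I2) auto
      then show "norm (\<integral>x. norm (f m x) \<partial>circ) \<le> z ^ Suc m / fact (Suc m)"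
        by (simp del: fact_Suc power_Suc)
    qed
  qed
  moreover have "(\<integral>x. f m x \<partial>circ) = (-1) ^ m * z ^ Suc m * wallis_ratio (Suc m) / fact (m + 2) / 2" for m
  proof -
    have "fact (m + 2) = (real m + 2) * fact (Suc m)" by (simp add: algebra_simps)
    moreover have "2 * real (Suc m) + 2 = 2 * (real m + 2)" by simp
    ultimately show ?thesis unfolding f_def integral_mult_right_zero sin_sq_cos_moment by (simp del: fact_Suc power_Suc)
  qed
  moreover have "(\<Sum>m. f m x) = (sin x)\<^sup>2 * (1 - exp (- z * (cos x)\<^sup>2))" for x
  proof -
    define y where "y = - z * (cos x)\<^sup>2"
    have "(\<lambda>n. y ^ n / fact n) sums exp y" using exp_converges[of y] by (simp add: divide_inverse mult.commute)
    then have "(\<lambda>m. y ^ Suc m / fact (Suc m)) sums (exp y - 1)" by (subst sums_Suc_iff) simp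
    from sums_mult[OF this, of "- (sin x)\<^sup>2"]
    have "(\<lambda>m. - (sin x)\<^sup>2 * (y ^ Suc m / fact (Suc m))) sums (- (sin x)\<^sup>2 * (exp y - 1))" .
    also have "(\<lambda>m. - (sin x)\<^sup>2 * (y ^ Suc m / fact (Suc m))) = (\<lambda>m. f m x)"
    proof
      fix m
      have "y ^ Suc m = (-1) ^ Suc m * (z ^ Suc m * ((cos x)\<^sup>2) ^ Suc m)"
        unfolding y_def power_mult_distrib[symmetric] by simp
      moreover have "(-1 :: real) ^ Suc m = - ((-1) ^ m)" by simp
      ultimately show "- (sin x)\<^sup>2 * (y ^ Suc m / fact (Suc m)) = f m x" by (simp add: f_def del: fact_Suc power_Suc)
    qed
    finally show ?thesis by (simp add: sums_iff y_def algebra_simps)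
  qed
  ultimately show ?thesis by simp
qed

lemma nn_integral_circ_bounded:
  assumes [measurable]: "f \<in> borel_measurable borel" and "\<And>x. 0 \<le> f x" "\<And>x. f x \<le> C"
  shows "(\<integral>\<^sup>+x. ennreal (f x) \<partial>circ) = ennreal (\<integral>x. f x \<partial>circ)"
  using assms by (intro nn_integral_eq_integral integrable_circ_bounded[of _ C]) auto

text \<open>Both sides have the same expansion in powers of \<open>1 / l\<close>.\<close>

lemma laplace_bessel_ratio_sq:
  assumes l: "l > 0"
  shows "(\<integral>\<^sup>+p. ennreal (indicator {0<..} p * ((bessel_ratio p)\<^sup>2 * exp (- l * p))) \<partial>lborel)
    = (\<integral>\<^sup>+x. ennreal (4 * ((sin x)\<^sup>2 * (1 - exp (- (2 / l) * (cos x)\<^sup>2)))) \<partial>circ)"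
proof -
  have b: "0 \<le> (sin x)\<^sup>2 * (1 - exp (- (2 / l) * (cos x)\<^sup>2))" "(sin x)\<^sup>2 * (1 - exp (- (2 / l) * (cos x)\<^sup>2)) \<le> 1" for x
  proof -
    have "0 \<le> 1 - exp (- (2 / l) * (cos x)\<^sup>2)" "1 - exp (- (2 / l) * (cos x)\<^sup>2) \<le> 1" using l by auto
    moreover have "0 \<le> (sin x)\<^sup>2" "(sin x)\<^sup>2 \<le> 1" by (simp_all add: abs_square_le_1)
    ultimately show "0 \<le> (sin x)\<^sup>2 * (1 - exp (- (2 / l) * (cos x)\<^sup>2))" "(sin x)\<^sup>2 * (1 - exp (- (2 / l) * (cos x)\<^sup>2)) \<le> 1"
      by (simp, intro mult_le_one) auto
  qed
  have "4 * (a / 2) = 2 * a" for a :: real by simp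
  moreover have "(\<lambda>m. 4 * ((-1) ^ m * (2 / l) ^ Suc m * wallis_ratio (Suc m) / fact (m + 2) / 2))
    sums (4 * (\<integral>x. (sin x)\<^sup>2 * (1 - exp (- (2 / l) * (cos x)\<^sup>2)) \<partial>circ))"
    using l by (intro sums_mult one_minus_exp_expectation_sums) simp
  ultimately have "(\<lambda>m. 2 * ((-1) ^ m * (2 / l) ^ Suc m * wallis_ratio (Suc m) / fact (m + 2)))
    sums (\<integral>x. 4 * ((sin x)\<^sup>2 * (1 - exp (- (2 / l) * (cos x)\<^sup>2))) \<partial>circ)"
    by (simp only: integral_mult_right_zero)
  from sums_unique2[OF laplace_bessel_ratio_sq_sums(2)[OF l] this]
  have "(\<integral>p. indicator {0<..} p * ((bessel_ratio p)\<^sup>2 * exp (- l * p)) \<partial>lborel) = (\<integral>x. 4 * ((sin x)\<^sup>2 * (1 - exp (- (2 / l) * (cos x)\<^sup>2))) \<partial>circ)" .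
  moreover have "(\<integral>\<^sup>+x. ennreal (4 * ((sin x)\<^sup>2 * (1 - exp (- (2 / l) * (cos x)\<^sup>2)))) \<partial>circ) = ennreal (\<integral>x. 4 * ((sin x)\<^sup>2 * (1 - exp (- (2 / l) * (cos x)\<^sup>2))) \<partial>circ)"
    using b by (intro nn_integral_circ_bounded[of _ 4]) auto
  moreover have "(\<integral>\<^sup>+p. ennreal (indicator {0<..} p * ((bessel_ratio p)\<^sup>2 * exp (- l * p))) \<partial>lborel) = ennreal (\<integral>p. indicator {0<..} p * ((bessel_ratio p)\<^sup>2 * exp (- l * p)) \<partial>lborel)"
    using laplace_bessel_ratio_sq_sums(1)[OF l] by (intro nn_integral_eq_integral) auto
  ultimately show ?thesis by simp
qed

section \<open>Elementary integrals leading to the logarithmic kernel\<close>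

lemma nn_integral_exp_Ioi:
  assumes "c > 0" shows "(\<integral>\<^sup>+l. ennreal (indicator {0<..} l * exp (- l * c)) \<partial>lborel) = ennreal (1 / c)"
proof -
  have "(\<integral>\<^sup>+l. ennreal (indicator {0<..} l * exp (- l * c)) \<partial>lborel) = ennreal (0 - (- (exp (- 0 * c) / c)))"
  proof (rule nn_integral_FTC_Ioi[where F="\<lambda>l. - (exp (- l * c) / c)"])
    fix x :: real
    show "((\<lambda>l. - (exp (- l * c) / c)) has_real_derivative exp (- x * c)) (at x)"
      using assms by (auto intro!: derivative_eq_intros)
    show "((\<lambda>l. - (exp (- l * c) / c)) \<longlongrightarrow> - (exp (- 0 * c) / c)) (at_right 0)"
      using assms by (intro tendsto_intros) auto
    show "((\<lambda>l. - (exp (- l * c) / c)) \<longlongrightarrow> 0) at_top" using assms by real_asymp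
  qed auto
  then show ?thesis by simp
qed

lemma nn_integral_exp_inverse_Ioi:
  assumes "c > 0" shows "(\<integral>\<^sup>+l. ennreal (indicator {0<..} l * (4 / l\<^sup>2 * exp (- (2 / l) * c))) \<partial>lborel) = ennreal (2 / c)"
proof -
  have "(\<integral>\<^sup>+l. ennreal (indicator {0<..} l * (4 / l\<^sup>2 * exp (- (2 / l) * c))) \<partial>lborel) = ennreal (2 / c - 0)"
  proof (rule nn_integral_FTC_Ioi[where F="\<lambda>l. 2 / c * exp (- (2 / l) * c)"])
    fix x :: real
    assume "0 < x"
    then show "((\<lambda>l. 2 / c * exp (- (2 / l) * c)) has_real_derivative 4 / x\<^sup>2 * exp (- (2 / x) * c)) (at x)"
      using assms by (auto intro!: derivative_eq_intros simp: power2_eq_square field_simps)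
    show "isCont (\<lambda>x. 4 / x\<^sup>2 * exp (- (2 / x) * c)) x" using \<open>0 < x\<close> by (intro continuous_intros) auto
  next
    show "((\<lambda>l. 2 / c * exp (- (2 / l) * c)) \<longlongrightarrow> 0) (at_right 0)" using assms by real_asymp
    show "((\<lambda>l. 2 / c * exp (- (2 / l) * c)) \<longlongrightarrow> 2 / c) at_top" using assms by real_asymp
  qed auto
  then show ?thesis by simp
qed

lemma nn_integral_exp_Ioo:
  assumes "0 < u" "0 < l"
  shows "(\<integral>\<^sup>+z. ennreal (indicator {0<..<u} z * (2 / l * exp (- (2 / l) * z))) \<partial>lborel) = ennreal (1 - exp (- (2 / l) * u))"
proof -
  have "(\<integral>\<^sup>+z. ennreal (indicator {0<..<u} z * (2 / l * exp (- (2 / l) * z))) \<partial>lborel) = ennreal (- exp (- (2 / l) * u) - (- exp (- (2 / l) * 0)))"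
  proof (rule nn_integral_FTC_Ioo[where F="\<lambda>z. - exp (- (2 / l) * z)"])
    fix x :: real
    show "((\<lambda>z. - exp (- (2 / l) * z)) has_real_derivative 2 / l * exp (- (2 / l) * x)) (at x)"
      using assms by (auto intro!: derivative_eq_intros)
    show "((\<lambda>z. - exp (- (2 / l) * z)) \<longlongrightarrow> - exp (- (2 / l) * 0)) (at_right 0)" by (intro tendsto_intros)
    show "((\<lambda>z. - exp (- (2 / l) * z)) \<longlongrightarrow> - exp (- (2 / l) * u)) (at_left u)" by (intro tendsto_intros)
  qed (use assms in auto)
  then show ?thesis by simp
qed

lemma nn_integral_inverse_Ioo:
  assumes "0 < a" "0 < v"
  shows "(\<integral>\<^sup>+b. ennreal (indicator {0<..<v} b * (2 / (a + b))) \<partial>lborel) = ennreal (2 * (ln (a + v) - ln a))"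
proof -
  have "(\<integral>\<^sup>+b. ennreal (indicator {0<..<v} b * (2 / (a + b))) \<partial>lborel) = ennreal (2 * ln (a + v) - 2 * ln (a + 0))"
  proof (rule nn_integral_FTC_Ioo[where F="\<lambda>b. 2 * ln (a + b)"])
    fix x :: real assume "0 < x" 
    then show "((\<lambda>b. 2 * ln (a + b)) has_real_derivative 2 / (a + x)) (at x)" "isCont (\<lambda>b. 2 / (a + b)) x"
      using assms by (auto intro!: derivative_eq_intros continuous_intros)
  next
    show "((\<lambda>b. 2 * ln (a + b)) \<longlongrightarrow> 2 * ln (a + 0)) (at_right 0)" using assms by (intro tendsto_intros) auto
    show "((\<lambda>b. 2 * ln (a + b)) \<longlongrightarrow> 2 * ln (a + v)) (at_left v)" using assms by (intro tendsto_intros) auto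
  qed (use assms in auto)
  then show ?thesis by simp
qed

definition log_kernel :: "real \<Rightarrow> real \<Rightarrow> real" where
  "log_kernel u v = xlogx (u + v) - xlogx u - xlogx v"

lemma nn_integral_log_Ioo:
  assumes "0 < u" "0 < v"
  shows "(\<integral>\<^sup>+a. ennreal (indicator {0<..<u} a * (2 * (ln (a + v) - ln a))) \<partial>lborel) = ennreal (2 * log_kernel u v)"
    and "0 \<le> log_kernel u v"
proof -
  define F where "F = (\<lambda>a. 2 * (xlogx (a + v) - xlogx a))"
  have "(\<integral>\<^sup>+a. ennreal (indicator {0<..<u} a * (2 * (ln (a + v) - ln a))) \<partial>lborel) = ennreal (F u - 2 * xlogx v)"
  proof (rule nn_integral_FTC_Ioo)
    fix x :: real assume "0 < x" 
    then show "(F has_real_derivative 2 * (ln (x + v) - ln x)) (at x)" "isCont (\<lambda>a. 2 * (ln (a + v) - ln a)) x"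
      using assms unfolding F_def xlogx_def by (auto intro!: derivative_eq_intros continuous_intros)
    show "0 \<le> 2 * (ln (x + v) - ln x)" using \<open>0 < x\<close> assms by simp
  next
    have "((\<lambda>a. 2 * ((a + v) * ln (a + v) - a * ln a)) \<longlongrightarrow> 2 * (v * ln v)) (at_right 0)" using assms by real_asymp
    then show "(F \<longlongrightarrow> 2 * xlogx v) (at_right 0)" by (simp add: F_def xlogx_def)
    show "(F \<longlongrightarrow> F u) (at_left u)" using assms unfolding F_def xlogx_def by (intro tendsto_intros) auto
  qed (use assms in auto)
  also have "F u - 2 * xlogx v = 2 * log_kernel u v" by (simp add: F_def log_kernel_def)
  finally show "(\<integral>\<^sup>+a. ennreal (indicator {0<..<u} a * (2 * (ln (a + v) - ln a))) \<partial>lborel) = ennreal (2 * log_kernel u v)" .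
  have "u * ln u \<le> u * ln (u + v)" "v * ln v \<le> v * ln (u + v)" using assms by (auto intro!: mult_left_mono)
  then show "0 \<le> log_kernel u v" by (simp add: log_kernel_def xlogx_def algebra_simps)
qed

text \<open>Each factor 1 - exp (-2 u / l) is the integral of (2 / l) exp (-2 z / l) over 0 < z < u.
  Integrating over l before a and b gives 2 / (a + b), whose integral over the rectangle with sides
  u and v is 2 \<open>log_kernel u v\<close>.\<close>

lemma nn_integral_one_minus_exp_product:
  assumes "0 \<le> u" "0 \<le> v"
  shows "(\<integral>\<^sup>+l. ennreal (indicator {0<..} l * ((1 - exp (- (2 / l) * u)) * (1 - exp (- (2 / l) * v)))) \<partial>lborel) = ennreal (2 * log_kernel u v)"
proof (cases "u = 0 \<or> v = 0")
  case True
  then show ?thesis by (auto simp: log_kernel_def xlogx_def)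
next
  case False
  then have uv: "0 < u" "0 < v" using assms by auto
  define g where "g = (\<lambda>u l z :: real. ennreal (indicator {0<..} l * (indicator {0<..<u} z * (2 / l * exp (- (2 / l) * z)))))"
  have m: "case_prod (g w) \<in> borel_measurable (lborel \<Otimes>\<^sub>M lborel)" for w
    unfolding g_def case_prod_beta by measurable
  have g: "(\<integral>\<^sup>+z. g w l z \<partial>lborel) = ennreal (indicator {0<..} l * (1 - exp (- (2 / l) * w)))" if "0 < w" for w l
    using nn_integral_exp_Ioo[OF that, of l] by (cases "0 < l") (simp_all add: g_def)
  have "(\<integral>\<^sup>+l. ennreal (indicator {0<..} l * ((1 - exp (- (2 / l) * u)) * (1 - exp (- (2 / l) * v)))) \<partial>lborel)
     = (\<integral>\<^sup>+l. (\<integral>\<^sup>+a. g u l a \<partial>lborel) * (\<integral>\<^sup>+b. g v l b \<partial>lborel) \<partial>lborel)"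
    using uv by (intro nn_integral_cong) (auto simp: g ennreal_mult[symmetric] indicator_def)
  also have "\<dots> = (\<integral>\<^sup>+z. (\<integral>\<^sup>+l. g u l (fst z) * g v l (snd z) \<partial>lborel) \<partial>(lborel \<Otimes>\<^sub>M lborel))"
    by (rule nn_integral_mult_Tonelli[OF _ _ m m]) (rule lborel.sigma_finite_measure_axioms)+
  also have "\<dots> = (\<integral>\<^sup>+z. ennreal (indicator {0<..<u} (fst z) * (indicator {0<..<v} (snd z) * (2 / (fst z + snd z)))) \<partial>(lborel \<Otimes>\<^sub>M lborel))"
  proof (rule nn_integral_cong)
    fix z :: "real \<times> real"
    define a b where "a = fst z" and "b = snd z"
    show "(\<integral>\<^sup>+l. g u l (fst z) * g v l (snd z) \<partial>lborel) = ennreal (indicator {0<..<u} (fst z) * (indicator {0<..<v} (snd z) * (2 / (fst z + snd z))))"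
    proof (cases "a \<in> {0<..<u} \<and> b \<in> {0<..<v}")
      case True
      have "g u l a * g v l b = ennreal (indicator {0<..} l * (4 / l\<^sup>2 * exp (- (2 / l) * (a + b))))" for l
        using True by (auto simp: g_def indicator_def ennreal_mult[symmetric] exp_add[symmetric] power2_eq_square algebra_simps add_divide_distrib)
      moreover have "a + b > 0" using True by auto
      ultimately show ?thesis using True nn_integral_exp_inverse_Ioi[of "a + b"] by (simp add: a_def b_def)
    next
      case False
      then show ?thesis by (auto simp: g_def a_def b_def indicator_def)
    qed
  qed
  also have "\<dots> = (\<integral>\<^sup>+a. (\<integral>\<^sup>+b. ennreal (indicator {0<..<u} a * (indicator {0<..<v} b * (2 / (a + b)))) \<partial>lborel) \<partial>lborel)"
    by (subst lborel.nn_integral_fst[symmetric]) simp_all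
  also have "\<dots> = (\<integral>\<^sup>+a. ennreal (indicator {0<..<u} a * (2 * (ln (a + v) - ln a))) \<partial>lborel)"
  proof (rule nn_integral_cong)
    fix a :: real
    show "(\<integral>\<^sup>+b. ennreal (indicator {0<..<u} a * (indicator {0<..<v} b * (2 / (a + b)))) \<partial>lborel) = ennreal (indicator {0<..<u} a * (2 * (ln (a + v) - ln a)))"
      using nn_integral_inverse_Ioo[of a v] uv by (cases "a \<in> {0<..<u}") simp_all
  qed
  finally show ?thesis using nn_integral_log_Ioo(1)[OF uv] by simp
qed

lemma log_kernel_nonneg: "0 \<le> u \<Longrightarrow> 0 \<le> v \<Longrightarrow> 0 \<le> log_kernel u v"
  using nn_integral_log_Ioo(2)[of u v] by (cases "u = 0 \<or> v = 0") (auto simp: log_kernel_def xlogx_def)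

text \<open>The 2 on the left cancels the 1/2 in \<open>limit_energy_density\<close>. The 32 on the
  right is 4 * 4 * 2: a factor 4 from each Laplace transform and a 2 from the integral over
  l.\<close>

lemma nn_integral_limit_energy_density_2:
  "(\<integral>\<^sup>+z. ennreal (2 * limit_energy_density 2 z) \<partial>lborel) =
   (\<integral>\<^sup>+z. ennreal (32 * ((sin (fst z))\<^sup>2 * (sin (snd z))\<^sup>2 * log_kernel ((cos (fst z))\<^sup>2) ((cos (snd z))\<^sup>2))) \<partial>(circ \<Otimes>\<^sub>M circ))"
proof -
  define g where "g = (\<lambda>l p. ennreal (indicator {0<..} l * (indicator {0<..} p * ((bessel_ratio p)\<^sup>2 * exp (- l * p)))))"
  define h where "h = (\<lambda>l x. ennreal (indicator {0<..} l * (4 * ((sin x)\<^sup>2 * (1 - exp (- (2 / l) * (cos x)\<^sup>2))))))"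
  have mg: "case_prod g \<in> borel_measurable (lborel \<Otimes>\<^sub>M lborel)" unfolding g_def case_prod_beta by measurable
  have mh: "case_prod h \<in> borel_measurable (lborel \<Otimes>\<^sub>M circ)" unfolding h_def case_prod_beta by measurable
  have gh: "(\<integral>\<^sup>+p. g l p \<partial>lborel) = (\<integral>\<^sup>+x. h l x \<partial>circ)" for l
    using laplace_bessel_ratio_sq[of l] by (cases "0 < l") (simp_all add: g_def h_def)
  have "(\<integral>\<^sup>+z. ennreal (2 * limit_energy_density 2 z) \<partial>lborel) = (\<integral>\<^sup>+z. (\<integral>\<^sup>+l. g l (fst z) * g l (snd z) \<partial>lborel) \<partial>lborel)"
  proof (rule nn_integral_cong)
    fix z :: "real \<times> real"
    define p q where "p = fst z" and "q = snd z"
    show "ennreal (2 * limit_energy_density 2 z) = (\<integral>\<^sup>+l. g l (fst z) * g l (snd z) \<partial>lborel)"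
    proof (cases "0 < p \<and> 0 < q")
      case True
      define d where "d = p + q"
      have "d > 0" using True by (simp add: d_def)
      have gg: "g l p * g l q = ennreal ((bessel_ratio p)\<^sup>2 * (bessel_ratio q)\<^sup>2) * ennreal (indicator {0<..} l * exp (- l * d))" for l
        unfolding d_def
        using True by (auto simp: g_def indicator_def ennreal_mult[symmetric] exp_add[symmetric] algebra_simps)
      have "(\<integral>\<^sup>+l. g l p * g l q \<partial>lborel) = ennreal ((bessel_ratio p)\<^sup>2 * (bessel_ratio q)\<^sup>2) * (\<integral>\<^sup>+l. ennreal (indicator {0<..} l * exp (- l * d)) \<partial>lborel)"
        unfolding gg by (rule nn_integral_cmult) measurable
      also have "\<dots> = ennreal ((bessel_ratio p)\<^sup>2 * (bessel_ratio q)\<^sup>2) * ennreal (1 / d)"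
        unfolding nn_integral_exp_Ioi[OF \<open>d > 0\<close>] ..
      also have "\<dots> = ennreal (2 * limit_energy_density 2 (p, q))"
        using True \<open>d > 0\<close> by (simp add: limit_energy_density_def ennreal_mult[symmetric] powr_minus_divide flip: d_def)
      finally show ?thesis by (simp add: p_def q_def)
    next
      case False
      then have "(\<integral>\<^sup>+l. g l p * g l q \<partial>lborel) = 0" by (cases "0 < p") (simp_all add: g_def)
      moreover have "limit_energy_density 2 (p, q) = 0" using False by (auto simp: limit_energy_density_def)
      ultimately show ?thesis by (simp add: p_def q_def)
    qed
  qed
  also have "\<dots> = (\<integral>\<^sup>+l. (\<integral>\<^sup>+a. g l a \<partial>lborel) * (\<integral>\<^sup>+b. g l b \<partial>lborel) \<partial>lborel)"
    using nn_integral_mult_Tonelli[OF lborel.sigma_finite_measure_axioms lborel.sigma_finite_measure_axioms mg mg]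
    by (simp add: lborel_prod)
  also have "\<dots> = (\<integral>\<^sup>+l. (\<integral>\<^sup>+a. h l a \<partial>circ) * (\<integral>\<^sup>+b. h l b \<partial>circ) \<partial>lborel)"
    by (simp add: gh)
  also have "\<dots> = (\<integral>\<^sup>+z. (\<integral>\<^sup>+l. h l (fst z) * h l (snd z) \<partial>lborel) \<partial>(circ \<Otimes>\<^sub>M circ))"
    by (rule nn_integral_mult_Tonelli[OF lborel.sigma_finite_measure_axioms circ.sigma_finite_measure_axioms mh mh])
  also have "\<dots> = (\<integral>\<^sup>+z. ennreal (32 * ((sin (fst z))\<^sup>2 * (sin (snd z))\<^sup>2 * log_kernel ((cos (fst z))\<^sup>2) ((cos (snd z))\<^sup>2))) \<partial>(circ \<Otimes>\<^sub>M circ))"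
  proof (rule nn_integral_cong)
    fix z :: "real \<times> real"
    define a b where "a = fst z" and "b = snd z"
    have hh: "h l a * h l b = ennreal (16 * ((sin a)\<^sup>2 * (sin b)\<^sup>2)) *
        ennreal (indicator {0<..} l * ((1 - exp (- (2 / l) * (cos a)\<^sup>2)) * (1 - exp (- (2 / l) * (cos b)\<^sup>2))))" for l
      by (auto simp: h_def indicator_def ennreal_mult[symmetric] mult_ac)
    have "(\<integral>\<^sup>+l. h l a * h l b \<partial>lborel) = ennreal (16 * ((sin a)\<^sup>2 * (sin b)\<^sup>2)) *
        (\<integral>\<^sup>+l. ennreal (indicator {0<..} l * ((1 - exp (- (2 / l) * (cos a)\<^sup>2)) * (1 - exp (- (2 / l) * (cos b)\<^sup>2)))) \<partial>lborel)"
      unfolding hh by (rule nn_integral_cmult) measurable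
    also have "\<dots> = ennreal (16 * ((sin a)\<^sup>2 * (sin b)\<^sup>2)) * ennreal (2 * log_kernel ((cos a)\<^sup>2) ((cos b)\<^sup>2))"
      by (subst nn_integral_one_minus_exp_product) simp_all
    also have "\<dots> = ennreal (32 * ((sin a)\<^sup>2 * (sin b)\<^sup>2 * log_kernel ((cos a)\<^sup>2) ((cos b)\<^sup>2)))"
      by (simp add: ennreal_mult[symmetric] log_kernel_nonneg mult_ac)
    finally show "(\<integral>\<^sup>+l. h l (fst z) * h l (snd z) \<partial>lborel) = ennreal (32 * ((sin (fst z))\<^sup>2 * (sin (snd z))\<^sup>2 * log_kernel ((cos (fst z))\<^sup>2) ((cos (snd z))\<^sup>2)))"
      by (simp add: a_def b_def)
  qed
  finally show ?thesis .
qed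

text \<open>At s = 2 the prefactor 2^(s/4-1) is 2^(-1/2). The integral of the limit density is 32 /
  2 = 16 times the torus average, which gives the power 2^(7/2).\<close>

lemma energy_const_2: "energy_const 2 = - (2 powr (7 / 2) * (4 - 24 * catalan_const + 3 * pi)) / (48 * pi)"
proof -
  define K where "K = (\<lambda>z::real\<times>real. (sin (fst z))\<^sup>2 * (sin (snd z))\<^sup>2 * log_kernel ((cos (fst z))\<^sup>2) ((cos (snd z))\<^sup>2))"
  have [measurable]: "K \<in> borel_measurable borel" unfolding K_def log_kernel_def by measurable
  have K0: "0 \<le> K z" for z by (simp add: K_def log_kernel_nonneg)
  have Kb: "\<bar>K z\<bar> \<le> 6" for z
  proof -
    have c: "0 \<le> (cos x)\<^sup>2" "(cos x)\<^sup>2 \<le> 1" "0 \<le> (sin x)\<^sup>2" "(sin x)\<^sup>2 \<le> 1" for x :: real by (simp_all add: abs_square_le_1)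
    have "\<bar>xlogx ((cos (fst z))\<^sup>2 + (cos (snd z))\<^sup>2)\<bar> \<le> 2" "\<bar>xlogx ((cos (fst z))\<^sup>2)\<bar> \<le> 2" "\<bar>xlogx ((cos (snd z))\<^sup>2)\<bar> \<le> 2"
      using c(1,2)[of "fst z"] c(1,2)[of "snd z"] by (auto intro!: abs_xlogx_le)
    then have l: "\<bar>log_kernel ((cos (fst z))\<^sup>2) ((cos (snd z))\<^sup>2)\<bar> \<le> 6" unfolding log_kernel_def by linarith
    have "\<bar>(sin (fst z))\<^sup>2 * (sin (snd z))\<^sup>2\<bar> \<le> 1" unfolding abs_mult using c(3,4) by (intro mult_le_one) auto
    then have "\<bar>(sin (fst z))\<^sup>2 * (sin (snd z))\<^sup>2\<bar> * \<bar>log_kernel ((cos (fst z))\<^sup>2) ((cos (snd z))\<^sup>2)\<bar> \<le> 1 * 6"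
      using l by (intro mult_mono) auto
    then show ?thesis unfolding K_def abs_mult[symmetric] by simp
  qed
  have iK: "(\<integral>z. K z \<partial>(circ \<Otimes>\<^sub>M circ)) = catalan_const / (2 * pi) - 1 / (12 * pi) - 1/16"
    using integral_torus_kernel_catalan by (simp add: K_def log_kernel_def)
  have "(\<integral>z. 2 * limit_energy_density 2 z \<partial>lborel) = enn2real (\<integral>\<^sup>+z. ennreal (2 * limit_energy_density 2 z) \<partial>lborel)"
    by (rule integral_eq_nn_integral) (auto simp: limit_energy_density_def)
  also have "\<dots> = enn2real (\<integral>\<^sup>+z. ennreal (32 * K z) \<partial>(circ \<Otimes>\<^sub>M circ))"
    unfolding nn_integral_limit_energy_density_2 K_def ..
  also have "\<dots> = (\<integral>z. 32 * K z \<partial>(circ \<Otimes>\<^sub>M circ))"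
    using K0 by (intro integral_eq_nn_integral[symmetric]) (auto simp: measurable_circ_pair)
  finally have "(\<integral>z. limit_energy_density 2 z \<partial>lborel) = 16 * (catalan_const / (2 * pi) - 1 / (12 * pi) - 1/16)"
    using iK by simp
  moreover have "2 powr (7/2) = 2 powr (2 / 4 - 1) * (16::real)"
  proof -
    have "(2::real) powr (7/2) = 2 powr (2 / 4 - 1 + 4)" by simp
    also have "\<dots> = 2 powr (2 / 4 - 1) * 2 powr 4" by (rule powr_add)
    finally show ?thesis by simp
  qed
  ultimately have "energy_const 2 = 2 powr (7/2) * (catalan_const / (2 * pi) - 1 / (12 * pi) - 1/16)"
    using energy_const_eq[of 2] by simp
  also have "catalan_const / (2 * pi) - 1 / (12 * pi) - 1/16 = - ((4 - 24 * catalan_const + 3 * pi) / (48 * pi))"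
    by (simp add: field_simps)
  finally show ?thesis by (simp only: mult_minus_right times_divide_eq_right minus_divide_left)
qed

section \<open>From the exact energy identity to the asymptotic expansion\<close>

lemma energy_difference_smallo:
  fixes W :: ennreal and F H :: "nat \<Rightarrow> ennreal" and D :: "nat \<Rightarrow> real"
  assumes "\<And>k. k \<ge> 1 \<Longrightarrow> F k + H k / 4 = ennreal ((D k)\<^sup>2) * W"
    and W: "W < \<infinity>" and H: "\<And>k. H k < \<infinity>" and D: "\<And>k. D k > 0"
    and lim: "(\<lambda>k. enn2real (H k) / 4 / D k powr a) \<longlonglongrightarrow> c"
  shows "\<And>k. k \<ge> 1 \<Longrightarrow> F k < \<infinity>"
    and "(\<lambda>k. enn2real (F k) - (enn2real W * D k ^ 2 - c * D k powr a)) \<in> o(\<lambda>k. D k powr a)"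
proof -
  \<comment> \<open>\<open>F k\<close> is finite because the whole sum is. With all terms finite the
    identity can be solved for \<open>F k\<close> in the reals.\<close>
  have fin: "F k < \<infinity>" "enn2real (F k) = (D k)\<^sup>2 * enn2real W - enn2real (H k) / 4" if "k \<ge> 1" for k
  proof -
    have "F k + H k / 4 < \<infinity>" unfolding assms(1)[OF that] using W by (simp add: ennreal_mult_less_top)
    then show F: "F k < \<infinity>" by simp
    have H4: "H k / 4 < \<infinity>" using H[of k] by (simp add: ennreal_divide_eq_top_iff less_top[symmetric])
    have "enn2real (F k) + enn2real (H k / 4) = (D k)\<^sup>2 * enn2real W"
      using arg_cong[OF assms(1)[OF that], of enn2real] F H4 by (simp add: enn2real_plus enn2real_mult)
    moreover have "enn2real (H k / 4) = enn2real (H k) / 4"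
    proof -
      have "H k = ennreal (enn2real (H k))" using H[of k] by simp
      then have "H k / 4 = ennreal (enn2real (H k) / 4)" using ennreal_divide_numeral[OF enn2real_nonneg] by metis
      then show ?thesis by simp
    qed
    ultimately show "enn2real (F k) = (D k)\<^sup>2 * enn2real W - enn2real (H k) / 4" by simp
  qed
  then show "\<And>k. k \<ge> 1 \<Longrightarrow> F k < \<infinity>" by blast
  \<comment> \<open>Divided by \<open>D k powr a\<close>, the error is \<open>c\<close> minus the
    normalised correction term, as soon as k \<ge> 1.\<close>
  show "(\<lambda>k. enn2real (F k) - (enn2real W * D k ^ 2 - c * D k powr a)) \<in> o(\<lambda>k. D k powr a)"
  proof (rule smalloI_tendsto)
    have "(\<lambda>k. c - enn2real (H k) / 4 / D k powr a) \<longlonglongrightarrow> c - c"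
      by (intro tendsto_intros lim)
    then have "(\<lambda>k. c - enn2real (H k) / 4 / D k powr a) \<longlonglongrightarrow> 0" by simp
    moreover have "\<forall>\<^sub>F k in sequentially. c - enn2real (H k) / 4 / D k powr a
        = (enn2real (F k) - (enn2real W * D k ^ 2 - c * D k powr a)) / D k powr a"
      using eventually_ge_at_top[of 1]
    proof eventually_elim
      case (elim k)
      have "D k powr a \<noteq> 0" using D[of k] by simp
      then show ?case unfolding fin(2)[OF elim] by (simp add: field_simps)
    qed
    ultimately show "(\<lambda>k. (enn2real (F k) - (enn2real W * D k ^ 2 - c * D k powr a)) / D k powr a) \<longlonglongrightarrow> 0"
      by (rule Lim_transform_eventually)
    show "\<forall>\<^sub>F k in sequentially. D k powr a \<noteq> 0" using D by (simp add: less_imp_neq[THEN not_sym])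
  qed
qed

theorem theorem2p7:
  fixes s :: real
    and \<sigma> :: "(real^4) set measure"
    and M :: "nat \<Rightarrow> 'w measure"
    and X :: "nat \<Rightarrow> 'w \<Rightarrow> (real^4) set set"
  assumes "0 < s" and "s < 4"
    and "\<sigma> \<in> gr24_prob_measures" and "O4_invariant \<sigma>"
    and "\<And>k. k \<ge> 1 \<Longrightarrow> harmonic_ensemble \<sigma> k (M k) (X k)"
  shows "wiener_const s < \<infinity> \<and>
    (\<forall>k\<ge>1. (\<integral>\<^sup>+\<omega>. riesz_energy s (X k \<omega>) \<partial>M k) < \<infinity>) \<and>
    (\<lambda>k. enn2real (\<integral>\<^sup>+\<omega>. riesz_energy s (X k \<omega>) \<partial>M k)
        - (enn2real (wiener_const s) * real (harmonic_dim k) ^ 2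
           - energy_const s * real (harmonic_dim k) powr (1 + s / 4)))
      \<in> o(\<lambda>k. real (harmonic_dim k) powr (1 + s / 4)) \<and>
    energy_const 2 = - (2 powr (7 / 2) * (4 - 24 * catalan_const + 3 * pi)) / (48 * pi)"
proof -
  note \<sigma> = assms(3,4)
  have W: "wiener_const s = uniform_energy s" by (rule wiener_const_eq[OF \<sigma> assms(1)])
  have D: "real (harmonic_dim k) > 0" for k by (simp add: harmonic_dim_eq add_pos_pos)
  have split: "(\<integral>\<^sup>+\<omega>. riesz_energy s (X k \<omega>) \<partial>M k) + harmonic_square_energy s k / 4
      = ennreal ((real (harmonic_dim k))\<^sup>2) * wiener_const s" if "k \<ge> 1" for k
    unfolding W by (rule expected_riesz_energy_split[OF \<sigma> assms(5)[OF that]])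
  have finW: "wiener_const s < \<infinity>" unfolding W by (rule uniform_energy_finite[OF assms(1,2)])
  note asym = harmonic_square_energy_asymp[OF assms(1,2)]
  show ?thesis
    using finW energy_const_2 energy_difference_smallo[OF split finW asym(1) D asym(2)] by blast
qed

end
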